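(* Let $p>1$ and let $g$ be a sense-preserving absolutely continuous homeomorphism of the unit circle $\mathbb S$ onto itself with $v=\log|g'|\in B_p^{\mathbb R}(\mathbb S)$. Let $G:\mathbb D\to\mathbb D$ be the quasiconformal extension of $g$ constructed in the context and $\nu=G_{\bar w}/G_w$ its complex dilatation. Then $$\iint_{\mathbb D}\frac{|\nu(w)|^p}{(1-|w|^2)^2}\,du\,dv\le C_p(v)\,\|v\|_{B_p}^p$$ for a constant $C_p(v)>0$ that is locally bounded as a function of $v\in B_p^{\mathbb R}(\mathbb S)$; in particular $g\in W_p(\mathbb S)$. Moreover, $\nu$ vanishes at the boundary, i.e. $\lim_{r\to1}\operatorname{ess\,sup}_{r<|w|<1}|\nu(w)|=0$, and $\frac{|\nu(w)|^2}{1-|w|^2}\,du\,dv$ is a vanishing Carleson measure on $\mathbb D$.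
   Context: $w=u+iv\in\mathbb D$, the unit disk. $B_p(\mathbb S)$ is the space of locally integrable $v$ on $\mathbb S$ with $\|v\|_{B_p}^p=\int_0^1\!\int_0^1\frac{|v(e^{2\pi ix})-v(e^{2\pi iy})|^p}{|e^{2\pi ix}-e^{2\pi iy}|^2}dxdy<\infty$, and $B_p^{\mathbb R}(\mathbb S)$ its real-valued elements. $W_p(\mathbb S)$ is the set of quasisymmetric self-homeomorphisms of $\mathbb S$ admitting a quasiconformal extension to $\mathbb D$ with complex dilatation $\nu$ satisfying $\iint_{\mathbb D}|\nu|^p(1-|w|^2)^{-2}dudv<\infty$. Construction of $G$: take the continuous lift $f:\mathbb R\to\mathbb R$ with $g(e^{2\pi ix})=e^{2\pi if(x)}$, so $f(x+1)=f(x)+1$ and $f'(x)=e^{u(x)}$ with $u(x)=\log|g'(e^{2\pi ix})|$. With $\phi(x)=\pi^{-1/2}e^{-x^2}$, $\psi=\phi'$, $\varphi_y(x)=y^{-1}\varphi(x/y)$, let $F(x,y)=(f*\phi_y)(x)+i(f*\psi_y)(x)$ on $\mathbb U=\{y>0\}$; $F$ is a quasiconformal self-map of $\mathbb U$ extending $f$ with $F(z+1)=F(z)+1$, and $G$ is the quasiconformal self-map of $\mathbb D$ with $G(e^{2\pi iz})=e^{2\pi iF(z)}$ for $z\in\mathbb U$, $G(0)=0$, $G|_{\mathbb S}=g$. A positive measure $\lambda$ on $\mathbb D$ is a vanishing Carleson measure if $\sup_I\lambda(S(I))/|I|<\infty$ and $\lambda(S(I))/|I|\to0$ as $|I|\to0$,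 where $I$ ranges over arcs of $\mathbb S$ and $S(I)=\{re^{i\theta}:e^{i\theta}\in I,\ 1-|I|\le r<1\}$. *)

theory Defs
  imports "HOL-Probability.Probability"
begin

definition circ :: "real \<Rightarrow> complex" where
  "circ x = cis (2 * pi * x)"

definition Bp_pow :: "real \<Rightarrow> (complex \<Rightarrow> real) \<Rightarrow> ennreal" where
  "Bp_pow p v =
     (\<integral>\<^sup>+ x. \<integral>\<^sup>+ y. indicator {0..1} x * indicator {0..1} y *
        ennreal (\<bar>v (circ x) - v (circ y)\<bar> powr p / (cmod (circ x - circ y))\<^sup>2) \<partial>lborel \<partial>lborel)"

definition Bp_pnorm :: "real \<Rightarrow> (complex \<Rightarrow> real) \<Rightarrow> real" where
  "Bp_pnorm p v = enn2real (Bp_pow p v)"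

definition in_BpR :: "real \<Rightarrow> (complex \<Rightarrow> real) \<Rightarrow> bool" where
  "in_BpR p v \<longleftrightarrow> set_integrable lborel {0..1} (\<lambda>x. v (circ x)) \<and> Bp_pow p v < \<infinity>"

definition abs_continuous_on :: "real \<Rightarrow> real \<Rightarrow> (real \<Rightarrow> real) \<Rightarrow> bool" where
  "abs_continuous_on a b f \<longleftrightarrow>
     (\<forall>\<epsilon>>0. \<exists>\<delta>>0. \<forall>(n::nat) (s::nat \<Rightarrow> real) t.
        (\<forall>i<n. a \<le> s i \<and> s i \<le> t i \<and> t i \<le> b) \<and>
        (\<forall>i<n. \<forall>j<n. i \<noteq> j \<longrightarrow> t i \<le> s j \<or> t j \<le> s i) \<and>
        (\<Sum>i<n. t i - s i) < \<delta> \<longrightarrow> (\<Sum>i<n. \<bar>f (t i) - f (s i)\<bar>) < \<epsilon>)"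

definition gphi :: "real \<Rightarrow> real" where
  "gphi x = exp (- x\<^sup>2) / sqrt pi"

text \<open>psi = phi'\<close>
definition gpsi :: "real \<Rightarrow> real" where
  "gpsi x = - 2 * x * exp (- x\<^sup>2) / sqrt pi"

definition scaled :: "(real \<Rightarrow> real) \<Rightarrow> real \<Rightarrow> real \<Rightarrow> real" where
  "scaled k y x = k (x / y) / y"

definition conv :: "(real \<Rightarrow> real) \<Rightarrow> (real \<Rightarrow> real) \<Rightarrow> real \<Rightarrow> real" where
  "conv f k x = (\<integral>t. f (x - t) * k t \<partial>lborel)"

definition extF :: "(real \<Rightarrow> real) \<Rightarrow> complex \<Rightarrow> complex" where
  "extF f z = complex_of_real (conv f (scaled gphi (Im z)) (Re z))
              + \<i> * complex_of_real (conv f (scaled gpsi (Im z)) (Re z))"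

text \<open>G(e^{2 pi i z}) = e^{2 pi i F(z)}, G(0)=0, G = g on the circle.
  For 0<|w|<1, z = Ln w / (2 pi i) lies in the upper half plane and exp(2 pi i z) = w.\<close>
definition extG :: "(real \<Rightarrow> real) \<Rightarrow> (complex \<Rightarrow> complex) \<Rightarrow> complex \<Rightarrow> complex" where
  "extG f g w =
     (if w = 0 then 0
      else if cmod w < 1 then exp (2 * pi * \<i> * extF f (Ln w / (2 * pi * \<i>)))
      else g w)"

text \<open>nu = H_wbar / H_w with H_w = (H_u - i H_v)/2, H_wbar = (H_u + i H_v)/2,
  at points of real differentiability (a.e. for quasiconformal maps); 0 elsewhere.\<close>
definition cdil :: "(complex \<Rightarrow> complex) \<Rightarrow> complex \<Rightarrow> complex" where
  "cdil H w =
     (if H differentiable (at w)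
      then (let D = frechet_derivative H (at w) in (D 1 + \<i> * D \<i>) / (D 1 - \<i> * D \<i>))
      else 0)"

definition dil_integral :: "real \<Rightarrow> (complex \<Rightarrow> complex) \<Rightarrow> ennreal" where
  "dil_integral p H =
     (\<integral>\<^sup>+ w. indicator (ball 0 1) w * ennreal (cmod (cdil H w) powr p / (1 - (cmod w)\<^sup>2)\<^sup>2) \<partial>lborel)"

definition quasisymmetric_circle :: "(complex \<Rightarrow> complex) \<Rightarrow> bool" where
  "quasisymmetric_circle g \<longleftrightarrow>
     (\<exists>h. homeomorphism (sphere 0 1) (sphere 0 1) g h) \<and>
     (\<exists>f. continuous_on UNIV f \<and> (\<forall>x. g (circ x) = circ (f x)) \<and>
        (\<exists>M\<ge>1. \<forall>x t. t > 0 \<longrightarrow>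
            \<bar>f (x + t) - f x\<bar> \<le> M * \<bar>f x - f (x - t)\<bar> \<and>
            \<bar>f x - f (x - t)\<bar> \<le> M * \<bar>f (x + t) - f x\<bar>))"

definition qc_ratio :: "(complex \<Rightarrow> complex) \<Rightarrow> complex \<Rightarrow> real \<Rightarrow> real" where
  "qc_ratio H z r = (SUP w\<in>sphere z r. cmod (H w - H z)) / (INF w\<in>sphere z r. cmod (H w - H z))"

definition quasiconformal_disc :: "(complex \<Rightarrow> complex) \<Rightarrow> bool" where
  "quasiconformal_disc H \<longleftrightarrow>
     (\<exists>H'. homeomorphism (ball 0 1) (ball 0 1) H H') \<and>
     (\<exists>K::real. \<forall>z\<in>ball 0 1. Limsup (at_right 0) (\<lambda>r. ereal (qc_ratio H z r)) \<le> ereal K)"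

definition in_Wp :: "real \<Rightarrow> (complex \<Rightarrow> complex) \<Rightarrow> bool" where
  "in_Wp p g \<longleftrightarrow> quasisymmetric_circle g \<and>
     (\<exists>H. continuous_on (cball 0 1) H \<and> quasiconformal_disc H \<and>
          (\<forall>z\<in>sphere 0 1. H z = g z) \<and> dil_integral p H < \<infinity>)"

definition carleson_box :: "real \<Rightarrow> real \<Rightarrow> complex set" where
  "carleson_box a l = {complex_of_real r * cis \<theta> | r \<theta>.
       a \<le> \<theta> \<and> \<theta> \<le> a + l \<and> 0 \<le> r \<and> 1 - l \<le> r \<and> r < 1}"

definition vanishing_carleson :: "complex measure \<Rightarrow> bool" where
  "vanishing_carleson \<mu> \<longleftrightarrow>
     (\<exists>M. \<forall>a l. 0 < l \<and> l \<le> 2 * pi \<longrightarrow> emeasure \<mu> (carleson_box a l) \<le> ennreal (M * l)) \<and>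
     (\<forall>\<epsilon>>0. \<exists>\<delta>>0. \<forall>a l. 0 < l \<and> l < \<delta> \<longrightarrow> emeasure \<mu> (carleson_box a l) \<le> ennreal (\<epsilon> * l))"

end

theory Submission
  imports Defs
begin

text \<open>Write \<open>f' = exp u\<close> and let \<open>E\<close> be the Besov energy of \<open>u\<close>. For a point \<open>w\<close> of the disc the squared chord
  length between two boundary points, weighted by the Poisson kernel of \<open>w\<close>, is at most the squared harmonic
  measure of the arc between them (times a constant). Hence the finiteness of \<open>E\<close> forces
  the harmonic measures of the level sets \<open>{u \<ge> m + k}\<close>, \<open>m\<close> a median of \<open>u\<close> seen from \<open>w\<close>, to decay faster than
  any exponential, so that \<open>exp (q * \<bar>u - m\<bar>)\<close> has bounded Poisson averages for every \<open>q\<close>.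

  The partial derivatives of \<open>F\<close> are Gaussian moments of \<open>exp u\<close>. The Jacobian is a variance, hence positive, and
  bounding it from below gives \<open>\<bar>mu\<bar> \<le> k < 1\<close>. The numerator of the dilatation integrates \<open>exp u\<close> against kernels
  of mean zero, so Hoelder's inequality and the exponential integrability bound \<open>\<bar>mu\<bar> powr p\<close> by the average of
  \<open>\<bar>u t - u s\<bar> powr p\<close> against products of squared Poisson kernels. Integrating these products over the disc in
  the hyperbolic area gives back the energy, and by dominated convergence the average tends to \<open>0\<close> uniformly at
  the boundary. \<open>F\<close> is injective since \<open>Im F\<close> increases along vertical lines and \<open>Re F\<close> increases along the level
  lines of \<open>Im F\<close>.

  For the Carleson condition, \<open>\<bar>nu\<bar>\<^sup>2 / (1 - \<bar>w\<bar>)\<close> is split into a small multiple of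
  \<open>\<bar>nu\<bar> powr (p + 4) / (1 - \<bar>w\<bar>)\<^sup>2\<close> and a power of \<open>1 - \<bar>w\<bar>\<close>, both of which are controlled on a Carleson box.\<close>

section \<open>The Poisson kernel\<close>

text \<open>Every estimate has to depend on \<open>u\<close> only through an upper bound
  \<open>E\<close> of its energy, because local boundedness of the final constant is read off from
  monotonicity in \<open>E\<close>; this is why the constants are carried along as explicit
  functions of \<open>E\<close>. As \<open>p\<close> may be close to 1, the conjugate exponent
  \<open>p / (p - 1)\<close> can be arbitrarily large, so exponential integrability is required for
  all \<open>q\<close>, around a centre that does not depend on \<open>q\<close>. The decay beats
  every exponential because each level set has at most the measure of the one a unit below it times
  its own share of the energy, and the shares have a finite sum. Lower bounds for integrals of
  \<open>exp u\<close> come from upper bounds for integrals of \<open>exp (- u)\<close>, through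
  \<open>exp x \<ge> 2 * \<tau> - \<tau>\<^sup>2 * exp (- x)\<close> with \<tau> chosen afterwards.
  The Gaussians live on the line while the energy lives on the circle; kernels of fourth order decay
  mediate between the two. For \<open>p > 2\<close> the square of the dilatation is not controlled
  by its \<open>p\<close>-th power, so the Carleson condition also has to use the vanishing of the
  dilatation at the boundary.\<close>

definition pois :: "complex \<Rightarrow> real \<Rightarrow> real" where
  "pois w t = (1 - (cmod w)\<^sup>2) / (cmod (circ t - w))\<^sup>2"

text \<open>Up to the factor \<open>2 * pi\<close> this is a continuous argument of the image of
  \<open>circ t\<close> under the disc automorphism that sends \<open>w\<close> to \<open>0\<close>.
  The principal logarithm suffices because \<open>1 - w * cnj (circ t)\<close> stays in the right
  half plane.\<close>

definition pois_prim :: "complex \<Rightarrow> real \<Rightarrow> real" where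
  "pois_prim w t = t + Im (Ln (1 - w * cnj (circ t))) / pi"

lemma norm_circ [simp]: "cmod (circ t) = 1"
  by (simp add: circ_def)

lemma circ_add_1 [simp]: "circ (t + 1) = circ t"
  by (simp add: circ_def distrib_left cis_mult[symmetric])

lemma circ_cnj_mult [simp]: "circ t * cnj (circ t) = 1"
  by (simp add: circ_def cis_cnj cis_mult)

lemma circ_neq_interior:
  assumes "cmod w < 1"
  shows "circ t \<noteq> w" "w \<noteq> circ t"
  using assms norm_circ[of t] by auto

lemma circ_exp: "circ t = exp (2 * pi * \<i> * of_real t)"
  by (simp add: circ_def cis_conv_exp mult_ac)

lemma cnj_circ_exp: "cnj (circ t) = exp (-(2 * pi * \<i> * of_real t))"
  by (simp add: circ_exp exp_cnj)

lemma circ_measurable [measurable]: "circ \<in> borel_measurable borel"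
  unfolding circ_def cis_conv_exp by measurable

lemma circ_has_vector_derivative:
  "(circ has_vector_derivative (2 * pi * \<i> * circ t)) (at t within S)"
proof -
  have "((\<lambda>z. exp (2 * pi * \<i> * z)) has_field_derivative (2 * pi * \<i> * exp (2 * pi * \<i> * of_real t)))
          (at (of_real t))"
    by (rule derivative_eq_intros refl)+ simp
  then have "((\<lambda>x. exp (2 * pi * \<i> * of_real x)) has_vector_derivative (2 * pi * \<i> * exp (2 * pi * \<i> * of_real t))) (at t within S)"
    by (rule has_vector_derivative_real_field)
  moreover have "(\<lambda>x. exp (2 * pi * \<i> * of_real x)) = circ"
    by (simp add: fun_eq_iff circ_exp)
  ultimately show ?thesis by (simp add: circ_exp)
qed

lemma dist_circ_le: "cmod (circ s - circ t) \<le> 2 * pi * \<bar>s - t\<bar>"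
proof -
  have "norm (circ s - circ t) \<le> (2 * pi) * norm (s - t)"
  proof (rule differentiable_bound[where f' = "\<lambda>t h. h *\<^sub>R (2 * pi * \<i> * circ t)" and S = UNIV])
    show "onorm (\<lambda>h::real. h *\<^sub>R (2 * pi * \<i> * circ x)) \<le> 2 * pi" for x
      by (rule onorm_bound) (auto simp: norm_mult)
  qed (use circ_has_vector_derivative[unfolded has_vector_derivative_def, where S = UNIV] in auto)
  then show ?thesis by simp
qed

lemma norm_one_minus_cnj:
  "cmod (1 - w * cnj (circ t)) = cmod (circ t - w)" "cmod (1 - cnj w * circ t) = cmod (circ t - w)"
proof -
  have "1 - w * cnj (circ t) = (circ t - w) * cnj (circ t)"
    by (simp add: algebra_simps)
  then show 1: "cmod (1 - w * cnj (circ t)) = cmod (circ t - w)"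
    by (simp add: norm_mult)
  have "1 - cnj w * circ t = cnj (1 - w * cnj (circ t))" by simp
  then show "cmod (1 - cnj w * circ t) = cmod (circ t - w)"
    using 1 by (metis complex_mod_cnj)
qed

lemma pois_pos: "cmod w < 1 \<Longrightarrow> pois w t > 0"
  unfolding pois_def using circ_neq_interior[of w t]
  by (auto intro!: divide_pos_pos simp: power_less_one_iff abs_square_less_1)

lemma pois_add_1 [simp]: "pois w (t + 1) = pois w t"
  by (simp add: pois_def)

lemma pois_measurable [measurable]: "case_prod pois \<in> borel_measurable borel"
  "pois w \<in> borel_measurable borel"
  "(\<lambda>w. pois w t) \<in> borel_measurable borel"
proof -
  have "(\<lambda>x. pois (fst x) (snd x)) \<in> borel_measurable (borel \<Otimes>\<^sub>M borel)"
    unfolding pois_def by measurable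
  then show "case_prod pois \<in> borel_measurable borel" by (simp add: borel_prod case_prod_beta')
qed (unfold pois_def, measurable)

text \<open>With \<open>z = w * cnj (circ t)\<close> the Poisson kernel is the real part of
  \<open>(1 + z) / (1 - z) = 1 + 2 * z / (1 - z)\<close>, and the second term is what
  differentiating \<open>Ln (1 - z)\<close> produces.\<close>

lemma pois_prim_deriv:
  assumes w: "cmod w < 1"
  shows "(pois_prim w has_real_derivative pois w t) (at t within S)"
proof -
  define e where "e = cnj (circ t)"
  have e: "cmod e = 1" by (simp add: e_def)
  have e': "e = exp (-(2 * pi * \<i> * of_real t))"
    by (simp add: e_def cnj_circ_exp)
  have we: "cmod (w * e) < 1" using w e by (simp add: norm_mult)
  then have "Re (w * e) < 1" using complex_Re_le_cmod[of "w*e"] by linarith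
  then have Re: "Re (1 - w * e) > 0" by simp
  have nz: "1 - w * e \<noteq> 0" using Re by force
  have "1 - w * e \<notin> \<real>\<^sub>\<le>\<^sub>0" using Re complex_nonpos_Reals_iff by auto
  then have "((\<lambda>z. Ln (1 - w * exp (-(2 * pi * \<i> * z)))) has_field_derivative
       (2 * pi * \<i> * (w * e) / (1 - w * e))) (at (of_real t))"
    unfolding e' by (auto intro!: derivative_eq_intros simp: field_simps)
  then have "((\<lambda>x. Ln (1 - w * exp (-(2 * pi * \<i> * of_real x)))) has_vector_derivative
       (2 * pi * \<i> * (w * e) / (1 - w * e))) (at t within S)"
    by (rule has_vector_derivative_real_field)
  then have "((\<lambda>x. Im (Ln (1 - w * exp (-(2 * pi * \<i> * of_real x))))) has_vector_derivative
       Im (2 * pi * \<i> * (w * e) / (1 - w * e))) (at t within S)"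
    by (rule bounded_linear.has_vector_derivative[OF bounded_linear_Im])
  moreover have "exp (-(2 * pi * \<i> * of_real x)) = cnj (circ x)" for x
    by (simp add: cnj_circ_exp)
  ultimately have D: "((\<lambda>x. Im (Ln (1 - w * cnj (circ x)))) has_real_derivative
       Im (2 * pi * \<i> * (w * e) / (1 - w * e))) (at t within S)"
    by (simp add: has_real_derivative_iff_has_vector_derivative)
  have I: "Im (2 * pi * \<i> * (w * e) / (1 - w * e)) = 2 * pi * Re ((w * e) / (1 - w * e))"
    by (simp add: field_simps Im_divide Re_divide)
  have "1 + 2 * Re ((w * e) / (1 - w * e)) = Re (1 + (w * e / (1 - w * e) + w * e / (1 - w * e)))"
    by (simp only: plus_complex.sel one_complex.sel mult_2)
  also have "1 + (w * e / (1 - w * e) + w * e / (1 - w * e)) = (1 + w * e) / (1 - w * e)"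
    using nz by (simp add: divide_simps)
  also have "Re \<dots> = (1 - (cmod (w * e))\<^sup>2) / (cmod (1 - w * e))\<^sup>2"
    unfolding Re_divide cmod_power2 by (simp add: power2_eq_square algebra_simps)
  also have "\<dots> = pois w t"
    unfolding pois_def using norm_one_minus_cnj(1)[of w t] e by (simp add: e_def[symmetric] norm_mult)
  finally have P: "1 + 2 * Re ((w * e) / (1 - w * e)) = pois w t" .
  show ?thesis
    unfolding pois_prim_def P[symmetric]
    using DERIV_add[OF DERIV_ident DERIV_cdivide[OF D, of pi]] unfolding I by simp
qed

lemma pois_prim_add_1: "pois_prim w (t + 1) = pois_prim w t + 1"
  by (simp add: pois_prim_def)

lemma nn_integral_pois:
  assumes w: "cmod w < 1" and "a \<le> b"
  shows "(\<integral>\<^sup>+t. ennreal (pois w t) * indicator {a..b} t \<partial>lborel) = ennreal (pois_prim w b - pois_prim w a)"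
  using assms pois_prim_deriv[OF w] pois_pos[OF w]
  by (intro nn_integral_FTC_Icc) (auto simp: less_imp_le)

lemma continuous_on_pois_prim: "cmod w < 1 \<Longrightarrow> continuous_on S (pois_prim w)"
  by (rule DERIV_continuous_on) (rule pois_prim_deriv)

lemma pois_prim_mono:
  assumes "cmod w < 1" "a \<le> b" shows "pois_prim w a \<le> pois_prim w b"
  using assms by (intro DERIV_nonneg_imp_nondecreasing[of a b "pois_prim w"])
    (auto intro!: exI[of _ "pois w _"] pois_prim_deriv less_imp_le pois_pos)

text \<open>Moebius invariance: the right-hand side is the arc length, and the left-hand side the chord
  length, between the images of the two points under the disc automorphism that sends \<open>w\<close> to \<open>0\<close>.\<close>
lemma chord_le_pois_prim:
  assumes w: "cmod w < 1"
  shows "(cmod (circ t - circ s))\<^sup>2 * (pois w t * pois w s) \<le> (2 * pi * (pois_prim w t - pois_prim w s))\<^sup>2"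
proof -
  define T where "T = (\<lambda>t. (circ t - w) / (1 - cnj w * circ t))"
  have nz: "1 - cnj w * circ x \<noteq> 0" for x
    using norm_one_minus_cnj(2)[of w x] circ_neq_interior[OF w, of x] by auto
  have D: "(T has_vector_derivative (2 * pi * \<i> * circ x * (1 - w * cnj w) / (1 - cnj w * circ x)\<^sup>2)) (at x within S)" for x S
  proof -
    have "((\<lambda>z. (z - w) / (1 - cnj w * z)) has_field_derivative ((1 - w * cnj w) / (1 - cnj w * circ x)\<^sup>2)) (at (circ x))"
      using nz[of x] by (auto intro!: derivative_eq_intros simp: power2_eq_square field_simps)
    from field_vector_diff_chain_within[OF circ_has_vector_derivative has_field_derivative_at_within[OF this]]
    show ?thesis unfolding T_def o_def by simp
  qed
  have ww: "1 - w * cnj w = of_real (1 - (cmod w)\<^sup>2)"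
    by (simp add: complex_norm_square[symmetric])
  have nww: "cmod (1 - w * cnj w) = 1 - (cmod w)\<^sup>2"
    unfolding ww norm_of_real using w by (simp add: abs_square_le_1)
  have nD: "norm (2 * pi * \<i> * circ x * (1 - w * cnj w) / (1 - cnj w * circ x)\<^sup>2) = 2 * pi * pois w x" for x
    by (simp add: norm_mult norm_divide norm_power norm_one_minus_cnj pois_def nww)
  have bound: "norm (T b - T a) \<le> 2 * pi * pois_prim w b - 2 * pi * pois_prim w a" if "a < b" for a b
  proof (rule differentiable_bound_general[OF that])
    show "continuous_on {a..b} T"
      by (rule continuous_on_vector_derivative[OF D])
    show "continuous_on {a..b} (\<lambda>x. 2 * pi * pois_prim w x)"
      by (intro continuous_intros continuous_on_pois_prim w)
    show "(T has_vector_derivative (2 * pi * \<i> * circ x * (1 - w * cnj w) / (1 - cnj w * circ x)\<^sup>2)) (at x)" for x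
      by (rule D)
    show "((\<lambda>x. 2 * pi * pois_prim w x) has_vector_derivative 2 * pi * pois w x) (at x)" for x
      unfolding has_real_derivative_iff_has_vector_derivative[symmetric]
      by (rule DERIV_cmult) (rule pois_prim_deriv[OF w])
  qed (use nD in auto)
  have *: "norm (T t - T s) \<le> \<bar>2 * pi * (pois_prim w t - pois_prim w s)\<bar>"
    using bound[of s t] bound[of t s]
    by (cases s t rule: linorder_cases) (auto simp: algebra_simps norm_minus_commute)
  \<comment> \<open>The two-point identity of disc automorphisms: the chord between the images is
    the chord between the points, weighted by the square roots of both Poisson kernels.\<close>
  have "T t - T s = (1 - w * cnj w) * (circ t - circ s) / ((1 - cnj w * circ t) * (1 - cnj w * circ s))"
    unfolding T_def using nz[of t] nz[of s] by (simp add: field_simps)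
  then have "(norm (T t - T s))\<^sup>2 = (cmod (circ t - circ s))\<^sup>2 * (pois w t * pois w s)"
    by (simp only: norm_mult norm_divide norm_one_minus_cnj pois_def nww power_mult_distrib power_divide)
       (simp add: power2_eq_square)
  moreover have "(norm (T t - T s))\<^sup>2 \<le> \<bar>2 * pi * (pois_prim w t - pois_prim w s)\<bar>\<^sup>2"
    by (intro power_mono *) auto
  ultimately show ?thesis by simp
qed

section \<open>Harmonic measure seen from a point of the disc\<close>

definition poism :: "complex \<Rightarrow> real measure" where
  "poism w = density lborel (\<lambda>t. ennreal (pois w t) * indicator {0..1} t)"

lemma sets_poism [measurable_cong, simp]: "sets (poism w) = sets borel"
  and space_poism [simp]: "space (poism w) = UNIV"
  by (simp_all add: poism_def)

lemma prob_space_poism: "cmod w < 1 \<Longrightarrow> prob_space (poism w)"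
proof
  assume w: "cmod w < 1"
  show "emeasure (poism w) (space (poism w)) = 1"
    using nn_integral_pois[OF w, of 0 1] pois_prim_add_1[of w 0]
    by (simp add: poism_def emeasure_density)
qed

text \<open>The distribution function \<open>pois_prim w\<close> carries \<open>poism w\<close> to
  Lebesgue measure on an interval of length \<open>1\<close>, so a subinterval of length
  \<open>2 * a\<close> has a preimage of mass \<open>2 * a\<close>.\<close>

lemma pois_prim_window:
  assumes w: "cmod w < 1" and t: "t \<in> {0..1}" and a: "0 < a" "2 * a \<le> 1"
  shows "ennreal (2 * a) \<le> emeasure (poism w) {s. \<bar>pois_prim w s - pois_prim w t\<bar> \<le> 2 * a}"
proof -
  let ?Q = "pois_prim w"
  \<comment> \<open>Clamping at \<open>?Q 0\<close> keeps the window inside the image of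
    \<open>{0..1}\<close>: since \<open>2 * a \<le> 1\<close>, its upper end does not exceed
    \<open>?Q 1\<close>, and all its points are within \<open>2 * a\<close> of
    \<open>?Q t\<close>.\<close>
  define lo where "lo = max (?Q 0) (?Q t - 2 * a)"
  have Q1: "?Q 1 = ?Q 0 + 1" using pois_prim_add_1[of w 0] by simp
  have t01: "?Q 0 \<le> ?Q t" "?Q t \<le> ?Q 1" using t by (auto intro: pois_prim_mono[OF w])
  have "\<exists>s1\<ge>0. s1 \<le> 1 \<and> ?Q s1 = lo"
    using t01 a Q1 by (intro IVT' continuous_on_pois_prim w) (auto simp: lo_def)
  then obtain s1 where s1: "0 \<le> s1" "s1 \<le> 1" "?Q s1 = lo" by auto
  have "\<exists>s2\<ge>s1. s2 \<le> 1 \<and> ?Q s2 = lo + 2 * a"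
    using t01 a Q1 s1 by (intro IVT' continuous_on_pois_prim w) (auto simp: lo_def)
  then obtain s2 where s2: "s1 \<le> s2" "s2 \<le> 1" "?Q s2 = lo + 2 * a" by auto
  have sub: "{s1..s2} \<subseteq> {s. \<bar>?Q s - ?Q t\<bar> \<le> 2 * a}"
  proof
    fix s assume "s \<in> {s1..s2}"
    then have "lo \<le> ?Q s" "?Q s \<le> lo + 2 * a" using s1 s2 pois_prim_mono[OF w] by (metis atLeastAtMost_iff)+
    then show "s \<in> {s. \<bar>?Q s - ?Q t\<bar> \<le> 2 * a}" using t01 by (auto simp: lo_def max_def split: if_splits)
  qed
  have [measurable]: "?Q \<in> borel_measurable borel"
    by (intro borel_measurable_continuous_onI continuous_on_pois_prim w)
  have "ennreal (2 * a) = (\<integral>\<^sup>+t. ennreal (pois w t) * indicator {s1..s2} t \<partial>lborel)"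
    using nn_integral_pois[OF w s2(1)] s1 s2 by simp
  also have "\<dots> = emeasure (poism w) {s1..s2}"
    using s1 s2 by (auto simp: poism_def emeasure_density intro!: nn_integral_cong split: split_indicator)
  also have "\<dots> \<le> emeasure (poism w) {s. \<bar>?Q s - ?Q t\<bar> \<le> 2 * a}"
    by (intro emeasure_mono sub) measurable
  finally show ?thesis .
qed

section \<open>Level sets of functions with finite energy\<close>

lemma circ_eq_circ_iff: "circ s = circ t \<longleftrightarrow> (\<exists>n::int. s = t + of_int n)"
proof -
  have "circ s = circ t \<longleftrightarrow> (\<exists>n::int. 2 * pi * \<i> * of_real s = 2 * pi * \<i> * of_real t + of_int (2 * n) * pi * \<i>)"
    unfolding circ_exp exp_eq by simp
  also have "\<dots> \<longleftrightarrow> (\<exists>n::int. s = t + of_int n)"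
  proof (intro arg_cong[where f = Ex] ext)
    fix n :: int
    have "2 * pi * \<i> * of_real s = 2 * pi * \<i> * of_real t + of_int (2 * n) * pi * \<i> \<longleftrightarrow>
       (2 * pi * \<i>) * of_real s = (2 * pi * \<i>) * of_real (t + of_int n)"
      by (simp add: algebra_simps)
    also have "\<dots> \<longleftrightarrow> s = t + of_int n"
      by (simp only: mult_cancel_left of_real_eq_iff) simp
    finally show "(2 * pi * \<i> * of_real s = 2 * pi * \<i> * of_real t + of_int (2 * n) * pi * \<i>) = (s = t + of_int n)" .
  qed
  finally show ?thesis .
qed

definition ener :: "real \<Rightarrow> (real \<Rightarrow> real) \<Rightarrow> ennreal" where
  "ener p u = (\<integral>\<^sup>+ x. \<integral>\<^sup>+ y. indicator {0..1} x * indicator {0..1} y *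
        ennreal (\<bar>u x - u y\<bar> powr p / (cmod (circ x - circ y))\<^sup>2) \<partial>lborel \<partial>lborel)"

lemma Bp_pow_eq_ener: "Bp_pow p v = ener p (\<lambda>x. v (circ x))"
  by (simp add: Bp_pow_def ener_def)

text \<open>The window of mass \<open>2 * a\<close> around \<open>t\<close> keeps mass at least
  \<open>a\<close> after \<open>A\<close> is removed. On it the harmonic distance to
  \<open>t\<close> is at most \<open>2 * a\<close>, so the chord inequality bounds the inverse
  squared chord below by \<open>pois w t * pois w s / (16 * pi\<^sup>2 * a\<^sup>2)\<close>;
  integration over \<open>s\<close> leaves one factor \<open>a\<close> in the denominator.\<close>

lemma poism_kernel_lower:
  assumes w: "cmod w < 1" and A [measurable]: "A \<in> sets borel" and t: "t \<in> A" "t \<in> {0..1}"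
    and a: "emeasure (poism w) A = ennreal a" "0 < a" "2 * a \<le> 1"
  shows "ennreal (pois w t) \<le> ennreal (16 * pi\<^sup>2 * a) *
           (\<integral>\<^sup>+s. indicator {0..1} s * indicator (-A) s * ennreal (1 / (cmod (circ t - circ s))\<^sup>2) \<partial>lborel)"
proof -
  let ?Q = "pois_prim w" and ?K = "pois w t / (16 * pi\<^sup>2 * a\<^sup>2)"
  define S where "S = {s. \<bar>?Q s - ?Q t\<bar> \<le> 2 * a}"
  have [measurable]: "?Q \<in> borel_measurable borel"
    by (intro borel_measurable_continuous_onI continuous_on_pois_prim w)
  have [measurable]: "S \<in> sets borel" unfolding S_def by measurable
  interpret prob_space "poism w" by (rule prob_space_poism[OF w])
  have P: "pois w x > 0" for x by (rule pois_pos[OF w])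
  have "ennreal (2 * a) \<le> emeasure (poism w) S"
    unfolding S_def by (rule pois_prim_window[OF w t(2) a(2,3)])
  also have "\<dots> \<le> emeasure (poism w) ((S - A) \<union> A)"
    by (intro emeasure_mono) auto
  also have "\<dots> \<le> emeasure (poism w) (S - A) + emeasure (poism w) A"
    by (intro emeasure_subadditive) auto
  finally have "ennreal (2 * a) \<le> emeasure (poism w) (S - A) + ennreal a"
    by (simp only: a)
  then have *: "ennreal a \<le> emeasure (poism w) (S - A)"
    using a(2) by (simp add: emeasure_eq_measure ennreal_plus[symmetric] del: ennreal_plus)
  have "ennreal ?K * ennreal a \<le> ennreal ?K * emeasure (poism w) (S - A)"
    by (intro mult_left_mono *) auto
  also have "emeasure (poism w) (S - A) =
      (\<integral>\<^sup>+s. ennreal (pois w s) * indicator {0..1} s * indicator (S - A) s \<partial>lborel)"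
    by (simp add: poism_def emeasure_density)
  also have "ennreal ?K * \<dots> = (\<integral>\<^sup>+s. ennreal ?K * (ennreal (pois w s) * indicator {0..1} s * indicator (S - A) s) \<partial>lborel)"
    by (intro nn_integral_cmult[symmetric]) measurable
  also have "\<dots> \<le> (\<integral>\<^sup>+s. indicator {0..1} s * indicator (-A) s * ennreal (1 / (cmod (circ t - circ s))\<^sup>2) \<partial>lborel)"
  proof (rule nn_integral_mono_AE)
    \<comment> \<open>\<open>circ\<close> identifies the end points, so for \<open>t = 0\<close> and
      \<open>s = 1\<close> the quotient on the right would be \<open>1 / 0 = 0\<close> and the
      pointwise estimate would fail.\<close>
    have "AE s in lborel. s \<noteq> 0 \<and> s \<noteq> (1::real)"
      by (simp add: AE_lborel_singleton AE_conj_iff)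
    then show "AE s in lborel. ennreal ?K * (ennreal (pois w s) * indicator {0..1} s * indicator (S - A) s)
        \<le> indicator {0..1} s * indicator (-A) s * ennreal (1 / (cmod (circ t - circ s))\<^sup>2)"
    proof eventually_elim
      case (elim s)
      show ?case
      proof (cases "s \<in> {0..1} \<and> s \<in> S \<and> s \<notin> A")
        case True
        then have s: "0 < s" "s < 1" "s \<in> S" "s \<notin> A" using elim by auto
        have "circ t \<noteq> circ s"
        proof
          assume "circ t = circ s"
          then obtain n :: int where n: "t = s + of_int n" by (auto simp: circ_eq_circ_iff)
          with s t have "real_of_int n < 1" "real_of_int n > -1" by auto
          then have "n = 0" by linarith
          with n s t show False by simp
        qed
        then have d: "cmod (circ t - circ s) > 0" by simp
        have "(cmod (circ t - circ s))\<^sup>2 * (pois w t * pois w s) \<le> (2 * pi * (?Q t - ?Q s))\<^sup>2"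
          by (rule chord_le_pois_prim[OF w])
        also have "\<dots> = (2 * pi)\<^sup>2 * \<bar>?Q s - ?Q t\<bar>\<^sup>2"
          by (simp add: power_mult_distrib power2_commute)
        also have "\<dots> \<le> (2 * pi)\<^sup>2 * (2 * a)\<^sup>2"
          using s by (intro mult_left_mono power_mono) (auto simp: S_def)
        finally have "(cmod (circ t - circ s))\<^sup>2 * (pois w t * pois w s) \<le> 16 * pi\<^sup>2 * a\<^sup>2"
          by (simp add: power_mult_distrib)
        then have "?K * pois w s \<le> 1 / (cmod (circ t - circ s))\<^sup>2"
          using a d by (simp add: field_simps)
        then have "ennreal (?K * pois w s) \<le> ennreal (1 / (cmod (circ t - circ s))\<^sup>2)"
          by (rule ennreal_leI)
        moreover have "ennreal ?K * ennreal (pois w s) = ennreal (?K * pois w s)"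
          using P[of t] P[of s] by (intro ennreal_mult[symmetric]) (auto simp: less_imp_le)
        ultimately show ?thesis using True by simp
      qed (auto simp: indicator_def)
    qed
  qed
  finally have "ennreal (?K * a) \<le> (\<integral>\<^sup>+s. indicator {0..1} s * indicator (-A) s * ennreal (1 / (cmod (circ t - circ s))\<^sup>2) \<partial>lborel)"
    using a P[of t] by (subst ennreal_mult) (auto simp: less_imp_le)
  then have "ennreal (16 * pi\<^sup>2 * a) * ennreal (?K * a) \<le> ennreal (16 * pi\<^sup>2 * a) * \<dots>"
    by (rule mult_left_mono) simp
  moreover have "ennreal (16 * pi\<^sup>2 * a) * ennreal (?K * a) = ennreal (pois w t)"
    using a P[of t] by (subst ennreal_mult'[symmetric]) (auto simp: power2_eq_square less_imp_le)
  ultimately show ?thesis by simp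
qed

text \<open>The pointwise bound of \<open>poism_kernel_lower\<close>, integrated over
  \<open>B\<close>. The factor \<open>emeasure (poism w) A\<close> on the right is the gain that can
  be iterated along a sequence of level sets.\<close>

lemma poism_level_step:
  assumes w: "cmod w < 1" and [measurable]: "A \<in> sets borel" "B \<in> sets borel" and "B \<subseteq> A"
    and le: "measure (poism w) A \<le> 1/2"
  shows "emeasure (poism w) B \<le> ennreal (16 * pi\<^sup>2) * emeasure (poism w) A *
     (\<integral>\<^sup>+t. \<integral>\<^sup>+s. indicator {0..1} t * indicator {0..1} s * (indicator B t * indicator (-A) s *
         ennreal (1 / (cmod (circ t - circ s))\<^sup>2)) \<partial>lborel \<partial>lborel)"
    (is "_ \<le> _ * _ * ?E")
proof -
  interpret prob_space "poism w" by (rule prob_space_poism[OF w])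
  define a where "a = measure (poism w) A"
  have a: "emeasure (poism w) A = ennreal a" by (simp add: a_def emeasure_eq_measure)
  have a0: "a \<ge> 0" by (simp add: a_def)
  show ?thesis
  proof (cases "a = 0")
    case True
    have "emeasure (poism w) B \<le> emeasure (poism w) A" by (intro emeasure_mono \<open>B \<subseteq> A\<close>) simp
    then show ?thesis using True a by simp
  next
    case False
    then have pos: "a > 0" using a0 by simp
    have a2: "2 * a \<le> 1" using le by (simp add: a_def)
    let ?I = "\<lambda>t. (\<integral>\<^sup>+s. indicator {0..1} s * indicator (-A) s * ennreal (1 / (cmod (circ t - circ s))\<^sup>2) \<partial>lborel)"
    have "emeasure (poism w) B = (\<integral>\<^sup>+t. ennreal (pois w t) * indicator {0..1} t * indicator B t \<partial>lborel)"
      by (simp add: poism_def emeasure_density)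
    also have "\<dots> \<le> (\<integral>\<^sup>+t. ennreal (16 * pi\<^sup>2 * a) * (indicator {0..1} t * indicator B t * ?I t) \<partial>lborel)"
    proof (rule nn_integral_mono)
      fix t
      show "ennreal (pois w t) * indicator {0..1} t * indicator B t \<le> ennreal (16 * pi\<^sup>2 * a) * (indicator {0..1} t * indicator B t * ?I t)"
      proof (cases "t \<in> {0..1} \<and> t \<in> B")
        case True
        then show ?thesis
          using poism_kernel_lower[OF w \<open>A \<in> sets borel\<close> _ _ a pos a2, of t] \<open>B \<subseteq> A\<close> by (auto simp: indicator_def)
      qed (auto simp: indicator_def)
    qed
    also have "\<dots> = ennreal (16 * pi\<^sup>2 * a) * (\<integral>\<^sup>+t. (indicator {0..1} t * indicator B t * ?I t) \<partial>lborel)"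
      by (intro nn_integral_cmult) measurable
    also have "(\<integral>\<^sup>+t. (indicator {0..1} t * indicator B t * ?I t) \<partial>lborel) = ?E"
      by (intro nn_integral_cong) (auto simp: indicator_def mult.assoc)
    also have "ennreal (16 * pi\<^sup>2 * a) = ennreal (16 * pi\<^sup>2) * emeasure (poism w) A"
      using pos by (simp add: a ennreal_mult)
    finally show ?thesis .
  qed
qed

text \<open>The sum counts the unit steps of the grid \<open>m + k\<close> that fit between
  \<open>y\<close> and \<open>x\<close>. Their number is at most \<open>max 0 (x - y)\<close>, and a
  single one forces \<open>x - y \<ge> 1\<close>, where \<open>x - y\<close> is below its
  \<open>p\<close>-th power.\<close>

lemma sum_crossings_le:
  fixes m x y :: real
  assumes "p \<ge> 1"
  shows "(\<Sum>k<n. if x \<ge> m + real k + 1 \<and> y < m + real k then 1 else 0::real) \<le> \<bar>x - y\<bar> powr p"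
proof -
  define S where "S = (\<lambda>n. \<Sum>k<n. if x \<ge> m + real k + 1 \<and> y < m + real k then 1 else 0::real)"
  have S_Suc: "S (Suc n) = S n + (if x \<ge> m + real n + 1 \<and> y < m + real n then 1 else 0)" for n
    by (simp add: S_def)
  \<comment> \<open>Invariant of the count: only the part of the interval from \<open>y - m\<close>
    to \<open>x - m\<close> that lies in \<open>{0..n}\<close> can contain steps.\<close>
  have "S n \<le> max 0 (min (x - m) n - max (y - m) 0)" for n
  proof (induction n)
    case (Suc n)
    have "0 \<le> real n" by simp
    with Suc show ?case unfolding S_Suc of_nat_Suc by (smt (verit))
  qed (simp add: S_def)
  then have 1: "(\<Sum>k<n. if x \<ge> m + real k + 1 \<and> y < m + real k then 1 else 0::real) \<le> max 0 (min (x - m) n - max (y - m) 0)"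
    by (simp add: S_def)
  show ?thesis
  proof (cases "\<exists>k<n. x \<ge> m + real k + 1 \<and> y < m + real k")
    case True
    then have "x - y \<ge> 1" by auto
    then have "x - y = (x - y) powr 1" by simp
    also have "\<dots> \<le> (x - y) powr p" using assms \<open>x - y \<ge> 1\<close> by (intro powr_mono) auto
    finally have "x - y \<le> \<bar>x - y\<bar> powr p" using \<open>x - y \<ge> 1\<close> by simp
    then show ?thesis using 1 \<open>x - y \<ge> 1\<close> by (smt (verit))
  next
    case False
    then have "(\<Sum>k<n. if x \<ge> m + real k + 1 \<and> y < m + real k then 1 else 0::real) = 0"
      by (intro sum.neutral) auto
    then show ?thesis by simp
  qed
qed

definition crossing :: "(real \<Rightarrow> real) \<Rightarrow> real \<Rightarrow> ennreal" where
  "crossing u m = (\<integral>\<^sup>+t. \<integral>\<^sup>+s. indicator {0..1} t * indicator {0..1} s * (indicator {t. u t \<ge> m + 1} t * indicator (-{s. u s \<ge> m}) s *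
         ennreal (1 / (cmod (circ t - circ s))\<^sup>2)) \<partial>lborel \<partial>lborel)"

text \<open>A pair of points is charged once for each unit step between its values, hence at most
  \<open>\<bar>u t - u s\<bar> powr p\<close> times, which is its weight in the energy.\<close>

lemma sum_crossing_le:
  assumes [measurable]: "u \<in> borel_measurable borel" and p: "p \<ge> 1"
  shows "(\<Sum>k<n. crossing u (m + real k)) \<le> ener p u"
proof -
  have "(\<Sum>k<n. crossing u (m + real k)) =
      (\<integral>\<^sup>+t. \<integral>\<^sup>+s. (\<Sum>k<n. indicator {0..1} t * indicator {0..1} s * (indicator {t. u t \<ge> m + real k + 1} t * indicator (-{s. u s \<ge> m + real k}) s *
         ennreal (1 / (cmod (circ t - circ s))\<^sup>2))) \<partial>lborel \<partial>lborel)"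
    unfolding crossing_def
    by (subst nn_integral_sum[symmetric], measurable, intro nn_integral_cong, subst nn_integral_sum, measurable)
  also have "\<dots> \<le> ener p u"
    unfolding ener_def
  proof (intro nn_integral_mono)
    fix t s :: real
    let ?d = "1 / (cmod (circ t - circ s))\<^sup>2"
    have "(\<Sum>k<n. indicator {t. u t \<ge> m + real k + 1} t * indicator (-{s. u s \<ge> m + real k}) s * ennreal ?d)
      = (\<Sum>k<n. ennreal (if u t \<ge> m + real k + 1 \<and> u s < m + real k then 1 else 0)) * ennreal ?d"
      unfolding sum_distrib_right by (intro sum.cong refl) (auto simp: indicator_def)
    also have "\<dots> = ennreal ((\<Sum>k<n. if u t \<ge> m + real k + 1 \<and> u s < m + real k then 1 else 0) * ?d)"
      by (subst sum_ennreal, simp, subst ennreal_mult'', auto)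
    also have "\<dots> \<le> ennreal (\<bar>u t - u s\<bar> powr p * ?d)"
      by (intro ennreal_leI mult_right_mono sum_crossings_le p) auto
    finally show "(\<Sum>k<n. indicator {0..1} t * indicator {0..1} s * (indicator {t. u t \<ge> m + real k + 1} t * indicator (-{s. u s \<ge> m + real k}) s *
         ennreal ?d)) \<le> indicator {0..1} t * indicator {0..1} s * ennreal (\<bar>u t - u s\<bar> powr p / (cmod (circ t - circ s))\<^sup>2)"
      unfolding sum_distrib_left[symmetric] by (auto intro: mult_left_mono)
  qed
  finally show ?thesis .
qed

text \<open>Consecutive level sets satisfy
  \<open>\<alpha> (Suc k) \<le> 16 * pi\<^sup>2 * \<alpha> k * e k\<close>, where the
  \<open>e k\<close> sum to at most \<open>E\<close>. As
  \<open>x \<le> \<delta> * exp (x / \<delta>)\<close>, the product of these factors is at most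
  \<open>\<delta> ^ n\<close> times a constant, for every \<delta>.\<close>

lemma poism_level_decay:
  assumes w: "cmod w < 1" and u [measurable]: "u \<in> borel_measurable borel" and p: "p \<ge> 1"
    and E: "ener p u \<le> ennreal E" "E \<ge> 0" and \<delta>: "\<delta> > 0"
    and half: "measure (poism w) {t. u t \<ge> m} \<le> 1/2"
  shows "measure (poism w) {t. u t \<ge> m + real n} \<le> \<delta> ^ n * exp (16 * pi\<^sup>2 * E / \<delta>)"
proof -
  interpret prob_space "poism w" by (rule prob_space_poism[OF w])
  define \<alpha> where "\<alpha> = (\<lambda>n. measure (poism w) {t. u t \<ge> m + real n})"
  have em: "emeasure (poism w) {t. u t \<ge> m + real n} = ennreal (\<alpha> n)" for n
    by (simp add: \<alpha>_def emeasure_eq_measure)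
  have \<alpha>0: "\<alpha> n \<ge> 0" for n by (simp add: \<alpha>_def)
  have \<alpha>half: "\<alpha> n \<le> 1/2" for n
    unfolding \<alpha>_def by (rule order.trans[OF finite_measure_mono half]) auto
  define e where "e = (\<lambda>k. enn2real (crossing u (m + real k)))"
  have fin: "crossing u (m + real k) < \<infinity>" for k
  proof -
    have "crossing u (m + real k) \<le> (\<Sum>k<Suc k. crossing u (m + real k))"
      by (rule member_le_sum) auto
    also have "\<dots> \<le> ener p u" by (rule sum_crossing_le[OF u p])
    also have "\<dots> < \<infinity>" using E(1) by (auto simp: less_top[symmetric] top_unique)
    finally show ?thesis .
  qed
  have ek: "crossing u (m + real k) = ennreal (e k)" for k
    using fin[of k] by (simp add: e_def less_top)
  have e0: "e k \<ge> 0" for k by (simp add: e_def)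
  have esum: "(\<Sum>k<n. e k) \<le> E" for n
  proof -
    have "ennreal (\<Sum>k<n. e k) = (\<Sum>k<n. crossing u (m + real k))"
      by (subst sum_ennreal[symmetric]) (auto simp: ek e0)
    also have "\<dots> \<le> ennreal E" using sum_crossing_le[OF u p, of m n] E(1) by (rule order.trans)
    finally show ?thesis using E(2) by simp
  qed
  have step: "\<alpha> (Suc k) \<le> 16 * pi\<^sup>2 * \<alpha> k * e k" for k
  proof -
    have "ennreal (\<alpha> (Suc k)) \<le> ennreal (16 * pi\<^sup>2) * ennreal (\<alpha> k) * ennreal (e k)"
      unfolding em[symmetric] ek[symmetric] crossing_def
    proof (rule order.trans[OF poism_level_step[OF w, of "{t. u t \<ge> m + real k}"]])
      show "prob {t. u t \<ge> m + real k} \<le> 1/2" using \<alpha>half[of k] by (simp add: \<alpha>_def)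
    qed (auto simp: add_ac)
    then have "ennreal (\<alpha> (Suc k)) \<le> ennreal (16 * pi\<^sup>2 * \<alpha> k * e k)"
      using \<alpha>0 e0 by (simp add: ennreal_mult)
    then show ?thesis using \<alpha>0 e0 by simp
  qed
  have "\<alpha> n \<le> \<delta> ^ n * exp (16 * pi\<^sup>2 * (\<Sum>k<n. e k) / \<delta>)"
  proof (induction n)
    case 0
    show ?case using \<alpha>half[of 0] by simp
  next
    case (Suc n)
    have "16 * pi\<^sup>2 * e n / \<delta> \<le> exp (16 * pi\<^sup>2 * e n / \<delta>)"
      using exp_ge_add_one_self[of "16 * pi\<^sup>2 * e n / \<delta>"] by linarith
    then have x: "16 * pi\<^sup>2 * e n \<le> \<delta> * exp (16 * pi\<^sup>2 * e n / \<delta>)"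
      using \<delta> by (simp add: field_simps)
    have "\<alpha> (Suc n) \<le> \<alpha> n * (16 * pi\<^sup>2 * e n)" using step[of n] by (simp add: mult_ac)
    also have "\<dots> \<le> (\<delta> ^ n * exp (16 * pi\<^sup>2 * (\<Sum>k<n. e k) / \<delta>)) * (\<delta> * exp (16 * pi\<^sup>2 * e n / \<delta>))"
      using \<delta> e0 by (intro mult_mono[OF Suc x]) auto
    also have "\<dots> = \<delta> ^ Suc n * exp (16 * pi\<^sup>2 * (\<Sum>k<Suc n. e k) / \<delta>)"
      by (simp add: exp_add[symmetric] add_divide_distrib distrib_left mult_ac)
    finally show ?case .
  qed
  also have "\<dots> \<le> \<delta> ^ n * exp (16 * pi\<^sup>2 * E / \<delta>)"
    using esum[of n] \<delta> by (intro mult_left_mono) (auto simp: divide_right_mono)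
  finally show ?thesis by (simp add: \<alpha>_def)
qed

text \<open>Twice the bound for one side of the median. The term \<open>exp q\<close> comes from the
  set where \<open>u - m \<le> 1\<close>; the other one is a geometric series of ratio
  \<open>exp (-1)\<close>, whose sum is at most \<open>2\<close>, and results from
  \<open>\<delta> = exp (- (q + 1))\<close> in the level set decay.\<close>

definition tm_const :: "real \<Rightarrow> real \<Rightarrow> real" where
  "tm_const q E = 2 * (exp q + 2 * exp (2 * q) * exp (16 * pi\<^sup>2 * E * exp (q + 1)))"

text \<open>Layers of height one, starting at \<open>1\<close> because a median up to an error of
  \<open>1\<close> controls the level sets only from \<open>m + 1\<close> on. Between
  \<open>n + 1\<close> and \<open>n + 2\<close> the exponent is at most
  \<open>q * (n + 2)\<close>.\<close>

lemma exp_le_layers: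
  fixes x q :: real
  assumes "q \<ge> 0"
  shows "ennreal (exp (q * max 0 x)) \<le>
    ennreal (exp q) + (\<Sum>n. ennreal (exp (q * (real n + 2))) * indicator {y. y \<ge> 1 + real n} x)"
proof (cases "x \<le> 1")
  case True
  then have "q * max 0 x \<le> q * 1" by (intro mult_left_mono assms) auto
  then have "ennreal (exp (q * max 0 x)) \<le> ennreal (exp q)" by (intro ennreal_leI) simp
  then show ?thesis by (rule order.trans) simp
next
  case False
  define n where "n = nat \<lfloor>x - 1\<rfloor>"
  have n: "real n \<le> x - 1" "x - 1 < real n + 1" using False by (auto simp: n_def)
  have "q * max 0 x \<le> q * (real n + 2)" using n False by (intro mult_left_mono assms) auto
  then have "ennreal (exp (q * max 0 x)) \<le> ennreal (exp (q * (real n + 2))) * indicator {y. y \<ge> 1 + real n} x"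
    using n by (auto simp: indicator_def)
  also have "\<dots> \<le> (\<Sum>n. ennreal (exp (q * (real n + 2))) * indicator {y. y \<ge> 1 + real n} x)"
  proof -
    define f where "f = (\<lambda>n. ennreal (exp (q * (real n + 2))) * indicator {y. y \<ge> 1 + real n} x)"
    have "f n \<le> suminf f" using sum_le_suminf[of f "{n}"] by simp
    then show ?thesis unfolding f_def .
  qed
  finally show ?thesis by (rule order.trans) simp
qed

lemma poism_exp_upper:
  assumes w: "cmod w < 1" and u [measurable]: "u \<in> borel_measurable borel" and p: "p \<ge> 1"
    and E: "ener p u \<le> ennreal E" "E \<ge> 0" and q: "q \<ge> 0"
    and half: "measure (poism w) {t. u t \<ge> m + 1} \<le> 1/2"
  shows "(\<integral>\<^sup>+t. ennreal (exp (q * max 0 (u t - m))) \<partial>poism w) \<le> ennreal (tm_const q E / 2)"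
proof -
  interpret prob_space "poism w" by (rule prob_space_poism[OF w])
  define K where "K = exp (16 * pi\<^sup>2 * E * exp (q + 1))"
  have inv: "16 * pi\<^sup>2 * E / exp (-(q + 1)) = 16 * pi\<^sup>2 * E * exp (q + 1)"
    by (simp only: exp_minus divide_inverse inverse_inverse_eq)
  have "measure (poism w) {t. u t \<ge> m + 1 + real n} \<le> exp (-(q + 1)) ^ n * K" for n
    using poism_level_decay[OF w u p E _ half, of "exp (-(q+1))" n] unfolding K_def inv by simp
  then have lev: "emeasure (poism w) {t. u t \<ge> m + 1 + real n} \<le> ennreal (exp (-(q + 1)) ^ n * K)" for n
    unfolding emeasure_eq_measure by (rule ennreal_leI)
  have gs: "(\<lambda>n. exp (2 * q) * K * exp (-1) ^ n) sums (exp (2 * q) * K * (1 / (1 - exp (-1))))"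
    using sums_mult[OF geometric_sums[of "exp (-1) :: real"], of "exp (2 * q) * K"] by simp
  have "(\<integral>\<^sup>+t. ennreal (exp (q * max 0 (u t - m))) \<partial>poism w) \<le>
     (\<integral>\<^sup>+t. ennreal (exp q) + (\<Sum>n. ennreal (exp (q * (real n + 2))) * indicator {y. y \<ge> 1 + real n} (u t - m)) \<partial>poism w)"
    by (intro nn_integral_mono exp_le_layers q)
  also have "\<dots> = ennreal (exp q) + (\<Sum>n. ennreal (exp (q * (real n + 2))) * (\<integral>\<^sup>+t. indicator {y. y \<ge> 1 + real n} (u t - m) \<partial>poism w))"
    by (subst nn_integral_add, measurable, subst nn_integral_suminf, measurable,
        simp add: nn_integral_cmult emeasure_space_1[simplified])
  also have "(\<lambda>n. \<integral>\<^sup>+t. indicator {y. y \<ge> 1 + real n} (u t - m) \<partial>poism w) = (\<lambda>n. emeasure (poism w) {t. u t \<ge> m + 1 + real n})"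
  proof
    fix n
    have "(\<integral>\<^sup>+t. indicator {y. y \<ge> 1 + real n} (u t - m) \<partial>poism w) = (\<integral>\<^sup>+t. indicator {t. u t \<ge> m + 1 + real n} t \<partial>poism w)"
      by (intro nn_integral_cong) (auto simp: indicator_def)
    then show "(\<integral>\<^sup>+t. indicator {y. y \<ge> 1 + real n} (u t - m) \<partial>poism w) = emeasure (poism w) {t. u t \<ge> m + 1 + real n}"
      by (subst (asm) nn_integral_indicator) auto
  qed
  also have "ennreal (exp q) + (\<Sum>n. ennreal (exp (q * (real n + 2))) * emeasure (poism w) {t. u t \<ge> m + 1 + real n})
    \<le> ennreal (exp q) + (\<Sum>n. ennreal (exp (q * (real n + 2))) * ennreal (exp (-(q + 1)) ^ n * K))"
    by (intro add_left_mono suminf_le mult_left_mono lev) auto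
  also have "(\<lambda>n. ennreal (exp (q * (real n + 2))) * ennreal (exp (-(q + 1)) ^ n * K)) = (\<lambda>n. ennreal (exp (2 * q) * K * exp (-1) ^ n))"
  proof
    fix n
    have "exp (q * (real n + 2)) * exp (-(q + 1)) ^ n = exp (2 * q) * exp (-1) ^ n"
      by (simp add: exp_of_nat_mult[symmetric] exp_add[symmetric] algebra_simps)
    then have "exp (q * (real n + 2)) * (exp (-(q + 1)) ^ n * K) = exp (2 * q) * K * exp (-1) ^ n"
      by (simp add: mult.assoc[symmetric])
    then show "ennreal (exp (q * (real n + 2))) * ennreal (exp (-(q + 1)) ^ n * K) = ennreal (exp (2 * q) * K * exp (-1) ^ n)"
      by (subst ennreal_mult[symmetric]) (auto simp: K_def)
  qed
  also have "(\<Sum>n. ennreal (exp (2 * q) * K * exp (-1) ^ n)) = ennreal (exp (2 * q) * K * (1 / (1 - exp (-1))))"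
    using gs by (intro suminf_ennreal_eq) (auto simp: K_def)
  also have "\<dots> \<le> ennreal (exp (2 * q) * K * 2)"
  proof (intro ennreal_leI mult_left_mono)
    have "(2::real) \<le> exp 1" using exp_ge_add_one_self[of 1] by simp
    then have "exp (-1) \<le> (1/2::real)" by (simp add: exp_minus field_simps)
    then show "1 / (1 - exp (-1)) \<le> (2::real)" by (simp add: field_simps)
  qed (auto simp: K_def)
  finally show ?thesis
    unfolding tm_const_def K_def[symmetric]
    by (simp add: mult_ac ennreal_plus[symmetric] add_divide_distrib K_def del: ennreal_plus)
qed

text \<open>A median up to an error of \<open>1\<close> is enough. Along integer levels the upper
  tails tend to \<open>0\<close> and to \<open>1\<close>, so there is a least index \<open>j\<close>
  at which the tail has dropped to \<open>1/2\<close>; the level just before it serves as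
  \<open>m\<close>.\<close>

lemma exists_median:
  fixes u :: "real \<Rightarrow> real"
  assumes w: "cmod w < 1" and u [measurable]: "u \<in> borel_measurable borel"
  shows "\<exists>m. measure (poism w) {t. u t \<ge> m + 1} \<le> 1/2 \<and> measure (poism w) {t. u t \<le> m - 1} \<le> 1/2"
proof -
  interpret prob_space "poism w" by (rule prob_space_poism[OF w])
  have "(\<lambda>n. prob {t. u t \<ge> real n}) \<longlonglongrightarrow> prob (\<Inter>n. {t. u t \<ge> real n})"
    by (intro finite_Lim_measure_decseq) (auto simp: decseq_def)
  also have "(\<Inter>n. {t. u t \<ge> real n}) = {}"
  proof -
    have "\<exists>n. \<not> u t \<ge> real n" for t
      using reals_Archimedean2[of "u t"] by (simp add: not_le)
    then show ?thesis by blast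
  qed
  finally have "\<forall>\<^sub>F n in sequentially. prob {t. u t \<ge> real n} < 1/2"
    by (intro order_tendstoD) auto
  then obtain n1 where "\<forall>n\<ge>n1. prob {t. u t \<ge> real n} < 1/2"
    unfolding eventually_sequentially by blast
  then have n1: "prob {t. u t \<ge> real n1} \<le> 1/2"
    by (simp add: less_imp_le)
  have "(\<lambda>n. prob {t. u t \<ge> - real n}) \<longlonglongrightarrow> prob (\<Union>n. {t. u t \<ge> - real n})"
    by (intro finite_Lim_measure_incseq) (auto simp: incseq_def)
  also have "(\<Union>n. {t. u t \<ge> - real n}) = UNIV"
  proof -
    have "\<exists>n. u t \<ge> - real n" for t
      using real_arch_simple[of "- u t"] by (auto intro: exI simp: minus_le_iff)
    then show ?thesis by auto
  qed
  finally have "\<forall>\<^sub>F n in sequentially. prob {t. u t \<ge> - real n} > 1/2"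
    using prob_space by (intro order_tendstoD) auto
  then obtain n0 where "\<forall>n\<ge>n0. prob {t. u t \<ge> - real n} > 1/2"
    unfolding eventually_sequentially by blast
  then have n0: "prob {t. u t \<ge> - real n0} > 1/2"
    by simp
  define j where "j = (LEAST j. prob {t. u t \<ge> - real n0 + real j} \<le> 1/2)"
  have j: "prob {t. u t \<ge> - real n0 + real j} \<le> 1/2"
    unfolding j_def by (rule LeastI[of _ "n0 + n1"]) (use n1 in simp)
  have "j \<noteq> 0"
    using j n0 by (intro notI) simp
  then have j': "prob {t. u t \<ge> - real n0 + real (j - 1)} > 1/2"
    using not_less_Least[of "j - 1" "\<lambda>j. prob {t. u t \<ge> - real n0 + real j} \<le> 1/2"]
    unfolding j_def[symmetric] by simp
  define m where "m = - real n0 + real (j - 1)"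
  have "prob {t. u t \<le> m - 1} \<le> prob (space (poism w) - {t. u t \<ge> m})"
    by (intro finite_measure_mono) auto
  also have "\<dots> = 1 - prob {t. u t \<ge> m}" by (intro prob_compl) auto
  also have "\<dots> \<le> 1/2" using j' by (simp add: m_def)
  finally have "prob {t. u t \<le> m - 1} \<le> 1/2" .
  moreover have "m + 1 = - real n0 + real j" using \<open>j \<noteq> 0\<close> by (simp add: m_def of_nat_diff)
  ultimately show ?thesis using j by (intro exI[of _ m]) simp
qed

lemma ener_uminus: "ener p (\<lambda>x. - u x) = ener p u"
  unfolding ener_def by (simp add: abs_minus_commute)

text \<open>The one-sided bound is applied to \<open>u\<close> and to \<open>- u\<close> around the
  same \<open>m\<close>. The centre is fixed before \<open>q\<close>, since one centre later serves
  the exponents \<open>0\<close>, \<open>1\<close> and \<open>p / (p - 1)\<close> together.\<close>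

theorem poism_exp_integrable:
  assumes w: "cmod w < 1" and u [measurable]: "u \<in> borel_measurable borel" and p: "p \<ge> 1"
    and E: "ener p u \<le> ennreal E" "E \<ge> 0"
  obtains m where "\<And>q. q \<ge> 0 \<Longrightarrow> (\<integral>\<^sup>+t. ennreal (exp (q * \<bar>u t - m\<bar>)) \<partial>poism w) \<le> ennreal (tm_const q E)"
proof -
  obtain m where m: "measure (poism w) {t. u t \<ge> m + 1} \<le> 1/2" "measure (poism w) {t. u t \<le> m - 1} \<le> 1/2"
    using exists_median[OF w u] by auto
  show thesis
  proof (rule that[of m])
    fix q :: real assume q: "q \<ge> 0"
    have "(\<integral>\<^sup>+t. ennreal (exp (q * \<bar>u t - m\<bar>)) \<partial>poism w) \<le>
       (\<integral>\<^sup>+t. ennreal (exp (q * max 0 (u t - m))) + ennreal (exp (q * max 0 (- u t - (- m)))) \<partial>poism w)"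
    proof (intro nn_integral_mono)
      fix t
      have "\<bar>u t - m\<bar> = max 0 (u t - m) \<or> \<bar>u t - m\<bar> = max 0 (- u t - (- m))" by auto
      then have "exp (q * \<bar>u t - m\<bar>) \<le> exp (q * max 0 (u t - m)) + exp (q * max 0 (- u t - (- m)))"
        by (metis exp_ge_zero le_add_same_cancel1 le_add_same_cancel2)
      then show "ennreal (exp (q * \<bar>u t - m\<bar>)) \<le> ennreal (exp (q * max 0 (u t - m))) + ennreal (exp (q * max 0 (- u t - (- m))))"
        by (simp add: ennreal_plus[symmetric] ennreal_leI del: ennreal_plus)
    qed
    also have "\<dots> = (\<integral>\<^sup>+t. ennreal (exp (q * max 0 (u t - m))) \<partial>poism w) + (\<integral>\<^sup>+t. ennreal (exp (q * max 0 (- u t - (- m)))) \<partial>poism w)"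
      by (intro nn_integral_add) measurable
    also have "\<dots> \<le> ennreal (tm_const q E / 2) + ennreal (tm_const q E / 2)"
    proof (intro add_mono poism_exp_upper[OF w _ p _ E(2) q])
      have "{t. - m + 1 \<le> - u t} = {t. u t \<le> m - 1}" by auto
      then show "prob_space.prob (poism w) {t. - m + 1 \<le> - u t} \<le> 1/2" using m by simp
    qed (use m E in \<open>auto simp: ener_uminus\<close>)
    also have "\<dots> = ennreal (tm_const q E)"
      by (subst ennreal_plus[symmetric]) (auto simp: tm_const_def)
    finally show "(\<integral>\<^sup>+t. ennreal (exp (q * \<bar>u t - m\<bar>)) \<partial>poism w) \<le> ennreal (tm_const q E)" .
  qed
qed

section \<open>Gaussian and squared Poisson kernels\<close>

text \<open>The fourth order decay of \<open>rho w\<close> away from the boundary point nearest to \<open>w\<close> is what makes the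
  integral of \<open>rho w t * rho w s\<close> against the hyperbolic area converge; the Poisson kernel itself is too flat.\<close>
definition rho :: "complex \<Rightarrow> real \<Rightarrow> real" where
  "rho w t = (1 - (cmod w)\<^sup>2) * (pois w t)\<^sup>2"

text \<open>Counterpart of \<open>rho\<close> on the upper half plane: height cubed over the fourth
  power of the distance to the boundary point. It majorises the Gaussian moment kernels and, unlike
  them, compares well with \<open>rho\<close>.\<close>

definition qker :: "real \<Rightarrow> real \<Rightarrow> real" where
  "qker y s = y ^ 3 / (y\<^sup>2 + s\<^sup>2)\<^sup>2"

definition pt :: "complex \<Rightarrow> complex" where
  "pt z = exp (2 * pi * \<i> * z)"

lemma norm_pt: "cmod (pt z) = exp (- 2 * pi * Im z)"
  by (simp add: pt_def norm_exp_eq_Re)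

lemma norm_pt_less_1: "Im z > 0 \<Longrightarrow> cmod (pt z) < 1"
  by (simp add: norm_pt)

lemma pt_circ: "pt z = of_real (exp (- 2 * pi * Im z)) * circ (Re z)"
proof -
  have "2 * pi * \<i> * z = of_real (- 2 * pi * Im z) + 2 * pi * \<i> * of_real (Re z)"
    by (simp add: complex_eq_iff)
  then show ?thesis
    unfolding pt_def circ_exp by (simp only: exp_add exp_of_real)
qed

lemma rho_measurable [measurable]: "case_prod rho \<in> borel_measurable borel" "rho w \<in> borel_measurable borel"
proof -
  have [measurable]: "(\<lambda>x. pois (fst x) (snd x)) \<in> borel_measurable (borel \<Otimes>\<^sub>M borel)"
    using pois_measurable(1) by (simp add: case_prod_beta' borel_prod)
  have "(\<lambda>x. rho (fst x) (snd x)) \<in> borel_measurable (borel \<Otimes>\<^sub>M borel)"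
    unfolding rho_def by measurable
  then show "case_prod rho \<in> borel_measurable borel" by (simp add: borel_prod case_prod_beta')
qed (unfold rho_def, measurable)

lemma rho_nonneg: "cmod w < 1 \<Longrightarrow> rho w t \<ge> 0"
  unfolding rho_def by (intro mult_nonneg_nonneg) (auto simp: abs_square_le_1)

lemma rho_add_1: "rho w (t + 1) = rho w t"
  by (simp add: rho_def)

lemma one_minus_norm_sq_le:
  assumes w: "cmod w < 1" shows "1 - (cmod w)\<^sup>2 \<le> 2 * cmod (circ t - w)"
proof -
  have "1 - (cmod w)\<^sup>2 = (1 - cmod w) * (1 + cmod w)" by (simp add: power2_eq_square algebra_simps)
  also have "\<dots> \<le> (1 - cmod w) * 2" using w by (intro mult_left_mono) auto
  also have "1 - cmod w \<le> cmod (circ t - w)"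
    using norm_triangle_ineq2[of "circ t" w] by simp
  finally show ?thesis by simp
qed

lemma rho_le_pois:
  assumes w: "cmod w < 1" shows "rho w t \<le> 4 * pois w t"
proof -
  have P: "pois w t > 0" by (rule pois_pos[OF w])
  have d: "cmod (circ t - w) > 0" using circ_neq_interior[OF w, of t] by simp
  have n: "1 - (cmod w)\<^sup>2 \<ge> 0" using w by (simp add: abs_square_le_1)
  have "(1 - (cmod w)\<^sup>2)\<^sup>2 \<le> (2 * cmod (circ t - w))\<^sup>2"
    by (intro power_mono one_minus_norm_sq_le w n)
  then have "(1 - (cmod w)\<^sup>2) * pois w t \<le> 4"
    using d by (simp add: pois_def power_mult_distrib field_simps power2_eq_square)
  then have "((1 - (cmod w)\<^sup>2) * pois w t) * pois w t \<le> 4 * pois w t"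
    using P by (intro mult_right_mono) auto
  then show ?thesis by (simp add: rho_def power2_eq_square mult_ac)
qed

section \<open>Periodic functions: from integrals over the line to integrals over the circle\<close>

lemma nn_integral_unit_interval:
  fixes h :: "real \<Rightarrow> ennreal"
  assumes [measurable]: "h \<in> borel_measurable borel" and per: "\<And>x. h (x + 1) = h x"
  shows "(\<integral>\<^sup>+x. h x * indicator {a..a+1} x \<partial>lborel) = (\<integral>\<^sup>+x. h x * indicator {0..1} x \<partial>lborel)"
proof -
  have pern: "h (x + real n) = h x" for x n
    by (induction n arbitrary: x) (auto simp: per add.assoc[symmetric] add.commute[of 1])
  have peri: "h (x + of_int n) = h x" for x n
  proof (cases "n \<ge> 0")
    case True then show ?thesis using pern[of x "nat n"] by simp
  next
    case False then show ?thesis using pern[of "x + of_int n" "nat (-n)"] by simp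
  qed
  define r where "r = a - of_int \<lfloor>a\<rfloor>"
  have r: "0 \<le> r" "r < 1" unfolding r_def by linarith+
  have "(\<integral>\<^sup>+x. h x * indicator {a..a+1} x \<partial>lborel) =
      (\<integral>\<^sup>+x. h (of_int \<lfloor>a\<rfloor> + x) * indicator {a..a+1} (of_int \<lfloor>a\<rfloor> + x) \<partial>lborel)"
    by (subst nn_integral_real_affine[of _ 1 "of_int \<lfloor>a\<rfloor>"]) auto
  also have "\<dots> = (\<integral>\<^sup>+x. h x * indicator {r..r+1} x \<partial>lborel)"
    using peri[of _ "\<lfloor>a\<rfloor>"] by (intro nn_integral_cong) (auto simp: r_def indicator_def add.commute)
  also have "\<dots> = (\<integral>\<^sup>+x. h x * indicator {r..1} x + h x * indicator {1<..r+1} x \<partial>lborel)"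
    using r by (intro nn_integral_cong) (auto simp: indicator_def)
  also have "\<dots> = (\<integral>\<^sup>+x. h x * indicator {r..1} x \<partial>lborel) + (\<integral>\<^sup>+x. h x * indicator {1<..r+1} x \<partial>lborel)"
    by (rule nn_integral_add) auto
  also have "(\<integral>\<^sup>+x. h x * indicator {1<..r+1} x \<partial>lborel) = (\<integral>\<^sup>+x. h (1 + x) * indicator {1<..r+1} (1 + x) \<partial>lborel)"
    by (subst nn_integral_real_affine[of _ 1 1]) auto
  also have "\<dots> = (\<integral>\<^sup>+x. h x * indicator {0<..r} x \<partial>lborel)"
    using per by (intro nn_integral_cong) (auto simp: indicator_def add.commute)
  also have "(\<integral>\<^sup>+x. h x * indicator {r..1} x \<partial>lborel) + \<dots> = (\<integral>\<^sup>+x. h x * indicator {r..1} x + h x * indicator {0<..r} x \<partial>lborel)"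
    by (rule nn_integral_add[symmetric]) auto
  also have "\<dots> = (\<integral>\<^sup>+x. h x * indicator {0..1} x \<partial>lborel)"
  proof (rule nn_integral_cong_AE)
    have "AE x in lborel. x \<noteq> 0 \<and> x \<noteq> r"
      by (simp add: AE_lborel_singleton AE_conj_iff)
    then show "AE x in lborel. h x * indicator {r..1} x + h x * indicator {0<..r} x = h x * indicator {0..1} x"
      by eventually_elim (use r in \<open>auto simp: indicator_def\<close>)
  qed
  finally show ?thesis .
qed

lemma nn_integral_inverse_1_plus_square:
  "(\<integral>\<^sup>+x. ennreal (1 / (1 + x\<^sup>2)) \<partial>lborel) = ennreal pi"
proof -
  have e: "einterval (-\<infinity>) \<infinity> = UNIV" by (auto simp: einterval_def)
  have 1: "integrable lborel (\<lambda>x::real. inverse (1 + x\<^sup>2))"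
    using integrable_inverse_1_plus_square unfolding e set_integrable_def by simp
  have "(LBINT x=-\<infinity>..\<infinity>. inverse (1 + x\<^sup>2)) = (\<integral>x. inverse (1 + x\<^sup>2) \<partial>lborel)"
    unfolding interval_lebesgue_integral_def e set_lebesgue_integral_def by simp
  then have 2: "(\<integral>x. inverse (1 + x\<^sup>2) \<partial>lborel) = pi"
    using LBINT_inverse_1_plus_square by simp
  have "(\<integral>\<^sup>+x. ennreal (inverse (1 + x\<^sup>2)) \<partial>lborel) = ennreal pi"
    using 1 2 by (subst nn_integral_eq_integral) auto
  then show ?thesis by (simp add: inverse_eq_divide)
qed

lemma nn_integral_cauchy:
  assumes y: "y > 0"
  shows "(\<integral>\<^sup>+s. ennreal (y / (y\<^sup>2 + (x - s)\<^sup>2)) \<partial>lborel) = ennreal pi"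
proof -
  have "(\<integral>\<^sup>+s. ennreal (y / (y\<^sup>2 + (x - s)\<^sup>2)) \<partial>lborel) =
     ennreal \<bar>y\<bar> * (\<integral>\<^sup>+s. ennreal (y / (y\<^sup>2 + (x - (x + y * s))\<^sup>2)) \<partial>lborel)"
    using y by (intro nn_integral_real_affine) auto
  also have "\<dots> = (\<integral>\<^sup>+s. ennreal \<bar>y\<bar> * ennreal (y / (y\<^sup>2 + (x - (x + y * s))\<^sup>2)) \<partial>lborel)"
    by (intro nn_integral_cmult[symmetric]) measurable
  also have "\<dots> = (\<integral>\<^sup>+s. ennreal (1 / (1 + s\<^sup>2)) \<partial>lborel)"
  proof (intro nn_integral_cong)
    fix s :: real
    have "1 + s\<^sup>2 > 0" by (simp add: add_pos_nonneg)
    moreover have "y\<^sup>2 + (x - (x + y * s))\<^sup>2 = y\<^sup>2 * (1 + s\<^sup>2)" by (simp add: power_mult_distrib algebra_simps)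
    ultimately have "y * (y / (y\<^sup>2 + (x - (x + y * s))\<^sup>2)) = 1 / (1 + s\<^sup>2)"
      using y by (simp add: power2_eq_square)
    then show "ennreal \<bar>y\<bar> * ennreal (y / (y\<^sup>2 + (x - (x + y * s))\<^sup>2)) = ennreal (1 / (1 + s\<^sup>2))"
      using y by (subst ennreal_mult[symmetric]) auto
  qed
  finally show ?thesis by (simp add: nn_integral_inverse_1_plus_square)
qed

lemma qker_measurable [measurable]: "qker y \<in> borel_measurable borel"
  unfolding qker_def by measurable

lemma qker_le_cauchy: "y > 0 \<Longrightarrow> qker y s \<le> y / (y\<^sup>2 + s\<^sup>2)"
proof -
  assume y: "y > 0"
  then have p: "y\<^sup>2 + s\<^sup>2 > 0" by (simp add: add_pos_nonneg)
  have "y\<^sup>2 / (y\<^sup>2 + s\<^sup>2) \<le> 1" using p by simp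
  then have "(y / (y\<^sup>2 + s\<^sup>2)) * (y\<^sup>2 / (y\<^sup>2 + s\<^sup>2)) \<le> (y / (y\<^sup>2 + s\<^sup>2)) * 1"
    using y by (intro mult_left_mono) auto
  then show ?thesis by (simp add: qker_def power2_eq_square power3_eq_cube mult_ac)
qed

lemma nn_integral_qker_le: "y > 0 \<Longrightarrow> (\<integral>\<^sup>+s. ennreal (qker y (x - s)) \<partial>lborel) \<le> ennreal pi"
  unfolding nn_integral_cauchy[of y x, symmetric] by (intro nn_integral_mono ennreal_leI qker_le_cauchy)

lemma qker_nonneg: "y > 0 \<Longrightarrow> qker y s \<ge> 0"
  by (simp add: qker_def)

text \<open>At heights \<open>y \<ge> 1\<close> a shift by at most \<open>1\<close> increases
  \<open>y\<^sup>2 + s\<^sup>2\<close> by a factor of at most \<open>4\<close>, and the kernel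
  contains the square of it.\<close>

lemma qker_harnack:
  assumes y: "y \<ge> 1" and r: "0 \<le> r" "r \<le> 1"
  shows "qker y s \<le> 16 * qker y (s - r)"
proof -
  have p: "y\<^sup>2 + s\<^sup>2 > 0" "y\<^sup>2 + (s - r)\<^sup>2 > 0" using y by (auto simp: add_pos_nonneg)
  have "(s - r)\<^sup>2 \<le> 2 * s\<^sup>2 + 2 * r\<^sup>2"
    using zero_le_power2[of "s + r"] by (simp add: power2_sum power2_diff)
  moreover have "r\<^sup>2 \<le> y\<^sup>2" using r y by (intro power_mono) auto
  ultimately have "y\<^sup>2 + (s - r)\<^sup>2 \<le> 4 * (y\<^sup>2 + s\<^sup>2)"
    using zero_le_power2[of y] zero_le_power2[of s] by (smt (verit, best))
  then have "(y\<^sup>2 + (s - r)\<^sup>2)\<^sup>2 \<le> (4 * (y\<^sup>2 + s\<^sup>2))\<^sup>2"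
    using p by (intro power_mono) auto
  then have sq: "(y\<^sup>2 + (s - r)\<^sup>2)\<^sup>2 \<le> 16 * (y\<^sup>2 + s\<^sup>2)\<^sup>2" unfolding power_mult_distrib by simp
  have inv: "1 / A \<le> 16 / B" if "B \<le> 16 * A" "A > 0" "B > 0" for A B :: real
    using that by (simp add: field_simps)
  have "1 / (y\<^sup>2 + s\<^sup>2)\<^sup>2 \<le> 16 / (y\<^sup>2 + (s - r)\<^sup>2)\<^sup>2"
    by (rule inv) (use p sq in auto)
  then have "y ^ 3 * (1 / (y\<^sup>2 + s\<^sup>2)\<^sup>2) \<le> y ^ 3 * (16 / (y\<^sup>2 + (s - r)\<^sup>2)\<^sup>2)"
    using y by (intro mult_left_mono) auto
  then show ?thesis by (simp add: qker_def mult.commute)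
qed

text \<open>Averaging the Harnack inequality over all shifts in a period decouples the function from
  the kernel: the one contributes its integral over a period, the other its total mass, which is at
  most \<open>pi\<close>.\<close>

lemma nn_integral_qker_large:
  fixes h :: "real \<Rightarrow> ennreal"
  assumes [measurable]: "h \<in> borel_measurable borel" and per: "\<And>x. h (x + 1) = h x" and y: "y \<ge> 1"
  shows "(\<integral>\<^sup>+t. h t * ennreal (qker y (x - t)) \<partial>lborel) \<le> ennreal (16 * pi) * (\<integral>\<^sup>+t. h t * indicator {0..1} t \<partial>lborel)"
proof -
  let ?N = "\<integral>\<^sup>+t. h t * indicator {0..1} t \<partial>lborel"
  let ?L = "\<integral>\<^sup>+t. h t * ennreal (qker y (x - t)) \<partial>lborel"
  have "?L = (\<integral>\<^sup>+r. indicator {0..1::real} r * ?L \<partial>lborel)"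
    by (simp add: nn_integral_multc)
  also have "\<dots> \<le> (\<integral>\<^sup>+r. indicator {0..1} r * (\<integral>\<^sup>+t. h t * ennreal (16 * qker y (x - t - r)) \<partial>lborel) \<partial>lborel)"
    using y by (intro nn_integral_mono) (auto simp: indicator_def intro!: nn_integral_mono mult_left_mono ennreal_leI qker_harnack)
  also have "\<dots> = (\<integral>\<^sup>+r. indicator {0..1} r * (\<integral>\<^sup>+s. h (-r + s) * ennreal (16 * qker y (x - s)) \<partial>lborel) \<partial>lborel)"
  proof (intro nn_integral_cong)
    fix r
    have "(\<integral>\<^sup>+t. h t * ennreal (16 * qker y (x - t - r)) \<partial>lborel) = (\<integral>\<^sup>+s. h (-r + s) * ennreal (16 * qker y (x - s)) \<partial>lborel)"
      by (subst nn_integral_real_affine[of _ 1 "-r"]) (auto simp: algebra_simps)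
    then show "indicator {0..1} r * (\<integral>\<^sup>+t. h t * ennreal (16 * qker y (x - t - r)) \<partial>lborel) =
      indicator {0..1} r * (\<integral>\<^sup>+s. h (-r + s) * ennreal (16 * qker y (x - s)) \<partial>lborel)" by simp
  qed
  also have "\<dots> = (\<integral>\<^sup>+r. (\<integral>\<^sup>+s. indicator {0..1} r * (h (-r + s) * ennreal (16 * qker y (x - s))) \<partial>lborel) \<partial>lborel)"
    by (intro nn_integral_cong nn_integral_cmult[symmetric]) measurable
  also have "\<dots> = (\<integral>\<^sup>+s. (\<integral>\<^sup>+r. indicator {0..1} r * (h (-r + s) * ennreal (16 * qker y (x - s))) \<partial>lborel) \<partial>lborel)"
    by (rule lborel_pair.Fubini') measurable
  also have "\<dots> = (\<integral>\<^sup>+s. ?N * ennreal (16 * qker y (x - s)) \<partial>lborel)"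
  proof (intro nn_integral_cong)
    fix s
    have "(\<integral>\<^sup>+r. indicator {0..1} r * (h (-r + s) * ennreal (16 * qker y (x - s))) \<partial>lborel) =
       (\<integral>\<^sup>+r. (indicator {0..1} r * h (-r + s)) * ennreal (16 * qker y (x - s)) \<partial>lborel)"
      by (simp add: mult.assoc)
    also have "\<dots> = (\<integral>\<^sup>+r. indicator {0..1} r * h (-r + s) \<partial>lborel) * ennreal (16 * qker y (x - s))"
      by (rule nn_integral_multc) measurable
    also have "(\<integral>\<^sup>+r. indicator {0..1} r * h (-r + s) \<partial>lborel) = (\<integral>\<^sup>+r. h r * indicator {s-1..s-1+1} r \<partial>lborel)"
      by (subst nn_integral_real_affine[of _ "-1" s]) (auto simp: indicator_def intro!: nn_integral_cong)
    also have "\<dots> = ?N" by (rule nn_integral_unit_interval) (auto simp: per)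
    finally show "(\<integral>\<^sup>+r. indicator {0..1} r * (h (-r + s) * ennreal (16 * qker y (x - s))) \<partial>lborel) = ?N * ennreal (16 * qker y (x - s))" .
  qed
  also have "\<dots> = ?N * (\<integral>\<^sup>+s. ennreal 16 * ennreal (qker y (x - s)) \<partial>lborel)"
    using y qker_nonneg[of y] by (subst nn_integral_cmult[symmetric]) (auto simp: ennreal_mult)
  also have "\<dots> = ?N * (ennreal 16 * (\<integral>\<^sup>+s. ennreal (qker y (x - s)) \<partial>lborel))"
    by (subst nn_integral_cmult) auto
  also have "\<dots> \<le> ?N * (ennreal 16 * ennreal pi)"
    using y by (intro mult_left_mono nn_integral_qker_le) auto
  also have "\<dots> = ennreal (16 * pi) * ?N" by (simp add: ennreal_mult mult_ac)
  finally show ?thesis .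
qed

text \<open>Off the central period \<open>1 + s\<^sup>2 \<le> 5 * s\<^sup>2\<close>, which is the
  origin of \<open>25\<close>. The tail at height \<open>y\<close> is thus reduced to the kernel at
  height \<open>1\<close>, with the small factor \<open>y ^ 3\<close>.\<close>

lemma qker_tail:
  assumes "0 < y" "\<bar>s\<bar> \<ge> 1/2" shows "qker y s \<le> 25 * y ^ 3 * qker 1 s"
proof -
  have s: "s\<^sup>2 \<ge> 1/4" using assms(2) power_mono[of "1/2" "\<bar>s\<bar>" 2] by (simp add: power2_eq_square)
  have "(1 + s\<^sup>2)\<^sup>2 \<le> (5 * s\<^sup>2)\<^sup>2" using s by (intro power_mono) auto
  also have "\<dots> \<le> (5 * (y\<^sup>2 + s\<^sup>2))\<^sup>2" by (intro power_mono) auto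
  finally have "(1 + s\<^sup>2)\<^sup>2 \<le> 25 * (y\<^sup>2 + s\<^sup>2)\<^sup>2" unfolding power_mult_distrib by simp
  moreover have "(1 + s\<^sup>2)\<^sup>2 > 0" "(y\<^sup>2 + s\<^sup>2)\<^sup>2 > 0" using assms by (auto simp: add_pos_nonneg zero_less_power2 add_nonneg_eq_0_iff)
  ultimately have "1 / (y\<^sup>2 + s\<^sup>2)\<^sup>2 \<le> 25 / (1 + s\<^sup>2)\<^sup>2"
    by (simp add: field_simps)
  then have "y ^ 3 * (1 / (y\<^sup>2 + s\<^sup>2)\<^sup>2) \<le> y ^ 3 * (25 / (1 + s\<^sup>2)\<^sup>2)"
    using assms by (intro mult_left_mono) auto
  then show ?thesis by (simp add: qker_def mult.commute)
qed

lemma one_minus_norm_pt_ge: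
  assumes "y > 0" shows "min 1 y / 2 \<le> 1 - (cmod (pt (Complex x y)))\<^sup>2"
proof -
  let ?m = "min 1 y"
  have "?m / 2 \<le> 1 - 1 / (1 + ?m)" using assms by (auto simp: min_def field_simps)
  also have "\<dots> \<le> 1 - exp (- ?m)"
    using exp_ge_add_one_self[of ?m] assms by (simp add: exp_minus field_simps)
  finally have 1: "?m / 2 \<le> 1 - exp (- ?m)" .
  have "1 * y \<le> 4 * pi * y" using assms pi_ge_two by (intro mult_right_mono) auto
  then have "exp (- (4 * pi * y)) \<le> exp (- ?m)" by (simp add: min_def)
  moreover have "exp (- (4 * pi * y)) = (cmod (pt (Complex x y)))\<^sup>2"
    by (simp add: norm_pt power2_eq_square exp_add[symmetric])
  ultimately show ?thesis using 1 by simp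
qed

text \<open>Both kernels are a height cubed over a fourth power of a distance. The constant is
  \<open>8\<close>, from \<open>y / 2 \<le> 1 - (cmod w)\<^sup>2\<close> cubed, times
  \<open>64 * pi ^ 4\<close>, from the bound \<open>2 * pi * (y + \<bar>x - t\<bar>)\<close> for the
  distance between \<open>circ t\<close> and \<open>w\<close>.\<close>

lemma rho_pt_ge_qker:
  assumes y: "0 < y" "y \<le> 1"
  shows "qker y (x - t) \<le> 512 * pi ^ 4 * rho (pt (Complex x y)) t"
proof -
  let ?w = "pt (Complex x y)"
  have w: "cmod ?w < 1" using y by (simp add: norm_pt_less_1)
  have d0: "cmod (circ t - ?w) > 0" using circ_neq_interior[OF w, of t] by simp
  have "cmod (circ t - ?w) \<le> cmod (circ t - circ x) + cmod (circ x - ?w)"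
    using norm_triangle_ineq[of "circ t - circ x" "circ x - ?w"] by simp
  also have "cmod (circ t - circ x) \<le> 2 * pi * \<bar>x - t\<bar>" using dist_circ_le[of t x] by (simp add: abs_minus_commute)
  also have "circ x - ?w = of_real (1 - exp (- 2 * pi * y)) * circ x" by (simp add: pt_circ algebra_simps)
  also have "cmod \<dots> = 1 - exp (- 2 * pi * y)"
    using y by (simp only: norm_mult norm_of_real norm_circ) simp
  also have "\<dots> \<le> 2 * pi * y" using exp_ge_add_one_self[of "- 2 * pi * y"] by simp
  finally have "cmod (circ t - ?w) \<le> 2 * pi * (y + \<bar>x - t\<bar>)" by (simp add: algebra_simps)
  then have "(cmod (circ t - ?w))\<^sup>2 \<le> (2 * pi * (y + \<bar>x - t\<bar>))\<^sup>2" by (intro power_mono) auto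
  also have "\<dots> \<le> 8 * pi\<^sup>2 * (y\<^sup>2 + (x - t)\<^sup>2)"
  proof -
    have "(y + \<bar>x - t\<bar>)\<^sup>2 \<le> 2 * (y\<^sup>2 + \<bar>x - t\<bar>\<^sup>2)"
      using zero_le_power2[of "y - \<bar>x - t\<bar>"] unfolding power2_sum power2_diff by simp
    then have "4 * pi\<^sup>2 * (y + \<bar>x - t\<bar>)\<^sup>2 \<le> 4 * pi\<^sup>2 * (2 * (y\<^sup>2 + \<bar>x - t\<bar>\<^sup>2))" by (intro mult_left_mono) auto
    then show ?thesis by (simp add: power_mult_distrib)
  qed
  finally have d: "(cmod (circ t - ?w))\<^sup>2 \<le> 8 * pi\<^sup>2 * (y\<^sup>2 + (x - t)\<^sup>2)" .
  have p: "y\<^sup>2 + (x - t)\<^sup>2 > 0" using y by (simp add: add_pos_nonneg)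
  have "((cmod (circ t - ?w))\<^sup>2)\<^sup>2 \<le> (8 * pi\<^sup>2 * (y\<^sup>2 + (x - t)\<^sup>2))\<^sup>2"
    by (intro power_mono d) auto
  then have d2: "((cmod (circ t - ?w))\<^sup>2)\<^sup>2 \<le> 64 * pi ^ 4 * (y\<^sup>2 + (x - t)\<^sup>2)\<^sup>2"
    by (simp add: power_mult_distrib)
  have e: "y / 2 \<le> 1 - (cmod ?w)\<^sup>2" using one_minus_norm_pt_ge[of y x] y by (simp add: min_def split: if_splits)
  then have "(y / 2) ^ 3 \<le> (1 - (cmod ?w)\<^sup>2) ^ 3" using y by (intro power_mono) auto
  then have e3: "y ^ 3 \<le> 8 * (1 - (cmod ?w)\<^sup>2) ^ 3" by (simp add: power_divide)
  have rho: "rho ?w t = (1 - (cmod ?w)\<^sup>2) ^ 3 / ((cmod (circ t - ?w))\<^sup>2)\<^sup>2"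
    unfolding rho_def pois_def by (simp add: power_divide power3_eq_cube power2_eq_square)
  have "qker y (x - t) \<le> 8 * (1 - (cmod ?w)\<^sup>2) ^ 3 / (y\<^sup>2 + (x - t)\<^sup>2)\<^sup>2"
    unfolding qker_def by (intro divide_right_mono e3) auto
  also have "\<dots> \<le> 8 * (1 - (cmod ?w)\<^sup>2) ^ 3 / (((cmod (circ t - ?w))\<^sup>2)\<^sup>2 / (64 * pi ^ 4))"
    using d2 d0 p e y by (intro divide_left_mono) (auto simp: field_simps intro!: mult_pos_pos)
  also have "\<dots> = 512 * pi ^ 4 * rho ?w t" by (simp add: rho)
  finally show ?thesis .
qed

lemma rho_pt_ge:
  assumes y: "0 < y"
  shows "(min 1 y) ^ 3 \<le> 128 * rho (pt (Complex x y)) t"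
proof -
  let ?w = "pt (Complex x y)"
  have w: "cmod ?w < 1" using y by (simp add: norm_pt_less_1)
  have d0: "cmod (circ t - ?w) > 0" using circ_neq_interior[OF w, of t] by simp
  have "cmod (circ t - ?w) \<le> 2" using norm_triangle_ineq4[of "circ t" ?w] w by simp
  then have "(cmod (circ t - ?w))^4 \<le> 2^4" by (intro power_mono) auto
  then have d: "((cmod (circ t - ?w))\<^sup>2)\<^sup>2 \<le> 16" by simp
  have e: "min 1 y / 2 \<le> 1 - (cmod ?w)\<^sup>2" using one_minus_norm_pt_ge[of y x] y by simp
  then have "(min 1 y / 2) ^ 3 \<le> (1 - (cmod ?w)\<^sup>2) ^ 3" using y by (intro power_mono) auto
  then have e3: "(min 1 y) ^ 3 \<le> 8 * (1 - (cmod ?w)\<^sup>2) ^ 3" by (simp add: power_divide)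
  have rho: "rho ?w t = (1 - (cmod ?w)\<^sup>2) ^ 3 / ((cmod (circ t - ?w))\<^sup>2)\<^sup>2"
    unfolding rho_def pois_def by (simp add: power_divide power3_eq_cube power2_eq_square)
  have "(1 - (cmod ?w)\<^sup>2) ^ 3 / 16 \<le> (1 - (cmod ?w)\<^sup>2) ^ 3 / ((cmod (circ t - ?w))\<^sup>2)\<^sup>2"
    using d d0 e y w by (intro divide_left_mono) (auto simp: abs_square_le_1)
  with e3 show ?thesis unfolding rho by simp
qed

text \<open>The first summand belongs to the central period. The second is the tail:
  \<open>25\<close> from \<open>qker_tail\<close>, \<open>16 * pi\<close> from the mean at height
  \<open>1\<close>, and \<open>128\<close> from \<open>rho_pt_ge\<close>.\<close>

definition ker_const :: real where "ker_const = 512 * pi ^ 4 + 51200 * pi"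

lemma ker_const_pos: "ker_const > 0"
  by (simp add: ker_const_def add_pos_pos)

lemma ennreal_mult_assoc:
  "0 \<le> a \<Longrightarrow> 0 \<le> b \<Longrightarrow> ennreal a * (ennreal b * R) = ennreal (a * b) * R"
  by (simp add: ennreal_mult mult.assoc)

text \<open>The bridge between Gaussian estimates on the line and Poisson estimates on the circle.
  For \<open>y < 1\<close> the kernels are compared on the period centred at \<open>x\<close>, and
  the rest is controlled by the mean over a period; for \<open>y \<ge> 1\<close> the mean alone
  controls everything.\<close>

lemma nn_integral_qker_le_rho:
  fixes h :: "real \<Rightarrow> ennreal"
  assumes [measurable]: "h \<in> borel_measurable borel" and per: "\<And>x. h (x + 1) = h x" and y: "y > 0"
  shows "(\<integral>\<^sup>+t. h t * ennreal (qker y (x - t)) \<partial>lborel) \<le>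
     ennreal ker_const * (\<integral>\<^sup>+t. h t * ennreal (rho (pt (Complex x y)) t) * indicator {0..1} t \<partial>lborel)"
    (is "?L \<le> _ * ?R")
proof -
  let ?w = "pt (Complex x y)"
  have w: "cmod ?w < 1" using y by (simp add: norm_pt_less_1)
  \<comment> \<open>The plain mean is absorbed into \<open>?R\<close> at the price of
    \<open>(min 1 y) ^ 3\<close>, which is the smallness that \<open>qker_tail\<close>
    provides.\<close>
  have N: "ennreal ((min 1 y) ^ 3) * (\<integral>\<^sup>+t. h t * indicator {0..1} t \<partial>lborel) \<le> ennreal 128 * ?R"
  proof -
    have "ennreal ((min 1 y) ^ 3) * (\<integral>\<^sup>+t. h t * indicator {0..1} t \<partial>lborel) =
       (\<integral>\<^sup>+t. ennreal ((min 1 y) ^ 3) * (h t * indicator {0..1} t) \<partial>lborel)"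
      by (intro nn_integral_cmult[symmetric]) measurable
    also have "\<dots> \<le> (\<integral>\<^sup>+t. ennreal 128 * (h t * ennreal (rho ?w t) * indicator {0..1} t) \<partial>lborel)"
    proof (intro nn_integral_mono)
      fix t
      have "ennreal ((min 1 y) ^ 3) \<le> ennreal 128 * ennreal (rho ?w t)"
        using rho_pt_ge[OF y, of x t] rho_nonneg[OF w, of t] by (subst ennreal_mult[symmetric]) (auto intro: ennreal_leI)
      then have "ennreal ((min 1 y) ^ 3) * (h t * indicator {0..1} t) \<le> (ennreal 128 * ennreal (rho ?w t)) * (h t * indicator {0..1} t)"
        by (intro mult_right_mono) auto
      then show "ennreal ((min 1 y) ^ 3) * (h t * indicator {0..1} t) \<le> ennreal 128 * (h t * ennreal (rho ?w t) * indicator {0..1} t)"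
        by (simp add: mult_ac)
    qed
    also have "\<dots> = ennreal 128 * ?R" by (intro nn_integral_cmult) measurable
    finally show ?thesis .
  qed
  show ?thesis
  proof (cases "y \<ge> 1")
    case True
    have "?L \<le> ennreal (16 * pi) * (\<integral>\<^sup>+t. h t * indicator {0..1} t \<partial>lborel)"
      by (rule nn_integral_qker_large) (use True per in auto)
    also have "\<dots> \<le> ennreal (16 * pi) * (ennreal 128 * ?R)"
      using N True by (intro mult_left_mono) (auto simp: min_def)
    also have "\<dots> = ennreal (2048 * pi) * ?R"
      by (subst ennreal_mult_assoc) auto
    also have "\<dots> \<le> ennreal ker_const * ?R"
      by (intro mult_right_mono ennreal_leI) (auto simp: ker_const_def)
    finally show ?thesis .
  next
    case False
    then have y1: "y \<le> 1" by simp
    let ?I = "{x - 1/2..x - 1/2 + 1}"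
    have "?L \<le> (\<integral>\<^sup>+t. ennreal (512 * pi ^ 4) * (h t * ennreal (rho ?w t) * indicator ?I t) + ennreal (25 * y ^ 3) * (h t * ennreal (qker 1 (x - t))) \<partial>lborel)"
    proof (intro nn_integral_mono)
      fix t
      show "h t * ennreal (qker y (x - t)) \<le> ennreal (512 * pi ^ 4) * (h t * ennreal (rho ?w t) * indicator ?I t) + ennreal (25 * y ^ 3) * (h t * ennreal (qker 1 (x - t)))"
      proof (cases "t \<in> ?I")
        case True
        have "ennreal (qker y (x - t)) \<le> ennreal (512 * pi ^ 4) * ennreal (rho ?w t)"
          using rho_pt_ge_qker[OF y y1, of x t] rho_nonneg[OF w, of t] by (subst ennreal_mult[symmetric]) (auto intro: ennreal_leI)
        then have "h t * ennreal (qker y (x - t)) \<le> h t * (ennreal (512 * pi ^ 4) * ennreal (rho ?w t))"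
          by (intro mult_left_mono) auto
        also have "\<dots> = ennreal (512 * pi ^ 4) * (h t * ennreal (rho ?w t) * indicator ?I t)" using True by (simp add: mult_ac)
        finally show ?thesis by (rule order.trans) simp
      next
        case False
        then have "\<bar>x - t\<bar> \<ge> 1/2" by auto
        then have "ennreal (qker y (x - t)) \<le> ennreal (25 * y ^ 3) * ennreal (qker 1 (x - t))"
          using qker_tail[OF y, of "x - t"] qker_nonneg[of 1 "x - t"] y by (subst ennreal_mult[symmetric]) (auto intro: ennreal_leI)
        then have "h t * ennreal (qker y (x - t)) \<le> h t * (ennreal (25 * y ^ 3) * ennreal (qker 1 (x - t)))"
          by (intro mult_left_mono) auto
        also have "\<dots> = ennreal (25 * y ^ 3) * (h t * ennreal (qker 1 (x - t)))" by (simp add: mult_ac)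
        finally show ?thesis by (rule order.trans) simp
      qed
    qed
    also have "\<dots> = ennreal (512 * pi ^ 4) * (\<integral>\<^sup>+t. h t * ennreal (rho ?w t) * indicator ?I t \<partial>lborel) + ennreal (25 * y ^ 3) * (\<integral>\<^sup>+t. h t * ennreal (qker 1 (x - t)) \<partial>lborel)"
      by (simp add: nn_integral_add nn_integral_cmult)
    also have "\<dots> \<le> ennreal (512 * pi ^ 4) * ?R + ennreal (51200 * pi) * ?R"
    proof (rule add_mono)
      have "(\<integral>\<^sup>+t. h t * ennreal (rho ?w t) * indicator ?I t \<partial>lborel) = ?R"
        by (rule nn_integral_unit_interval) (auto simp: per rho_add_1)
      then show "ennreal (512 * pi ^ 4) * (\<integral>\<^sup>+t. h t * ennreal (rho ?w t) * indicator ?I t \<partial>lborel) \<le> ennreal (512 * pi ^ 4) * ?R"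
        by simp
      let ?N = "\<integral>\<^sup>+t. h t * indicator {0..1} t \<partial>lborel"
      have "ennreal (25 * y ^ 3) * (\<integral>\<^sup>+t. h t * ennreal (qker 1 (x - t)) \<partial>lborel) \<le> ennreal (25 * y ^ 3) * (ennreal (16 * pi) * ?N)"
        by (intro mult_left_mono nn_integral_qker_large) (auto simp: per)
      also have "\<dots> = ennreal (400 * pi * y ^ 3) * ?N"
        using y by (subst ennreal_mult_assoc) (auto simp: mult_ac)
      also have "\<dots> = ennreal (400 * pi) * (ennreal (y ^ 3) * ?N)"
        using y by (subst ennreal_mult_assoc) auto
      also have "\<dots> \<le> ennreal (400 * pi) * (ennreal 128 * ?R)"
        using N y1 by (intro mult_left_mono) (auto simp: min_def split: if_splits)
      also have "\<dots> = ennreal (51200 * pi) * ?R"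
        by (subst ennreal_mult_assoc) auto
      finally show "ennreal (25 * y ^ 3) * (\<integral>\<^sup>+t. h t * ennreal (qker 1 (x - t)) \<partial>lborel) \<le> ennreal (51200 * pi) * ?R" .
    qed
    also have "\<dots> = ennreal ker_const * ?R"
      unfolding ker_const_def by (simp add: distrib_right)
    finally show ?thesis .
  qed
qed

section \<open>Gaussian moment kernels and elementary inequalities\<close>

definition gk :: "nat \<Rightarrow> real \<Rightarrow> real \<Rightarrow> real \<Rightarrow> real" where
  "gk j x y t = ((x - t) / y) ^ j * gphi ((x - t) / y) / y"

lemma gphi_measurable [measurable]: "gphi \<in> borel_measurable borel"
  unfolding gphi_def by measurable

lemma gk_measurable [measurable]: "gk j x y \<in> borel_measurable borel"
  unfolding gk_def by measurable

lemma gphi_nonneg: "gphi s \<ge> 0" by (simp add: gphi_def)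

text \<open>Fourth power of \<open>(1 + s\<^sup>2) / 4 \<le> exp (s\<^sup>2 / 4)\<close>; hence
  \<open>256 = 4 ^ 4\<close>.\<close>

lemma exp_neg_square_le: "exp (- s\<^sup>2) \<le> 256 / (1 + s\<^sup>2) ^ 4" for s :: real
proof -
  have "(1 + x) / 4 \<le> e" if "1 + x / 4 \<le> e" for x e :: real
    using that by (simp add: field_simps)
  then have "(1 + s\<^sup>2) / 4 \<le> exp (s\<^sup>2 / 4)"
    using exp_ge_add_one_self[of "s\<^sup>2 / 4"] by blast
  then have "((1 + s\<^sup>2) / 4) ^ 4 \<le> exp (s\<^sup>2 / 4) ^ 4" by (intro power_mono) auto
  also have "\<dots> = exp (s\<^sup>2)" by (simp add: exp_of_nat_mult[symmetric])
  finally have "(1 + s\<^sup>2) ^ 4 \<le> 256 * exp (s\<^sup>2)" by (simp add: power_divide)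
  moreover have "(1 + s\<^sup>2) ^ 4 > 0" by (intro zero_less_power add_pos_nonneg) auto
  moreover have "inverse e \<le> 256 / B" if "B \<le> 256 * e" "B > 0" "e > 0" for B e :: real
    using that by (simp add: field_simps)
  ultimately show ?thesis unfolding exp_minus by (meson exp_gt_zero)
qed

lemma gphi_bound:
  assumes "j \<le> 4" shows "\<bar>s\<bar> ^ j * gphi s \<le> 256 / (1 + s\<^sup>2) ^ 2"
proof -
  have pos: "1 + s\<^sup>2 > 0" by (simp add: add_pos_nonneg)
  have j: "\<bar>s\<bar> ^ j \<le> (1 + s\<^sup>2)\<^sup>2"
  proof (cases "\<bar>s\<bar> \<le> 1")
    case True
    then have "\<bar>s\<bar> ^ j \<le> 1" by (simp add: power_le_one)
    also have "1 \<le> (1 + s\<^sup>2)\<^sup>2" by (simp add: one_le_power)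
    finally show ?thesis .
  next
    case False
    then have "\<bar>s\<bar> ^ j \<le> \<bar>s\<bar> ^ 4" using assms by (intro power_increasing) auto
    also have "\<dots> = (s\<^sup>2)\<^sup>2" by simp
    also have "\<dots> \<le> (1 + s\<^sup>2)\<^sup>2" by (intro power_mono) auto
    finally show ?thesis .
  qed
  have "1 \<le> sqrt pi" using pi_ge_two by (intro real_le_rsqrt) simp
  then have "gphi s \<le> exp (- s\<^sup>2) / 1" unfolding gphi_def by (intro divide_left_mono) auto
  then have g: "gphi s \<le> 256 / (1 + s\<^sup>2) ^ 4" using exp_neg_square_le[of s] by simp
  have "\<bar>s\<bar> ^ j * gphi s \<le> (1 + s\<^sup>2)\<^sup>2 * (256 / (1 + s\<^sup>2) ^ 4)"
    by (intro mult_mono j g) (auto simp: gphi_nonneg)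
  also have "A\<^sup>2 * (256 / A ^ 4) = 256 / A ^ 2" if "A > 0" for A :: real
    using that by (simp add: field_simps power2_eq_square power4_eq_xxxx)
  note this[OF pos]
  finally show ?thesis .
qed

lemma abs_gk_le:
  assumes "j \<le> 4" "y > 0" shows "\<bar>gk j x y t\<bar> \<le> 256 * qker y (x - t)"
proof -
  let ?s = "(x - t) / y"
  have "y\<^sup>2 + (x - t)\<^sup>2 = y\<^sup>2 * (1 + ?s\<^sup>2)" using assms(2) by (simp add: power_divide distrib_left)
  then have "qker y (x - t) = 1 / (1 + ?s\<^sup>2) ^ 2 / y"
    using assms(2) by (simp add: qker_def power_mult_distrib power2_eq_square power3_eq_cube)
  moreover have "\<bar>gk j x y t\<bar> = \<bar>?s\<bar> ^ j * gphi ?s / y"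
    using assms(2) by (simp add: gk_def abs_mult power_abs gphi_nonneg)
  ultimately show ?thesis
    using divide_right_mono[OF gphi_bound[OF assms(1), of ?s], of y] assms(2) by simp
qed

lemma has_bochner_integral_gphi_moments:
  "has_bochner_integral lborel gphi 1"
  "has_bochner_integral lborel (\<lambda>s. s * gphi s) 0"
  "has_bochner_integral lborel (\<lambda>s. s\<^sup>2 * gphi s) (1/2)"
proof -
  have "has_bochner_integral lborel (\<lambda>s::real. exp (- s\<^sup>2) * s ^ (2 * 0)) (2 * (sqrt pi / 2 * (fact (2 * 0) / (2 ^ (2 * 0) * fact 0))))"
    using has_bochner_integral_even_function[OF gaussian_moment_even_pos[of 0]] by simp
  from has_bochner_integral_divide_zero[OF this, of "sqrt pi"]
  show "has_bochner_integral lborel gphi 1" by (simp add: gphi_def[abs_def])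
  have "has_bochner_integral lborel (\<lambda>s::real. exp (- s\<^sup>2) * s ^ (2 * 0 + 1)) 0"
    using has_bochner_integral_odd_function[OF gaussian_moment_odd_pos[of 0]] by simp
  from has_bochner_integral_divide_zero[OF this, of "sqrt pi"]
  show "has_bochner_integral lborel (\<lambda>s. s * gphi s) 0" by (simp add: gphi_def[abs_def] mult.commute)
  have "has_bochner_integral lborel (\<lambda>s::real. exp (- s\<^sup>2) * s ^ (2 * 1)) (2 * (sqrt pi / 2 * (fact (2 * 1) / (2 ^ (2 * 1) * fact 1))))"
    using has_bochner_integral_even_function[OF gaussian_moment_even_pos[of 1]] by simp
  from has_bochner_integral_divide_zero[OF this, of "sqrt pi"]
  show "has_bochner_integral lborel (\<lambda>s. s\<^sup>2 * gphi s) (1/2)" by (simp add: gphi_def[abs_def] mult.commute)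
qed

lemma has_bochner_integral_gk:
  assumes y: "y > 0"
  shows "has_bochner_integral lborel (gk 0 x y) 1"
    "has_bochner_integral lborel (gk 1 x y) 0"
    "has_bochner_integral lborel (gk 2 x y) (1/2)"
proof -
  have *: "has_bochner_integral lborel (\<lambda>t. k ((x - t) / y) / y) c" if "has_bochner_integral lborel k c" for k :: "real \<Rightarrow> real" and c
  proof -
    have eq: "x / y + (- 1 / y) * t = (x - t) / y" for t using y by (simp add: field_simps)
    have "has_bochner_integral lborel (\<lambda>t. k (x / y + (- 1 / y) * t)) (c /\<^sub>R \<bar>- 1 / y\<bar>)"
      using that y by (intro lborel_has_bochner_integral_real_affine_iff[THEN iffD1]) auto
    from has_bochner_integral_divide_zero[OF this, of y] show ?thesis
      unfolding eq using y by simp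
  qed
  show "has_bochner_integral lborel (gk 0 x y) 1"
    using *[OF has_bochner_integral_gphi_moments(1)] by (simp add: gk_def[abs_def])
  show "has_bochner_integral lborel (gk 1 x y) 0"
    using *[OF has_bochner_integral_gphi_moments(2)] by (simp add: gk_def[abs_def])
  show "has_bochner_integral lborel (gk 2 x y) (1/2)"
    using *[OF has_bochner_integral_gphi_moments(3)] by (simp add: gk_def[abs_def])
qed

definition dosc :: "real \<Rightarrow> (real \<Rightarrow> real) \<Rightarrow> complex \<Rightarrow> ennreal" where
  "dosc p u w = (\<integral>\<^sup>+t. \<integral>\<^sup>+s. indicator {0..1} t * indicator {0..1} s *
     ennreal (\<bar>u t - u s\<bar> powr p * (rho w t * rho w s)) \<partial>lborel \<partial>lborel)"

text \<open>Young's inequality with a free parameter, by comparing \<open>X\<close> with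
  \<open>\<sigma> * W powr (1 / (p - 1))\<close>. Integrating it and optimising \<sigma> afterwards
  plays the role of Hoelder's inequality for nonnegative extended integrals.\<close>

lemma mult_le_powr_split:
  fixes X W \<sigma> p :: real
  assumes "X \<ge> 0" "W > 0" "\<sigma> > 0" "p > 1"
  shows "X * W \<le> \<sigma> powr (1 - p) * X powr p + \<sigma> * W powr (p / (p - 1))"
proof (cases "X \<ge> \<sigma> * W powr (1 / (p - 1))")
  case True
  then have X: "X > 0" using assms by (intro less_le_trans[OF _ True]) auto
  have "W powr (1 / (p - 1)) \<le> X / \<sigma>" using True assms by (simp add: field_simps)
  then have "(W powr (1 / (p - 1))) powr (p - 1) \<le> (X / \<sigma>) powr (p - 1)"
    using assms by (intro powr_mono2) auto
  then have "W \<le> (X / \<sigma>) powr (p - 1)" using assms by (simp add: powr_powr)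
  then have "X * W \<le> X * (X / \<sigma>) powr (p - 1)" using X by (intro mult_left_mono) auto
  also have "\<dots> = \<sigma> powr (1 - p) * X powr p"
  proof -
    have "X powr p = X powr 1 * X powr (p - 1)" unfolding powr_add[symmetric] by simp
    moreover have "\<sigma> powr (1 - p) = 1 / \<sigma> powr (p - 1)"
      unfolding powr_minus_divide[symmetric] by simp
    ultimately show ?thesis using X assms by (simp add: powr_divide)
  qed
  finally show ?thesis using assms by (simp add: add_increasing2)
next
  case False
  have "X * W \<le> (\<sigma> * W powr (1 / (p - 1))) * W"
    using False assms by (intro mult_right_mono) auto
  also have "\<dots> = \<sigma> * (W powr (1 / (p - 1)) * W powr 1)" using assms by simp
  also have "\<dots> = \<sigma> * W powr (p / (p - 1))"
  proof -
    have "1 / (p - 1) + 1 = p / (p - 1)" using assms by (simp add: field_simps)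
    then show ?thesis unfolding powr_add[symmetric] by simp
  qed
  finally show ?thesis using assms by (simp add: add_increasing)
qed

lemma abs_exp_diff_le:
  "\<bar>exp a - exp b\<bar> \<le> \<bar>a - b\<bar> * (exp \<bar>a\<bar> + exp \<bar>b\<bar>)" for a b :: real
proof -
  have *: "exp a - exp b \<le> (a - b) * exp \<bar>a\<bar>" if "a \<ge> b" for a b :: real
  proof -
    have "1 - (a - b) \<le> exp (- (a - b))" using exp_ge_add_one_self[of "-(a - b)"] by linarith
    then have "exp a * (1 - exp (- (a - b))) \<le> exp a * (a - b)" by (intro mult_left_mono) auto
    also have "exp a * (1 - exp (- (a - b))) = exp a - exp b"
      by (simp add: right_diff_distrib exp_add[symmetric])
    also have "exp a * (a - b) \<le> exp \<bar>a\<bar> * (a - b)" using that by (intro mult_right_mono) auto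
    finally show ?thesis by (simp add: mult.commute)
  qed
  show ?thesis
  proof (cases "a \<ge> b")
    case True
    have "(a - b) * exp \<bar>a\<bar> \<le> (a - b) * (exp \<bar>a\<bar> + exp \<bar>b\<bar>)" using True by (intro mult_left_mono) auto
    then show ?thesis using *[OF True] True by simp
  next
    case False
    have "(b - a) * exp \<bar>b\<bar> \<le> (b - a) * (exp \<bar>a\<bar> + exp \<bar>b\<bar>)" using False by (intro mult_left_mono) auto
    then have "exp b - exp a \<le> (b - a) * (exp \<bar>a\<bar> + exp \<bar>b\<bar>)"
      using *[of a b] False by linarith
    then show ?thesis using False by simp
  qed
qed

text \<open>A completed square. Integrated against a positive weight it bounds an integral of
  \<open>exp x\<close> from below in terms of an upper bound for that of \<open>exp (- x)\<close>:
  Cauchy-Schwarz in a form that is linear in the integrals.\<close>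

lemma exp_ge_parabola: "exp x \<ge> 2 * \<tau> - \<tau>\<^sup>2 * exp (- x)" for x \<tau> :: real
proof -
  have "0 \<le> (exp (x / 2) - \<tau> * exp (- x / 2))\<^sup>2" by simp
  also have "\<dots> = exp x - 2 * \<tau> + \<tau>\<^sup>2 * exp (- x)"
    by (simp add: power2_diff power_mult_distrib exp_add[symmetric] power2_eq_square algebra_simps)
  finally show ?thesis by simp
qed

section \<open>Gaussian moments and the dilatation\<close>

definition osc_const :: "real \<Rightarrow> real \<Rightarrow> real" where
  "osc_const q E = 4 * tm_const q E"

definition mom_const :: "real \<Rightarrow> real" where
  "mom_const E = 256 * (ker_const * osc_const 1 E)"

lemma tm_const_pos: "tm_const q E > 0"
  unfolding tm_const_def by (intro mult_pos_pos add_pos_pos) auto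

lemma osc_const_pos: "osc_const q E > 0"
  by (simp add: osc_const_def tm_const_pos)

lemma mom_const_pos: "mom_const E > 0"
  by (simp add: mom_const_def osc_const_pos ker_const_pos)

locale besov =
  fixes p E :: real and u :: "real \<Rightarrow> real"
  assumes p: "p > 1" and u [measurable]: "u \<in> borel_measurable borel"
    and per [simp]: "\<And>x. u (x + 1) = u x"
    and ener: "ener p u \<le> ennreal E" and E: "E \<ge> 0"
begin

lemma u_add_nat: "u (x + real n) = u x"
proof (induction n)
  case (Suc n)
  then show ?case using per[of "x + real n"] by (simp add: add_ac)
qed simp

lemma u_add_of_int: "u (x + of_int n) = u x"
proof (cases "n \<ge> 0")
  case True
  then show ?thesis using u_add_nat[of x "nat n"] by simp
next
  case False
  then show ?thesis using u_add_nat[of "x + of_int n" "nat (- n)"] by simp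
qed

lemma exp_osc_rho:
  assumes w: "cmod w < 1"
  obtains m where "\<And>q. q \<ge> 0 \<Longrightarrow> (\<integral>\<^sup>+t. ennreal (exp (q * \<bar>u t - m\<bar>)) * ennreal (rho w t) * indicator {0..1} t \<partial>lborel) \<le> ennreal (osc_const q E)"
proof -
  obtain m where m: "\<And>q. q \<ge> 0 \<Longrightarrow> (\<integral>\<^sup>+t. ennreal (exp (q * \<bar>u t - m\<bar>)) \<partial>poism w) \<le> ennreal (tm_const q E)"
    using poism_exp_integrable[OF w u _ ener E] p by (metis less_imp_le)
  show thesis
  proof (rule that[of m])
    fix q :: real assume q: "q \<ge> 0"
    have "(\<integral>\<^sup>+t. ennreal (exp (q * \<bar>u t - m\<bar>)) * ennreal (rho w t) * indicator {0..1} t \<partial>lborel) \<le>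
      (\<integral>\<^sup>+t. 4 * (ennreal (pois w t) * indicator {0..1} t * ennreal (exp (q * \<bar>u t - m\<bar>))) \<partial>lborel)"
    proof (intro nn_integral_mono)
      fix t
      have "ennreal (rho w t) \<le> ennreal (4 * pois w t)" by (intro ennreal_leI rho_le_pois w)
      then have "ennreal (rho w t) \<le> 4 * ennreal (pois w t)" by (simp add: ennreal_mult')
      then have "ennreal (exp (q * \<bar>u t - m\<bar>)) * ennreal (rho w t) * indicator {0..1} t \<le>
         ennreal (exp (q * \<bar>u t - m\<bar>)) * (4 * ennreal (pois w t)) * indicator {0..1} t"
        by (intro mult_mono) auto
      then show "ennreal (exp (q * \<bar>u t - m\<bar>)) * ennreal (rho w t) * indicator {0..1} t \<le>
         4 * (ennreal (pois w t) * indicator {0..1} t * ennreal (exp (q * \<bar>u t - m\<bar>)))"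
        by (simp add: mult_ac)
    qed
    also have "\<dots> = 4 * (\<integral>\<^sup>+t. ennreal (exp (q * \<bar>u t - m\<bar>)) \<partial>poism w)"
      by (simp add: nn_integral_cmult poism_def nn_integral_density)
    also have "\<dots> \<le> 4 * ennreal (tm_const q E)"
      by (intro mult_left_mono m q) auto
    also have "\<dots> = ennreal (osc_const q E)" by (simp add: osc_const_def ennreal_mult')
    finally show "(\<integral>\<^sup>+t. ennreal (exp (q * \<bar>u t - m\<bar>)) * ennreal (rho w t) * indicator {0..1} t \<partial>lborel) \<le> ennreal (osc_const q E)" .
  qed
qed

text \<open>One number for all \<open>q\<close>. It only enters estimates at a fixed point
  \<open>w\<close>, where it normalises \<open>u\<close>, so an arbitrary choice serves.\<close>

definition med :: "complex \<Rightarrow> real" where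
  "med w = (SOME m. \<forall>q\<ge>0. (\<integral>\<^sup>+t. ennreal (exp (q * \<bar>u t - m\<bar>)) * ennreal (rho w t) * indicator {0..1} t \<partial>lborel) \<le> ennreal (osc_const q E))"

lemma exp_osc_med:
  assumes w: "cmod w < 1" and q: "q \<ge> 0"
  shows "(\<integral>\<^sup>+t. ennreal (exp (q * \<bar>u t - med w\<bar>)) * ennreal (rho w t) * indicator {0..1} t \<partial>lborel) \<le> ennreal (osc_const q E)"
proof -
  have "\<exists>m. \<forall>q\<ge>0. (\<integral>\<^sup>+t. ennreal (exp (q * \<bar>u t - m\<bar>)) * ennreal (rho w t) * indicator {0..1} t \<partial>lborel) \<le> ennreal (osc_const q E)"
    using exp_osc_rho[OF w] by metis
  from someI_ex[OF this] q show ?thesis unfolding med_def by blast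
qed

context
  fixes x y :: real and w :: complex and m :: real
  assumes y: "y > 0"
  defines "w \<equiv> pt (Complex x y)" and "m \<equiv> med w"
begin

lemma exp_osc_qker:
  "(\<integral>\<^sup>+t. ennreal (exp (\<bar>u t - m\<bar>)) * ennreal (qker y (x - t)) \<partial>lborel) \<le> ennreal (ker_const * osc_const 1 E)"
proof -
  have w: "cmod w < 1" using y by (simp add: w_def norm_pt_less_1)
  have "(\<integral>\<^sup>+t. ennreal (exp (\<bar>u t - m\<bar>)) * ennreal (qker y (x - t)) \<partial>lborel) \<le>
     ennreal ker_const * (\<integral>\<^sup>+t. ennreal (exp (1 * \<bar>u t - med w\<bar>)) * ennreal (rho w t) * indicator {0..1} t \<partial>lborel)"
    using nn_integral_qker_le_rho[OF _ _ y, of "\<lambda>t. ennreal (exp (\<bar>u t - m\<bar>))" x] by (simp add: w_def m_def)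
  also have "\<dots> \<le> ennreal ker_const * ennreal (osc_const 1 E)"
    by (intro mult_left_mono exp_osc_med w) auto
  also have "\<dots> = ennreal (ker_const * osc_const 1 E)"
    by (intro ennreal_mult[symmetric]) (auto intro: less_imp_le osc_const_pos ker_const_pos)
  finally show ?thesis .
qed

text \<open>Stated for any \<open>f\<close> below \<open>exp \<bar>u t - m\<bar>\<close>, so that
  one bound covers both \<open>exp (u t - m)\<close> and its reciprocal, the two sides of
  \<open>exp_ge_parabola\<close>.\<close>

lemma gk_weighted:
  assumes j: "j \<le> 4" and f [measurable]: "f \<in> borel_measurable borel" and le: "\<And>t. \<bar>f t\<bar> \<le> exp \<bar>u t - m\<bar>"
  shows "integrable lborel (\<lambda>t. f t * gk j x y t)" "(\<integral>t. \<bar>f t * gk j x y t\<bar> \<partial>lborel) \<le> mom_const E"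
proof -
  have *: "(\<integral>\<^sup>+t. ennreal (norm (f t * gk j x y t)) \<partial>lborel) \<le> ennreal (mom_const E)"
  proof -
    have "(\<integral>\<^sup>+t. ennreal (norm (f t * gk j x y t)) \<partial>lborel) \<le>
       (\<integral>\<^sup>+t. ennreal 256 * (ennreal (exp \<bar>u t - m\<bar>) * ennreal (qker y (x - t))) \<partial>lborel)"
    proof (intro nn_integral_mono)
      fix t
      have "\<bar>f t\<bar> * \<bar>gk j x y t\<bar> \<le> exp \<bar>u t - m\<bar> * (256 * qker y (x - t))"
        by (intro mult_mono le abs_gk_le j y) auto
      then have "ennreal (norm (f t * gk j x y t)) \<le> ennreal (256 * (exp \<bar>u t - m\<bar> * qker y (x - t)))"
        by (intro ennreal_leI) (simp add: abs_mult mult_ac)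
      then show "ennreal (norm (f t * gk j x y t)) \<le> ennreal 256 * (ennreal (exp \<bar>u t - m\<bar>) * ennreal (qker y (x - t)))"
        using qker_nonneg[OF y, of "x - t"] by (simp add: ennreal_mult)
    qed
    also have "\<dots> = ennreal 256 * (\<integral>\<^sup>+t. ennreal (exp \<bar>u t - m\<bar>) * ennreal (qker y (x - t)) \<partial>lborel)"
      by (intro nn_integral_cmult) measurable
    also have "\<dots> \<le> ennreal 256 * ennreal (ker_const * osc_const 1 E)"
      by (intro mult_left_mono exp_osc_qker) auto
    also have "\<dots> = ennreal (mom_const E)"
      unfolding mom_const_def by (intro ennreal_mult[symmetric]) (auto intro!: less_imp_le mult_pos_pos osc_const_pos ker_const_pos)
    finally show ?thesis .
  qed
  then show int: "integrable lborel (\<lambda>t. f t * gk j x y t)"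
    by (intro integrableI_bounded) (auto simp: less_top[symmetric] top_unique le_less_trans[OF _ ennreal_less_top])
  have "ennreal (\<integral>t. \<bar>f t * gk j x y t\<bar> \<partial>lborel) \<le> ennreal (mom_const E)"
    using int * by (subst nn_integral_eq_integral[symmetric]) (auto intro!: integrable_abs)
  then show "(\<integral>t. \<bar>f t * gk j x y t\<bar> \<partial>lborel) \<le> mom_const E"
    using mom_const_pos[of E] by (simp add: ennreal_le_iff less_imp_le)
qed

lemma gk_weighted_exp:
  assumes "j \<le> 4"
  shows "integrable lborel (\<lambda>t. exp (u t - m) * gk j x y t)" "(\<integral>t. \<bar>exp (u t - m) * gk j x y t\<bar> \<partial>lborel) \<le> mom_const E"
    "integrable lborel (\<lambda>t. exp (- (u t - m)) * gk j x y t)" "(\<integral>t. \<bar>exp (- (u t - m)) * gk j x y t\<bar> \<partial>lborel) \<le> mom_const E"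
  by (rule gk_weighted[OF assms]; simp)+

text \<open>Normalised moments: the energy ignores additive constants of \<open>u\<close>, so
  \<open>m\<close> is not bounded by it, and only after division by \<open>exp m\<close> can upper
  and lower bounds depend on \<open>E\<close> alone.\<close>

definition nmom :: "nat \<Rightarrow> real" where
  "nmom j = (\<integral>t. exp (u t - m) * gk j x y t \<partial>lborel)"

lemma abs_nmom_le: "j \<le> 4 \<Longrightarrow> \<bar>nmom j\<bar> \<le> mom_const E"
  unfolding nmom_def using gk_weighted_exp(2)[of j] integral_abs_bound[of lborel "\<lambda>t. exp (u t - m) * gk j x y t"] by linarith

lemma gk_even_nonneg: "gk 0 x y t \<ge> 0" "gk 2 x y t \<ge> 0"
  using y by (auto simp: gk_def gphi_nonneg)

text \<open>The parabola bound integrated against \<open>gk 0\<close>, whose mass is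
  \<open>1\<close>, gives \<open>2 * \<tau> - \<tau>\<^sup>2 * mom_const E\<close>. The choice of
  \<tau> maximises this expression.\<close>

lemma nmom_0_ge: "nmom 0 \<ge> 1 / mom_const E"
proof -
  define \<tau> where "\<tau> = 1 / mom_const E"
  have g: "integrable lborel (gk 0 x y)" "(\<integral>t. gk 0 x y t \<partial>lborel) = 1"
    using has_bochner_integral_gk(1)[OF y, of x] by (auto simp: has_bochner_integral_iff)
  have "(\<integral>t. 2 * \<tau> * gk 0 x y t - \<tau>\<^sup>2 * (exp (- (u t - m)) * gk 0 x y t) \<partial>lborel) \<le> nmom 0"
    unfolding nmom_def
  proof (intro integral_mono)
    fix t
    have "(2 * \<tau> - \<tau>\<^sup>2 * exp (- (u t - m))) * gk 0 x y t \<le> exp (u t - m) * gk 0 x y t"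
      by (intro mult_right_mono exp_ge_parabola gk_even_nonneg)
    then show "2 * \<tau> * gk 0 x y t - \<tau>\<^sup>2 * (exp (- (u t - m)) * gk 0 x y t) \<le> exp (u t - m) * gk 0 x y t"
      by (simp add: algebra_simps)
  qed (use g gk_weighted_exp[of 0] in auto)
  also have "(\<integral>t. 2 * \<tau> * gk 0 x y t - \<tau>\<^sup>2 * (exp (- (u t - m)) * gk 0 x y t) \<partial>lborel) =
     2 * \<tau> - \<tau>\<^sup>2 * (\<integral>t. exp (- (u t - m)) * gk 0 x y t \<partial>lborel)"
    using g gk_weighted_exp(3)[of 0] by (subst Bochner_Integration.integral_diff) auto
  finally have "2 * \<tau> - \<tau>\<^sup>2 * (\<integral>t. exp (- (u t - m)) * gk 0 x y t \<partial>lborel) \<le> nmom 0" .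
  moreover have "(\<integral>t. exp (- (u t - m)) * gk 0 x y t \<partial>lborel) \<le> mom_const E"
    using gk_weighted_exp(4)[of 0] integral_abs_bound[of lborel "\<lambda>t. exp (- (u t - m)) * gk 0 x y t"] by linarith
  then have "\<tau>\<^sup>2 * (\<integral>t. exp (- (u t - m)) * gk 0 x y t \<partial>lborel) \<le> \<tau>\<^sup>2 * mom_const E"
    by (intro mult_left_mono) auto
  moreover have "\<tau>\<^sup>2 * mom_const E = \<tau>"
    using mom_const_pos[of E] by (simp add: \<tau>_def power2_eq_square)
  ultimately show ?thesis by (simp add: \<tau>_def)
qed

text \<open>The variance of the probability density proportional to \<open>exp u\<close> times the Gaussian is what
  makes the Jacobian of the extension positive.\<close>
lemma nmom_variance_ge:
  "nmom 0 * nmom 2 - (nmom 1)\<^sup>2 \<ge> 1 / (8 * (1 + mom_const E ^ 4) * mom_const E ^ 2)"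
proof -
  define A where "A = mom_const E"
  have A: "A > 0" by (simp add: A_def mom_const_pos)
  have n0: "nmom 0 \<ge> 1 / A" using nmom_0_ge by (simp add: A_def)
  then have n0p: "nmom 0 > 0" using A by (meson less_le_trans zero_less_divide_1_iff)
  \<comment> \<open>The mean of \<open>(x - t) / y\<close> under the density proportional to
    \<open>exp (u t) * gk 0 x y t\<close>. Centring there turns the determinant into
    \<open>nmom 0\<close> times the integral of \<open>exp (u t - m)\<close> against a nonnegative
    kernel.\<close>
  define \<xi> where "\<xi> = nmom 1 / nmom 0"
  have "\<bar>\<xi>\<bar> = \<bar>nmom 1\<bar> / nmom 0" using n0p by (simp add: \<xi>_def)
  also have "\<dots> \<le> A / (1 / A)"
    using abs_nmom_le[of 1] n0 A n0p by (intro frac_le) (auto simp: A_def)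
  finally have xi: "\<bar>\<xi>\<bar> \<le> A\<^sup>2" by (simp add: power2_eq_square)
  then have xi2: "\<xi>\<^sup>2 \<le> A ^ 4" using power_mono[OF xi, of 2] by simp
  define k where "k = (\<lambda>t. gk 2 x y t - 2 * \<xi> * gk 1 x y t + \<xi>\<^sup>2 * gk 0 x y t)"
  have gs: "gk 1 x y t = ((x - t) / y) * gk 0 x y t" "gk 2 x y t = ((x - t) / y)\<^sup>2 * gk 0 x y t" for t
    by (simp_all add: gk_def)
  have sq: "s\<^sup>2 * c - 2 * \<xi> * (s * c) + \<xi>\<^sup>2 * c = (s - \<xi>)\<^sup>2 * c"
    "(s + \<xi>)\<^sup>2 * c = 2 * (s\<^sup>2 * c) + 2 * \<xi>\<^sup>2 * c - (s\<^sup>2 * c - 2 * \<xi> * (s * c) + \<xi>\<^sup>2 * c)" for s c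
    by (simp_all add: power2_diff power2_sum algebra_simps)
  have k: "k t = ((x - t) / y - \<xi>)\<^sup>2 * gk 0 x y t" for t
    unfolding k_def gs sq ..
  have k0: "k t \<ge> 0" for t unfolding k by (intro mult_nonneg_nonneg gk_even_nonneg) auto
  have k_le: "k t \<le> 2 * gk 2 x y t + 2 * \<xi>\<^sup>2 * gk 0 x y t" for t
  proof -
    have "0 \<le> ((x - t) / y + \<xi>)\<^sup>2 * gk 0 x y t" by (intro mult_nonneg_nonneg gk_even_nonneg) auto
    also have "\<dots> = 2 * gk 2 x y t + 2 * \<xi>\<^sup>2 * gk 0 x y t - k t"
      unfolding k_def gs sq(2) ..
    finally show ?thesis by simp
  qed
  have gi: "integrable lborel (gk 0 x y)" "integrable lborel (gk 1 x y)" "integrable lborel (gk 2 x y)"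
    using has_bochner_integral_gk[OF y, of x] by (auto simp: has_bochner_integral_iff)
  have gv: "(\<integral>t. gk 0 x y t \<partial>lborel) = 1" "(\<integral>t. gk 1 x y t \<partial>lborel) = 0" "(\<integral>t. gk 2 x y t \<partial>lborel) = 1/2"
    using has_bochner_integral_gk[OF y, of x] by (auto simp: has_bochner_integral_iff)
  have ki: "integrable lborel k" "(\<integral>t. k t \<partial>lborel) = 1/2 + \<xi>\<^sup>2"
    unfolding k_def using gi gv by auto
  have ek: "exp (u t - m) * k t = exp (u t - m) * gk 2 x y t - 2 * \<xi> * (exp (u t - m) * gk 1 x y t) + \<xi>\<^sup>2 * (exp (u t - m) * gk 0 x y t)" for t
    by (simp add: k_def algebra_simps)
  have eki: "integrable lborel (\<lambda>t. exp (u t - m) * k t)" "(\<integral>t. exp (u t - m) * k t \<partial>lborel) = nmom 2 - 2 * \<xi> * nmom 1 + \<xi>\<^sup>2 * nmom 0"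
    unfolding ek nmom_def using gk_weighted_exp(1)[of 0] gk_weighted_exp(1)[of 1] gk_weighted_exp(1)[of 2] by auto
  have nk: "exp (- (u t - m)) * k t = exp (- (u t - m)) * gk 2 x y t - 2 * \<xi> * (exp (- (u t - m)) * gk 1 x y t) + \<xi>\<^sup>2 * (exp (- (u t - m)) * gk 0 x y t)" for t
    by (simp add: k_def algebra_simps)
  have nki: "integrable lborel (\<lambda>t. exp (- (u t - m)) * k t)"
    unfolding nk using gk_weighted_exp(3)[of 0] gk_weighted_exp(3)[of 1] gk_weighted_exp(3)[of 2] by auto
  have "(\<integral>t. exp (- (u t - m)) * k t \<partial>lborel) \<le>
      (\<integral>t. 2 * \<bar>exp (- (u t - m)) * gk 2 x y t\<bar> + 2 * \<xi>\<^sup>2 * \<bar>exp (- (u t - m)) * gk 0 x y t\<bar> \<partial>lborel)"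
  proof (intro integral_mono nki)
    fix t
    have "exp (- (u t - m)) * k t \<le> exp (- (u t - m)) * (2 * gk 2 x y t + 2 * \<xi>\<^sup>2 * gk 0 x y t)"
      by (intro mult_left_mono k_le) auto
    then show "exp (- (u t - m)) * k t \<le> 2 * \<bar>exp (- (u t - m)) * gk 2 x y t\<bar> + 2 * \<xi>\<^sup>2 * \<bar>exp (- (u t - m)) * gk 0 x y t\<bar>"
      using gk_even_nonneg[of t] by (simp add: abs_mult algebra_simps)
  qed (use gk_weighted_exp(3)[of 0] gk_weighted_exp(3)[of 2] in auto)
  also have "\<dots> = 2 * (\<integral>t. \<bar>exp (- (u t - m)) * gk 2 x y t\<bar> \<partial>lborel) + 2 * \<xi>\<^sup>2 * (\<integral>t. \<bar>exp (- (u t - m)) * gk 0 x y t\<bar> \<partial>lborel)"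
    using gk_weighted_exp(3)[of 0] gk_weighted_exp(3)[of 2] by (subst Bochner_Integration.integral_add) auto
  also have "\<dots> \<le> 2 * A + 2 * A ^ 4 * A"
    using gk_weighted_exp(4)[of 0] gk_weighted_exp(4)[of 2] xi2 A
    by (intro add_mono mult_mono) (auto simp: A_def)
  finally have nkb: "(\<integral>t. exp (- (u t - m)) * k t \<partial>lborel) \<le> 2 * (1 + A ^ 4) * A"
    by (simp add: algebra_simps)
  define B where "B = 2 * (1 + A ^ 4) * A"
  have B: "B > 0" unfolding B_def using A by (intro mult_pos_pos add_pos_pos) auto
  \<comment> \<open>Maximises \<open>\<tau> - \<tau>\<^sup>2 * B\<close>, which is the parabola
    bound when only \<open>1/2\<close> is used from the integral of \<open>k\<close>; the maximum is
    \<open>\<tau> / 2\<close>.\<close>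
  define \<tau> where "\<tau> = 1 / (2 * B)"
  have "(\<integral>t. 2 * \<tau> * k t - \<tau>\<^sup>2 * (exp (- (u t - m)) * k t) \<partial>lborel) \<le> (\<integral>t. exp (u t - m) * k t \<partial>lborel)"
  proof (intro integral_mono)
    fix t
    have "(2 * \<tau> - \<tau>\<^sup>2 * exp (- (u t - m))) * k t \<le> exp (u t - m) * k t"
      by (intro mult_right_mono exp_ge_parabola k0)
    then show "2 * \<tau> * k t - \<tau>\<^sup>2 * (exp (- (u t - m)) * k t) \<le> exp (u t - m) * k t"
      by (simp add: algebra_simps)
  qed (use ki eki nki in auto)
  also have "(\<integral>t. 2 * \<tau> * k t - \<tau>\<^sup>2 * (exp (- (u t - m)) * k t) \<partial>lborel) =
     2 * \<tau> * (1/2 + \<xi>\<^sup>2) - \<tau>\<^sup>2 * (\<integral>t. exp (- (u t - m)) * k t \<partial>lborel)"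
    using ki nki by (subst Bochner_Integration.integral_diff) auto
  finally have 1: "2 * \<tau> * (1/2 + \<xi>\<^sup>2) - \<tau>\<^sup>2 * (\<integral>t. exp (- (u t - m)) * k t \<partial>lborel) \<le> nmom 2 - 2 * \<xi> * nmom 1 + \<xi>\<^sup>2 * nmom 0"
    unfolding eki .
  have "\<tau>\<^sup>2 * (\<integral>t. exp (- (u t - m)) * k t \<partial>lborel) \<le> \<tau>\<^sup>2 * B"
    using nkb by (intro mult_left_mono) (auto simp: B_def)
  moreover have "\<tau>\<^sup>2 * B = \<tau> / 2" using B by (simp add: \<tau>_def power2_eq_square)
  moreover have "2 * \<tau> * (1/2 + \<xi>\<^sup>2) \<ge> 2 * \<tau> * (1/2)"
    using B by (intro mult_left_mono) (auto simp: \<tau>_def)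
  ultimately have 2: "\<tau> / 2 \<le> nmom 2 - 2 * \<xi> * nmom 1 + \<xi>\<^sup>2 * nmom 0"
    using 1 by linarith
  have "(1 / A) * (\<tau> / 2) \<le> nmom 0 * (nmom 2 - 2 * \<xi> * nmom 1 + \<xi>\<^sup>2 * nmom 0)"
    using n0 2 A B n0p by (intro mult_mono) (auto simp: \<tau>_def)
  also have "\<dots> = nmom 0 * nmom 2 - (nmom 1)\<^sup>2"
    using n0p by (simp add: \<xi>_def power2_eq_square field_simps)
  also have "(1 / A) * (\<tau> / 2) = 1 / (8 * (1 + A ^ 4) * A ^ 2)"
    by (simp add: \<tau>_def B_def power2_eq_square mult_ac)
  finally show ?thesis unfolding A_def .
qed

end

end

section \<open>Kernels of mean zero and the oscillation of the exponential\<close>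

definition conj_exp :: "real \<Rightarrow> real" where "conj_exp p = p / (p - 1)"

definition split_const :: "real \<Rightarrow> real \<Rightarrow> real" where
  "split_const p E = 2 powr conj_exp p * (2 * (osc_const (conj_exp p) E * osc_const 0 E))"

text \<open>\<open>1536\<close> bounds the kernels of mean zero in the first variable,
  \<open>256\<close> the Gaussian used for averaging in the second, and each of the two variables
  costs one \<open>ker_const\<close>.\<close>

definition diff_const :: "real \<Rightarrow> real \<Rightarrow> real" where
  "diff_const p E = 1536 * 256 * ker_const\<^sup>2 * (1 + split_const p E)"

lemma split_const_pos: "split_const p E > 0"
  by (simp add: split_const_def osc_const_pos)

lemma diff_const_pos: "diff_const p E > 0"
  unfolding diff_const_def using split_const_pos[of p E] ker_const_pos by (intro mult_pos_pos) auto

context besov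
begin

context
  fixes x y :: real and w :: complex and m :: real
  assumes y: "y > 0"
  defines "w \<equiv> pt (Complex x y)" and "m \<equiv> med w"
begin

private lemma norm_w: "cmod w < 1"
  using y by (simp add: w_def norm_pt_less_1)

definition dexp :: ennreal where
  "dexp = (\<integral>\<^sup>+s. \<integral>\<^sup>+t. indicator {0..1} s * indicator {0..1} t *
     ennreal (\<bar>exp (u t - m) - exp (u s - m)\<bar> * (rho w t * rho w s)) \<partial>lborel \<partial>lborel)"

text \<open>As \<open>K\<close> has mean zero, \<open>exp (u s - m)\<close> may be subtracted from
  \<open>exp (u t - m)\<close> for any \<open>s\<close>. Averaging over \<open>s\<close> against the
  Gaussian, whose mass is \<open>1\<close>, and moving both variables to the circle produces the
  double integral \<open>dexp\<close>.\<close>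

lemma weighted_cancel:
  assumes K [measurable]: "K \<in> borel_measurable borel" and Kle: "\<And>t. \<bar>K t\<bar> \<le> 1536 * qker y (x - t)"
    and K0: "integrable lborel K" "(\<integral>t. K t \<partial>lborel) = 0" and eK: "integrable lborel (\<lambda>t. exp (u t - m) * K t)"
  shows "ennreal \<bar>\<integral>t. exp (u t - m) * K t \<partial>lborel\<bar> \<le> ennreal (1536 * 256 * ker_const\<^sup>2) * dexp"
proof -
  let ?M = "\<integral>t. exp (u t - m) * K t \<partial>lborel"
  define H where "H = (\<lambda>s. \<integral>\<^sup>+t. ennreal \<bar>exp (u t - m) - exp (u s - m)\<bar> * ennreal (rho w t) * indicator {0..1} t \<partial>lborel)"
  have Hm [measurable]: "H \<in> borel_measurable borel" unfolding H_def by measurable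
  have Hper: "H (s + 1) = H s" for s unfolding H_def by simp
  have 1: "ennreal \<bar>?M\<bar> \<le> ennreal (1536 * ker_const) * H s" for s
  proof -
    have "?M = (\<integral>t. (exp (u t - m) - exp (u s - m)) * K t \<partial>lborel)"
      using K0 eK by (simp add: left_diff_distrib)
    then have "ennreal \<bar>?M\<bar> = ennreal (norm (\<integral>t. (exp (u t - m) - exp (u s - m)) * K t \<partial>lborel))" by simp
    also have "\<dots> \<le> (\<integral>\<^sup>+t. ennreal (norm ((exp (u t - m) - exp (u s - m)) * K t)) \<partial>lborel)"
      using K0 eK by (intro integral_norm_bound_ennreal) (auto simp: left_diff_distrib)
    also have "\<dots> \<le> (\<integral>\<^sup>+t. ennreal 1536 * (ennreal \<bar>exp (u t - m) - exp (u s - m)\<bar> * ennreal (qker y (x - t))) \<partial>lborel)"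
    proof (intro nn_integral_mono)
      fix t
      have "\<bar>exp (u t - m) - exp (u s - m)\<bar> * \<bar>K t\<bar> \<le> \<bar>exp (u t - m) - exp (u s - m)\<bar> * (1536 * qker y (x - t))"
        by (intro mult_left_mono Kle) auto
      then have "ennreal (norm ((exp (u t - m) - exp (u s - m)) * K t)) \<le> ennreal (1536 * (\<bar>exp (u t - m) - exp (u s - m)\<bar> * qker y (x - t)))"
        by (intro ennreal_leI) (simp add: abs_mult mult_ac)
      then show "ennreal (norm ((exp (u t - m) - exp (u s - m)) * K t)) \<le> ennreal 1536 * (ennreal \<bar>exp (u t - m) - exp (u s - m)\<bar> * ennreal (qker y (x - t)))"
        using qker_nonneg[OF y, of "x - t"] by (simp add: ennreal_mult)
    qed
    also have "\<dots> = ennreal 1536 * (\<integral>\<^sup>+t. ennreal \<bar>exp (u t - m) - exp (u s - m)\<bar> * ennreal (qker y (x - t)) \<partial>lborel)"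
      by (intro nn_integral_cmult) measurable
    also have "\<dots> \<le> ennreal 1536 * (ennreal ker_const * H s)"
      unfolding H_def w_def by (intro mult_left_mono nn_integral_qker_le_rho y) auto
    also have "\<dots> = ennreal (1536 * ker_const) * H s"
      using ker_const_pos by (intro ennreal_mult_assoc) auto
    finally show ?thesis .
  qed
  have g: "integrable lborel (gk 0 x y)" "(\<integral>t. gk 0 x y t \<partial>lborel) = 1"
    using has_bochner_integral_gk(1)[OF y, of x] by (auto simp: has_bochner_integral_iff)
  have g0: "gk 0 x y t \<ge> 0" for t using y by (simp add: gk_def gphi_nonneg)
  have "(\<integral>\<^sup>+s. ennreal (gk 0 x y s) \<partial>lborel) = 1"
    using g g0 by (subst nn_integral_eq_integral) auto
  then have "ennreal \<bar>?M\<bar> = (\<integral>\<^sup>+s. ennreal \<bar>?M\<bar> * ennreal (gk 0 x y s) \<partial>lborel)"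
    by (simp add: nn_integral_cmult)
  also have "\<dots> \<le> (\<integral>\<^sup>+s. ennreal (1536 * ker_const * 256) * (H s * ennreal (qker y (x - s))) \<partial>lborel)"
  proof (intro nn_integral_mono)
    fix s
    have "ennreal (gk 0 x y s) \<le> ennreal (256 * qker y (x - s))"
      using abs_gk_le[of 0 y x s] y by (intro ennreal_leI) auto
    then have "ennreal \<bar>?M\<bar> * ennreal (gk 0 x y s) \<le> (ennreal (1536 * ker_const) * H s) * ennreal (256 * qker y (x - s))"
      by (intro mult_mono 1) auto
    also have "\<dots> = ennreal (1536 * ker_const) * (ennreal 256 * (H s * ennreal (qker y (x - s))))"
      using qker_nonneg[OF y, of "x - s"] by (simp add: ennreal_mult mult_ac)
    also have "\<dots> = ennreal (1536 * ker_const * 256) * (H s * ennreal (qker y (x - s)))"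
      using ker_const_pos by (intro ennreal_mult_assoc) auto
    finally show "ennreal \<bar>?M\<bar> * ennreal (gk 0 x y s) \<le> \<dots>" .
  qed
  also have "\<dots> = ennreal (1536 * ker_const * 256) * (\<integral>\<^sup>+s. H s * ennreal (qker y (x - s)) \<partial>lborel)"
    by (intro nn_integral_cmult) measurable
  also have "\<dots> \<le> ennreal (1536 * ker_const * 256) * (ennreal ker_const * (\<integral>\<^sup>+s. H s * ennreal (rho w s) * indicator {0..1} s \<partial>lborel))"
    unfolding w_def by (intro mult_left_mono nn_integral_qker_le_rho y Hper) auto
  also have "(\<integral>\<^sup>+s. H s * ennreal (rho w s) * indicator {0..1} s \<partial>lborel) = dexp"
    unfolding dexp_def
  proof (intro nn_integral_cong)
    fix s
    have "H s * ennreal (rho w s) * indicator {0..1} s =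
       (\<integral>\<^sup>+t. (ennreal \<bar>exp (u t - m) - exp (u s - m)\<bar> * ennreal (rho w t) * indicator {0..1} t) * (ennreal (rho w s) * indicator {0..1} s) \<partial>lborel)"
      unfolding H_def mult.assoc[of _ "ennreal (rho w s)"] by (intro nn_integral_multc[symmetric]) measurable
    also have "\<dots> = (\<integral>\<^sup>+t. indicator {0..1} s * indicator {0..1} t *
     ennreal (\<bar>exp (u t - m) - exp (u s - m)\<bar> * (rho w t * rho w s)) \<partial>lborel)"
      using rho_nonneg[OF norm_w] by (intro nn_integral_cong) (simp add: ennreal_mult mult_ac)
    finally show "H s * ennreal (rho w s) * indicator {0..1} s = \<dots>" .
  qed
  also have "ennreal (1536 * ker_const * 256) * (ennreal ker_const * dexp) = ennreal (1536 * 256 * ker_const\<^sup>2) * dexp"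
    using ker_const_pos by (subst ennreal_mult_assoc) (auto simp: power2_eq_square mult_ac)
  finally show ?thesis .
qed

text \<open>A difference of exponentials is at most \<open>\<bar>u s - u t\<bar>\<close> times a sum
  of exponentials. Young's inequality separates the two factors, and the exponentials have integrals
  bounded in terms of \<open>E\<close> alone.\<close>

lemma dexp_le:
  assumes \<sigma>: "\<sigma> > 0"
  shows "dexp \<le> ennreal (\<sigma> powr (1 - p)) * dosc p u w + ennreal (\<sigma> * split_const p E)"
proof -
  define q where "q = conj_exp p"
  have q: "q > 0" using p by (simp add: q_def conj_exp_def)
  define e where "e = (\<lambda>t. exp (q * \<bar>u t - m\<bar>))"
  have [measurable]: "e \<in> borel_measurable borel" unfolding e_def by measurable
  have em: "(\<integral>\<^sup>+t. ennreal (e t) * ennreal (rho w t) * indicator {0..1} t \<partial>lborel) \<le> ennreal (osc_const q E)"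
    using exp_osc_med[OF norm_w, of q] q by (simp add: e_def m_def)
  have rm: "(\<integral>\<^sup>+t. ennreal (rho w t) * indicator {0..1} t \<partial>lborel) \<le> ennreal (osc_const 0 E)"
    using exp_osc_med[OF norm_w, of 0] by simp
  note r0 = rho_nonneg[OF norm_w]
  let ?D = "\<lambda>s t. indicator {0..1} s * indicator {0..1} t * ennreal (\<bar>u s - u t\<bar> powr p * (rho w s * rho w t))"
  let ?F = "\<lambda>s. ennreal (e s) * ennreal (rho w s) * indicator {0..1} s"
  let ?R = "\<lambda>s. ennreal (rho w s) * indicator {0..1} s"
  let ?c = "ennreal (\<sigma> * 2 powr q)"
  have pw: "\<bar>exp (u t - m) - exp (u s - m)\<bar> \<le> \<sigma> powr (1 - p) * \<bar>u s - u t\<bar> powr p + \<sigma> * 2 powr q * (e t + e s)" for s t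
  proof -
    let ?W = "exp \<bar>u t - m\<bar> + exp \<bar>u s - m\<bar>"
    have "\<bar>exp (u t - m) - exp (u s - m)\<bar> \<le> \<bar>u s - u t\<bar> * ?W"
      using abs_exp_diff_le[of "u t - m" "u s - m"] by (simp add: abs_minus_commute)
    also have "\<dots> \<le> \<sigma> powr (1 - p) * \<bar>u s - u t\<bar> powr p + \<sigma> * ?W powr q"
      unfolding q_def conj_exp_def using p \<sigma> by (intro mult_le_powr_split) (auto intro: add_pos_pos)
    also have "?W powr q \<le> 2 powr q * (e t + e s)"
    proof -
      have "?W \<le> 2 * exp (max \<bar>u t - m\<bar> \<bar>u s - m\<bar>)" by (auto simp: max_def)
      then have "?W powr q \<le> (2 * exp (max \<bar>u t - m\<bar> \<bar>u s - m\<bar>)) powr q"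
        using q by (intro powr_mono2) (auto intro: add_nonneg_nonneg)
      also have "\<dots> = 2 powr q * exp (q * max \<bar>u t - m\<bar> \<bar>u s - m\<bar>)"
        by (simp add: powr_mult exp_powr_real mult.commute)
      also have "exp (q * max \<bar>u t - m\<bar> \<bar>u s - m\<bar>) \<le> e t + e s"
        by (auto simp: e_def max_def)
      finally show ?thesis by simp
    qed
    then have "\<sigma> * ?W powr q \<le> \<sigma> * (2 powr q * (e t + e s))" using \<sigma> by (intro mult_left_mono) auto
    finally show ?thesis by (simp add: mult.assoc)
  qed
  have "dexp \<le> (\<integral>\<^sup>+s. \<integral>\<^sup>+t. ennreal (\<sigma> powr (1 - p)) * ?D s t + ?c * (?F t * ?R s + ?F s * ?R t) \<partial>lborel \<partial>lborel)"
    unfolding dexp_def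
  proof (intro nn_integral_mono)
    fix s t :: real
    show "indicator {0..1} s * indicator {0..1} t * ennreal (\<bar>exp (u t - m) - exp (u s - m)\<bar> * (rho w t * rho w s))
      \<le> ennreal (\<sigma> powr (1 - p)) * ?D s t + ?c * (?F t * ?R s + ?F s * ?R t)"
    proof (cases "s \<in> {0..1} \<and> t \<in> {0..1}")
      case True
      have "\<bar>exp (u t - m) - exp (u s - m)\<bar> * (rho w t * rho w s) \<le>
         (\<sigma> powr (1 - p) * \<bar>u s - u t\<bar> powr p + \<sigma> * 2 powr q * (e t + e s)) * (rho w t * rho w s)"
        by (intro mult_right_mono pw mult_nonneg_nonneg r0)
      also have "\<dots> = \<sigma> powr (1 - p) * (\<bar>u s - u t\<bar> powr p * (rho w s * rho w t)) + \<sigma> * 2 powr q * (e t * rho w t * rho w s + e s * rho w s * rho w t)"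
        by (simp add: algebra_simps)
      finally have "ennreal (\<bar>exp (u t - m) - exp (u s - m)\<bar> * (rho w t * rho w s)) \<le>
        ennreal (\<sigma> powr (1 - p) * (\<bar>u s - u t\<bar> powr p * (rho w s * rho w t)) + \<sigma> * 2 powr q * (e t * rho w t * rho w s + e s * rho w s * rho w t))"
        by (rule ennreal_leI)
      then show ?thesis using True r0[of s] r0[of t] \<sigma>
        by (simp add: ennreal_mult ennreal_plus e_def)
    qed (auto simp: indicator_def)
  qed
  also have "\<dots> = (\<integral>\<^sup>+s. ennreal (\<sigma> powr (1 - p)) * (\<integral>\<^sup>+t. ?D s t \<partial>lborel) + ?c * ((\<integral>\<^sup>+t. ?F t \<partial>lborel) * ?R s + ?F s * (\<integral>\<^sup>+t. ?R t \<partial>lborel)) \<partial>lborel)"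
  proof (intro nn_integral_cong)
    fix s
    have "(\<integral>\<^sup>+t. ennreal (\<sigma> powr (1 - p)) * ?D s t + ?c * (?F t * ?R s + ?F s * ?R t) \<partial>lborel) =
      (\<integral>\<^sup>+t. ennreal (\<sigma> powr (1 - p)) * ?D s t \<partial>lborel) + (\<integral>\<^sup>+t. ?c * (?F t * ?R s + ?F s * ?R t) \<partial>lborel)"
      by (intro nn_integral_add) measurable
    also have "(\<integral>\<^sup>+t. ennreal (\<sigma> powr (1 - p)) * ?D s t \<partial>lborel) = ennreal (\<sigma> powr (1 - p)) * (\<integral>\<^sup>+t. ?D s t \<partial>lborel)"
      by (intro nn_integral_cmult) measurable
    also have "(\<integral>\<^sup>+t. ?c * (?F t * ?R s + ?F s * ?R t) \<partial>lborel) = ?c * (\<integral>\<^sup>+t. ?F t * ?R s + ?F s * ?R t \<partial>lborel)"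
      by (intro nn_integral_cmult) measurable
    also have "(\<integral>\<^sup>+t. ?F t * ?R s + ?F s * ?R t \<partial>lborel) = (\<integral>\<^sup>+t. ?F t * ?R s \<partial>lborel) + (\<integral>\<^sup>+t. ?F s * ?R t \<partial>lborel)"
      by (intro nn_integral_add) measurable
    also have "(\<integral>\<^sup>+t. ?F t * ?R s \<partial>lborel) = (\<integral>\<^sup>+t. ?F t \<partial>lborel) * ?R s"
      by (intro nn_integral_multc) measurable
    also have "(\<integral>\<^sup>+t. ?F s * ?R t \<partial>lborel) = ?F s * (\<integral>\<^sup>+t. ?R t \<partial>lborel)"
      by (intro nn_integral_cmult) measurable
    finally show "(\<integral>\<^sup>+t. ennreal (\<sigma> powr (1 - p)) * ?D s t + ?c * (?F t * ?R s + ?F s * ?R t) \<partial>lborel) =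
      ennreal (\<sigma> powr (1 - p)) * (\<integral>\<^sup>+t. ?D s t \<partial>lborel) + ?c * ((\<integral>\<^sup>+t. ?F t \<partial>lborel) * ?R s + ?F s * (\<integral>\<^sup>+t. ?R t \<partial>lborel))" .
  qed
  also have "\<dots> \<le> (\<integral>\<^sup>+s. ennreal (\<sigma> powr (1 - p)) * (\<integral>\<^sup>+t. ?D s t \<partial>lborel) + ?c * (ennreal (osc_const q E) * ?R s + ?F s * ennreal (osc_const 0 E)) \<partial>lborel)"
    by (intro nn_integral_mono add_left_mono mult_left_mono add_mono mult_right_mono em rm) auto
  also have "\<dots> = ennreal (\<sigma> powr (1 - p)) * (\<integral>\<^sup>+s. \<integral>\<^sup>+t. ?D s t \<partial>lborel \<partial>lborel) + ?c * (ennreal (osc_const q E) * (\<integral>\<^sup>+s. ?R s \<partial>lborel) + (\<integral>\<^sup>+s. ?F s \<partial>lborel) * ennreal (osc_const 0 E))"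
  proof -
    have "(\<integral>\<^sup>+s. ennreal (\<sigma> powr (1 - p)) * (\<integral>\<^sup>+t. ?D s t \<partial>lborel) + ?c * (ennreal (osc_const q E) * ?R s + ?F s * ennreal (osc_const 0 E)) \<partial>lborel) =
      (\<integral>\<^sup>+s. ennreal (\<sigma> powr (1 - p)) * (\<integral>\<^sup>+t. ?D s t \<partial>lborel) \<partial>lborel) + (\<integral>\<^sup>+s. ?c * (ennreal (osc_const q E) * ?R s + ?F s * ennreal (osc_const 0 E)) \<partial>lborel)"
      by (intro nn_integral_add) measurable
    also have "(\<integral>\<^sup>+s. ennreal (\<sigma> powr (1 - p)) * (\<integral>\<^sup>+t. ?D s t \<partial>lborel) \<partial>lborel) = ennreal (\<sigma> powr (1 - p)) * (\<integral>\<^sup>+s. \<integral>\<^sup>+t. ?D s t \<partial>lborel \<partial>lborel)"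
      by (intro nn_integral_cmult) measurable
    also have "(\<integral>\<^sup>+s. ?c * (ennreal (osc_const q E) * ?R s + ?F s * ennreal (osc_const 0 E)) \<partial>lborel) = ?c * (\<integral>\<^sup>+s. ennreal (osc_const q E) * ?R s + ?F s * ennreal (osc_const 0 E) \<partial>lborel)"
      by (intro nn_integral_cmult) measurable
    also have "(\<integral>\<^sup>+s. ennreal (osc_const q E) * ?R s + ?F s * ennreal (osc_const 0 E) \<partial>lborel) =
       (\<integral>\<^sup>+s. ennreal (osc_const q E) * ?R s \<partial>lborel) + (\<integral>\<^sup>+s. ?F s * ennreal (osc_const 0 E) \<partial>lborel)"
      by (intro nn_integral_add) measurable
    also have "(\<integral>\<^sup>+s. ennreal (osc_const q E) * ?R s \<partial>lborel) = ennreal (osc_const q E) * (\<integral>\<^sup>+s. ?R s \<partial>lborel)"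
      by (intro nn_integral_cmult) measurable
    also have "(\<integral>\<^sup>+s. ?F s * ennreal (osc_const 0 E) \<partial>lborel) = (\<integral>\<^sup>+s. ?F s \<partial>lborel) * ennreal (osc_const 0 E)"
      by (intro nn_integral_multc) measurable
    finally show ?thesis .
  qed
  also have "\<dots> \<le> ennreal (\<sigma> powr (1 - p)) * dosc p u w + ?c * (ennreal (osc_const q E) * ennreal (osc_const 0 E) + ennreal (osc_const q E) * ennreal (osc_const 0 E))"
    unfolding dosc_def by (intro add_left_mono mult_left_mono add_mono mult_right_mono em rm) auto
  also have "?c * (ennreal (osc_const q E) * ennreal (osc_const 0 E) + ennreal (osc_const q E) * ennreal (osc_const 0 E)) = ennreal (\<sigma> * split_const p E)"
  proof -
    have o: "osc_const q E \<ge> 0" "osc_const 0 E \<ge> 0" using osc_const_pos less_imp_le by auto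
    then have "ennreal (osc_const q E) * ennreal (osc_const 0 E) + ennreal (osc_const q E) * ennreal (osc_const 0 E) = ennreal (2 * (osc_const q E * osc_const 0 E))"
      by (simp add: ennreal_mult[symmetric] ennreal_plus[symmetric] del: ennreal_plus)
    then show ?thesis using \<sigma> o
      by (simp add: split_const_def q_def[symmetric] ennreal_mult[symmetric] mult.assoc)
  qed
  finally show ?thesis .
qed

text \<open>Removes the parameter. For a finite positive value \<open>D\<close> of the oscillation,
  \<open>\<sigma> = D powr (1 / p)\<close> makes both terms of \<open>dexp_le\<close> multiples of
  \<sigma>, and the \<open>p\<close>-th power of the bound becomes linear in
  \<open>D\<close>.\<close>

lemma weighted_cancel_powr:
  assumes "ennreal M \<le> ennreal (1536 * 256 * ker_const\<^sup>2) * dexp" "M \<ge> 0"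
  shows "ennreal (M powr p) \<le> ennreal (diff_const p E powr p) * dosc p u w"
proof (cases "dosc p u w = \<infinity>")
  case True
  then show ?thesis using diff_const_pos[of p E] by (simp add: ennreal_mult_top)
next
  case False
  then obtain D where D: "dosc p u w = ennreal D" "D \<ge> 0" by (cases "dosc p u w") auto
  define k where "k = 1536 * 256 * ker_const\<^sup>2"
  have k: "k > 0" using ker_const_pos by (simp add: k_def)
  note sp = split_const_pos[of p E]
  have *: "M \<le> k * (\<sigma> powr (1 - p) * D + \<sigma> * split_const p E)" if \<sigma>: "\<sigma> > 0" for \<sigma>
  proof -
    have "ennreal M \<le> ennreal k * (ennreal (\<sigma> powr (1 - p)) * ennreal D + ennreal (\<sigma> * split_const p E))"
      using assms(1) mult_left_mono[OF dexp_le[OF \<sigma>], of "ennreal k"] unfolding D(1)[symmetric] k_def by (rule order.trans) simp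
    also have "\<dots> = ennreal (k * (\<sigma> powr (1 - p) * D + \<sigma> * split_const p E))"
      using k D \<sigma> sp by (simp add: ennreal_mult ennreal_plus)
    finally show ?thesis using k D \<sigma> sp by (subst (asm) ennreal_le_iff) auto
  qed
  show ?thesis
  proof (cases "D = 0")
    case True
    \<comment> \<open>The oscillation term is absent here, so \<sigma> can be made arbitrarily
      small.\<close>
    have "M \<le> 0 + e" if e: "e > 0" for e
      using *[of "e / (k * split_const p E)"] True e k sp by (simp add: field_simps)
    then have "M \<le> 0" by (rule field_le_epsilon)
    with assms(2) show ?thesis by simp
  next
    case False
    then have D0: "D > 0" using D by simp
    define \<sigma> where "\<sigma> = D powr (1 / p)"
    have \<sigma>: "\<sigma> > 0" using D0 by (simp add: \<sigma>_def)
    have "\<sigma> powr (1 - p) * D = D powr ((1 / p) * (1 - p)) * D powr 1"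
      using D0 by (simp add: \<sigma>_def powr_powr)
    also have "\<dots> = D powr ((1 / p) * (1 - p) + 1)" by (simp only: powr_add)
    also have "(1 / p) * (1 - p) + 1 = 1 / p" using p by (simp add: field_simps)
    finally have "\<sigma> powr (1 - p) * D = \<sigma>" by (simp add: \<sigma>_def)
    with *[OF \<sigma>] have "M \<le> k * (\<sigma> + \<sigma> * split_const p E)" by simp
    then have "M \<le> diff_const p E * \<sigma>" by (simp add: diff_const_def k_def algebra_simps)
    then have "M powr p \<le> (diff_const p E * \<sigma>) powr p"
      using assms(2) p by (intro powr_mono2) auto
    also have "\<dots> = diff_const p E powr p * D"
      using p D0 \<sigma> diff_const_pos[of p E] by (simp add: powr_mult \<sigma>_def powr_powr)
    finally have "ennreal (M powr p) \<le> ennreal (diff_const p E powr p * D)" by (rule ennreal_leI)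
    then show ?thesis by (simp add: D ennreal_mult)
  qed
qed

end

end

text \<open>Compared with \<open>nmom_variance_ge\<close> there is an extra
  \<open>mom_const E ^ 2\<close> in the denominator: the variance is now measured against the square
  of the zeroth moment, using that the normalised one is at most \<open>mom_const E\<close>.\<close>

definition var_const :: "real \<Rightarrow> real" where
  "var_const E = 1 / (8 * (1 + mom_const E ^ 4) * mom_const E ^ 4)"

definition dil_const :: "real \<Rightarrow> real \<Rightarrow> real" where
  "dil_const p E = (7 * mom_const E / 2) powr p * diff_const p E powr p"

lemma var_const_pos: "var_const E > 0"
  unfolding var_const_def using mom_const_pos[of E] by (intro divide_pos_pos mult_pos_pos add_pos_pos) auto

lemma dil_const_pos: "dil_const p E > 0"
  unfolding dil_const_def using mom_const_pos[of E] diff_const_pos[of p E] by (intro mult_pos_pos) auto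

definition mom :: "(real \<Rightarrow> real) \<Rightarrow> nat \<Rightarrow> real \<Rightarrow> real \<Rightarrow> real" where
  "mom u j x y = (\<integral>t. exp (u t) * gk j x y t \<partial>lborel)"

text \<open>The quotient of the Wirtinger derivatives of \<open>extF f\<close>: the common factor \<open>1/2\<close> is dropped, and all first
  order partial derivatives are Gaussian moments of \<open>f' = exp u\<close> (see \<open>real_linear_complex\<close>).\<close>
definition mu :: "(real \<Rightarrow> real) \<Rightarrow> real \<Rightarrow> real \<Rightarrow> complex" where
  "mu u x y = Complex (mom u 0 x y - 2 * mom u 2 x y) (- 3 * mom u 1 x y) / Complex (mom u 0 x y + 2 * mom u 2 x y) (- mom u 1 x y)"

definition mu_bound :: "real \<Rightarrow> real" where
  "mu_bound E = sqrt (1 - 8 * var_const E / ((1 + 2 * mom_const E ^ 2)\<^sup>2 + mom_const E ^ 2))"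

context besov
begin

lemma mom_eq_nmom:
  assumes y: "y > 0"
  shows "mom u j x y = exp (med (pt (Complex x y))) * nmom x y j"
  unfolding mom_def nmom_def[OF y] integral_mult_right_zero[symmetric]
  by (intro Bochner_Integration.integral_cong refl) (simp add: exp_diff field_simps)

lemma integrable_exp_gk:
  assumes y: "y > 0" and j: "j \<le> 4"
  shows "integrable lborel (\<lambda>t. exp (u t) * gk j x y t)"
proof -
  let ?m = "med (pt (Complex x y))"
  have "integrable lborel (\<lambda>t. exp ?m * (exp (u t - ?m) * gk j x y t))"
    using gk_weighted_exp(1)[OF y j] by simp
  then show ?thesis by (simp add: exp_diff)
qed

lemma mom_0_pos:
  assumes y: "y > 0" shows "mom u 0 x y > 0"
proof -
  have "0 < 1 / mom_const E" using mom_const_pos[of E] by simp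
  also have "\<dots> \<le> nmom x y 0" by (rule nmom_0_ge[OF y])
  finally show ?thesis by (simp add: mom_eq_nmom[OF y])
qed

lemma mom_2_nonneg: "y > 0 \<Longrightarrow> mom u 2 x y \<ge> 0"
  unfolding mom_def by (intro integral_nonneg_AE) (auto simp: gk_def gphi_nonneg)

lemma mom_2_le:
  assumes y: "y > 0" shows "mom u 2 x y \<le> mom_const E ^ 2 * mom u 0 x y"
proof -
  let ?A = "mom_const E"
  have A: "?A > 0" by (rule mom_const_pos)
  have "nmom x y 2 \<le> ?A" using abs_nmom_le[OF y, of 2 x] by simp
  also have "\<dots> = ?A ^ 2 * (1 / ?A)" using A by (simp add: power2_eq_square)
  also have "\<dots> \<le> ?A ^ 2 * nmom x y 0" using nmom_0_ge[OF y, of x] by (intro mult_left_mono) auto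
  finally show ?thesis by (simp add: mom_eq_nmom[OF y])
qed

lemma mom_variance_ge:
  assumes y: "y > 0"
  shows "mom u 0 x y * mom u 2 x y - (mom u 1 x y)\<^sup>2 \<ge> var_const E * (mom u 0 x y)\<^sup>2"
proof -
  let ?A = "mom_const E" and ?m = "med (pt (Complex x y))"
  have A: "?A > 0" by (rule mom_const_pos)
  have v: "var_const E * ?A\<^sup>2 = 1 / (8 * (1 + ?A ^ 4) * ?A ^ 2)"
  proof -
    have "1 + ?A ^ 4 > 0" using A by (simp add: add_pos_pos)
    then show ?thesis using A unfolding var_const_def by (simp add: power2_eq_square power4_eq_xxxx)
  qed
  have "\<bar>nmom x y 0\<bar>\<^sup>2 \<le> ?A\<^sup>2" by (intro power_mono abs_nmom_le[OF y]) auto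
  then have "var_const E * (nmom x y 0)\<^sup>2 \<le> var_const E * ?A\<^sup>2"
    using var_const_pos[of E] by (intro mult_left_mono) auto
  also have "\<dots> \<le> nmom x y 0 * nmom x y 2 - (nmom x y 1)\<^sup>2"
    unfolding v by (rule nmom_variance_ge[OF y])
  finally have "(exp ?m)\<^sup>2 * (var_const E * (nmom x y 0)\<^sup>2) \<le> (exp ?m)\<^sup>2 * (nmom x y 0 * nmom x y 2 - (nmom x y 1)\<^sup>2)"
    by (intro mult_left_mono) auto
  moreover have "V * (e * a)\<^sup>2 \<le> (e * a) * (e * c) - (e * b)\<^sup>2" if "e\<^sup>2 * (V * a\<^sup>2) \<le> e\<^sup>2 * (a * c - b\<^sup>2)" for V e a b c :: real
    using that by (simp add: power2_eq_square algebra_simps)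
  ultimately show ?thesis unfolding mom_eq_nmom[OF y] by blast
qed

lemma mom_variance_pos:
  assumes y: "y > 0" shows "mom u 0 x y * mom u 2 x y - (mom u 1 x y)\<^sup>2 > 0"
proof -
  have "0 < var_const E * (mom u 0 x y)\<^sup>2"
    using var_const_pos[of E] mom_0_pos[OF y, of x] by simp
  also have "\<dots> \<le> mom u 0 x y * mom u 2 x y - (mom u 1 x y)\<^sup>2" by (rule mom_variance_ge[OF y])
  finally show ?thesis .
qed

text \<open>Both parts of the numerator are integrals of \<open>exp u\<close> against kernels of
  mean zero: \<open>gk 1\<close> is odd about \<open>x\<close>, and \<open>gk 0 - 2 * gk 2\<close>
  has integral \<open>1 - 2 * (1/2)\<close>. The denominator is at least the zeroth moment, hence at
  least \<open>1 / mom_const E\<close> after normalisation.\<close>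

lemma norm_mu_powr_le:
  assumes y: "y > 0"
  shows "ennreal (cmod (mu u x y) powr p) \<le> ennreal (dil_const p E) * dosc p u (pt (Complex x y))"
proof -
  let ?w = "pt (Complex x y)" let ?m = "med ?w" let ?A = "mom_const E"
  have A: "?A > 0" by (rule mom_const_pos)
  let ?k = "ennreal (1536 * 256 * ker_const\<^sup>2) * dexp x y"
  have q: "qker y (x - t) \<ge> 0" for t by (rule qker_nonneg[OF y])
  have hb: "integrable lborel (gk 0 x y)" "integrable lborel (gk 1 x y)" "integrable lborel (gk 2 x y)"
    "(\<integral>t. gk 0 x y t \<partial>lborel) = 1" "(\<integral>t. gk 1 x y t \<partial>lborel) = 0" "(\<integral>t. gk 2 x y t \<partial>lborel) = 1/2"
    using has_bochner_integral_gk[OF y, of x] by (auto simp: has_bochner_integral_iff)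
  note we = gk_weighted_exp(1)[OF y, of _ x]
  have b: "ennreal \<bar>nmom x y 1\<bar> \<le> ?k"
    unfolding nmom_def[OF y]
  proof (rule weighted_cancel[OF y])
    show "\<bar>gk 1 x y t\<bar> \<le> 1536 * qker y (x - t)" for t
      using abs_gk_le[of 1 y x t] y q[of t] by simp
  qed (use hb we[of 1] in auto)
  have n: "nmom x y 0 - 2 * nmom x y 2 = - (1/2) * (\<integral>t. exp (u t - ?m) * (4 * gk 2 x y t - 2 * gk 0 x y t) \<partial>lborel)"
  proof -
    have "(\<integral>t. exp (u t - ?m) * (4 * gk 2 x y t - 2 * gk 0 x y t) \<partial>lborel) =
      (\<integral>t. 4 * (exp (u t - ?m) * gk 2 x y t) - 2 * (exp (u t - ?m) * gk 0 x y t) \<partial>lborel)"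
      by (intro Bochner_Integration.integral_cong) (auto simp: algebra_simps)
    also have "\<dots> = 4 * nmom x y 2 - 2 * nmom x y 0"
      unfolding nmom_def[OF y] using we[of 0] we[of 2] by simp
    finally show ?thesis by (simp add: field_simps)
  qed
  have c: "ennreal \<bar>2 * (nmom x y 0 - 2 * nmom x y 2)\<bar> \<le> ?k"
  proof -
    have "\<bar>2 * (nmom x y 0 - 2 * nmom x y 2)\<bar> = \<bar>\<integral>t. exp (u t - ?m) * (4 * gk 2 x y t - 2 * gk 0 x y t) \<partial>lborel\<bar>"
      unfolding n by simp
    also have "ennreal \<dots> \<le> ?k"
    proof (rule weighted_cancel[OF y])
      show "\<bar>4 * gk 2 x y t - 2 * gk 0 x y t\<bar> \<le> 1536 * qker y (x - t)" for t
        using abs_gk_le[of 0 y x t] abs_gk_le[of 2 y x t] y by simp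
      show "integrable lborel (\<lambda>t. exp (u t - ?m) * (4 * gk 2 x y t - 2 * gk 0 x y t))"
      proof -
        have "(\<lambda>t. exp (u t - ?m) * (4 * gk 2 x y t - 2 * gk 0 x y t)) =
          (\<lambda>t. 4 * (exp (u t - ?m) * gk 2 x y t) - 2 * (exp (u t - ?m) * gk 0 x y t))"
          by (simp add: fun_eq_iff algebra_simps)
        then show ?thesis using we[of 0] we[of 2] by simp
      qed
    qed (use hb in auto)
    finally show ?thesis .
  qed
  \<comment> \<open>A weighted mean, with weights \<open>1/7\<close> and \<open>6/7\<close>, of two
    quantities below \<open>?k\<close>; with these weights \<open>7 * M / 2\<close> is the triangle
    inequality bound for the numerator.\<close>
  define M where "M = (\<bar>2 * (nmom x y 0 - 2 * nmom x y 2)\<bar> + 6 * \<bar>nmom x y 1\<bar>) / 7"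
  have M0: "M \<ge> 0" by (simp add: M_def)
  have "ennreal M \<le> ?k"
  proof (cases "\<bar>2 * (nmom x y 0 - 2 * nmom x y 2)\<bar> \<le> \<bar>nmom x y 1\<bar>")
    case True
    then have "ennreal M \<le> ennreal \<bar>nmom x y 1\<bar>" by (intro ennreal_leI) (simp add: M_def)
    with b show ?thesis by (rule order.trans[rotated])
  next
    case False
    then have "ennreal M \<le> ennreal \<bar>2 * (nmom x y 0 - 2 * nmom x y 2)\<bar>" by (intro ennreal_leI) (simp add: M_def)
    with c show ?thesis by (rule order.trans[rotated])
  qed
  from weighted_cancel_powr[OF y this M0]
  have Mp: "ennreal (M powr p) \<le> ennreal (diff_const p E powr p) * dosc p u ?w" .
  have mu: "mu u x y = Complex (nmom x y 0 - 2 * nmom x y 2) (- 3 * nmom x y 1) / Complex (nmom x y 0 + 2 * nmom x y 2) (- nmom x y 1)"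
  proof -
    have "Complex (e * a - 2 * (e * c)) (- 3 * (e * b)) / Complex (e * a + 2 * (e * c)) (- (e * b)) = Complex (a - 2 * c) (- 3 * b) / Complex (a + 2 * c) (- b)"
      if "e > 0" for a b c e :: real
    proof -
      have "Complex (e * a - 2 * (e * c)) (- 3 * (e * b)) = of_real e * Complex (a - 2 * c) (- 3 * b)"
        "Complex (e * a + 2 * (e * c)) (- (e * b)) = of_real e * Complex (a + 2 * c) (- b)"
        by (simp_all add: complex_eq_iff algebra_simps)
      then show ?thesis using that by simp
    qed
    then show ?thesis unfolding mu_def mom_eq_nmom[OF y] by simp
  qed
  have n2: "nmom x y 2 \<ge> 0" using mom_2_nonneg[OF y, of x] by (simp add: mom_eq_nmom[OF y] zero_le_mult_iff)
  have "1 / ?A \<le> nmom x y 0" by (rule nmom_0_ge[OF y])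
  also have "\<dots> \<le> \<bar>Re (Complex (nmom x y 0 + 2 * nmom x y 2) (- nmom x y 1))\<bar>" using n2 by simp
  also have "\<dots> \<le> cmod (Complex (nmom x y 0 + 2 * nmom x y 2) (- nmom x y 1))" by (rule abs_Re_le_cmod)
  finally have den: "1 / ?A \<le> cmod (Complex (nmom x y 0 + 2 * nmom x y 2) (- nmom x y 1))" .
  have "cmod (Complex (nmom x y 0 - 2 * nmom x y 2) (- 3 * nmom x y 1)) \<le> \<bar>nmom x y 0 - 2 * nmom x y 2\<bar> + \<bar>- 3 * nmom x y 1\<bar>"
    using cmod_le[of "Complex (nmom x y 0 - 2 * nmom x y 2) (- 3 * nmom x y 1)"] by simp
  also have "\<dots> = 7 * M / 2" by (simp only: M_def abs_mult) simp
  finally have num: "cmod (Complex (nmom x y 0 - 2 * nmom x y 2) (- 3 * nmom x y 1)) \<le> 7 * M / 2" .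
  have "cmod (mu u x y) \<le> (7 * M / 2) / (1 / ?A)"
    unfolding mu norm_divide using num den A by (intro frac_le) (auto simp: M0)
  also have "\<dots> = (7 * ?A / 2) * M" by simp
  finally have "cmod (mu u x y) powr p \<le> ((7 * ?A / 2) * M) powr p"
    using p by (intro powr_mono2) auto
  also have "\<dots> = (7 * ?A / 2) powr p * M powr p" by (subst powr_mult) (use A M0 in auto)
  finally have "ennreal (cmod (mu u x y) powr p) \<le> ennreal ((7 * ?A / 2) powr p) * ennreal (M powr p)"
    unfolding ennreal_mult[symmetric, OF powr_ge_zero powr_ge_zero] by (rule ennreal_leI)
  also have "\<dots> \<le> ennreal ((7 * ?A / 2) powr p) * (ennreal (diff_const p E powr p) * dosc p u ?w)"
    by (intro mult_left_mono Mp) auto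
  also have "\<dots> = ennreal (dil_const p E) * dosc p u ?w"
    unfolding dil_const_def by (intro ennreal_mult_assoc) auto
  finally show ?thesis .
qed

text \<open>With \<open>N\<close> the squared modulus of the denominator, the squared modulus of
  \<open>mu\<close> is \<open>1 - 8 * (a * c - b\<^sup>2) / N\<close>. The variance bound from
  below, together with \<open>N \<le> L * a\<^sup>2\<close>, which follows from
  \<open>b\<^sup>2 \<le> a * c\<close> and \<open>c \<le> mom_const E ^ 2 * a\<close>, keeps the
  fraction away from zero.\<close>

lemma norm_mu_le:
  assumes y: "y > 0"
  shows "cmod (mu u x y) \<le> mu_bound E"
proof -
  let ?A = "mom_const E"
  define a where "a = mom u 0 x y" define b where "b = mom u 1 x y" define c where "c = mom u 2 x y"
  have A: "?A > 0" by (rule mom_const_pos)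
  have a: "a > 0" using mom_0_pos[OF y] by (simp add: a_def)
  have c: "0 \<le> c" "c \<le> ?A ^ 2 * a" using mom_2_nonneg[OF y] mom_2_le[OF y] by (simp_all add: a_def c_def)
  have v: "a * c - b\<^sup>2 \<ge> var_const E * a\<^sup>2" using mom_variance_ge[OF y, of x] by (simp add: a_def b_def c_def)
  define N where "N = (a + 2 * c)\<^sup>2 + b\<^sup>2"
  define L where "L = (1 + 2 * ?A ^ 2)\<^sup>2 + ?A ^ 2"
  have N0: "N > 0" unfolding N_def using a c by (intro add_pos_nonneg) auto
  have L0: "L > 0" unfolding L_def using A by (intro add_nonneg_pos) auto
  have m2: "(cmod (mu u x y))\<^sup>2 = ((a - 2 * c)\<^sup>2 + (3 * b)\<^sup>2) / N"
    by (simp add: mu_def norm_divide power_divide cmod_power2 N_def a_def b_def c_def)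
  also have "(a - 2 * c)\<^sup>2 + (3 * b)\<^sup>2 = N - 8 * (a * c - b\<^sup>2)"
    by (simp add: N_def power2_eq_square algebra_simps)
  also have "\<dots> / N = 1 - 8 * (a * c - b\<^sup>2) / N" using N0 by (simp add: diff_divide_distrib)
  also have "\<dots> \<le> 1 - 8 * var_const E / L"
  proof -
    have bc: "b\<^sup>2 \<le> a * c" using v var_const_pos[of E] by (smt (verit) mult_nonneg_nonneg zero_le_power2)
    also have "\<dots> \<le> a * (?A ^ 2 * a)" using a c by (intro mult_left_mono) auto
    finally have b2: "b\<^sup>2 \<le> ?A ^ 2 * a\<^sup>2" by (simp add: power2_eq_square mult_ac)
    have "(a + 2 * c)\<^sup>2 \<le> (1 + 2 * ?A ^ 2)\<^sup>2 * a\<^sup>2"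
      unfolding power_mult_distrib[symmetric] using a c by (intro power_mono) (auto simp: algebra_simps)
    then have "N \<le> L * a\<^sup>2" using b2 unfolding N_def L_def distrib_right by linarith
    then have "8 * (var_const E * a\<^sup>2) / (L * a\<^sup>2) \<le> 8 * (a * c - b\<^sup>2) / N"
      using v N0 bc by (intro frac_le mult_left_mono mult_nonneg_nonneg) auto
    moreover have "8 * (V * s) / (l * s) = 8 * V / l" if "s \<noteq> 0" for V s l :: real
      using that by simp
    from this[of "a\<^sup>2"] have "8 * (var_const E * a\<^sup>2) / (L * a\<^sup>2) = 8 * var_const E / L" using a by simp
    ultimately show ?thesis by simp
  qed
  finally have "(cmod (mu u x y))\<^sup>2 \<le> 1 - 8 * var_const E / L" .
  then have "sqrt ((cmod (mu u x y))\<^sup>2) \<le> mu_bound E"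
    unfolding mu_bound_def L_def by (rule real_sqrt_le_mono)
  then show ?thesis by simp
qed

end

lemma mu_bound_less_1: "mu_bound E < 1"
proof -
  let ?L = "(1 + 2 * mom_const E ^ 2)\<^sup>2 + mom_const E ^ 2"
  have "?L > 0" using mom_const_pos[of E] by (intro add_nonneg_pos) auto
  then have "8 * var_const E / ?L > 0" using var_const_pos[of E] by simp
  then show ?thesis unfolding mu_bound_def by (simp add: real_sqrt_lt_1_iff)
qed

section \<open>Integration over the disc\<close>

text \<open>With \<open>D = 1 - (cmod w)\<^sup>2\<close> the product of the kernels is
  \<open>D ^ 6\<close> over the fourth powers of both distances. The larger distance cancels against
  the factor on the left, and the smaller one absorbs four powers of \<open>D\<close>, since
  \<open>D\<close> is at most twice the distance from \<open>w\<close> to any point of the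
  circle.\<close>

lemma rho_rho_le:
  assumes w: "cmod w < 1"
  shows "rho w t * rho w s * (max (cmod (circ t - w)) (cmod (circ s - w))) ^ 4 \<le> 16 * (1 - (cmod w)\<^sup>2)\<^sup>2"
proof -
  have *: "D ^ 6 / (\<alpha> ^ 4 * \<beta> ^ 4) * \<beta> ^ 4 \<le> 16 * D\<^sup>2"
    if "D \<ge> 0" "D \<le> 2 * \<alpha>" "\<alpha> > 0" "\<beta> > 0" for D \<alpha> \<beta> :: real
  proof -
    have "D ^ 4 \<le> (2 * \<alpha>) ^ 4" using that by (intro power_mono) auto
    then have "D ^ 4 * D ^ 2 \<le> 16 * \<alpha> ^ 4 * D ^ 2" by (intro mult_right_mono) (auto simp: power_mult_distrib)
    moreover have "D ^ 4 * D ^ 2 = D ^ 6" by (simp add: power_add[symmetric])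
    ultimately have "D ^ 6 \<le> 16 * D\<^sup>2 * \<alpha> ^ 4" by (simp add: mult_ac)
    then have "D ^ 6 / \<alpha> ^ 4 \<le> 16 * D\<^sup>2" using that by (simp add: pos_divide_le_eq)
    then show ?thesis using that by simp
  qed
  define D where "D = 1 - (cmod w)\<^sup>2"
  have D: "D \<ge> 0" using w by (simp add: D_def abs_square_le_1)
  have r: "rho w x = D ^ 3 / cmod (circ x - w) ^ 4" for x
    by (simp add: rho_def pois_def D_def power_divide power3_eq_cube power2_eq_square power4_eq_xxxx mult_ac)
  have pos: "cmod (circ x - w) > 0" for x using circ_neq_interior[OF w, of x] by simp
  have le: "D \<le> 2 * cmod (circ x - w)" for x unfolding D_def by (rule one_minus_norm_sq_le[OF w])
  have rr: "rho w t * rho w s = D ^ 6 / (cmod (circ t - w) ^ 4 * cmod (circ s - w) ^ 4)"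
    by (simp add: r power_add[symmetric])
  show ?thesis
    using *[OF D le[of t] pos[of t] pos[of s]] *[OF D le[of s] pos[of s] pos[of t]]
    unfolding rr D_def[symmetric] max_def by (auto simp: mult.commute)
qed

lemma dist_circ_le_max:
  "cmod (circ t - circ s) \<le> 2 * max (cmod (circ t - w)) (cmod (circ s - w))"
  using norm_triangle_ineq4[of "circ t - w" "circ s - w"] by (auto simp: max_def)

text \<open>The first bound supplies the dominating function for dominated convergence; the second
  one is the decay as \<open>w\<close> approaches the circle, for a fixed pair of distinct boundary
  points.\<close>

lemma rho_rho_dist_2:
  assumes w: "cmod w < 1"
  shows "rho w t * rho w s * (cmod (circ t - circ s))\<^sup>2 \<le> 256"
    "rho w t * rho w s * (cmod (circ t - circ s)) ^ 4 \<le> 256 * (1 - (cmod w)\<^sup>2)\<^sup>2"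
proof -
  define M where "M = max (cmod (circ t - w)) (cmod (circ s - w))"
  define D where "D = 1 - (cmod w)\<^sup>2"
  have D: "D \<ge> 0" using w by (simp add: D_def abs_square_le_1)
  have M: "M > 0" using circ_neq_interior[OF w, of t] by (simp add: M_def less_max_iff_disj)
  have rr0: "rho w t * rho w s \<ge> 0" using rho_nonneg[OF w] by simp
  have rr: "rho w t * rho w s * M ^ 4 \<le> 16 * D\<^sup>2" unfolding M_def D_def by (rule rho_rho_le[OF w])
  have d: "cmod (circ t - circ s) \<le> 2 * M" unfolding M_def by (rule dist_circ_le_max)
  have "D \<le> 2 * M" using one_minus_norm_sq_le[OF w, of t] by (simp add: D_def M_def)
  then have "D\<^sup>2 \<le> (2 * M)\<^sup>2" using D by (intro power_mono) auto
  then have D2: "D\<^sup>2 \<le> 4 * M\<^sup>2" by (simp add: power_mult_distrib)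
  have "rho w t * rho w s * (cmod (circ t - circ s)) ^ 4 \<le> rho w t * rho w s * (2 * M) ^ 4"
    using rr0 d by (intro mult_left_mono power_mono) auto
  also have "\<dots> = 16 * (rho w t * rho w s * M ^ 4)" by (simp add: power_mult_distrib)
  also have "\<dots> \<le> 16 * (16 * D\<^sup>2)" by (intro mult_left_mono rr) auto
  finally show "rho w t * rho w s * (cmod (circ t - circ s)) ^ 4 \<le> 256 * (1 - (cmod w)\<^sup>2)\<^sup>2"
    by (simp add: D_def)
  have "rho w t * rho w s * M ^ 4 \<le> 64 * M\<^sup>2" using rr D2 by linarith
  then have "(rho w t * rho w s * M\<^sup>2) * M\<^sup>2 \<le> 64 * M\<^sup>2" by (simp add: power2_eq_square power4_eq_xxxx mult_ac)
  then have r2: "rho w t * rho w s * M\<^sup>2 \<le> 64" using M by simp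
  have "rho w t * rho w s * (cmod (circ t - circ s))\<^sup>2 \<le> rho w t * rho w s * (2 * M)\<^sup>2"
    using rr0 d by (intro mult_left_mono power_mono) auto
  also have "\<dots> = 4 * (rho w t * rho w s * M\<^sup>2)" by (simp add: power_mult_distrib)
  also have "\<dots> \<le> 4 * 64" by (intro mult_left_mono r2) auto
  finally show "rho w t * rho w s * (cmod (circ t - circ s))\<^sup>2 \<le> 256" by simp
qed

text \<open>The larger of the two distances dominates \<open>h\<close> as well as the distance from
  \<open>w\<close> to \<open>circ t\<close>. Bounding its square from below with one coordinate at a
  time gives a product of a function of \<open>Re w\<close> and a function of \<open>Im w\<close>,
  so that the area integral splits.\<close>

lemma rho_rho_area_bound:
  assumes w: "cmod w < 1" and h_def: "h = cmod (circ t - circ s) / 2" and h: "h > 0"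
  shows "rho w t * rho w s / (1 - (cmod w)\<^sup>2)\<^sup>2 \<le> 64 * (1 / (h\<^sup>2 + (Re (circ t) - Re w)\<^sup>2) * (1 / (h\<^sup>2 + (Im (circ t) - Im w)\<^sup>2)))"
proof -
  define M where "M = max (cmod (circ t - w)) (cmod (circ s - w))"
  define D where "D = 1 - (cmod w)\<^sup>2"
  have D: "D > 0" using w by (simp add: D_def abs_square_less_1)
  have M: "M > 0" using circ_neq_interior[OF w, of t] by (simp add: M_def less_max_iff_disj)
  have rr: "rho w t * rho w s * M ^ 4 \<le> 16 * D\<^sup>2" unfolding M_def D_def by (rule rho_rho_le[OF w])
  have hM: "h\<^sup>2 \<le> M\<^sup>2" unfolding h_def M_def using dist_circ_le_max[of t s w] by (intro power_mono) auto
  have tM: "(cmod (circ t - w))\<^sup>2 \<le> M\<^sup>2" unfolding M_def by (intro power_mono) auto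
  let ?X = "h\<^sup>2 + (Re (circ t) - Re w)\<^sup>2" and ?Y = "h\<^sup>2 + (Im (circ t) - Im w)\<^sup>2"
  have XY: "?X > 0" "?Y > 0" using h by (auto simp: add_pos_nonneg)
  have "?X \<le> 2 * M\<^sup>2" "?Y \<le> 2 * M\<^sup>2" using hM tM by (auto simp: cmod_power2) (smt (verit) zero_le_power2)+
  then have "?X * ?Y \<le> (2 * M\<^sup>2) * (2 * M\<^sup>2)" using XY by (intro mult_mono) auto
  also have "\<dots> = 4 * M ^ 4" by (simp add: power2_eq_square power4_eq_xxxx)
  finally have XYM: "?X * ?Y \<le> 4 * M ^ 4" .
  have "rho w t * rho w s * (?X * ?Y) \<le> rho w t * rho w s * (4 * M ^ 4)"
    using rho_nonneg[OF w] XYM by (intro mult_left_mono) auto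
  also have "\<dots> \<le> 64 * D\<^sup>2" using rr by linarith
  finally have "rho w t * rho w s * (?X * ?Y) \<le> 64 * D\<^sup>2" .
  moreover have "r / E \<le> 64 / Z" if "r * Z \<le> 64 * E" "Z > 0" "E > 0" for r E Z :: real
    using that by (simp add: field_simps)
  ultimately have "rho w t * rho w s / D\<^sup>2 \<le> 64 / (?X * ?Y)"
    using XY D by simp
  then show ?thesis by (simp add: D_def)
qed

section \<open>Hyperbolic area integrals and vanishing of the oscillation at the circle\<close>

lemma lborel_complex: "lborel = distr (lborel \<Otimes>\<^sub>M lborel) borel (\<lambda>(x, y). Complex x y)"
proof (rule lborel_eqI)
  have "(\<lambda>(x, y). Complex x y) \<in> measurable (borel \<Otimes>\<^sub>M borel) borel"
    unfolding borel_prod by (intro borel_measurable_continuous_onI) (auto simp: case_prod_beta intro!: continuous_intros)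
  then have m: "(\<lambda>(x, y). Complex x y) \<in> measurable (lborel \<Otimes>\<^sub>M lborel) borel"
    by (simp cong: measurable_cong_sets)
  fix l u :: complex assume le: "\<And>b. b \<in> Basis \<Longrightarrow> l \<bullet> b \<le> u \<bullet> b"
  have le': "Re l \<le> Re u" "Im l \<le> Im u" using le[of 1] le[of \<i>] by (auto simp: Basis_complex_def)
  have "emeasure (distr (lborel \<Otimes>\<^sub>M lborel) borel (\<lambda>(x, y). Complex x y)) (box l u) =
     emeasure (lborel \<Otimes>\<^sub>M lborel) ((\<lambda>(x, y). Complex x y) -` box l u \<inter> space (lborel \<Otimes>\<^sub>M lborel))"
    by (rule emeasure_distr[OF m]) simp
  also have "(\<lambda>(x, y). Complex x y) -` box l u \<inter> space (lborel \<Otimes>\<^sub>M lborel) = {Re l<..<Re u} \<times> {Im l<..<Im u}"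
    by (auto simp: space_pair_measure box_def Basis_complex_def)
  also have "emeasure (lborel \<Otimes>\<^sub>M lborel) ({Re l<..<Re u} \<times> {Im l<..<Im u}) = emeasure lborel {Re l<..<Re u} * emeasure lborel {Im l<..<Im u}"
    by (intro lborel.emeasure_pair_measure_Times) auto
  also have "\<dots> = ennreal (\<Prod>b\<in>Basis. (u - l) \<bullet> b)"
    using le' by (simp add: Basis_complex_def ennreal_mult)
  finally show "emeasure (distr (lborel \<Otimes>\<^sub>M lborel) borel (\<lambda>(x, y). Complex x y)) (box l u) = ennreal (\<Prod>b\<in>Basis. (u - l) \<bullet> b)" .
qed simp

lemma nn_integral_complex:
  assumes [measurable]: "f \<in> borel_measurable borel"
  shows "(\<integral>\<^sup>+w. f w \<partial>lborel) = (\<integral>\<^sup>+x. \<integral>\<^sup>+y. f (Complex x y) \<partial>lborel \<partial>lborel)"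
proof -
  have m [measurable]: "(\<lambda>(x, y). Complex x y) \<in> borel \<Otimes>\<^sub>M borel \<rightarrow>\<^sub>M borel"
    unfolding borel_prod by (intro borel_measurable_continuous_onI) (auto simp: case_prod_beta intro!: continuous_intros)
  have "(\<integral>\<^sup>+w. f w \<partial>lborel) = (\<integral>\<^sup>+z. f ((\<lambda>(x, y). Complex x y) z) \<partial>(lborel \<Otimes>\<^sub>M lborel))"
    by (subst lborel_complex, rule nn_integral_distr) auto
  also have "\<dots> = (\<integral>\<^sup>+x. \<integral>\<^sup>+y. f ((\<lambda>(x, y). Complex x y) (x, y)) \<partial>lborel \<partial>lborel)"
    by (rule lborel.nn_integral_fst[symmetric]) simp
  finally show ?thesis by simp
qed

lemma nn_integral_inverse_square:
  assumes h: "h > 0" shows "(\<integral>\<^sup>+x. ennreal (1 / (h\<^sup>2 + (a - x)\<^sup>2)) \<partial>lborel) = ennreal (pi / h)"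
proof -
  have "(\<integral>\<^sup>+x. ennreal (1 / (h\<^sup>2 + (a - x)\<^sup>2)) \<partial>lborel) = (\<integral>\<^sup>+x. ennreal (1 / h) * ennreal (h / (h\<^sup>2 + (a - x)\<^sup>2)) \<partial>lborel)"
    using h by (intro nn_integral_cong) (simp add: ennreal_mult[symmetric])
  also have "\<dots> = ennreal (1 / h) * ennreal pi"
    using h by (subst nn_integral_cmult) (auto simp: nn_integral_cauchy)
  finally show ?thesis using h by (simp add: ennreal_mult[symmetric])
qed

text \<open>After enlarging the disc to the plane, each coordinate contributes a Cauchy integral
  \<open>pi / h\<close>. With \<open>h\<close> half the chord,
  \<open>64 * pi\<^sup>2 / h\<^sup>2\<close> is the bound: the kernel of the energy
  reappears.\<close>

lemma nn_integral_rho_rho: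
  assumes d: "circ t \<noteq> circ s"
  shows "(\<integral>\<^sup>+w. indicator (ball 0 1) w * ennreal (rho w t * rho w s / (1 - (cmod w)\<^sup>2)\<^sup>2) \<partial>lborel) \<le> ennreal (256 * pi\<^sup>2 / (cmod (circ t - circ s))\<^sup>2)"
proof -
  define h where "h = cmod (circ t - circ s) / 2"
  have h: "h > 0" using d by (simp add: h_def)
  let ?f = "\<lambda>x. ennreal (1 / (h\<^sup>2 + (Re (circ t) - x)\<^sup>2))" and ?g = "\<lambda>y. ennreal (1 / (h\<^sup>2 + (Im (circ t) - y)\<^sup>2))"
  have "(\<integral>\<^sup>+w. indicator (ball 0 1) w * ennreal (rho w t * rho w s / (1 - (cmod w)\<^sup>2)\<^sup>2) \<partial>lborel) \<le>
     (\<integral>\<^sup>+w. 64 * (?f (Re w) * ?g (Im w)) \<partial>lborel)"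
  proof (intro nn_integral_mono)
    fix w
    show "indicator (ball 0 1) w * ennreal (rho w t * rho w s / (1 - (cmod w)\<^sup>2)\<^sup>2) \<le> 64 * (?f (Re w) * ?g (Im w))"
    proof (cases "cmod w < 1")
      case True
      have "ennreal (rho w t * rho w s / (1 - (cmod w)\<^sup>2)\<^sup>2) \<le> ennreal (64 * (1 / (h\<^sup>2 + (Re (circ t) - Re w)\<^sup>2) * (1 / (h\<^sup>2 + (Im (circ t) - Im w)\<^sup>2))))"
        using rho_rho_area_bound[OF True h_def h] by (intro ennreal_leI)
      also have "\<dots> = 64 * (?f (Re w) * ?g (Im w))" by (simp only: ennreal_mult' ennreal_mult'' zero_le_divide_1_iff ennreal_numeral sum_power2_ge_zero zero_le_numeral)
      finally show ?thesis using True by simp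
    qed simp
  qed
  also have "\<dots> = 64 * (\<integral>\<^sup>+w. ?f (Re w) * ?g (Im w) \<partial>lborel)"
    by (intro nn_integral_cmult) measurable
  also have "(\<integral>\<^sup>+w. ?f (Re w) * ?g (Im w) \<partial>lborel) = (\<integral>\<^sup>+x. \<integral>\<^sup>+y. ?f x * ?g y \<partial>lborel \<partial>lborel)"
    by (subst nn_integral_complex) auto
  also have "\<dots> = (\<integral>\<^sup>+x. ?f x * (\<integral>\<^sup>+y. ?g y \<partial>lborel) \<partial>lborel)"
    by (intro nn_integral_cong nn_integral_cmult) measurable
  also have "\<dots> = (\<integral>\<^sup>+x. ?f x \<partial>lborel) * (\<integral>\<^sup>+y. ?g y \<partial>lborel)"
    by (intro nn_integral_multc) measurable
  also have "\<dots> = ennreal (pi\<^sup>2 / h\<^sup>2)"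
    unfolding nn_integral_inverse_square[OF h] using h by (simp add: ennreal_mult[symmetric] power2_eq_square)
  also have "64 * \<dots> = ennreal (256 * pi\<^sup>2 / (cmod (circ t - circ s))\<^sup>2)"
    by (simp add: h_def power_divide ennreal_mult'[symmetric] ennreal_numeral[symmetric] del: ennreal_numeral)
  finally show ?thesis .
qed

lemma rho_measurable_comp [measurable (raw)]:
  assumes "f \<in> N \<rightarrow>\<^sub>M borel" "g \<in> N \<rightarrow>\<^sub>M borel"
  shows "(\<lambda>x. rho (f x) (g x)) \<in> borel_measurable N"
proof -
  have "(\<lambda>x. (case_prod rho) (f x, g x)) \<in> borel_measurable N"
    by (rule measurable_compose[OF _ rho_measurable(1)[folded borel_prod]]) (use assms in measurable)
  then show ?thesis by simp
qed

text \<open>Tonelli's theorem moves the area integral inside, where it is the energy kernel. Pairs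
  that give the same boundary point contribute nothing, because \<open>u\<close> takes the same
  value on them.\<close>

lemma nn_integral_dosc_le:
  assumes u [measurable]: "u \<in> borel_measurable borel" and cu: "\<And>s t. circ s = circ t \<Longrightarrow> u s = u t"
  shows "(\<integral>\<^sup>+w. indicator (ball 0 1) w * (dosc p u w * ennreal (1 / (1 - (cmod w)\<^sup>2)\<^sup>2)) \<partial>lborel) \<le> ennreal (256 * pi\<^sup>2) * ener p u"
proof -
  let ?D = "\<lambda>w::complex. 1 / (1 - (cmod w)\<^sup>2)\<^sup>2"
  let ?I = "\<lambda>t s::real. indicator {0..1} t * indicator {0..1} s :: ennreal"
  let ?R = "\<lambda>t s w. indicator (ball 0 1) w * ennreal (rho w t * rho w s / (1 - (cmod w)\<^sup>2)\<^sup>2)"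
  let ?G = "\<lambda>w t s. ?I t s * ennreal (\<bar>u t - u s\<bar> powr p) * ?R t s w"
  have [measurable]: "ball (0::complex) 1 \<in> sets borel" by simp
  have "(\<integral>\<^sup>+w. indicator (ball 0 1) w * (dosc p u w * ennreal (?D w)) \<partial>lborel) =
     (\<integral>\<^sup>+w. \<integral>\<^sup>+t. \<integral>\<^sup>+s. ?G w t s \<partial>lborel \<partial>lborel \<partial>lborel)"
  proof (intro nn_integral_cong)
    fix w
    show "indicator (ball 0 1) w * (dosc p u w * ennreal (?D w)) = (\<integral>\<^sup>+t. \<integral>\<^sup>+s. ?G w t s \<partial>lborel \<partial>lborel)"
    proof (cases "cmod w < 1")
      case True
      note r0 = rho_nonneg[OF True]
      have "dosc p u w * ennreal (?D w) = (\<integral>\<^sup>+t. (\<integral>\<^sup>+s. ?I t s * ennreal (\<bar>u t - u s\<bar> powr p * (rho w t * rho w s)) \<partial>lborel) * ennreal (?D w) \<partial>lborel)"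
        unfolding dosc_def by (intro nn_integral_multc[symmetric]) measurable
      also have "\<dots> = (\<integral>\<^sup>+t. (\<integral>\<^sup>+s. ?I t s * ennreal (\<bar>u t - u s\<bar> powr p * (rho w t * rho w s)) * ennreal (?D w) \<partial>lborel) \<partial>lborel)"
        by (intro nn_integral_cong nn_integral_multc[symmetric]) measurable
      also have "\<dots> = (\<integral>\<^sup>+t. \<integral>\<^sup>+s. ?G w t s \<partial>lborel \<partial>lborel)"
      proof (intro nn_integral_cong)
        fix t s
        have "ennreal (\<bar>u t - u s\<bar> powr p * (rho w t * rho w s)) * ennreal (?D w) = ennreal (\<bar>u t - u s\<bar> powr p) * ennreal (rho w t * rho w s / (1 - (cmod w)\<^sup>2)\<^sup>2)"
          using r0[of t] r0[of s] by (simp add: ennreal_mult[symmetric])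
        then show "?I t s * ennreal (\<bar>u t - u s\<bar> powr p * (rho w t * rho w s)) * ennreal (?D w) = ?G w t s"
          using True by (simp add: mult.assoc)
      qed
      finally show ?thesis using True by simp
    qed simp
  qed
  also have "\<dots> = (\<integral>\<^sup>+t. \<integral>\<^sup>+w. \<integral>\<^sup>+s. ?G w t s \<partial>lborel \<partial>lborel \<partial>lborel)"
    by (rule lborel_pair.Fubini') measurable
  also have "\<dots> = (\<integral>\<^sup>+t. \<integral>\<^sup>+s. \<integral>\<^sup>+w. ?G w t s \<partial>lborel \<partial>lborel \<partial>lborel)"
    by (intro nn_integral_cong lborel_pair.Fubini') measurable
  also have "\<dots> \<le> (\<integral>\<^sup>+t. \<integral>\<^sup>+s. ennreal (256 * pi\<^sup>2) * (?I t s * ennreal (\<bar>u t - u s\<bar> powr p / (cmod (circ t - circ s))\<^sup>2)) \<partial>lborel \<partial>lborel)"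
  proof (intro nn_integral_mono)
    fix t s
    have "(\<integral>\<^sup>+w. ?G w t s \<partial>lborel) = ?I t s * ennreal (\<bar>u t - u s\<bar> powr p) * (\<integral>\<^sup>+w. ?R t s w \<partial>lborel)"
      by (intro nn_integral_cmult) (unfold rho_def, measurable)
    also have "\<dots> \<le> ennreal (256 * pi\<^sup>2) * (?I t s * ennreal (\<bar>u t - u s\<bar> powr p / (cmod (circ t - circ s))\<^sup>2))"
    proof (cases "circ t = circ s")
      case True
      then show ?thesis using cu[OF True] by simp
    next
      case False
      have "?I t s * ennreal (\<bar>u t - u s\<bar> powr p) * (\<integral>\<^sup>+w. ?R t s w \<partial>lborel) \<le>
         ?I t s * ennreal (\<bar>u t - u s\<bar> powr p) * ennreal (256 * pi\<^sup>2 / (cmod (circ t - circ s))\<^sup>2)"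
        by (intro mult_left_mono nn_integral_rho_rho False) auto
      also have "\<dots> = ?I t s * ennreal (\<bar>u t - u s\<bar> powr p * (256 * pi\<^sup>2 / (cmod (circ t - circ s))\<^sup>2))"
        by (subst ennreal_mult) (auto simp: mult.assoc)
      also have "\<bar>u t - u s\<bar> powr p * (256 * pi\<^sup>2 / (cmod (circ t - circ s))\<^sup>2) = 256 * pi\<^sup>2 * (\<bar>u t - u s\<bar> powr p / (cmod (circ t - circ s))\<^sup>2)"
        by simp
      also have "ennreal \<dots> = ennreal (256 * pi\<^sup>2) * ennreal (\<bar>u t - u s\<bar> powr p / (cmod (circ t - circ s))\<^sup>2)"
        by (intro ennreal_mult) auto
      finally show ?thesis by (simp add: mult.left_commute)
    qed
    finally show "(\<integral>\<^sup>+w. ?G w t s \<partial>lborel) \<le> ennreal (256 * pi\<^sup>2) * (?I t s * ennreal (\<bar>u t - u s\<bar> powr p / (cmod (circ t - circ s))\<^sup>2))" .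
  qed
  also have "\<dots> = ennreal (256 * pi\<^sup>2) * ener p u"
    unfolding ener_def by (simp add: nn_integral_cmult)
  finally show ?thesis .
qed

text \<open>On the annulus belonging to \<open>n\<close> the integrand is below \<open>?g n\<close>,
  which does not depend on \<open>w\<close>. Dominated convergence for \<open>?g n\<close> therefore
  yields a bound that is uniform in \<open>w\<close>.\<close>

lemma dosc_vanishing:
  assumes u [measurable]: "u \<in> borel_measurable borel" and fin: "ener p u < \<infinity>" and cu: "\<And>s t. circ s = circ t \<Longrightarrow> u s = u t"
    and e: "e > 0"
  shows "\<exists>r<1. \<forall>w. r < cmod w \<longrightarrow> cmod w < 1 \<longrightarrow> dosc p u w \<le> ennreal e"
proof -
  let ?I = "\<lambda>z::real \<times> real. indicator {0..1} (fst z) * indicator {0..1} (snd z) :: ennreal"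
  let ?d = "\<lambda>z. cmod (circ (fst z) - circ (snd z))"
  let ?X = "\<lambda>z. \<bar>u (fst z) - u (snd z)\<bar> powr p"
  let ?g = "\<lambda>n z. ?I z * ennreal (256 * ?X z * min (1 / (?d z)\<^sup>2) ((1 / real (Suc n)) / (?d z) ^ 4))"
  have "(\<lambda>n. \<integral>\<^sup>+z. ?g n z \<partial>(lborel \<Otimes>\<^sub>M lborel)) \<longlonglongrightarrow> (\<integral>\<^sup>+(z::real \<times> real). 0 \<partial>(lborel \<Otimes>\<^sub>M lborel))"
  proof (rule nn_integral_dominated_convergence[where u' = "\<lambda>_. 0" and w = "\<lambda>z. ?I z * ennreal (256 * (?X z / (?d z)\<^sup>2))"])
    show "AE z in lborel \<Otimes>\<^sub>M lborel. ?g n z \<le> ?I z * ennreal (256 * (?X z / (?d z)\<^sup>2))" for n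
    proof (rule AE_I2)
      fix z
      have "?X z * min (1 / (?d z)\<^sup>2) ((1 / real (Suc n)) / (?d z) ^ 4) \<le> ?X z * (1 / (?d z)\<^sup>2)"
        by (intro mult_left_mono) auto
      then show "?g n z \<le> ?I z * ennreal (256 * (?X z / (?d z)\<^sup>2))"
        by (intro mult_left_mono ennreal_leI) auto
    qed
    have "(\<integral>\<^sup>+z. ?I z * ennreal (256 * (?X z / (?d z)\<^sup>2)) \<partial>(lborel \<Otimes>\<^sub>M lborel)) =
      (\<integral>\<^sup>+t. \<integral>\<^sup>+s. indicator {0..1} t * indicator {0..1} s * ennreal (256 * (\<bar>u t - u s\<bar> powr p / (cmod (circ t - circ s))\<^sup>2)) \<partial>lborel \<partial>lborel)"
      by (subst lborel.nn_integral_fst[symmetric]) auto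
    also have "\<dots> = (\<integral>\<^sup>+t. \<integral>\<^sup>+s. 256 * (indicator {0..1} t * indicator {0..1} s * ennreal (\<bar>u t - u s\<bar> powr p / (cmod (circ t - circ s))\<^sup>2)) \<partial>lborel \<partial>lborel)"
    proof (intro nn_integral_cong)
      fix t s :: real
      have *: "ennreal (256 * X) = 256 * ennreal X" for X by (simp add: ennreal_mult')
      show "indicator {0..1} t * indicator {0..1} s * ennreal (256 * (\<bar>u t - u s\<bar> powr p / (cmod (circ t - circ s))\<^sup>2)) =
         256 * (indicator {0..1} t * indicator {0..1} s * ennreal (\<bar>u t - u s\<bar> powr p / (cmod (circ t - circ s))\<^sup>2))"
        unfolding * by (simp only: mult_ac)
    qed
    also have "\<dots> = 256 * ener p u"
      unfolding ener_def by (simp add: nn_integral_cmult)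
    also have "\<dots> < \<infinity>" using fin by (simp add: ennreal_mult_less_top)
    finally show "(\<integral>\<^sup>+z. ?I z * ennreal (256 * (?X z / (?d z)\<^sup>2)) \<partial>(lborel \<Otimes>\<^sub>M lborel)) < \<infinity>" .
    show "AE z in lborel \<Otimes>\<^sub>M lborel. (\<lambda>n. ?g n z) \<longlonglongrightarrow> 0"
    proof (rule AE_I2)
      fix z
      have "(\<lambda>n. 256 * ?X z * min (1 / (?d z)\<^sup>2) ((1 / real (Suc n)) / (?d z) ^ 4)) \<longlonglongrightarrow> 256 * ?X z * min (1 / (?d z)\<^sup>2) (0 / (?d z) ^ 4)"
      proof (intro tendsto_mult tendsto_min tendsto_const)
        have "(\<lambda>n. 1 / real (Suc n)) \<longlonglongrightarrow> 0" using LIMSEQ_Suc[OF lim_1_over_n] by simp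
        from tendsto_mult[OF this tendsto_const[of "inverse (?d z ^ 4)"]]
        show "(\<lambda>n. 1 / real (Suc n) / ?d z ^ 4) \<longlonglongrightarrow> 0 / ?d z ^ 4" unfolding divide_inverse by simp
      qed
      \<comment> \<open>The minimum vanishes on the diagonal as well, where both quotients are
        \<open>0\<close> by convention.\<close>
      moreover have "256 * ?X z * min (1 / (?d z)\<^sup>2) (0 / (?d z) ^ 4) = 0"
        by (simp add: min_absorb2)
      ultimately have "(\<lambda>n. ennreal (256 * ?X z * min (1 / (?d z)\<^sup>2) ((1 / real (Suc n)) / (?d z) ^ 4))) \<longlonglongrightarrow> ennreal 0"
        by (intro tendsto_ennrealI) (simp only:)
      moreover have "?I z = 0 \<or> ?I z = 1" by (auto simp: indicator_def)
      ultimately show "(\<lambda>n. ?g n z) \<longlonglongrightarrow> 0" by auto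
    qed
  qed measurable
  then have "(\<lambda>n. \<integral>\<^sup>+z. ?g n z \<partial>(lborel \<Otimes>\<^sub>M lborel)) \<longlonglongrightarrow> 0" by simp
  then have "\<forall>\<^sub>F n in sequentially. (\<integral>\<^sup>+z. ?g n z \<partial>(lborel \<Otimes>\<^sub>M lborel)) < ennreal e"
    by (rule order_tendstoD) (use e in simp)
  then obtain n where n: "(\<integral>\<^sup>+z. ?g n z \<partial>(lborel \<Otimes>\<^sub>M lborel)) < ennreal e"
    by (auto simp: eventually_sequentially)
  define r where "r = sqrt (1 - 1 / (2 * real (Suc n)))"
  have r1: "r < 1" by (simp add: r_def)
  show ?thesis
  proof (intro exI[of _ r] conjI r1 allI impI)
    fix w assume w: "r < cmod w" "cmod w < 1"
    have "1 - 1 / (2 * real (Suc n)) \<ge> 0" by (simp add: field_simps)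
    then have "r\<^sup>2 = 1 - 1 / (2 * real (Suc n))" "r \<ge> 0" by (auto simp: r_def)
    moreover from this w have "r\<^sup>2 \<le> (cmod w)\<^sup>2" by (intro power_mono) auto
    ultimately have "1 - (cmod w)\<^sup>2 \<le> 1 / (2 * real (Suc n))" by linarith
    also have "\<dots> \<le> 1 / real (Suc n)" by (simp add: field_simps)
    finally have D: "1 - (cmod w)\<^sup>2 \<le> 1 / real (Suc n)" .
    have D0: "1 - (cmod w)\<^sup>2 \<ge> 0" "1 - (cmod w)\<^sup>2 \<le> 1" using w by (auto simp: abs_square_le_1)
    have "(1 - (cmod w)\<^sup>2)\<^sup>2 \<le> 1 * (1 - (cmod w)\<^sup>2)"
      unfolding power2_eq_square using D0 by (intro mult_right_mono) (auto simp: power2_eq_square)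
    then have D2: "(1 - (cmod w)\<^sup>2)\<^sup>2 \<le> 1 / real (Suc n)" using D by (metis mult_1 order.trans)
    have "dosc p u w = (\<integral>\<^sup>+z. ?I z * ennreal (?X z * (rho w (fst z) * rho w (snd z))) \<partial>(lborel \<Otimes>\<^sub>M lborel))"
      unfolding dosc_def by (subst lborel.nn_integral_fst[symmetric]) auto
    also have "\<dots> \<le> (\<integral>\<^sup>+z. ?g n z \<partial>(lborel \<Otimes>\<^sub>M lborel))"
    proof (intro nn_integral_mono mult_left_mono ennreal_leI)
      fix z
      show "?X z * (rho w (fst z) * rho w (snd z)) \<le> 256 * ?X z * min (1 / (?d z)\<^sup>2) ((1 / real (Suc n)) / (?d z) ^ 4)"
      proof (cases "?d z = 0")
        case True
        then have "u (fst z) = u (snd z)" by (intro cu) simp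
        then show ?thesis by simp
      next
        case False
        then have d: "?d z > 0" by simp
        have 1: "rho w (fst z) * rho w (snd z) \<le> 256 * (1 / (?d z)\<^sup>2)"
          using rho_rho_dist_2(1)[OF w(2), of "fst z" "snd z"] d by (simp add: field_simps)
        have "rho w (fst z) * rho w (snd z) * ?d z ^ 4 \<le> 256 * (1 / real (Suc n))"
          using rho_rho_dist_2(2)[OF w(2), of "fst z" "snd z"] D2 by linarith
        then have 2: "rho w (fst z) * rho w (snd z) \<le> 256 * ((1 / real (Suc n)) / (?d z) ^ 4)"
          using d by (simp add: pos_le_divide_eq mult_ac)
        have "rho w (fst z) * rho w (snd z) \<le> 256 * min (1 / (?d z)\<^sup>2) ((1 / real (Suc n)) / (?d z) ^ 4)"
          using 1 2 by (auto simp: min_def)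
        then have "?X z * (rho w (fst z) * rho w (snd z)) \<le> ?X z * (256 * min (1 / (?d z)\<^sup>2) ((1 / real (Suc n)) / (?d z) ^ 4))"
          by (intro mult_left_mono) auto
        then show ?thesis by (simp add: mult_ac)
      qed
    qed auto
    also have "\<dots> \<le> ennreal e" using n by (rule less_imp_le)
    finally show "dosc p u w \<le> ennreal e" .
  qed
qed

section \<open>Absolutely continuous functions and convolutions\<close>

text \<open>The intervals lie in an open set of small measure, so absolute continuity makes their
  increments small. Degenerate intervals are left out: a single point may sit inside another member
  of a division, and the ordering condition in \<open>abs_continuous_on\<close> forbids
  that.\<close>

lemma abs_continuous_small_sum:
  fixes f :: "real \<Rightarrow> real"
  assumes ac: "\<forall>(n::nat) (s::nat \<Rightarrow> real) t. (\<forall>i<n. a \<le> s i \<and> s i \<le> t i \<and> t i \<le> b) \<and>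
        (\<forall>i<n. \<forall>j<n. i \<noteq> j \<longrightarrow> t i \<le> s j \<or> t j \<le> s i) \<and>
        (\<Sum>i<n. t i - s i) < \<delta> \<longrightarrow> (\<Sum>i<n. \<bar>f (t i) - f (s i)\<bar>) < \<epsilon>"
    and p: "p tagged_division_of {a..b}"
    and q: "q = {(x, K). (x, K) \<in> p \<and> x \<in> N \<and> Inf K < Sup K}"
    and T: "open T" "emeasure lborel T < ennreal \<delta>" and \<delta>: "\<delta> > 0"
    and sub: "\<And>x K. (x, K) \<in> q \<Longrightarrow> K \<subseteq> T"
  shows "(\<Sum>(x, K)\<in>q. \<bar>f (Sup K) - f (Inf K)\<bar>) < \<epsilon>"
proof -
  have fin: "finite q" using p unfolding q by (intro finite_subset[OF _ tagged_division_ofD(1)[OF p]]) auto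
  obtain h where h: "bij_betw h {..<card q} q"
    using ex_bij_betw_nat_finite[OF fin] by (auto simp: atLeast0LessThan)
  let ?n = "card q"
  define s where "s = (\<lambda>i. Inf (snd (h i)))"
  define t where "t = (\<lambda>i. Sup (snd (h i)))"
  have hq: "h i \<in> q" if "i < ?n" for i using h that by (auto simp: bij_betw_def)
  have K: "snd (h i) = {s i..t i} \<and> s i < t i \<and> {s i..t i} \<subseteq> {a..b}" if "i < ?n" for i
  proof -
    obtain x L where xL: "h i = (x, L)" by fastforce
    have L: "(x, L) \<in> p" "Inf L < Sup L" using hq[OF that] xL by (auto simp: q)
    then obtain c d where cd: "L = cbox c d" using tagged_division_ofD(4)[OF p] by blast
    have "x \<in> L" using tagged_division_ofD(2)[OF p L(1)] .
    then have "c \<le> d" using cd by auto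
    then have "Inf L = c" "Sup L = d" by (auto simp: cd)
    moreover have "L \<subseteq> {a..b}" using tagged_division_ofD(3)[OF p L(1)] .
    ultimately show ?thesis using xL cd L(2) by (simp add: s_def t_def)
  qed
  have disj: "t i \<le> s j \<or> t j \<le> s i" if "i < ?n" "j < ?n" "i \<noteq> j" for i j
  proof (rule ccontr)
    assume "\<not> (t i \<le> s j \<or> t j \<le> s i)"
    then have lt: "max (s i) (s j) < min (t i) (t j)" using K[OF that(1)] K[OF that(2)] by auto
    have "h i \<noteq> h j" using h that by (auto simp: bij_betw_def inj_on_def)
    moreover have "h i \<in> p" "h j \<in> p" using hq[OF that(1)] hq[OF that(2)] by (auto simp: q)
    ultimately have "interior (snd (h i)) \<inter> interior (snd (h j)) = {}"
      using tagged_division_ofD(5)[OF p] by (metis prod.collapse)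
    then have "{s i<..<t i} \<inter> {s j<..<t j} = {}"
      using K[OF that(1)] K[OF that(2)] by (simp add: interior_atLeastAtMost_real)
    moreover from dense[OF lt] obtain z where "max (s i) (s j) < z" "z < min (t i) (t j)" by auto
    ultimately show False by auto
  qed
  have "ennreal (\<Sum>i<?n. t i - s i) = (\<Sum>i<?n. emeasure lborel {s i<..<t i})"
    using K by (subst sum_ennreal[symmetric]) (auto intro!: sum.cong simp: less_imp_le)
  also have "\<dots> = emeasure lborel (\<Union>i<?n. {s i<..<t i})"
  proof (rule sum_emeasure)
    show "disjoint_family_on (\<lambda>i. {s i<..<t i}) {..<?n}"
      using disj by (fastforce simp: disjoint_family_on_def)
  qed auto
  also have "\<dots> \<le> emeasure lborel T"
  proof (rule emeasure_mono)
    show "(\<Union>i<?n. {s i<..<t i}) \<subseteq> T"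
    proof
      fix z assume "z \<in> (\<Union>i<?n. {s i<..<t i})"
      then obtain i where i: "i < ?n" "z \<in> {s i..t i}" by auto
      then have "z \<in> snd (h i)" using K by auto
      moreover have "(fst (h i), snd (h i)) \<in> q" using hq[OF i(1)] by simp
      ultimately show "z \<in> T" using sub by blast
    qed
  qed (use T in auto)
  also have "\<dots> < ennreal \<delta>" by (rule T)
  finally have "(\<Sum>i<?n. t i - s i) < \<delta>"
    using K by (subst (asm) ennreal_less_iff) (auto intro!: sum_nonneg simp: less_imp_le)
  then have "(\<Sum>i<?n. \<bar>f (t i) - f (s i)\<bar>) < \<epsilon>"
    using ac[THEN spec, THEN spec, THEN spec, of ?n s t] K disj by (auto simp: less_imp_le)
  also have "(\<Sum>i<?n. \<bar>f (t i) - f (s i)\<bar>) = (\<Sum>(x, K)\<in>q. \<bar>f (Sup K) - f (Inf K)\<bar>)"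
    unfolding s_def t_def using sum.reindex_bij_betw[OF h, of "\<lambda>(x, K). \<bar>f (Sup K) - f (Inf K)\<bar>"]
    by (simp add: case_prod_beta)
  finally show ?thesis .
qed

text \<open>A Henstock-Kurzweil argument. Off the exceptional set the gauge is a ball given by
  differentiability; on it the gauge is an open set of small measure, where the derivative is
  replaced by \<open>0\<close> and absolute continuity controls the increments.\<close>

lemma abs_continuous_FTC:
  fixes f g :: "real \<Rightarrow> real"
  assumes ac: "abs_continuous_on a b f" and ab: "a \<le> b"
    and D: "AE x in lborel. x \<in> {a..b} \<longrightarrow> (f has_real_derivative g x) (at x)"
  shows "(g has_integral (f b - f a)) {a..b}"
proof -
  from AE_E[OF D] obtain N where N: "{x \<in> space lborel. \<not> (x \<in> {a..b} \<longrightarrow> (f has_real_derivative g x) (at x))} \<subseteq> N"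
    "emeasure lborel N = 0" "N \<in> sets lborel" by blast
  have N0: "N \<in> null_sets lborel" using N(2,3) by (rule null_setsI)
  have Nd: "(f has_real_derivative g x) (at x)" if "x \<in> {a..b}" "x \<notin> N" for x
  proof (rule ccontr)
    assume "\<not> (f has_real_derivative g x) (at x)"
    then have "x \<in> {x \<in> space lborel. \<not> (x \<in> {a..b} \<longrightarrow> (f has_real_derivative g x) (at x))}" using that by simp
    with N(1) that show False by blast
  qed
  define g' where "g' = (\<lambda>x. if x \<in> N then 0 else g x)"
  have "(g' has_integral (f b - f a)) (cbox a b)"
    unfolding has_integral
  proof (intro allI impI)
    fix e :: real assume e: "e > 0"
    define e2 where "e2 = e / (4 * (b - a + 1))"
    have e2: "e2 > 0" "e2 * (b - a) \<le> e / 4" using e ab by (auto simp: e2_def field_simps)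
    have "\<exists>\<delta>>0. \<forall>(n::nat) (s::nat \<Rightarrow> real) t. (\<forall>i<n. a \<le> s i \<and> s i \<le> t i \<and> t i \<le> b) \<and>
        (\<forall>i<n. \<forall>j<n. i \<noteq> j \<longrightarrow> t i \<le> s j \<or> t j \<le> s i) \<and>
        (\<Sum>i<n. t i - s i) < \<delta> \<longrightarrow> (\<Sum>i<n. \<bar>f (t i) - f (s i)\<bar>) < e / 2"
      by (rule ac[unfolded abs_continuous_on_def, THEN spec, THEN mp]) (use e in simp)
    then obtain \<delta> where \<delta>: "\<delta> > 0" and acd: "\<forall>(n::nat) (s::nat \<Rightarrow> real) t. (\<forall>i<n. a \<le> s i \<and> s i \<le> t i \<and> t i \<le> b) \<and>
        (\<forall>i<n. \<forall>j<n. i \<noteq> j \<longrightarrow> t i \<le> s j \<or> t j \<le> s i) \<and>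
        (\<Sum>i<n. t i - s i) < \<delta> \<longrightarrow> (\<Sum>i<n. \<bar>f (t i) - f (s i)\<bar>) < e / 2"
      by (elim exE conjE)
    have Nl: "N \<in> null_sets lebesgue" by (rule null_sets_completionI[OF N0])
    then have "N \<in> sets lebesgue" by auto
    from sets_lebesgue_outer_open[OF this \<delta>]
    obtain T where T: "open T" "N \<subseteq> T" "emeasure lebesgue (T - N) < ennreal \<delta>" by metis
    have "emeasure lborel T = emeasure lebesgue T" using T(1) by simp
    also have "\<dots> \<le> emeasure lebesgue ((T - N) \<union> N)"
      using T Nl by (intro emeasure_mono) auto
    also have "\<dots> \<le> emeasure lebesgue (T - N) + emeasure lebesgue N"
      using T Nl by (intro emeasure_subadditive) auto
    also have "\<dots> < ennreal \<delta>" using T Nl by (simp add: null_sets_def)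
    finally have TM: "emeasure lborel T < ennreal \<delta>" .
    have "\<exists>d>0. \<forall>y. \<bar>y - x\<bar> < d \<longrightarrow> \<bar>f y - f x - (y - x) * g x\<bar> \<le> e2 * \<bar>y - x\<bar>" if "x \<in> {a..b}" "x \<notin> N" for x
      using Nd[OF that] e2(1) unfolding has_field_derivative_def has_derivative_at_alt
      by (auto simp: mult.commute)
    then obtain d where d: "\<And>x. x \<in> {a..b} \<Longrightarrow> x \<notin> N \<Longrightarrow> d x > 0"
      "\<And>x y. x \<in> {a..b} \<Longrightarrow> x \<notin> N \<Longrightarrow> \<bar>y - x\<bar> < d x \<Longrightarrow> \<bar>f y - f x - (y - x) * g x\<bar> \<le> e2 * \<bar>y - x\<bar>"
      by metis
    define \<gamma> where "\<gamma> = (\<lambda>x. if x \<in> N then T else if x \<in> {a..b} then ball x (d x) else UNIV)"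
    have gau: "gauge \<gamma>" unfolding gauge_def \<gamma>_def using T d(1) by auto
    have nm: "norm ((\<Sum>(x,K)\<in>p. measure lborel K *\<^sub>R g' x) - (f b - f a)) < e"
      if p: "p tagged_division_of cbox a b" and fine: "\<gamma> fine p" for p
    proof -
      have p': "p tagged_division_of {a..b}" using p by simp
      define q where "q = {(x, K). (x, K) \<in> p \<and> x \<in> N \<and> Inf K < Sup K}"
      have qs: "(\<Sum>(x, K)\<in>q. \<bar>f (Sup K) - f (Inf K)\<bar>) < e / 2"
      proof (rule abs_continuous_small_sum[OF acd p' q_def T(1) TM \<delta>])
        show "K \<subseteq> T" if "(x, K) \<in> q" for x K
        proof -
          have "(x, K) \<in> p" "x \<in> N" using that by (auto simp: q_def)
          then show ?thesis using fineD[OF fine, of x K] by (simp add: \<gamma>_def)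
        qed
      qed
      have fp: "finite p" using p by blast
      have ba: "b - a = (\<Sum>(x,K)\<in>p. Sup K - Inf K)" "f b - f a = (\<Sum>(x,K)\<in>p. f(Sup K) - f(Inf K))"
        using additive_tagged_division_1[where f= "\<lambda>x. x"] additive_tagged_division_1[where f= f] ab p' by auto
      have "norm ((\<Sum>(x,K)\<in>p. measure lborel K *\<^sub>R g' x) - (f b - f a)) =
         norm (\<Sum>(x,K)\<in>p. measure lborel K *\<^sub>R g' x - (f (Sup K) - f (Inf K)))"
        unfolding ba by (simp add: sum_subtractf case_prod_unfold)
      also have "\<dots> \<le> (\<Sum>z\<in>p. e2 * (Sup (snd z) - Inf (snd z)) + (if z \<in> q then \<bar>f (Sup (snd z)) - f (Inf (snd z))\<bar> else 0))"
      proof (rule sum_norm_le, safe)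
        fix x K assume xK: "(x, K) \<in> p"
        then obtain u v where K: "K = cbox u v" using p by blast
        have x: "x \<in> K" "K \<subseteq> {a..b}" using xK p by auto
        then have uv: "u \<le> v" "u \<le> x" "x \<le> v" using K by auto
        have SI: "Sup K = v" "Inf K = u" "measure lborel K = v - u" using uv by (auto simp: K)
        show "norm (measure lborel K *\<^sub>R g' x - (f (Sup K) - f (Inf K))) \<le>
          e2 * (Sup (snd (x, K)) - Inf (snd (x, K))) + (if (x, K) \<in> q then \<bar>f (Sup (snd (x, K))) - f (Inf (snd (x, K)))\<bar> else 0)"
        proof (cases "x \<in> N")
          case True
          show ?thesis
          proof (cases "u < v")
            case True
            then show ?thesis using \<open>x \<in> N\<close> xK e2 by (auto simp: g'_def q_def SI abs_minus_commute)
          next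
            case False
            then have "u = v" using uv by simp
            then show ?thesis using \<open>x \<in> N\<close> by (simp add: g'_def SI)
          qed
        next
          case False
          have xab: "x \<in> {a..b}" using x by blast
          have "K \<subseteq> ball x (d x)" using fineD[OF fine xK] False xab by (simp only: \<gamma>_def if_True if_False)
          moreover have "u \<in> K" "v \<in> K" using uv K by auto
          ultimately have "\<bar>u - x\<bar> < d x" "\<bar>v - x\<bar> < d x" by (auto simp: dist_real_def abs_minus_commute)
          then have "\<bar>f u - f x - (u - x) * g x\<bar> \<le> e2 * \<bar>u - x\<bar>" "\<bar>f v - f x - (v - x) * g x\<bar> \<le> e2 * \<bar>v - x\<bar>"
            using d(2)[of x] x False by auto
          then have "\<bar>f u - f x - (u - x) * g x\<bar> + \<bar>f v - f x - (v - x) * g x\<bar> \<le> e2 * (v - u)"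
            using uv by (simp add: algebra_simps)
          moreover have "(v - u) * g x - (f v - f u) = (f u - f x - (u - x) * g x) - (f v - f x - (v - x) * g x)"
            by (simp add: algebra_simps)
          ultimately have "\<bar>(v - u) * g x - (f v - f u)\<bar> \<le> e2 * (v - u)" by linarith
          then show ?thesis using False by (simp add: g'_def SI q_def)
        qed
      qed
      also have "\<dots> = e2 * (b - a) + (\<Sum>(x, K)\<in>q. \<bar>f (Sup K) - f (Inf K)\<bar>)"
      proof -
        have "p \<inter> q = q" by (auto simp: q_def)
        then have "(\<Sum>z\<in>p. (if z \<in> q then \<bar>f (Sup (snd z)) - f (Inf (snd z))\<bar> else 0)) = (\<Sum>z\<in>q. \<bar>f (Sup (snd z)) - f (Inf (snd z))\<bar>)"
          using sum.inter_restrict[OF fp, of "\<lambda>z. \<bar>f (Sup (snd z)) - f (Inf (snd z))\<bar>" q] by simp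
        then show ?thesis unfolding sum.distrib ba(1) sum_distrib_left by (simp add: case_prod_unfold)
      qed
      also have "\<dots> < e" using qs e2 e by linarith
      finally show ?thesis .
    qed
    show "\<exists>\<gamma>. gauge \<gamma> \<and> (\<forall>\<D>. \<D> tagged_division_of cbox a b \<and> \<gamma> fine \<D> \<longrightarrow> norm ((\<Sum>(x,K)\<in>\<D>. measure lborel K *\<^sub>R g' x) - (f b - f a)) < e)"
      by (intro exI[of _ \<gamma>] conjI gau allI impI; elim conjE; rule nm; assumption)
  qed
  then have int: "(g' has_integral (f b - f a)) {a..b}" by simp
  have neg: "negligible N" using N0 by (simp add: negligible_iff_null_sets null_sets_completionI)
  show ?thesis
    by (rule has_integral_spike[OF neg _ int]) (simp add: g'_def)
qed

section \<open>Differentiation of convolutions with rescaled kernels\<close>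

lemma has_derivative_ratio_kernel:
  fixes k k' :: "real \<Rightarrow> real"
  assumes k: "\<And>s. (k has_real_derivative k' s) (at s)" and z: "Im z > 0"
  shows "((\<lambda>z. k ((Re z - t) / Im z)) has_derivative
     (\<lambda>\<zeta>. k' ((Re z - t) / Im z) * (Re \<zeta> / Im z - ((Re z - t) / Im z) * Im \<zeta> / Im z))) (at z within S)"
proof -
  have "((\<lambda>z. (Re z - t) / Im z) has_derivative (\<lambda>\<zeta>. Re \<zeta> / Im z - ((Re z - t) / Im z) * Im \<zeta> / Im z)) (at z within S)"
    using z by (auto intro!: derivative_eq_intros bounded_linear.has_derivative[OF bounded_linear_Re] bounded_linear.has_derivative[OF bounded_linear_Im] simp: field_simps power2_eq_square)
  from has_derivative_compose[OF this k[unfolded has_field_derivative_def, of "(Re z - t) / Im z"]]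
  show ?thesis by simp
qed

text \<open>With \<open>s = (x - t) / y\<close> one has \<open>t = x - y * s\<close>, hence
  \<open>t\<^sup>2 \<le> 2 * x\<^sup>2 + 2 * (y * s)\<^sup>2\<close>. The constant is uniform over
  bounded \<open>x\<close> and \<open>y\<close>, which gives one integrable majorant for all nearby
  kernels.\<close>

lemma shifted_weight_le:
  fixes x y t X Y :: real
  assumes y: "y > 0" "y \<le> Y" and x: "\<bar>x\<bar> \<le> X"
  shows "1 / (1 + ((x - t) / y)\<^sup>2)\<^sup>2 \<le> (1 + 2 * X\<^sup>2 + 2 * Y\<^sup>2)\<^sup>2 / (1 + t\<^sup>2)\<^sup>2"
proof -
  let ?s = "(x - t) / y"
  have t: "t = x - y * ?s" using y by simp
  have "t\<^sup>2 \<le> 2 * x\<^sup>2 + 2 * (y * ?s)\<^sup>2"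
    using zero_le_power2[of "x + y * ?s"] by (subst t) (simp only: power2_sum power2_diff)
  also have "x\<^sup>2 \<le> X\<^sup>2" using power_mono[OF x, of 2] by simp
  also have "(y * ?s)\<^sup>2 \<le> Y\<^sup>2 * ?s\<^sup>2"
    unfolding power_mult_distrib using y by (intro mult_right_mono power_mono) auto
  finally have "1 + t\<^sup>2 \<le> 1 + 2 * X\<^sup>2 + 2 * (Y\<^sup>2 * ?s\<^sup>2)" by simp
  also have "\<dots> \<le> (1 + 2 * X\<^sup>2 + 2 * Y\<^sup>2) * (1 + ?s\<^sup>2)"
  proof -
    have "(1 + 2 * A + 2 * B) * (1 + S) = 1 + 2 * A + 2 * (B * S) + (2 * B + S + 2 * A * S)" for A B S :: real
      by (simp add: algebra_simps)
    moreover have "0 \<le> 2 * Y\<^sup>2 + ?s\<^sup>2 + 2 * X\<^sup>2 * ?s\<^sup>2" by simp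
    ultimately show ?thesis by simp
  qed
  finally have le: "1 + t\<^sup>2 \<le> (1 + 2 * X\<^sup>2 + 2 * Y\<^sup>2) * (1 + ?s\<^sup>2)" .
  have p: "1 + t\<^sup>2 > 0" "1 + ?s\<^sup>2 > 0" by (auto simp: add_pos_nonneg)
  have "(1 + t\<^sup>2)\<^sup>2 \<le> (1 + 2 * X\<^sup>2 + 2 * Y\<^sup>2)\<^sup>2 * (1 + ?s\<^sup>2)\<^sup>2"
    unfolding power_mult_distrib[symmetric] using p le by (intro power_mono) auto
  moreover have "1 / S \<le> L / T" if "T \<le> L * S" "S > 0" "T > 0" for S L T :: real
    using that by (simp add: field_simps)
  ultimately show ?thesis using p by simp
qed

lemma convolution_integrable:
  fixes f k :: "real \<Rightarrow> real"
  assumes f: "f \<in> borel_measurable borel" and int: "integrable lborel (\<lambda>t. f t / (1 + t\<^sup>2)\<^sup>2)"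
    and km: "k \<in> borel_measurable borel" and kb: "\<And>s. \<bar>k s\<bar> \<le> B / (1 + s\<^sup>2)\<^sup>2" and y: "y > 0"
  shows "integrable lborel (\<lambda>t. f t * k ((x - t) / y))"
proof -
  note [measurable] = f km
  let ?L = "(1 + 2 * \<bar>x\<bar>\<^sup>2 + 2 * y\<^sup>2)\<^sup>2"
  have B: "B \<ge> 0" using kb[of 0] by simp
  show ?thesis
  proof (rule Bochner_Integration.integrable_bound)
    show "integrable lborel (\<lambda>t. B * ?L * (f t / (1 + t\<^sup>2)\<^sup>2))" by (intro integrable_mult_right int)
    show "AE t in lborel. norm (f t * k ((x - t) / y)) \<le> norm (B * ?L * (f t / (1 + t\<^sup>2)\<^sup>2))"
    proof (rule AE_I2)
      fix t
      have "\<bar>k ((x - t) / y)\<bar> \<le> B * (1 / (1 + ((x - t) / y)\<^sup>2)\<^sup>2)" using kb[of "(x - t) / y"] by simp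
      also have "\<dots> \<le> B * (?L / (1 + t\<^sup>2)\<^sup>2)"
        by (intro mult_left_mono B shifted_weight_le y) auto
      finally have "\<bar>f t\<bar> * \<bar>k ((x - t) / y)\<bar> \<le> \<bar>f t\<bar> * (B * (?L / (1 + t\<^sup>2)\<^sup>2))" by (intro mult_left_mono) auto
      then show "norm (f t * k ((x - t) / y)) \<le> norm (B * ?L * (f t / (1 + t\<^sup>2)\<^sup>2))"
        using B by (simp add: abs_mult mult_ac)
    qed
  qed measurable
qed

text \<open>The dilatation requires the full real derivative in \<open>z\<close>, not just partial
  ones. The mean value theorem bounds the remainder of each integrand by a multiple of the
  displacement, and dominated convergence along sequences does the rest. Differentiation in the
  height brings a factor \<open>(Re z - t) / Im z\<close>, which accounts for the stronger decay
  asked of \<open>k'\<close>.\<close>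

lemma has_derivative_convolution:
  fixes f k k' :: "real \<Rightarrow> real"
  assumes f: "f \<in> borel_measurable borel" and int: "integrable lborel (\<lambda>t. f t / (1 + t\<^sup>2)\<^sup>2)"
    and k: "\<And>s. (k has_real_derivative k' s) (at s)" and k'm: "k' \<in> borel_measurable borel"
    and kb: "\<And>s. \<bar>k s\<bar> \<le> B / (1 + s\<^sup>2)\<^sup>2"
    and k'b: "\<And>s. \<bar>k' s\<bar> \<le> B / (1 + s\<^sup>2) ^ 3" and z: "Im z > 0"
  shows "((\<lambda>z. \<integral>t. f t * k ((Re z - t) / Im z) \<partial>lborel) has_derivative
     (\<lambda>\<zeta>. (\<integral>t. f t * k' ((Re z - t) / Im z) \<partial>lborel) * (Re \<zeta> / Im z)
        - (\<integral>t. f t * (((Re z - t) / Im z) * k' ((Re z - t) / Im z)) \<partial>lborel) * (Im \<zeta> / Im z))) (at z)"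
proof -
  have km: "k \<in> borel_measurable borel"
    using k by (intro borel_measurable_continuous_onI continuous_at_imp_continuous_on ballI DERIV_isCont) auto
  note [measurable] = f k'm km
  have B: "B \<ge> 0" using kb[of 0] by simp
  have pos: "1 + s\<^sup>2 > 0" for s :: real by (simp add: add_pos_nonneg)
  have dom: "\<bar>k' s\<bar> * (1 + \<bar>s\<bar>) \<le> 2 * B / (1 + s\<^sup>2)\<^sup>2" for s
  proof -
    have "\<bar>s\<bar> \<le> 1 + s\<^sup>2" using sum_squares_bound[of "\<bar>s\<bar>" 1] by simp
    then have "1 + \<bar>s\<bar> \<le> 2 * (1 + s\<^sup>2)" using zero_le_power2[of s] by (smt (verit))
    then have "\<bar>k' s\<bar> * (1 + \<bar>s\<bar>) \<le> (B / (1 + s\<^sup>2) ^ 3) * (2 * (1 + s\<^sup>2))"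
      using pos[of s] B by (intro mult_mono k'b) auto
    also have "(B / A ^ 3) * (2 * A) = 2 * B / A\<^sup>2" if "A > 0" for A
      using that by (simp add: power2_eq_square power3_eq_cube)
    note this[OF pos]
    finally show ?thesis .
  qed
  have k'b2: "\<bar>k' s\<bar> \<le> 2 * B / (1 + s\<^sup>2)\<^sup>2" "\<bar>s * k' s\<bar> \<le> 2 * B / (1 + s\<^sup>2)\<^sup>2" for s
  proof -
    have "\<bar>k' s\<bar> \<le> \<bar>k' s\<bar> * (1 + \<bar>s\<bar>)" "\<bar>s * k' s\<bar> \<le> \<bar>k' s\<bar> * (1 + \<bar>s\<bar>)"
      by (auto simp: distrib_left abs_mult mult.commute)
    with dom[of s] show "\<bar>k' s\<bar> \<le> 2 * B / (1 + s\<^sup>2)\<^sup>2" "\<bar>s * k' s\<bar> \<le> 2 * B / (1 + s\<^sup>2)\<^sup>2" by linarith+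
  qed
  define D where "D = (\<lambda>t z \<zeta>. k' ((Re z - t) / Im z) * (Re \<zeta> / Im z - ((Re z - t) / Im z) * Im \<zeta> / Im z))"
  define g where "g = (\<lambda>t z. k ((Re z - t) / Im z))"
  have gD: "(g t has_derivative D t z) (at z within S)" if "Im z > 0" for t z S
    unfolding g_def D_def by (rule has_derivative_ratio_kernel[OF k that])
  \<comment> \<open>Half the height keeps the ball at heights between \<open>Im z / 2\<close> and
    \<open>2 * Im z\<close>, where the majorant is uniform.\<close>
  define r where "r = Im z / 2"
  define X where "X = \<bar>Re z\<bar> + Im z"
  define L where "L = (1 + 2 * X\<^sup>2 + 2 * (2 * Im z)\<^sup>2)\<^sup>2"
  define M where "M = 4 * B * L / Im z"
  have L0: "L \<ge> 0" by (simp add: L_def)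
  have M0: "M \<ge> 0" using B L0 z by (simp add: M_def)
  have near: "Im z / 2 \<le> Im z'" "Im z' \<le> 2 * Im z" "\<bar>Re z'\<bar> \<le> X" if "z' \<in> ball z r" for z'
  proof -
    have "cmod (z - z') < Im z / 2" using that by (simp add: r_def dist_norm)
    then have "\<bar>Re z - Re z'\<bar> < Im z / 2" "\<bar>Im z - Im z'\<bar> < Im z / 2"
      using abs_Re_le_cmod[of "z - z'"] abs_Im_le_cmod[of "z - z'"] by auto
    then show "Im z / 2 \<le> Im z'" "Im z' \<le> 2 * Im z" "\<bar>Re z'\<bar> \<le> X" using z unfolding X_def by linarith+
  qed
  have Db: "\<bar>D t z' \<zeta>\<bar> \<le> M / (1 + t\<^sup>2)\<^sup>2 * norm \<zeta>" if "z' \<in> ball z r" for t z' \<zeta>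
  proof -
    let ?s = "(Re z' - t) / Im z'"
    note n = near[OF that]
    have y: "Im z' > 0" using n z by linarith
    have "\<bar>Re \<zeta> / Im z' - ?s * Im \<zeta> / Im z'\<bar> \<le> \<bar>Re \<zeta>\<bar> / Im z' + \<bar>?s\<bar> * \<bar>Im \<zeta>\<bar> / Im z'"
      using abs_triangle_ineq4[of "Re \<zeta> / Im z'" "?s * Im \<zeta> / Im z'"] y by (simp add: abs_mult)
    also have "\<dots> \<le> norm \<zeta> / Im z' + \<bar>?s\<bar> * norm \<zeta> / Im z'"
      using y by (intro add_mono divide_right_mono mult_left_mono abs_Re_le_cmod abs_Im_le_cmod) auto
    also have "\<dots> = (1 + \<bar>?s\<bar>) * (norm \<zeta> / Im z')" by (simp only: distrib_right mult_1 times_divide_eq_right add_divide_distrib)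
    finally have "\<bar>D t z' \<zeta>\<bar> \<le> \<bar>k' ?s\<bar> * ((1 + \<bar>?s\<bar>) * (norm \<zeta> / Im z'))"
      unfolding D_def abs_mult by (intro mult_left_mono) auto
    also have "\<dots> = (\<bar>k' ?s\<bar> * (1 + \<bar>?s\<bar>)) * (norm \<zeta> / Im z')" by simp
    also have "\<dots> \<le> (2 * B * (1 / (1 + ?s\<^sup>2)\<^sup>2)) * (norm \<zeta> / Im z')"
      using dom[of ?s] y by (intro mult_right_mono) auto
    also have "\<dots> \<le> (2 * B * (L / (1 + t\<^sup>2)\<^sup>2)) * (norm \<zeta> / (Im z / 2))"
      unfolding L_def using n y z B by (intro mult_mono mult_left_mono shifted_weight_le divide_left_mono mult_nonneg_nonneg) auto
    also have "\<dots> = M / (1 + t\<^sup>2)\<^sup>2 * norm \<zeta>" by (simp add: M_def mult_ac)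
    finally show ?thesis .
  qed
  have zr: "z \<in> ball z r" using z by (simp add: r_def)
  have rem: "\<bar>g t z' - g t z - D t z (z' - z)\<bar> \<le> 2 * M / (1 + t\<^sup>2)\<^sup>2 * norm (z' - z)" if z': "z' \<in> ball z r" for t z'
  proof -
    have "norm (g t z' - g t z) \<le> M / (1 + t\<^sup>2)\<^sup>2 * norm (z' - z)"
    proof (rule differentiable_bound[where S = "ball z r" and f' = "D t"])
      show "(g t has_derivative D t x) (at x within ball z r)" if "x \<in> ball z r" for x
        using near[OF that] z by (intro gD) linarith
      show "onorm (D t x) \<le> M / (1 + t\<^sup>2)\<^sup>2" if "x \<in> ball z r" for x
        using Db[OF that] M0 by (intro onorm_bound) (auto simp: mult.commute)
    qed (use z' zr in auto)
    moreover have "\<bar>D t z (z' - z)\<bar> \<le> M / (1 + t\<^sup>2)\<^sup>2 * norm (z' - z)" by (rule Db[OF zr])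
    ultimately show ?thesis by (simp add: add_divide_distrib[symmetric])
  qed
  let ?A = "\<integral>t. f t * k' ((Re z - t) / Im z) \<partial>lborel"
  let ?C = "\<integral>t. f t * (((Re z - t) / Im z) * k' ((Re z - t) / Im z)) \<partial>lborel"
  let ?F = "\<lambda>z. \<integral>t. f t * g t z \<partial>lborel"
  have iA: "integrable lborel (\<lambda>t. f t * k' ((Re z - t) / Im z))"
    by (rule convolution_integrable[OF f int _ k'b2(1) z]) measurable
  have iC: "integrable lborel (\<lambda>t. f t * (((Re z - t) / Im z) * k' ((Re z - t) / Im z)))"
    by (rule convolution_integrable[OF f int _ k'b2(2) z]) measurable
  have ig: "integrable lborel (\<lambda>t. f t * g t z')" if "Im z' > 0" for z'
    unfolding g_def by (rule convolution_integrable[OF f int km kb that])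
  have fD: "f t * D t z \<zeta> = (f t * k' ((Re z - t) / Im z)) * (Re \<zeta> / Im z) - (f t * (((Re z - t) / Im z) * k' ((Re z - t) / Im z))) * (Im \<zeta> / Im z)" for t \<zeta>
    by (simp add: D_def right_diff_distrib mult.assoc)
  have iD: "integrable lborel (\<lambda>t. f t * D t z \<zeta>)" for \<zeta>
    unfolding fD by (intro Bochner_Integration.integrable_diff integrable_mult_left iA iC)
  have vD: "(\<integral>t. f t * D t z \<zeta> \<partial>lborel) = ?A * (Re \<zeta> / Im z) - ?C * (Im \<zeta> / Im z)" for \<zeta>
    unfolding fD using iA iC by (subst Bochner_Integration.integral_diff) (auto simp del: times_divide_eq_right times_divide_eq_left)
  have "(?F has_derivative (\<lambda>\<zeta>. ?A * (Re \<zeta> / Im z) - ?C * (Im \<zeta> / Im z))) (at z)"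
    unfolding has_derivative_iff_norm tendsto_at_iff_sequentially
  proof (intro conjI allI impI)
    show "bounded_linear (\<lambda>\<zeta>. ?A * (Re \<zeta> / Im z) - ?C * (Im \<zeta> / Im z))"
      by (intro bounded_linear_sub bounded_linear_const_mult bounded_linear_divide bounded_linear_compose[OF bounded_linear_divide bounded_linear_Re] bounded_linear_compose[OF bounded_linear_divide bounded_linear_Im])
    fix S :: "nat \<Rightarrow> complex"
    assume S: "\<forall>i. S i \<in> UNIV - {z}" "S \<longlonglongrightarrow> z"
    have "\<forall>\<^sub>F n in sequentially. S n \<in> ball z r"
      using S(2) zr by (intro topological_tendstoD) auto
    then obtain N where N: "\<And>n. n \<ge> N \<Longrightarrow> S n \<in> ball z r" by (auto simp: eventually_sequentially)
    define Q where "Q = (\<lambda>n t. f t * ((g t (S (n + N)) - g t z - D t z (S (n + N) - z)) / norm (S (n + N) - z)))"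
    have SN: "S (n + N) \<in> ball z r" "Im (S (n + N)) > 0" "norm (S (n + N) - z) > 0" for n
      using N[of "n + N"] near(1)[of "S (n + N)"] z S(1) by auto
    have lim: "(\<lambda>n. \<integral>t. Q n t \<partial>lborel) \<longlonglongrightarrow> (\<integral>t. 0 \<partial>(lborel :: real measure))"
    proof (rule integral_dominated_convergence[where w = "\<lambda>t. 2 * M * \<bar>f t / (1 + t\<^sup>2)\<^sup>2\<bar>"])
      show "Q n \<in> borel_measurable lborel" for n
        unfolding Q_def g_def D_def by measurable
      show "integrable lborel (\<lambda>t. 2 * M * \<bar>f t / (1 + t\<^sup>2)\<^sup>2\<bar>)" by (intro integrable_mult_right integrable_abs int)
      show "AE t in lborel. norm (Q n t) \<le> 2 * M * \<bar>f t / (1 + t\<^sup>2)\<^sup>2\<bar>" for n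
      proof (rule AE_I2)
        fix t
        have "\<bar>(g t (S (n + N)) - g t z - D t z (S (n + N) - z)) / norm (S (n + N) - z)\<bar> \<le> 2 * M / (1 + t\<^sup>2)\<^sup>2"
          using rem[OF SN(1), of t] SN(3) by (simp add: pos_divide_le_eq)
        then have "\<bar>f t\<bar> * \<bar>(g t (S (n + N)) - g t z - D t z (S (n + N) - z)) / norm (S (n + N) - z)\<bar> \<le> \<bar>f t\<bar> * (2 * M / (1 + t\<^sup>2)\<^sup>2)"
          by (intro mult_left_mono) auto
        then show "norm (Q n t) \<le> 2 * M * \<bar>f t / (1 + t\<^sup>2)\<^sup>2\<bar>"
          by (simp add: Q_def abs_mult mult_ac)
      qed
      show "AE t in lborel. (\<lambda>n. Q n t) \<longlonglongrightarrow> 0"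
      proof (rule AE_I2)
        fix t
        have "((\<lambda>y. (g t y - g t z - D t z (y - z)) /\<^sub>R norm (y - z)) \<longlongrightarrow> 0) (at z)"
          using gD[OF z, of t UNIV] unfolding has_derivative_at_within by blast
        then have "(\<lambda>n. (g t (S n) - g t z - D t z (S n - z)) /\<^sub>R norm (S n - z)) \<longlonglongrightarrow> 0"
          using S unfolding tendsto_at_iff_sequentially o_def by blast
        from LIMSEQ_ignore_initial_segment[OF this, of N]
        have "(\<lambda>n. f t * ((g t (S (n + N)) - g t z - D t z (S (n + N) - z)) /\<^sub>R norm (S (n + N) - z))) \<longlonglongrightarrow> f t * 0"
          by (intro tendsto_mult tendsto_const)
        then show "(\<lambda>n. Q n t) \<longlonglongrightarrow> 0" by (simp add: Q_def divide_inverse mult.commute)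
      qed
    qed simp
    have eq: "norm (?F (S (n + N)) - ?F z - (?A * (Re (S (n + N) - z) / Im z) - ?C * (Im (S (n + N) - z) / Im z))) / norm (S (n + N) - z) = norm (\<integral>t. Q n t \<partial>lborel)" for n
    proof -
      have "(\<integral>t. Q n t \<partial>lborel) = (\<integral>t. (f t * g t (S (n + N)) - f t * g t z - f t * D t z (S (n + N) - z)) / norm (S (n + N) - z) \<partial>lborel)"
        by (intro Bochner_Integration.integral_cong) (auto simp: Q_def right_diff_distrib)
      also have "\<dots> = (\<integral>t. f t * g t (S (n + N)) - f t * g t z - f t * D t z (S (n + N) - z) \<partial>lborel) / norm (S (n + N) - z)"
        by (rule integral_divide_zero)
      also have "(\<integral>t. f t * g t (S (n + N)) - f t * g t z - f t * D t z (S (n + N) - z) \<partial>lborel) = ?F (S (n + N)) - ?F z - (\<integral>t. f t * D t z (S (n + N) - z) \<partial>lborel)"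
        using ig[OF SN(2)] ig[OF z] iD by simp
      finally show ?thesis unfolding vD by simp
    qed
    have "(\<lambda>n. norm (\<integral>t. Q n t \<partial>lborel)) \<longlonglongrightarrow> 0" using tendsto_norm[OF lim] by simp
    then have "(\<lambda>n. norm (?F (S (n + N)) - ?F z - (?A * (Re (S (n + N) - z) / Im z) - ?C * (Im (S (n + N) - z) / Im z))) / norm (S (n + N) - z)) \<longlonglongrightarrow> 0"
      unfolding eq .
    then show "((\<lambda>y. norm (?F y - ?F z - (?A * (Re (y - z) / Im z) - ?C * (Im (y - z) / Im z))) / norm (y - z)) \<circ> S) \<longlonglongrightarrow> 0"
      unfolding o_def by (rule LIMSEQ_offset)
  qed
  then show ?thesis by (simp add: g_def)
qed

section \<open>The extension to the half plane\<close>

lemma abs_continuous_on_subset: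
  assumes "abs_continuous_on a b f" "a \<le> c" "d \<le> b"
  shows "abs_continuous_on c d f"
  unfolding abs_continuous_on_def
proof (intro allI impI)
  fix e :: real assume "e > 0"
  then obtain \<delta> where \<delta>: "\<delta> > 0" "\<forall>(n::nat) (s::nat \<Rightarrow> real) t.
        (\<forall>i<n. a \<le> s i \<and> s i \<le> t i \<and> t i \<le> b) \<and>
        (\<forall>i<n. \<forall>j<n. i \<noteq> j \<longrightarrow> t i \<le> s j \<or> t j \<le> s i) \<and>
        (\<Sum>i<n. t i - s i) < \<delta> \<longrightarrow> (\<Sum>i<n. \<bar>f (t i) - f (s i)\<bar>) < e"
    using assms(1)[unfolded abs_continuous_on_def, THEN spec, of e] by (elim impE exE conjE)
  show "\<exists>\<delta>>0. \<forall>(n::nat) (s::nat \<Rightarrow> real) t.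
        (\<forall>i<n. c \<le> s i \<and> s i \<le> t i \<and> t i \<le> d) \<and>
        (\<forall>i<n. \<forall>j<n. i \<noteq> j \<longrightarrow> t i \<le> s j \<or> t j \<le> s i) \<and>
        (\<Sum>i<n. t i - s i) < \<delta> \<longrightarrow> (\<Sum>i<n. \<bar>f (t i) - f (s i)\<bar>) < e"
  proof (intro exI[of _ \<delta>] conjI \<delta>(1) allI impI)
    fix n :: nat and s t :: "nat \<Rightarrow> real"
    assume A: "(\<forall>i<n. c \<le> s i \<and> s i \<le> t i \<and> t i \<le> d) \<and> (\<forall>i<n. \<forall>j<n. i \<noteq> j \<longrightarrow> t i \<le> s j \<or> t j \<le> s i) \<and>
        (\<Sum>i<n. t i - s i) < \<delta>"
    moreover from A have "\<forall>i<n. a \<le> s i \<and> s i \<le> t i \<and> t i \<le> b" using assms(2,3) by (meson order.trans)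
    ultimately show "(\<Sum>i<n. \<bar>f (t i) - f (s i)\<bar>) < e" using \<delta>(2) by blast
  qed
qed

locale bext = besov +
  fixes f :: "real \<Rightarrow> real"
  assumes f_cont: "continuous_on UNIV f" and f_mono: "strict_mono f" and f_per: "\<And>x. f (x + 1) = f x + 1"
    and f_ac: "abs_continuous_on 0 1 f"
    and f_deriv: "AE x in lborel. x \<in> {0..1} \<longrightarrow> (f has_real_derivative exp (u x)) (at x)"
begin

lemma f_measurable [measurable]: "f \<in> borel_measurable borel"
  using f_cont by (rule borel_measurable_continuous_onI)

lemma f_le: "x \<le> y \<Longrightarrow> f x \<le> f y"
  using f_mono by (simp add: strict_mono_less_eq)

lemma nn_integral_exp_u_unit:
  assumes x: "0 \<le> x" "x \<le> 1"
  shows "(\<integral>\<^sup>+t. ennreal (exp (u t)) * indicator {0..x} t \<partial>lborel) = ennreal (f x - f 0)"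
proof -
  have "((\<lambda>t. exp (u t)) has_integral (f x - f 0)) {0..x}"
  proof (rule abs_continuous_FTC[OF abs_continuous_on_subset[OF f_ac]])
    show "AE t in lborel. t \<in> {0..x} \<longrightarrow> (f has_real_derivative exp (u t)) (at t)"
      using f_deriv by eventually_elim (use x in auto)
  qed (use x in auto)
  then show ?thesis by (intro nn_integral_has_integral_lebesgue') auto
qed

lemma nn_integral_exp_u_0:
  assumes "0 \<le> x" "x \<le> real n"
  shows "(\<integral>\<^sup>+t. ennreal (exp (u t)) * indicator {0..x} t \<partial>lborel) = ennreal (f x - f 0)"
  using assms
proof (induction n arbitrary: x)
  case 0
  then show ?case using nn_integral_exp_u_unit[of x] by simp
next
  case (Suc n)
  show ?case
  proof (cases "x \<le> 1")
    case True
    then show ?thesis using nn_integral_exp_u_unit[of x] Suc.prems by simp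
  next
    case False
    have "(\<integral>\<^sup>+t. ennreal (exp (u t)) * indicator {0..x} t \<partial>lborel) =
      (\<integral>\<^sup>+t. ennreal (exp (u t)) * indicator {0..1} t + ennreal (exp (u t)) * indicator {1<..x} t \<partial>lborel)"
      using False by (intro nn_integral_cong) (auto simp: indicator_def)
    also have "\<dots> = (\<integral>\<^sup>+t. ennreal (exp (u t)) * indicator {0..1} t \<partial>lborel) + (\<integral>\<^sup>+t. ennreal (exp (u t)) * indicator {1<..x} t \<partial>lborel)"
      by (intro nn_integral_add) auto
    also have "(\<integral>\<^sup>+t. ennreal (exp (u t)) * indicator {1<..x} t \<partial>lborel) = (\<integral>\<^sup>+t. ennreal (exp (u (1 + t))) * indicator {1<..x} (1 + t) \<partial>lborel)"
      by (subst nn_integral_real_affine[of _ 1 1]) auto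
    also have "\<dots> = (\<integral>\<^sup>+t. ennreal (exp (u t)) * indicator {0..x-1} t \<partial>lborel)"
    proof (intro nn_integral_cong_AE)
      have "AE t in lborel. t \<noteq> (0::real)" by (rule AE_lborel_singleton)
      then show "AE t in lborel. ennreal (exp (u (1 + t))) * indicator {1<..x} (1 + t) = ennreal (exp (u t)) * indicator {0..x-1} t"
        by eventually_elim (auto simp: indicator_def add.commute[of 1])
    qed
    also have "\<dots> = ennreal (f (x - 1) - f 0)" using Suc.IH[of "x - 1"] Suc.prems False by simp
    also have "(\<integral>\<^sup>+t. ennreal (exp (u t)) * indicator {0..1} t \<partial>lborel) = ennreal (f 1 - f 0)"
      by (rule nn_integral_exp_u_unit) auto
    also have "ennreal (f 1 - f 0) + ennreal (f (x - 1) - f 0) = ennreal (f x - f 0)"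
    proof -
      have "f x - f 0 = (f 1 - f 0) + (f (x - 1) - f 0)" using f_per[of 0] f_per[of "x - 1"] by simp
      moreover have "f 0 \<le> f (x - 1)" "f 0 \<le> f 1" using False by (auto intro: f_le)
      ultimately show ?thesis by (simp only: ennreal_plus diff_ge_0_iff_ge)
    qed
    finally show ?thesis .
  qed
qed

lemma f_add_nat: "f (x + real n) = f x + real n"
proof (induction n)
  case (Suc n)
  then show ?case using f_per[of "x + real n"] by (simp add: add_ac)
qed simp

text \<open>Absolute continuity is given on one period; periodicity of \<open>u\<close> and integer
  translations of \<open>f\<close> carry the fundamental theorem to arbitrary intervals.\<close>

lemma nn_integral_exp_u:
  assumes ab: "a \<le> b"
  shows "(\<integral>\<^sup>+t. ennreal (exp (u t)) * indicator {a..b} t \<partial>lborel) = ennreal (f b - f a)"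
proof -
  obtain n :: nat where n: "- a \<le> real n" using real_arch_simple by blast
  define c d where "c = a + real n" and "d = b + real n"
  have cd: "0 \<le> c" "c \<le> d" using n ab by (auto simp: c_def d_def)
  obtain m :: nat where m: "d \<le> real m" using real_arch_simple by blast
  have "(\<integral>\<^sup>+t. ennreal (exp (u t)) * indicator {c..d} t \<partial>lborel) = (\<integral>\<^sup>+t. ennreal (exp (u (real n + t))) * indicator {c..d} (real n + t) \<partial>lborel)"
    by (subst nn_integral_real_affine[of _ 1 "real n"]) auto
  also have "\<dots> = (\<integral>\<^sup>+t. ennreal (exp (u t)) * indicator {a..b} t \<partial>lborel)"
    by (intro nn_integral_cong) (auto simp: indicator_def add.commute[of "real n"] u_add_nat c_def d_def)
  finally have 1: "(\<integral>\<^sup>+t. ennreal (exp (u t)) * indicator {a..b} t \<partial>lborel) = (\<integral>\<^sup>+t. ennreal (exp (u t)) * indicator {c..d} t \<partial>lborel)" ..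
  have "ennreal (f d - f 0) = (\<integral>\<^sup>+t. ennreal (exp (u t)) * indicator {0..d} t \<partial>lborel)"
    using nn_integral_exp_u_0[of d m] cd m by simp
  also have "\<dots> = (\<integral>\<^sup>+t. ennreal (exp (u t)) * indicator {0..c} t + ennreal (exp (u t)) * indicator {c..d} t \<partial>lborel)"
  proof (intro nn_integral_cong_AE)
    have "AE t in lborel. t \<noteq> c" by (rule AE_lborel_singleton)
    then show "AE t in lborel. ennreal (exp (u t)) * indicator {0..d} t = ennreal (exp (u t)) * indicator {0..c} t + ennreal (exp (u t)) * indicator {c..d} t"
      by eventually_elim (use cd in \<open>auto simp: indicator_def\<close>)
  qed
  also have "\<dots> = (\<integral>\<^sup>+t. ennreal (exp (u t)) * indicator {0..c} t \<partial>lborel) + (\<integral>\<^sup>+t. ennreal (exp (u t)) * indicator {c..d} t \<partial>lborel)"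
    by (intro nn_integral_add) auto
  also have "(\<integral>\<^sup>+t. ennreal (exp (u t)) * indicator {0..c} t \<partial>lborel) = ennreal (f c - f 0)"
    using nn_integral_exp_u_0[of c m] cd m by simp
  finally have 2: "ennreal (f c - f 0) + (\<integral>\<^sup>+t. ennreal (exp (u t)) * indicator {c..d} t \<partial>lborel) = ennreal (f c - f 0) + ennreal (f d - f c)"
    using f_le[of 0 c] f_le[of c d] cd by (subst ennreal_plus[symmetric]) auto
  then have "(\<integral>\<^sup>+t. ennreal (exp (u t)) * indicator {c..d} t \<partial>lborel) = ennreal (f d - f c)"
    by (simp add: ennreal_add_left_cancel)
  also have "f d - f c = f b - f a" by (simp add: c_def d_def f_add_nat)
  finally show ?thesis using 1 by simp
qed

lemma exp_u_weight_integrable: "integrable lborel (\<lambda>t. exp (u t) / (1 + t\<^sup>2)\<^sup>2)"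
proof (rule integrableI_bounded)
  have "(\<integral>\<^sup>+t. ennreal (norm (exp (u t) / (1 + t\<^sup>2)\<^sup>2)) \<partial>lborel) = (\<integral>\<^sup>+t. ennreal (exp (u t)) * ennreal (qker 1 (0 - t)) \<partial>lborel)"
    by (intro nn_integral_cong) (simp add: qker_def ennreal_mult[symmetric])
  also have "\<dots> \<le> ennreal (16 * pi) * (\<integral>\<^sup>+t. ennreal (exp (u t)) * indicator {0..1} t \<partial>lborel)"
    by (rule nn_integral_qker_large) auto
  also have "\<dots> < \<infinity>" using nn_integral_exp_u[of 0 1] by (simp add: ennreal_mult_less_top)
  finally show "(\<integral>\<^sup>+t. ennreal (norm (exp (u t) / (1 + t\<^sup>2)\<^sup>2)) \<partial>lborel) < \<infinity>" .
qed measurable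

lemma abs_f_diff_le: "\<bar>f x - f y\<bar> \<le> \<bar>x - y\<bar> + 1"
proof -
  have *: "f a - f b \<le> a - b + 1 \<and> f b \<le> f a" if "b \<le> a" for a b
  proof -
    define n where "n = nat \<lceil>a - b\<rceil>"
    have n: "a \<le> b + real n" "real n \<le> a - b + 1" using that unfolding n_def by linarith+
    have "f a \<le> f (b + real n)" by (rule f_le[OF n(1)])
    then show ?thesis using n f_le[OF that] by (simp add: f_add_nat)
  qed
  show ?thesis using *[of x y] *[of y x] by (cases "x \<le> y") auto
qed

lemma f_weight_integrable: "integrable lborel (\<lambda>t. f t / (1 + t\<^sup>2)\<^sup>2)"
proof (rule Bochner_Integration.integrable_bound)
  show "integrable lborel (\<lambda>t. (\<bar>f 0\<bar> + 2) * (1 / (1 + t\<^sup>2)))"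
  proof (intro integrable_mult_right integrableI_nonneg)
    show "(\<integral>\<^sup>+t. ennreal (1 / (1 + t\<^sup>2)) \<partial>lborel) < \<infinity>" by (simp add: nn_integral_inverse_1_plus_square)
  qed auto
  show "AE t in lborel. norm (f t / (1 + t\<^sup>2)\<^sup>2) \<le> norm ((\<bar>f 0\<bar> + 2) * (1 / (1 + t\<^sup>2)))"
  proof (rule AE_I2)
    fix t :: real
    have p: "1 + t\<^sup>2 > 0" by (simp add: add_pos_nonneg)
    have "\<bar>t\<bar> \<le> 1 + t\<^sup>2" using sum_squares_bound[of "\<bar>t\<bar>" 1] by simp
    then have "\<bar>f t\<bar> \<le> \<bar>f 0\<bar> + (1 + t\<^sup>2) + 1" using abs_f_diff_le[of t 0] by simp
    also have "\<dots> \<le> (\<bar>f 0\<bar> + 2) * (1 + t\<^sup>2)"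
    proof -
      have "A + (1 + S) + 1 \<le> (A + 2) * (1 + S)" if "A \<ge> 0" "S \<ge> 0" for A S :: real
        using that by (simp add: algebra_simps)
      then show ?thesis by simp
    qed
    finally have "\<bar>f t\<bar> / (1 + t\<^sup>2)\<^sup>2 \<le> (\<bar>f 0\<bar> + 2) * (1 + t\<^sup>2) / (1 + t\<^sup>2)\<^sup>2" by (intro divide_right_mono) auto
    also have "\<dots> = (\<bar>f 0\<bar> + 2) * (1 / (1 + t\<^sup>2))" using p by (simp add: power2_eq_square)
    finally show "norm (f t / (1 + t\<^sup>2)\<^sup>2) \<le> norm ((\<bar>f 0\<bar> + 2) * (1 / (1 + t\<^sup>2)))" using p by simp
  qed
qed measurable

end

section \<open>Gaussian convolutions and the derivative of the extension\<close>

lemma gphi_bound3: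
  assumes "j \<le> 2" shows "\<bar>s\<bar> ^ j * gphi s \<le> 256 / (1 + s\<^sup>2) ^ 3"
proof -
  have pos: "1 + s\<^sup>2 > 0" by (simp add: add_pos_nonneg)
  have j: "\<bar>s\<bar> ^ j \<le> 1 + s\<^sup>2"
  proof (cases "\<bar>s\<bar> \<le> 1")
    case True
    then have "\<bar>s\<bar> ^ j \<le> 1" by (simp add: power_le_one)
    also have "1 \<le> 1 + s\<^sup>2" by simp
    finally show ?thesis .
  next
    case False
    then have "\<bar>s\<bar> ^ j \<le> \<bar>s\<bar> ^ 2" using assms by (intro power_increasing) auto
    then show ?thesis by simp
  qed
  have "1 \<le> sqrt pi" using pi_ge_two by (intro real_le_rsqrt) simp
  then have "gphi s \<le> exp (- s\<^sup>2) / 1" unfolding gphi_def by (intro divide_left_mono) auto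
  then have g: "gphi s \<le> 256 / (1 + s\<^sup>2) ^ 4" using exp_neg_square_le[of s] by simp
  have "\<bar>s\<bar> ^ j * gphi s \<le> (1 + s\<^sup>2) * (256 / (1 + s\<^sup>2) ^ 4)"
    using pos by (intro mult_mono j g) (auto simp: gphi_nonneg)
  also have "A * (256 / A ^ 4) = 256 / A ^ 3" if "A > 0" for A :: real
    using that by (simp add: power3_eq_cube power4_eq_xxxx)
  note this[OF pos]
  finally show ?thesis .
qed

lemma gphi_deriv: "(gphi has_real_derivative (- 2 * (s * gphi s))) (at s)"
proof -
  have "((\<lambda>x. exp (- x\<^sup>2)) has_real_derivative exp (- s\<^sup>2) * (- (2 * s))) (at s)"
    by (auto intro!: derivative_eq_intros)
  from DERIV_cdivide[OF this, of "sqrt pi"] show ?thesis by (simp add: gphi_def[abs_def] mult_ac)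
qed

lemma s_gphi_deriv: "((\<lambda>s. s * gphi s) has_real_derivative (gphi s - 2 * (s\<^sup>2 * gphi s))) (at s)"
proof -
  have "((\<lambda>s. s * gphi s) has_real_derivative (1 * gphi s + (- 2 * (s * gphi s)) * s)) (at s)"
    by (rule DERIV_mult[OF DERIV_ident gphi_deriv])
  then show ?thesis by (simp add: power2_eq_square mult_ac)
qed

lemma gpsi_eq: "gpsi s = - 2 * (s ^ 1 * gphi s)"
  by (simp add: gpsi_def gphi_def)

text \<open>Moments without the factor \<open>1 / Im z\<close> of \<open>gk\<close>: in this form
  \<open>has_derivative_convolution\<close> applies directly, and derivatives of moments are again
  combinations of moments.\<close>

definition cpow :: "(real \<Rightarrow> real) \<Rightarrow> nat \<Rightarrow> complex \<Rightarrow> real" where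
  "cpow h j z = (\<integral>t. h t * (((Re z - t) / Im z) ^ j * gphi ((Re z - t) / Im z)) \<partial>lborel)"

lemma cpow_integrable:
  assumes "h \<in> borel_measurable borel" "integrable lborel (\<lambda>t. h t / (1 + t\<^sup>2)\<^sup>2)" "y > 0" "j \<le> 4"
  shows "integrable lborel (\<lambda>t. h t * (((x - t) / y) ^ j * gphi ((x - t) / y)))"
proof (rule convolution_integrable[OF assms(1,2) _ _ assms(3), of "\<lambda>s. s ^ j * gphi s" 256])
  show "\<bar>s ^ j * gphi s\<bar> \<le> 256 / (1 + s\<^sup>2)\<^sup>2" for s
    using gphi_bound[OF assms(4), of s] by (simp add: abs_mult power_abs gphi_nonneg)
qed measurable

lemma cpow_0_has_derivative:
  assumes h: "h \<in> borel_measurable borel" "integrable lborel (\<lambda>t. h t / (1 + t\<^sup>2)\<^sup>2)" and z: "Im z > 0"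
  shows "(cpow h 0 has_derivative (\<lambda>\<zeta>. - 2 * cpow h 1 z * (Re \<zeta> / Im z) + 2 * cpow h 2 z * (Im \<zeta> / Im z))) (at z)"
proof -
  have D: "((\<lambda>z. \<integral>t. h t * gphi ((Re z - t) / Im z) \<partial>lborel) has_derivative
     (\<lambda>\<zeta>. (\<integral>t. h t * (- 2 * (((Re z - t) / Im z) * gphi ((Re z - t) / Im z))) \<partial>lborel) * (Re \<zeta> / Im z)
        - (\<integral>t. h t * (((Re z - t) / Im z) * (- 2 * (((Re z - t) / Im z) * gphi ((Re z - t) / Im z)))) \<partial>lborel) * (Im \<zeta> / Im z))) (at z)"
  proof (rule has_derivative_convolution[OF h gphi_deriv _ _ _ z, where B = 512])
    show "\<bar>gphi s\<bar> \<le> 512 / (1 + s\<^sup>2)\<^sup>2" for s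
      using gphi_bound[of 0 s] gphi_nonneg[of s] divide_right_mono[of 256 512 "(1 + s\<^sup>2)\<^sup>2"] by simp
    show "\<bar>- 2 * (s * gphi s)\<bar> \<le> 512 / (1 + s\<^sup>2) ^ 3" for s
      using gphi_bound3[of 1 s] by (simp add: abs_mult gphi_nonneg)
  qed measurable
  have 1: "(\<integral>t. h t * (- 2 * (((Re z - t) / Im z) * gphi ((Re z - t) / Im z))) \<partial>lborel) = - 2 * cpow h 1 z"
    unfolding cpow_def integral_mult_right_zero[symmetric] by (intro Bochner_Integration.integral_cong) auto
  have 2: "(\<integral>t. h t * (((Re z - t) / Im z) * (- 2 * (((Re z - t) / Im z) * gphi ((Re z - t) / Im z)))) \<partial>lborel) = - 2 * cpow h 2 z"
    unfolding cpow_def integral_mult_right_zero[symmetric] by (intro Bochner_Integration.integral_cong) (auto simp: power2_eq_square)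
  have 3: "(\<lambda>z. \<integral>t. h t * gphi ((Re z - t) / Im z) \<partial>lborel) = cpow h 0"
    by (simp add: cpow_def fun_eq_iff)
  show ?thesis using D unfolding 1 2 3 by simp
qed

text \<open>The vertical coefficient involves a third moment. It is left anonymous because the
  formula serves for the derivative along horizontal lines.\<close>

lemma cpow_1_has_derivative:
  assumes h: "h \<in> borel_measurable borel" "integrable lborel (\<lambda>t. h t / (1 + t\<^sup>2)\<^sup>2)" and z: "Im z > 0"
  shows "\<exists>c. (cpow h 1 has_derivative (\<lambda>\<zeta>. (cpow h 0 z - 2 * cpow h 2 z) * (Re \<zeta> / Im z) - c * (Im \<zeta> / Im z))) (at z)"
proof -
  have D: "((\<lambda>z. \<integral>t. h t * (((Re z - t) / Im z) * gphi ((Re z - t) / Im z)) \<partial>lborel) has_derivative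
     (\<lambda>\<zeta>. (\<integral>t. h t * (gphi ((Re z - t) / Im z) - 2 * (((Re z - t) / Im z)\<^sup>2 * gphi ((Re z - t) / Im z))) \<partial>lborel) * (Re \<zeta> / Im z)
        - (\<integral>t. h t * (((Re z - t) / Im z) * (gphi ((Re z - t) / Im z) - 2 * (((Re z - t) / Im z)\<^sup>2 * gphi ((Re z - t) / Im z)))) \<partial>lborel) * (Im \<zeta> / Im z))) (at z)"
  proof (rule has_derivative_convolution[OF h s_gphi_deriv _ _ _ z, where B = 768])
    show "\<bar>s * gphi s\<bar> \<le> 768 / (1 + s\<^sup>2)\<^sup>2" for s
      using gphi_bound[of 1 s] divide_right_mono[of 256 768 "(1 + s\<^sup>2)\<^sup>2"] by (simp add: abs_mult gphi_nonneg)
    show "\<bar>gphi s - 2 * (s\<^sup>2 * gphi s)\<bar> \<le> 768 / (1 + s\<^sup>2) ^ 3" for s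
      using gphi_bound3[of 0 s] gphi_bound3[of 2 s] gphi_nonneg[of s] abs_triangle_ineq4[of "gphi s" "2 * (s\<^sup>2 * gphi s)"]
      by (simp add: abs_mult)
  qed measurable
  have 1: "(\<integral>t. h t * (gphi ((Re z - t) / Im z) - 2 * (((Re z - t) / Im z)\<^sup>2 * gphi ((Re z - t) / Im z))) \<partial>lborel) = cpow h 0 z - 2 * cpow h 2 z"
  proof -
    have "(\<integral>t. h t * (gphi ((Re z - t) / Im z) - 2 * (((Re z - t) / Im z)\<^sup>2 * gphi ((Re z - t) / Im z))) \<partial>lborel) =
      (\<integral>t. h t * (((Re z - t) / Im z) ^ 0 * gphi ((Re z - t) / Im z)) - 2 * (h t * (((Re z - t) / Im z) ^ 2 * gphi ((Re z - t) / Im z))) \<partial>lborel)"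
      by (intro Bochner_Integration.integral_cong refl) (simp only: right_diff_distrib power_0 mult_1 mult.left_commute[of 2])
    also have "\<dots> = cpow h 0 z - 2 * cpow h 2 z"
      unfolding cpow_def using cpow_integrable[OF h z, of 0 "Re z"] cpow_integrable[OF h z, of 2 "Re z"] by simp
    finally show ?thesis .
  qed
  have 3: "(\<lambda>z. \<integral>t. h t * (((Re z - t) / Im z) * gphi ((Re z - t) / Im z)) \<partial>lborel) = cpow h 1"
    by (simp add: cpow_def fun_eq_iff)
  show ?thesis
    by (rule exI[where x = "\<integral>t. h t * (((Re z - t) / Im z) * (gphi ((Re z - t) / Im z) - 2 * (((Re z - t) / Im z)\<^sup>2 * gphi ((Re z - t) / Im z)))) \<partial>lborel"])
       (rule D[unfolded 1 3])
qed

lemma conv_scaled_eq: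
  assumes "y > 0"
  shows "conv h (scaled k y) x = (\<integral>t. h t * k ((x - t) / y) \<partial>lborel) / y"
proof -
  have "conv h (scaled k y) x = (\<integral>t. h (x - (x + (-1) * t)) * (k ((x + (-1) * t) / y) / y) \<partial>lborel)"
    unfolding conv_def scaled_def using lborel_integral_real_affine[of "-1" "\<lambda>t. h (x - t) * (k (t / y) / y)" x] by simp
  also have "\<dots> = (\<integral>t. h t * k ((x - t) / y) / y \<partial>lborel)"
    by (intro Bochner_Integration.integral_cong) auto
  finally show ?thesis by (simp only: integral_divide_zero)
qed

lemma has_real_derivative_slice:
  assumes "(F has_derivative F') (at (Complex x y))"
  shows "((\<lambda>x. F (Complex x y)) has_real_derivative F' 1) (at x)"
proof -
  have d: "((\<lambda>x. Complex x y) has_derivative (\<lambda>h. of_real h)) (at x)"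
    by (auto simp: complex_eq_iff Complex_eq intro!: derivative_eq_intros has_derivative_of_real)
  from has_derivative_compose[OF d assms]
  have "((\<lambda>x. F (Complex x y)) has_derivative (\<lambda>h. F' (of_real h))) (at x)" .
  moreover have "(\<lambda>h. F' (of_real h)) = (*) (F' 1)"
  proof
    fix h :: real
    have "F' (of_real h) = F' (h *\<^sub>R 1)" by (simp add: scaleR_conv_of_real)
    also have "\<dots> = h *\<^sub>R F' 1"
      by (rule linear_cmul[OF bounded_linear.linear[OF has_derivative_bounded_linear[OF assms]]])
    finally show "F' (of_real h) = F' 1 * h" by simp
  qed
  ultimately show ?thesis by (simp add: has_field_derivative_def)
qed

context bext
begin

lemma mom_cpow: "y > 0 \<Longrightarrow> mom u j x y = cpow (\<lambda>t. exp (u t)) j (Complex x y) / y"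
  unfolding mom_def cpow_def gk_def integral_divide_zero[symmetric] by (intro Bochner_Integration.integral_cong) auto

lemma exp_u_measurable: "(\<lambda>t. exp (u t)) \<in> borel_measurable borel" by measurable

lemma mom_0_deriv_x:
  assumes y: "y > 0"
  shows "((\<lambda>x. mom u 0 x y) has_real_derivative (- 2 * mom u 1 x y / y)) (at x)"
proof -
  have "((\<lambda>x. cpow (\<lambda>t. exp (u t)) 0 (Complex x y)) has_real_derivative (- 2 * cpow (\<lambda>t. exp (u t)) 1 (Complex x y) * (1 / y))) (at x)"
    using has_real_derivative_slice[OF cpow_0_has_derivative[OF exp_u_measurable exp_u_weight_integrable, of "Complex x y"]] y by simp
  from DERIV_cdivide[OF this, of y] show ?thesis using y by (simp add: mom_cpow)
qed

text \<open>Tonelli's theorem: integrating the translates of \<open>exp u\<close> over an interval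
  gives increments of \<open>f\<close>, which the Gaussian then averages.\<close>

lemma nn_integral_mom_0:
  assumes y: "y > 0" and le: "x1 \<le> x2"
  shows "(\<integral>\<^sup>+x. ennreal (mom u 0 x y) * indicator {x1..x2} x \<partial>lborel) = ennreal (conv f (scaled gphi y) x2 - conv f (scaled gphi y) x1)"
proof -
  define \<kappa> where "\<kappa> = scaled gphi y"
  have \<kappa>: "\<kappa> t = gphi (t / y) / y" for t by (simp add: \<kappa>_def scaled_def)
  have \<kappa>0: "\<kappa> t \<ge> 0" for t using y by (simp add: \<kappa> gphi_nonneg)
  have [measurable]: "\<kappa> \<in> borel_measurable borel" unfolding \<kappa>_def scaled_def by measurable
  have int: "integrable lborel (\<lambda>t. f (x - t) * \<kappa> t)" for x
  proof -
    have "integrable lborel (\<lambda>t. f t * (((x - t) / y) ^ 0 * gphi ((x - t) / y)) / y)"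
      by (intro integrable_divide_zero cpow_integrable f_weight_integrable y) auto
    from lborel_integrable_real_affine[OF this, of "-1" x] show ?thesis by (simp add: \<kappa>)
  qed
  have intd: "integrable lborel (\<lambda>t. (f (x2 - t) - f (x1 - t)) * \<kappa> t)"
    using int[of x1] int[of x2] by (simp add: left_diff_distrib)
  have "ennreal (conv f \<kappa> x2 - conv f \<kappa> x1) = ennreal (\<integral>t. (f (x2 - t) - f (x1 - t)) * \<kappa> t \<partial>lborel)"
    unfolding conv_def using int[of x1] int[of x2] by (simp add: left_diff_distrib)
  also have "\<dots> = (\<integral>\<^sup>+t. ennreal ((f (x2 - t) - f (x1 - t)) * \<kappa> t) \<partial>lborel)"
    using \<kappa>0 f_le le by (intro nn_integral_eq_integral[symmetric, OF intd] AE_I2 mult_nonneg_nonneg) auto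
  also have "\<dots> = (\<integral>\<^sup>+t. (\<integral>\<^sup>+x. ennreal (exp (u (x - t)) * \<kappa> t) * indicator {x1..x2} x \<partial>lborel) \<partial>lborel)"
  proof (intro nn_integral_cong)
    fix t
    have "ennreal ((f (x2 - t) - f (x1 - t)) * \<kappa> t) = ennreal (f (x2 - t) - f (x1 - t)) * ennreal (\<kappa> t)"
      using f_le[of "x1 - t" "x2 - t"] le \<kappa>0 by (simp add: ennreal_mult)
    also have "ennreal (f (x2 - t) - f (x1 - t)) = (\<integral>\<^sup>+x. ennreal (exp (u x)) * indicator {x1 - t..x2 - t} x \<partial>lborel)"
      using le by (intro nn_integral_exp_u[symmetric]) simp
    also have "\<dots> = (\<integral>\<^sup>+x. ennreal (exp (u (- t + x))) * indicator {x1 - t..x2 - t} (- t + x) \<partial>lborel)"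
      by (subst nn_integral_real_affine[of _ 1 "-t"]) auto
    also have "\<dots> * ennreal (\<kappa> t) = (\<integral>\<^sup>+x. ennreal (exp (u (- t + x))) * indicator {x1 - t..x2 - t} (- t + x) * ennreal (\<kappa> t) \<partial>lborel)"
      by (intro nn_integral_multc[symmetric]) measurable
    also have "\<dots> = (\<integral>\<^sup>+x. ennreal (exp (u (x - t)) * \<kappa> t) * indicator {x1..x2} x \<partial>lborel)"
      using \<kappa>0 by (intro nn_integral_cong) (auto simp: indicator_def ennreal_mult)
    finally show "ennreal ((f (x2 - t) - f (x1 - t)) * \<kappa> t) = (\<integral>\<^sup>+x. ennreal (exp (u (x - t)) * \<kappa> t) * indicator {x1..x2} x \<partial>lborel)" .
  qed
  also have "\<dots> = (\<integral>\<^sup>+x. (\<integral>\<^sup>+t. ennreal (exp (u (x - t)) * \<kappa> t) * indicator {x1..x2} x \<partial>lborel) \<partial>lborel)"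
    by (rule lborel_pair.Fubini') measurable
  also have "\<dots> = (\<integral>\<^sup>+x. ennreal (mom u 0 x y) * indicator {x1..x2} x \<partial>lborel)"
  proof (intro nn_integral_cong)
    fix x
    have "(\<integral>\<^sup>+t. ennreal (exp (u (x - t)) * \<kappa> t) * indicator {x1..x2} x \<partial>lborel) = (\<integral>\<^sup>+t. ennreal (exp (u (x - t)) * \<kappa> t) \<partial>lborel) * indicator {x1..x2} x"
      by (intro nn_integral_multc) measurable
    also have "(\<integral>\<^sup>+t. ennreal (exp (u (x - t)) * \<kappa> t) \<partial>lborel) = (\<integral>\<^sup>+t. ennreal (exp (u t) * gk 0 x y t) \<partial>lborel)"
      by (subst nn_integral_real_affine[of _ "-1" x]) (auto simp: gk_def \<kappa>)
    also have "\<dots> = ennreal (mom u 0 x y)"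
      unfolding mom_def using integrable_exp_gk[OF y, of 0 x] y
      by (intro nn_integral_eq_integral) (auto simp: gk_def gphi_nonneg)
    finally show "(\<integral>\<^sup>+t. ennreal (exp (u (x - t)) * \<kappa> t) * indicator {x1..x2} x \<partial>lborel) = ennreal (mom u 0 x y) * indicator {x1..x2} x" .
  qed
  finally show ?thesis by (simp add: \<kappa>_def)
qed

text \<open>As \<open>f\<close> is differentiable only almost everywhere, its derivative is not
  taken under the integral. Both sides are compared after integration in \<open>x\<close>, by
  \<open>nn_integral_mom_0\<close>, and the fundamental theorem recovers the continuous
  integrand.\<close>

lemma conv_gphi_deriv_x:
  assumes y: "y > 0"
  shows "((\<lambda>x. conv f (scaled gphi y) x) has_real_derivative mom u 0 x y) (at x)"
proof -
  let ?U = "conv f (scaled gphi y)" and ?A = "\<lambda>x. mom u 0 x y"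
  have cA: "continuous_on S ?A" for S
    by (intro continuous_at_imp_continuous_on ballI DERIV_isCont[OF mom_0_deriv_x[OF y]])
  have eq: "integral {a..b} ?A = ?U b - ?U a" if "a \<le> b" for a b
  proof -
    have "(?A has_integral integral {a..b} ?A) {a..b}"
      by (intro integrable_integral integrable_continuous_real cA)
    then have "(\<integral>\<^sup>+x. ennreal (?A x) * indicator {a..b} x \<partial>lborel) = ennreal (integral {a..b} ?A)"
      using mom_0_pos[OF y] by (intro nn_integral_has_integral_lebesgue') (auto simp: less_imp_le)
    with nn_integral_mom_0[OF y that] have e: "ennreal (integral {a..b} ?A) = ennreal (?U b - ?U a)" by simp
    have "integral {a..b} ?A \<ge> 0"
      using mom_0_pos[OF y] by (intro Henstock_Kurzweil_Integration.integral_nonneg integrable_continuous_real cA) (auto simp: less_imp_le)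
    moreover have "?U b - ?U a \<ge> 0"
    proof -
      have "integrable lborel (\<lambda>t. f (x - t) * scaled gphi y t)" for x
      proof -
        have "integrable lborel (\<lambda>t. f t * (((x - t) / y) ^ 0 * gphi ((x - t) / y)) / y)"
          by (intro integrable_divide_zero cpow_integrable f_weight_integrable y) auto
        from lborel_integrable_real_affine[OF this, of "-1" x] show ?thesis by (simp add: scaled_def)
      qed
      then have "?U a \<le> ?U b"
        unfolding conv_def using y that f_le by (intro integral_mono) (auto intro!: mult_right_mono divide_right_mono simp: scaled_def gphi_nonneg)
      then show ?thesis by simp
    qed
    ultimately show ?thesis using e by simp
  qed
  have "((\<lambda>b. integral {x - 1..b} ?A) has_real_derivative ?A x) (at x within {x - 1..x + 1})"
    by (rule integral_has_real_derivative[OF cA]) auto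
  then have "((\<lambda>b. integral {x - 1..b} ?A) has_real_derivative ?A x) (at x)"
    by (simp add: at_within_Icc_at)
  then have "((\<lambda>b. integral {x - 1..b} ?A + ?U (x - 1)) has_real_derivative ?A x) (at x)"
    by (auto intro!: derivative_eq_intros)
  then show ?thesis
  proof (rule DERIV_cong_ev[THEN iffD1, rotated -1, OF _ refl _ refl])
    have "\<forall>\<^sub>F b in nhds x. b \<in> {x - 1<..}" by (intro eventually_nhds_in_open) auto
    then show "\<forall>\<^sub>F b in nhds x. integral {x - 1..b} ?A + ?U (x - 1) = ?U b"
      by eventually_elim (simp add: eq)
  qed
qed

text \<open>Integration by parts in disguise: the horizontal derivative of the Gaussian mean of
  \<open>f\<close> is computed once on the kernel and once on \<open>f\<close>, and the results
  agree by uniqueness of derivatives.\<close>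

lemma cpow_f_1:
  assumes y: "y > 0"
  shows "- 2 * cpow f 1 (Complex x y) = y\<^sup>2 * mom u 0 x y"
proof -
  have c: "conv f (scaled gphi y) x = cpow f 0 (Complex x y) / y" for x
    using y by (simp add: conv_scaled_eq cpow_def)
  have "((\<lambda>x. cpow f 0 (Complex x y)) has_real_derivative (- 2 * cpow f 1 (Complex x y) * (1 / y))) (at x)"
    using has_real_derivative_slice[OF cpow_0_has_derivative[OF f_measurable f_weight_integrable, of "Complex x y"]] y by simp
  from DERIV_cdivide[OF this, of y]
  have "((\<lambda>x. conv f (scaled gphi y) x) has_real_derivative (- 2 * cpow f 1 (Complex x y) * (1 / y) / y)) (at x)"
    by (simp add: c)
  from DERIV_unique[OF this conv_gphi_deriv_x[OF y]] show ?thesis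
    using y by (simp add: field_simps power2_eq_square)
qed

text \<open>The same comparison one order higher: \<open>cpow_f_1\<close>, an identity in
  \<open>x\<close>, is differentiated on both sides.\<close>

lemma cpow_f_2:
  assumes y: "y > 0"
  shows "cpow f 0 (Complex x y) - 2 * cpow f 2 (Complex x y) = y\<^sup>2 * mom u 1 x y"
proof -
  obtain c where "(cpow f 1 has_derivative (\<lambda>\<zeta>. (cpow f 0 (Complex x y) - 2 * cpow f 2 (Complex x y)) * (Re \<zeta> / Im (Complex x y)) - c * (Im \<zeta> / Im (Complex x y)))) (at (Complex x y))"
    using cpow_1_has_derivative[OF f_measurable f_weight_integrable, of "Complex x y"] y by auto
  from has_real_derivative_slice[OF this]
  have 1: "((\<lambda>x. cpow f 1 (Complex x y)) has_real_derivative ((cpow f 0 (Complex x y) - 2 * cpow f 2 (Complex x y)) * (1 / y))) (at x)" by simp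
  have eq: "cpow f 1 (Complex x y) = (- (y\<^sup>2) / 2) * mom u 0 x y" for x
    using cpow_f_1[OF y, of x] by simp
  have "((\<lambda>x. cpow f 1 (Complex x y)) has_real_derivative ((- (y\<^sup>2) / 2) * (- 2 * mom u 1 x y / y))) (at x)"
    unfolding eq by (rule DERIV_cmult[OF mom_0_deriv_x[OF y]])
  from DERIV_unique[OF 1 this] show ?thesis using y by (simp add: field_simps power2_eq_square)
qed

lemma extF_eq:
  assumes "Im z > 0"
  shows "extF f z = Complex (cpow f 0 z / Im z) (cpow (\<lambda>t. exp (u t)) 0 z)"
proof -
  have "conv f (scaled gpsi (Im z)) (Re z) = (\<integral>t. f t * gpsi ((Re z - t) / Im z) \<partial>lborel) / Im z"
    by (rule conv_scaled_eq[OF assms])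
  also have "(\<integral>t. f t * gpsi ((Re z - t) / Im z) \<partial>lborel) = - 2 * cpow f 1 z"
    unfolding cpow_def integral_mult_right_zero[symmetric]
    by (intro Bochner_Integration.integral_cong refl) (simp only: gpsi_eq mult.left_commute)
  also have "\<dots> = (Im z)\<^sup>2 * mom u 0 (Re z) (Im z)" using cpow_f_1[OF assms, of "Re z"] by simp
  also have "mom u 0 (Re z) (Im z) = cpow (\<lambda>t. exp (u t)) 0 z / Im z" using mom_cpow[OF assms, of 0 "Re z"] by simp
  finally have "conv f (scaled gpsi (Im z)) (Re z) = cpow (\<lambda>t. exp (u t)) 0 z"
    using assms by (simp add: power2_eq_square)
  moreover have "conv f (scaled gphi (Im z)) (Re z) = cpow f 0 z / Im z"
    using assms by (simp add: conv_scaled_eq cpow_def)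
  ultimately show ?thesis by (simp add: extF_def complex_eq_iff)
qed

lemma Im_extF: "Im z > 0 \<Longrightarrow> Im (extF f z) = Im z * mom u 0 (Re z) (Im z)"
  using mom_cpow[of "Im z" 0 "Re z"] by (simp add: extF_eq)

text \<open>The imaginary part is itself a Gaussian moment of \<open>exp u\<close>, so only the
  kernel is differentiated. The real part is differentiated as a convolution of \<open>f\<close>,
  and \<open>cpow_f_1\<close> and \<open>cpow_f_2\<close> convert its coefficients into moments of
  \<open>exp u\<close>.\<close>

theorem extF_has_derivative:
  assumes z: "Im z > 0"
  shows "(extF f has_derivative (\<lambda>\<zeta>. Complex (mom u 0 (Re z) (Im z) * Re \<zeta> - mom u 1 (Re z) (Im z) * Im \<zeta>)
      (- 2 * mom u 1 (Re z) (Im z) * Re \<zeta> + 2 * mom u 2 (Re z) (Im z) * Im \<zeta>))) (at z)"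
proof -
  let ?e = "\<lambda>t. exp (u t)" and ?y = "Im z"
  let ?V' = "\<lambda>\<zeta>. - 2 * cpow ?e 1 z * (Re \<zeta> / ?y) + 2 * cpow ?e 2 z * (Im \<zeta> / ?y)"
  let ?P' = "\<lambda>\<zeta>. - 2 * cpow f 1 z * (Re \<zeta> / ?y) + 2 * cpow f 2 z * (Im \<zeta> / ?y)"
  have V: "(cpow ?e 0 has_derivative ?V') (at z)"
    by (rule cpow_0_has_derivative[OF exp_u_measurable exp_u_weight_integrable z])
  have P: "(cpow f 0 has_derivative ?P') (at z)"
    by (rule cpow_0_has_derivative[OF f_measurable f_weight_integrable z])
  have I: "(Im has_derivative Im) (at z)" by (rule bounded_linear.has_derivative[OF bounded_linear_Im has_derivative_ident])
  have U: "((\<lambda>z. cpow f 0 z / Im z) has_derivative (\<lambda>\<zeta>. (?P' \<zeta> * ?y - cpow f 0 z * Im \<zeta>) / (?y * ?y))) (at z)"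
    using has_derivative_divide'[OF P I] z by simp
  have "((\<lambda>z. of_real (cpow f 0 z / Im z) + \<i> * of_real (cpow ?e 0 z)) has_derivative
     (\<lambda>\<zeta>. of_real ((?P' \<zeta> * ?y - cpow f 0 z * Im \<zeta>) / (?y * ?y)) + \<i> * of_real (?V' \<zeta>))) (at z)"
    by (intro has_derivative_add has_derivative_mult_right has_derivative_of_real U V)
  then have "(extF f has_derivative (\<lambda>\<zeta>. of_real ((?P' \<zeta> * ?y - cpow f 0 z * Im \<zeta>) / (?y * ?y)) + \<i> * of_real (?V' \<zeta>))) (at z)"
  proof (rule has_derivative_transform_within_open[OF _ open_halfspace_Im_gt[of 0]])
    show "of_real (cpow f 0 x / Im x) + \<i> * of_real (cpow ?e 0 x) = extF f x" if "x \<in> {z. Im z > 0}" for x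
      using that by (simp add: extF_eq complex_eq_iff)
  qed (use z in auto)
  moreover have "of_real ((?P' \<zeta> * ?y - cpow f 0 z * Im \<zeta>) / (?y * ?y)) + \<i> * of_real (?V' \<zeta>) =
     Complex (mom u 0 (Re z) (Im z) * Re \<zeta> - mom u 1 (Re z) (Im z) * Im \<zeta>)
      (- 2 * mom u 1 (Re z) (Im z) * Re \<zeta> + 2 * mom u 2 (Re z) (Im z) * Im \<zeta>)" for \<zeta>
  proof (rule complex_eqI)
    have "?P' \<zeta> * ?y - cpow f 0 z * Im \<zeta> = (- 2 * cpow f 1 z) * Re \<zeta> - (cpow f 0 z - 2 * cpow f 2 z) * Im \<zeta>"
      using z by (simp add: field_simps)
    also have "\<dots> = ?y\<^sup>2 * mom u 0 (Re z) ?y * Re \<zeta> - ?y\<^sup>2 * mom u 1 (Re z) ?y * Im \<zeta>"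
      using cpow_f_1[OF z, of "Re z"] cpow_f_2[OF z, of "Re z"] by simp
    also have "\<dots> = (?y * ?y) * (mom u 0 (Re z) ?y * Re \<zeta> - mom u 1 (Re z) ?y * Im \<zeta>)"
      by (simp add: power2_eq_square algebra_simps)
    finally have "(?P' \<zeta> * ?y - cpow f 0 z * Im \<zeta>) / (?y * ?y) = mom u 0 (Re z) ?y * Re \<zeta> - mom u 1 (Re z) ?y * Im \<zeta>"
      using z by simp
    then show "Re (of_real ((?P' \<zeta> * ?y - cpow f 0 z * Im \<zeta>) / (?y * ?y)) + \<i> * of_real (?V' \<zeta>)) =
       Re (Complex (mom u 0 (Re z) (Im z) * Re \<zeta> - mom u 1 (Re z) (Im z) * Im \<zeta>) (- 2 * mom u 1 (Re z) (Im z) * Re \<zeta> + 2 * mom u 2 (Re z) (Im z) * Im \<zeta>))"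
      by simp
    show "Im (of_real ((?P' \<zeta> * ?y - cpow f 0 z * Im \<zeta>) / (?y * ?y)) + \<i> * of_real (?V' \<zeta>)) =
       Im (Complex (mom u 0 (Re z) (Im z) * Re \<zeta> - mom u 1 (Re z) (Im z) * Im \<zeta>) (- 2 * mom u 1 (Re z) (Im z) * Re \<zeta> + 2 * mom u 2 (Re z) (Im z) * Im \<zeta>))"
      using mom_cpow[OF z, of 1 "Re z"] mom_cpow[OF z, of 2 "Re z"] by simp
  qed
  ultimately show ?thesis by simp
qed

end

section \<open>Boundary values and periodicity of the half-plane map\<close>

lemma conv_scaled_eq':
  assumes "y > 0"
  shows "conv h (scaled k y) x = (\<integral>s. h (x - y * s) * k s \<partial>lborel)"
proof -
  have "conv h (scaled k y) x = \<bar>y\<bar> *\<^sub>R (\<integral>s. h (x - (0 + y * s)) * (k ((0 + y * s) / y) / y) \<partial>lborel)"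
    unfolding conv_def scaled_def using assms lborel_integral_real_affine[of y "\<lambda>t. h (x - t) * (k (t / y) / y)" 0] by simp
  also have "\<dots> = (\<integral>s. y * (h (x - (0 + y * s)) * (k ((0 + y * s) / y) / y)) \<partial>lborel)"
    using assms by simp
  also have "\<dots> = (\<integral>s. h (x - y * s) * k s \<partial>lborel)"
    using assms by (intro Bochner_Integration.integral_cong) auto
  finally show ?thesis .
qed

lemma gpsi_measurable [measurable]: "gpsi \<in> borel_measurable borel"
  unfolding gpsi_def by measurable

lemma abs_gpsi_le: "\<bar>gpsi s\<bar> \<le> 512 / (1 + s\<^sup>2)\<^sup>2"
  using gphi_bound[of 1 s] by (simp add: gpsi_eq abs_mult gphi_nonneg)

lemma abs_gphi_le: "\<bar>gphi s\<bar> \<le> 512 / (1 + s\<^sup>2)\<^sup>2"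
  using gphi_bound[of 0 s] gphi_nonneg[of s] divide_right_mono[of 256 512 "(1 + s\<^sup>2)\<^sup>2"] by simp

lemma has_bochner_integral_gpsi:
  "has_bochner_integral lborel gpsi 0" "has_bochner_integral lborel (\<lambda>s. s * gpsi s) (- 1)"
proof -
  from has_bochner_integral_mult_right[OF has_bochner_integral_gphi_moments(2), of "-2"]
  show "has_bochner_integral lborel gpsi 0" by (simp add: gpsi_eq[abs_def])
  have "(\<lambda>s. - 2 * (s\<^sup>2 * gphi s)) = (\<lambda>s. s * gpsi s)" by (simp add: gpsi_eq fun_eq_iff power2_eq_square)
  with has_bochner_integral_mult_right[OF has_bochner_integral_gphi_moments(3), of "-2"]
  show "has_bochner_integral lborel (\<lambda>s. s * gpsi s) (- 1)" by simp
qed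

lemma integrable_inverse_1_plus_square': "integrable lborel (\<lambda>x::real. 1 / (1 + x\<^sup>2))"
  by (intro integrableI_nonneg) (auto simp: nn_integral_inverse_1_plus_square)

lemma linear_weight_le:
  fixes s X Y :: real
  assumes "X \<ge> 0" "Y \<ge> 0"
  shows "(X + Y * \<bar>s\<bar>) * (B / (1 + s\<^sup>2)\<^sup>2) \<le> \<bar>B\<bar> * (X + Y) * (1 / (1 + s\<^sup>2))"
proof -
  have p: "1 + s\<^sup>2 > 0" by (simp add: add_pos_nonneg)
  have "\<bar>s\<bar> \<le> 1 + s\<^sup>2" using sum_squares_bound[of "\<bar>s\<bar>" 1] by simp
  then have "X + Y * \<bar>s\<bar> \<le> X * (1 + s\<^sup>2) + Y * (1 + s\<^sup>2)"
    using assms by (intro add_mono mult_left_mono) (auto simp: distrib_left)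
  then have "X + Y * \<bar>s\<bar> \<le> (X + Y) * (1 + s\<^sup>2)" by (simp add: distrib_right)
  then have "(X + Y * \<bar>s\<bar>) * (B / (1 + s\<^sup>2)\<^sup>2) \<le> ((X + Y) * (1 + s\<^sup>2)) * (\<bar>B\<bar> / (1 + s\<^sup>2)\<^sup>2)"
    using assms p by (intro mult_mono' divide_right_mono order.trans[OF mult_left_mono[OF divide_right_mono[OF abs_ge_self[of B]]] mult_right_mono]) auto
  also have "\<dots> = \<bar>B\<bar> * (X + Y) * (1 / (1 + s\<^sup>2))"
    using p by (simp add: power2_eq_square)
  finally show ?thesis .
qed

context bext
begin

lemma f_add_int: "f (x + of_int n) = f x + of_int n"
proof (cases "n \<ge> 0")
  case True then show ?thesis using f_add_nat[of x "nat n"] by simp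
next
  case False then show ?thesis using f_add_nat[of "x + of_int n" "nat (-n)"] by simp
qed

lemma abs_f_minus_id: "\<bar>f r - r - f 0\<bar> \<le> 1"
proof -
  define n where "n = \<lfloor>r\<rfloor>"
  have n: "of_int n \<le> r" "r \<le> of_int n + 1" unfolding n_def by linarith+
  have "f (0 + of_int n) \<le> f r" "f r \<le> f (0 + of_int (n + 1))" using n by (auto intro!: f_le)
  then show ?thesis using n unfolding f_add_int by simp
qed

text \<open>After rescaling, the point occurs only in the argument of \<open>f\<close>, which grows
  at most linearly; one integrable majorant then serves the whole sequence, and the approach to
  \<open>x0\<close> need not be vertical.\<close>

lemma conv_limit:
  assumes k [measurable]: "k \<in> borel_measurable borel" and kb: "\<And>s. \<bar>k s\<bar> \<le> 512 / (1 + s\<^sup>2)\<^sup>2"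
    and z: "\<And>n. Im (z n) > 0" and lim: "z \<longlonglongrightarrow> of_real x0"
  shows "(\<lambda>n. conv f (scaled k (Im (z n))) (Re (z n))) \<longlonglongrightarrow> f x0 * (\<integral>s. k s \<partial>lborel)"
proof -
  have xl: "(\<lambda>n. Re (z n)) \<longlonglongrightarrow> x0" using tendsto_Re[OF lim] by simp
  have yl: "(\<lambda>n. Im (z n)) \<longlonglongrightarrow> 0" using tendsto_Im[OF lim] by simp
  obtain X where X: "X > 0" "\<And>n. \<bar>Re (z n)\<bar> \<le> X"
    using convergent_imp_Bseq[OF convergentI[OF xl]] by (auto simp: Bseq_def)
  obtain Y where Y: "Y > 0" "\<And>n. \<bar>Im (z n)\<bar> \<le> Y"
    using convergent_imp_Bseq[OF convergentI[OF yl]] by (auto simp: Bseq_def)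
  have "(\<lambda>n. \<integral>s. f (Re (z n) - Im (z n) * s) * k s \<partial>lborel) \<longlonglongrightarrow> (\<integral>s. f x0 * k s \<partial>lborel)"
  proof (rule integral_dominated_convergence[where w = "\<lambda>s. 512 * ((\<bar>f 0\<bar> + 1 + X) + Y) * (1 / (1 + s\<^sup>2))"])
    show "integrable lborel (\<lambda>s. 512 * ((\<bar>f 0\<bar> + 1 + X) + Y) * (1 / (1 + s\<^sup>2)))"
      by (intro integrable_mult_right integrable_inverse_1_plus_square')
    show "AE s in lborel. (\<lambda>n. f (Re (z n) - Im (z n) * s) * k s) \<longlonglongrightarrow> f x0 * k s"
    proof (rule AE_I2)
      fix s
      have "(\<lambda>n. Re (z n) - Im (z n) * s) \<longlonglongrightarrow> x0 - 0 * s"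
        by (intro tendsto_diff tendsto_mult xl yl tendsto_const)
      then have "(\<lambda>n. f (Re (z n) - Im (z n) * s)) \<longlonglongrightarrow> f x0"
        using f_cont by (intro continuous_on_tendsto_compose[OF f_cont]) auto
      then show "(\<lambda>n. f (Re (z n) - Im (z n) * s) * k s) \<longlonglongrightarrow> f x0 * k s" by (intro tendsto_mult tendsto_const)
    qed
    show "AE s in lborel. norm (f (Re (z n) - Im (z n) * s) * k s) \<le> 512 * ((\<bar>f 0\<bar> + 1 + X) + Y) * (1 / (1 + s\<^sup>2))" for n
    proof (rule AE_I2)
      fix s
      have "\<bar>Re (z n) - Im (z n) * s\<bar> \<le> \<bar>Re (z n)\<bar> + \<bar>Im (z n)\<bar> * \<bar>s\<bar>"
        unfolding abs_mult[symmetric] by (rule abs_triangle_ineq4)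
      also have "\<dots> \<le> X + Y * \<bar>s\<bar>" by (intro add_mono mult_right_mono X Y) auto
      finally have "\<bar>f (Re (z n) - Im (z n) * s)\<bar> \<le> (\<bar>f 0\<bar> + 1 + X) + Y * \<bar>s\<bar>"
        using abs_f_diff_le[of "Re (z n) - Im (z n) * s" 0] by simp
      then have "norm (f (Re (z n) - Im (z n) * s) * k s) \<le> ((\<bar>f 0\<bar> + 1 + X) + Y * \<bar>s\<bar>) * (512 / (1 + s\<^sup>2)\<^sup>2)"
        unfolding real_norm_def abs_mult by (intro mult_mono kb) auto
      also have "\<dots> \<le> \<bar>512\<bar> * ((\<bar>f 0\<bar> + 1 + X) + Y) * (1 / (1 + s\<^sup>2))"
        using X Y by (intro linear_weight_le) auto
      finally show "norm (f (Re (z n) - Im (z n) * s) * k s) \<le> 512 * ((\<bar>f 0\<bar> + 1 + X) + Y) * (1 / (1 + s\<^sup>2))" by simp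
    qed
  qed measurable
  then show ?thesis using z by (simp add: conv_scaled_eq')
qed

text \<open>\<open>gphi\<close> has mass \<open>1\<close> and \<open>gpsi\<close> has mass
  \<open>0\<close>, so the real part tends to \<open>f x0\<close> and the imaginary part to
  \<open>0\<close>.\<close>

lemma extF_limit:
  assumes z: "\<And>n. Im (z n) > 0" and lim: "z \<longlonglongrightarrow> of_real x0"
  shows "(\<lambda>n. extF f (z n)) \<longlonglongrightarrow> of_real (f x0)"
proof -
  have 1: "(\<integral>s. gphi s \<partial>lborel) = 1" "(\<integral>s. gpsi s \<partial>lborel) = 0"
    using has_bochner_integral_gphi_moments(1) has_bochner_integral_gpsi(1) by (auto simp: has_bochner_integral_iff)
  have "(\<lambda>n. of_real (conv f (scaled gphi (Im (z n))) (Re (z n))) + \<i> * of_real (conv f (scaled gpsi (Im (z n))) (Re (z n))))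
     \<longlonglongrightarrow> of_real (f x0 * (\<integral>s. gphi s \<partial>lborel)) + \<i> * of_real (f x0 * (\<integral>s. gpsi s \<partial>lborel))"
    by (intro tendsto_add tendsto_mult tendsto_of_real tendsto_const conv_limit abs_gphi_le abs_gpsi_le z lim) measurable
  then show ?thesis by (simp add: extF_def 1)
qed

lemma extF_tendsto_boundary: "(extF f \<longlongrightarrow> of_real (f x0)) (at (of_real x0) within {z. Im z > 0})"
  unfolding tendsto_at_iff_sequentially o_def
proof (intro allI impI)
  fix X :: "nat \<Rightarrow> complex"
  assume "\<forall>i. X i \<in> {z. Im z > 0} - {of_real x0}" and l: "X \<longlonglongrightarrow> of_real x0"
  then have "Im (X n) > 0" for n by simp
  then show "(\<lambda>n. extF f (X n)) \<longlonglongrightarrow> of_real (f x0)" using l by (rule extF_limit)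
qed

lemma extF_add_1:
  assumes z: "Im z > 0" shows "extF f (z + 1) = extF f z + 1"
proof -
  let ?y = "Im z" and ?x = "Re z"
  have k: "(\<integral>s. f (?x + 1 - ?y * s) * k s \<partial>lborel) = (\<integral>s. f (?x - ?y * s) * k s \<partial>lborel) + (\<integral>s. k s \<partial>lborel)"
    if ki: "integrable lborel k" and kb: "\<And>s. \<bar>k s\<bar> \<le> 512 / (1 + s\<^sup>2)\<^sup>2" for k
  proof -
    have [measurable]: "k \<in> borel_measurable borel" using borel_measurable_integrable[OF ki] by simp
    have "integrable lborel (\<lambda>t. f t * k ((?x - t) / ?y))"
      by (rule convolution_integrable[OF f_measurable f_weight_integrable _ kb z]) measurable
    from lborel_integrable_real_affine[OF this, of "- ?y" ?x]
    have i: "integrable lborel (\<lambda>s. f (?x - ?y * s) * k s)" using z by simp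
    have "f (?x + 1 - ?y * s) = f (?x - ?y * s) + 1" for s using f_per[of "?x - ?y * s"] by (simp add: algebra_simps)
    then show ?thesis using i ki by (simp add: distrib_right)
  qed
  have 1: "integrable lborel gphi" "integrable lborel gpsi" "(\<integral>s. gphi s \<partial>lborel) = 1" "(\<integral>s. gpsi s \<partial>lborel) = 0"
    using has_bochner_integral_gphi_moments(1) has_bochner_integral_gpsi(1) by (auto simp: has_bochner_integral_iff)
  show ?thesis
    unfolding extF_def using z k[OF 1(1) abs_gphi_le] k[OF 1(2) abs_gpsi_le] 1(3,4)
    by (simp add: conv_scaled_eq' complex_eq_iff)
qed

lemma extF_add_int:
  assumes z: "Im z > 0" shows "extF f (z + of_int n) = extF f z + of_int n"
proof -
  have nat: "extF f (z + of_nat m) = extF f z + of_nat m" if "Im z > 0" for z m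
  proof (induction m)
    case (Suc m)
    then show ?case using extF_add_1[of "z + of_nat m"] that by (simp add: add_ac)
  qed simp
  show ?thesis
  proof (cases "n \<ge> 0")
    case True then show ?thesis using nat[OF z, of "nat n"] by simp
  next
    case False then show ?thesis using nat[of "z + of_int n" "nat (-n)"] z by simp
  qed
qed

definition im_const :: real where
  "im_const = (\<bar>f 0\<bar> + 1) * (\<integral>s. \<bar>gpsi s\<bar> \<partial>lborel)"

text \<open>\<open>f\<close> is the identity plus a function bounded by
  \<open>\<bar>f 0\<bar> + 1\<close>. The identity contributes exactly \<open>Im z\<close>, because
  \<open>gpsi\<close> has mass \<open>0\<close> and first moment \<open>- 1\<close>; the rest
  contributes at most \<open>im_const\<close>.\<close>

lemma abs_Im_extF_minus_Im:
  assumes z: "Im z > 0" shows "\<bar>Im (extF f z) - Im z\<bar> \<le> im_const"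
proof -
  let ?y = "Im z" and ?x = "Re z"
  have psi: "integrable lborel gpsi" "(\<integral>s. gpsi s \<partial>lborel) = 0" "integrable lborel (\<lambda>s. s * gpsi s)" "(\<integral>s. s * gpsi s \<partial>lborel) = - 1"
    using has_bochner_integral_gpsi by (auto simp: has_bochner_integral_iff)
  have "integrable lborel (\<lambda>t. f t * gpsi ((?x - t) / ?y))"
    by (rule convolution_integrable[OF f_measurable f_weight_integrable _ abs_gpsi_le z]) measurable
  from lborel_integrable_real_affine[OF this, of "- ?y" ?x]
  have i: "integrable lborel (\<lambda>s. f (?x - ?y * s) * gpsi s)" using z by simp
  have e: "(f (?x - ?y * s) - (?x - ?y * s)) * gpsi s = f (?x - ?y * s) * gpsi s - ?x * gpsi s + ?y * (s * gpsi s)" for s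
    by (simp add: algebra_simps)
  have "(\<integral>s. (f (?x - ?y * s) - (?x - ?y * s)) * gpsi s \<partial>lborel) = (\<integral>s. f (?x - ?y * s) * gpsi s \<partial>lborel) - ?y"
    unfolding e using i psi by simp
  also have "\<dots> = Im (extF f z) - ?y" using z by (simp add: extF_def conv_scaled_eq')
  finally have eq: "Im (extF f z) - ?y = (\<integral>s. (f (?x - ?y * s) - (?x - ?y * s)) * gpsi s \<partial>lborel)" ..
  have ie: "integrable lborel (\<lambda>s. (f (?x - ?y * s) - (?x - ?y * s)) * gpsi s)"
    unfolding e using i psi by simp
  have "\<bar>Im (extF f z) - ?y\<bar> \<le> (\<integral>s. \<bar>(f (?x - ?y * s) - (?x - ?y * s)) * gpsi s\<bar> \<partial>lborel)"
    unfolding eq by (rule integral_abs_bound)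
  also have "\<dots> \<le> (\<integral>s. (\<bar>f 0\<bar> + 1) * \<bar>gpsi s\<bar> \<partial>lborel)"
  proof (intro integral_mono integrable_abs ie integrable_mult_right psi)
    fix s
    have "\<bar>f (?x - ?y * s) - (?x - ?y * s)\<bar> \<le> \<bar>f 0\<bar> + 1" using abs_f_minus_id[of "?x - ?y * s"] by linarith
    then show "\<bar>(f (?x - ?y * s) - (?x - ?y * s)) * gpsi s\<bar> \<le> (\<bar>f 0\<bar> + 1) * \<bar>gpsi s\<bar>"
      unfolding abs_mult by (intro mult_right_mono) auto
  qed
  finally show ?thesis by (simp add: im_const_def)
qed

section \<open>Bijectivity of the half-plane map\<close>

lemma Im_extF_pos: "Im z > 0 \<Longrightarrow> Im (extF f z) > 0"
  using mom_0_pos[of "Im z" "Re z"] by (simp add: Im_extF)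

lemma mom_2_pos:
  assumes y: "y > 0" shows "mom u 2 x y > 0"
proof -
  have "0 \<le> (mom u 1 x y)\<^sup>2" by simp
  then have "0 < mom u 0 x y * mom u 2 x y" using mom_variance_pos[OF y, of x] by linarith
  then show ?thesis using mom_0_pos[OF y, of x] by (simp add: zero_less_mult_iff)
qed

lemma continuous_on_extF: "continuous_on {z. Im z > 0} (extF f)"
proof (intro continuous_at_imp_continuous_on ballI)
  fix z assume "z \<in> {z. Im z > 0}"
  then have "Im z > 0" by simp
  from has_derivative_continuous[OF extF_has_derivative[OF this]] show "isCont (extF f) z" .
qed

lemma Im_extF_strict_mono:
  assumes "0 < y1" "y1 < y2"
  shows "Im (extF f (Complex x y1)) < Im (extF f (Complex x y2))"
proof (rule DERIV_pos_imp_increasing[OF assms(2)])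
  fix y assume "y1 \<le> y" "y \<le> y2"
  then have y: "y > 0" using assms by simp
  have d: "((\<lambda>y. Complex x y) has_derivative (\<lambda>h. \<i> * of_real h)) (at y)"
    by (auto simp: Complex_eq intro!: derivative_eq_intros)
  have "((\<lambda>z. Im (extF f z)) has_derivative (\<lambda>\<zeta>. - 2 * mom u 1 x y * Re \<zeta> + 2 * mom u 2 x y * Im \<zeta>)) (at (Complex x y))"
    using bounded_linear.has_derivative[OF bounded_linear_Im extF_has_derivative[of "Complex x y"]] y by simp
  from has_derivative_compose[OF d this]
  have "((\<lambda>y. Im (extF f (Complex x y))) has_derivative (\<lambda>h. 2 * mom u 2 x y * h)) (at y)" by simp
  then have "((\<lambda>y. Im (extF f (Complex x y))) has_real_derivative 2 * mom u 2 x y) (at y)"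
    by (simp add: has_field_derivative_def)
  then show "\<exists>d. ((\<lambda>y. Im (extF f (Complex x y))) has_real_derivative d) (at y) \<and> 0 < d"
    using mom_2_pos[OF y, of x] by auto
qed

text \<open>Along a vertical line the imaginary part tends to \<open>0\<close> at the boundary and
  is at least \<open>Im z - im_const\<close>, so the intermediate value theorem reaches every
  positive value.\<close>

lemma Im_extF_surj:
  assumes \<eta>: "\<eta> > 0"
  shows "\<exists>y>0. Im (extF f (Complex x y)) = \<eta>"
proof -
  have "(\<lambda>n. extF f (Complex x (1 / real (Suc n)))) \<longlonglongrightarrow> of_real (f x)"
  proof (rule extF_limit)
    have "(\<lambda>n. 1 / real (Suc n)) \<longlonglongrightarrow> 0" using LIMSEQ_Suc[OF lim_1_over_n] by simp
    then show "(\<lambda>n. Complex x (1 / real (Suc n))) \<longlonglongrightarrow> of_real x"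
      by (simp add: tendsto_complex_iff)
  qed simp
  from tendsto_Im[OF this] have "(\<lambda>n. Im (extF f (Complex x (1 / real (Suc n))))) \<longlonglongrightarrow> 0" by simp
  then have "\<forall>\<^sub>F n in sequentially. Im (extF f (Complex x (1 / real (Suc n)))) < \<eta>"
    using \<eta> by (rule order_tendstoD)
  then obtain n where n: "Im (extF f (Complex x (1 / real (Suc n)))) < \<eta>"
    by (auto simp: eventually_sequentially)
  define a where "a = 1 / real (Suc n)"
  have a: "a > 0" "Im (extF f (Complex x a)) < \<eta>" using n by (auto simp: a_def)
  define b where "b = a + \<eta> + im_const"
  have ic: "im_const \<ge> 0" by (simp add: im_const_def)
  have b: "b > 0" "a \<le> b" using a \<eta> ic by (auto simp: b_def)
  have bv: "Im (extF f (Complex x b)) \<ge> \<eta>"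
    using abs_Im_extF_minus_Im[of "Complex x b"] b a by (auto simp: b_def)
  have "continuous_on {a..b} (\<lambda>y. extF f (Complex x y))"
  proof (rule continuous_on_compose2[OF continuous_on_extF])
    show "continuous_on {a..b} (Complex x)" unfolding Complex_eq[abs_def] by (intro continuous_intros)
  qed (use a in auto)
  then have c: "continuous_on {a..b} (\<lambda>y. Im (extF f (Complex x y)))" by (rule continuous_on_Im)
  have "\<exists>y\<ge>a. y \<le> b \<and> Im (extF f (Complex x y)) = \<eta>"
    by (rule IVT'[OF less_imp_le[OF a(2)] bv b(2) c])
  then obtain y where "a \<le> y" "Im (extF f (Complex x y)) = \<eta>" by blast
  then show ?thesis using a(1) by (intro exI[of _ y]) simp
qed

text \<open>\<open>strip\<close> straightens the level lines of \<open>Im (extF f)\<close>, so that the injectivity of \<open>extF f\<close> reduces to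
  the monotonicity of its real part along each of these lines.\<close>
definition strip :: "complex \<Rightarrow> complex" where
  "strip z = Complex (Re z) (Im (extF f z))"

definition unstrip :: "complex \<Rightarrow> complex" where
  "unstrip \<omega> = Complex (Re \<omega>) (SOME y. y > 0 \<and> Im (extF f (Complex (Re \<omega>) y)) = Im \<omega>)"

lemma unstrip:
  assumes "Im \<omega> > 0"
  shows "Im (unstrip \<omega>) > 0" "strip (unstrip \<omega>) = \<omega>" "Re (unstrip \<omega>) = Re \<omega>"
proof -
  have "\<exists>y>0. Im (extF f (Complex (Re \<omega>) y)) = Im \<omega>" by (rule Im_extF_surj[OF assms])
  then have "(SOME y. y > 0 \<and> Im (extF f (Complex (Re \<omega>) y)) = Im \<omega>) > 0 \<and>
    Im (extF f (Complex (Re \<omega>) (SOME y. y > 0 \<and> Im (extF f (Complex (Re \<omega>) y)) = Im \<omega>))) = Im \<omega>"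
    by (rule someI_ex)
  then show "Im (unstrip \<omega>) > 0" "strip (unstrip \<omega>) = \<omega>" "Re (unstrip \<omega>) = Re \<omega>"
    by (auto simp: unstrip_def strip_def complex_eq_iff)
qed

lemma strip_inj:
  assumes "Im z > 0" "Im z' > 0" "strip z = strip z'" shows "z = z'"
proof -
  have re: "Re z = Re z'" and im: "Im (extF f z) = Im (extF f z')" using assms(3) by (auto simp: strip_def)
  have "Im z = Im z'"
  proof (rule ccontr)
    assume "Im z \<noteq> Im z'"
    have e: "Complex (Re z) (Im z') = z'" "Complex (Re z) (Im z) = z" using re by (auto simp: complex_eq_iff)
    from \<open>Im z \<noteq> Im z'\<close> consider "Im z < Im z'" | "Im z' < Im z" by linarith
    then show False
      using Im_extF_strict_mono[OF assms(1), of "Im z'" "Re z"] Im_extF_strict_mono[OF assms(2), of "Im z" "Re z"] im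
      unfolding e by cases simp_all
  qed
  with re show ?thesis by (simp add: complex_eq_iff)
qed

lemma unstrip_strip:
  assumes z: "Im z > 0" shows "unstrip (strip z) = z"
proof -
  have "Im (strip z) > 0" using Im_extF_pos[OF z] by (simp add: strip_def)
  from unstrip(1,2)[OF this] show ?thesis by (rule strip_inj[OF _ z])
qed

text \<open>The derivative of \<open>strip\<close> is triangular with diagonal entries
  \<open>1\<close> and \<open>2 * mom u 2\<close>, the second being positive. The inverse function
  theorem applies with \<open>unstrip\<close> as the given left inverse.\<close>

lemma unstrip_has_derivative:
  assumes \<omega>: "Im \<omega> > 0"
  defines "z \<equiv> unstrip \<omega>"
  shows "(unstrip has_derivative (\<lambda>h. Complex (Re h) ((Im h + 2 * mom u 1 (Re z) (Im z) * Re h) / (2 * mom u 2 (Re z) (Im z))))) (at \<omega>)"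
proof -
  have z: "Im z > 0" "strip z = \<omega>" using unstrip[OF \<omega>] by (auto simp: z_def)
  let ?b = "mom u 1 (Re z) (Im z)" and ?c = "mom u 2 (Re z) (Im z)"
  have c: "?c > 0" using mom_2_pos z(1) by simp
  have D: "(strip has_derivative (\<lambda>\<zeta>. Complex (Re \<zeta>) (- 2 * ?b * Re \<zeta> + 2 * ?c * Im \<zeta>))) (at z)"
  proof -
    have "((\<lambda>z. of_real (Re z) + \<i> * of_real (Im (extF f z))) has_derivative
       (\<lambda>\<zeta>. of_real (Re \<zeta>) + \<i> * of_real (- 2 * ?b * Re \<zeta> + 2 * ?c * Im \<zeta>))) (at z)"
      using bounded_linear.has_derivative[OF bounded_linear_Im extF_has_derivative[OF z(1)]]
      by (intro has_derivative_add has_derivative_mult_right has_derivative_of_real bounded_linear.has_derivative[OF bounded_linear_Re has_derivative_ident]) simp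
    then show ?thesis by (simp add: strip_def[abs_def] Complex_eq)
  qed
  have "continuous_on {z. Im z > 0} (\<lambda>z. of_real (Re z) + \<i> * of_real (Im (extF f z)))"
    by (intro continuous_intros continuous_on_extF)
  then have C: "continuous_on {z. Im z > 0} strip" by (simp add: strip_def[abs_def] Complex_eq)
  have "(unstrip has_derivative (\<lambda>h. Complex (Re h) ((Im h + 2 * ?b * Re h) / (2 * ?c)))) (at (strip z))"
    by (rule has_derivative_inverse_strong[OF open_halfspace_Im_gt[of 0] _ C _ D])
       (use z c in \<open>auto simp: unstrip_strip fun_eq_iff complex_eq_iff field_simps\<close>)
  then show ?thesis by (simp add: z(2))
qed

definition level :: "real \<Rightarrow> real \<Rightarrow> real" where
  "level \<eta> x = Re (extF f (unstrip (Complex x \<eta>)))"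

text \<open>Moving along a level line couples the height to \<open>x\<close> so that the imaginary
  part stays constant; the real part then grows at the rate \<open>(a * c - b\<^sup>2) / c\<close>.
  Its sign is the sign of the variance, which up to a factor \<open>2\<close> is the
  Jacobian.\<close>

lemma level_deriv:
  assumes \<eta>: "\<eta> > 0"
  shows "\<exists>d>0. (level \<eta> has_real_derivative d) (at x)"
proof -
  define \<omega> where "\<omega> = Complex x \<eta>"
  define z where "z = unstrip \<omega>"
  have \<omega>: "Im \<omega> > 0" using \<eta> by (simp add: \<omega>_def)
  have z: "Im z > 0" using unstrip[OF \<omega>] by (simp add: z_def)
  let ?a = "mom u 0 (Re z) (Im z)" and ?b = "mom u 1 (Re z) (Im z)" and ?c = "mom u 2 (Re z) (Im z)"
  have c: "?c > 0" using mom_2_pos z by simp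
  have "((\<lambda>\<omega>. Re (extF f (unstrip \<omega>))) has_derivative (\<lambda>h. ?a * Re h - ?b * ((Im h + 2 * ?b * Re h) / (2 * ?c)))) (at \<omega>)"
    using has_derivative_compose[OF unstrip_has_derivative[OF \<omega>]
       bounded_linear.has_derivative[OF bounded_linear_Re extF_has_derivative[OF z, unfolded z_def]]] by (simp add: z_def)
  from has_real_derivative_slice[OF this[unfolded \<omega>_def]]
  have "(level \<eta> has_real_derivative (?a - ?b * ((2 * ?b) / (2 * ?c)))) (at x)"
    by (simp add: level_def[abs_def])
  moreover have "?a - ?b * ((2 * ?b) / (2 * ?c)) = (?a * ?c - ?b\<^sup>2) / ?c"
    using c by (simp add: field_simps power2_eq_square)
  moreover have "\<dots> > 0" using mom_variance_pos[OF z] c by simp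
  ultimately show ?thesis by metis
qed

lemma unstrip_add_1:
  assumes \<omega>: "Im \<omega> > 0" shows "unstrip (\<omega> + 1) = unstrip \<omega> + 1"
proof (rule strip_inj)
  have "strip (unstrip \<omega> + 1) = strip (unstrip \<omega>) + 1"
    unfolding strip_def using extF_add_1[OF unstrip(1)[OF \<omega>]] by (simp add: complex_eq_iff)
  then show "strip (unstrip (\<omega> + 1)) = strip (unstrip \<omega> + 1)"
    using unstrip(2)[of "\<omega> + 1"] unstrip(2)[OF \<omega>] \<omega> by simp
qed (use unstrip(1)[of \<omega>] unstrip(1)[of "\<omega> + 1"] \<omega> in auto)

lemma level_add_int:
  assumes "\<eta> > 0" shows "level \<eta> (x + of_nat n) = level \<eta> x + of_nat n"
proof (induction n)
  case (Suc n)
  have "Complex (x + of_nat (Suc n)) \<eta> = Complex (x + of_nat n) \<eta> + 1" by (simp add: complex_eq_iff)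
  then have "level \<eta> (x + of_nat (Suc n)) = level \<eta> (x + of_nat n) + 1"
    unfolding level_def using unstrip_add_1[of "Complex (x + of_nat n) \<eta>"] extF_add_1[of "unstrip (Complex (x + of_nat n) \<eta>)"] unstrip(1)[of "Complex (x + of_nat n) \<eta>"] assms
    by simp
  then show ?case using Suc by simp
qed simp

lemma level_strict_mono:
  assumes "\<eta> > 0" "x < x'" shows "level \<eta> x < level \<eta> x'"
proof (rule DERIV_pos_imp_increasing[OF assms(2)])
  show "\<exists>d. (level \<eta> has_real_derivative d) (at t) \<and> 0 < d" for t
    using level_deriv[OF assms(1), of t] by auto
qed

theorem extF_inj:
  assumes "Im z > 0" "Im z' > 0" "extF f z = extF f z'" shows "z = z'"
proof -
  let ?\<eta> = "Im (extF f z)"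
  have \<eta>: "?\<eta> > 0" by (rule Im_extF_pos[OF assms(1)])
  have s: "strip z = Complex (Re z) ?\<eta>" "strip z' = Complex (Re z') ?\<eta>" using assms(3) by (auto simp: strip_def)
  then have "level ?\<eta> (Re z) = Re (extF f z)" "level ?\<eta> (Re z') = Re (extF f z')"
    using unstrip_strip[OF assms(1)] unstrip_strip[OF assms(2)] assms(3) unfolding level_def s(1)[symmetric] s(2)[symmetric] by simp_all
  then have "level ?\<eta> (Re z) = level ?\<eta> (Re z')" using assms(3) by simp
  then have "Re z = Re z'" using level_strict_mono[OF \<eta>] by (metis less_irrefl linorder_less_linear)
  then have "strip z = strip z'" using s by simp
  then show ?thesis by (rule strip_inj[OF assms(1,2)])
qed

text \<open>The real part gains \<open>1\<close> over each period of a level line, so it is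
  unbounded in both directions and takes every value.\<close>

theorem extF_surj:
  assumes \<omega>: "Im \<omega> > 0" shows "\<exists>z. Im z > 0 \<and> extF f z = \<omega>"
proof -
  let ?\<eta> = "Im \<omega>"
  obtain n :: nat where n: "\<bar>Re \<omega> - level ?\<eta> 0\<bar> \<le> real n" using real_arch_simple by blast
  have 1: "level ?\<eta> (- real n) = level ?\<eta> 0 - real n" using level_add_int[OF \<omega>, of "- real n" n] by simp
  have 2: "level ?\<eta> (real n) = level ?\<eta> 0 + real n" using level_add_int[OF \<omega>, of 0 n] by simp
  have "isCont (level ?\<eta>) t" for t using level_deriv[OF \<omega>, of t] by (auto intro: DERIV_isCont)
  then have c: "continuous_on {- real n..real n} (level ?\<eta>)"
    by (intro continuous_at_imp_continuous_on) auto
  have "\<exists>x\<ge>- real n. x \<le> real n \<and> level ?\<eta> x = Re \<omega>"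
    using n 1 2 by (intro IVT' c) auto
  then obtain x where x: "level ?\<eta> x = Re \<omega>" by blast
  have u: "Im (Complex x ?\<eta>) > 0" using \<omega> by simp
  note un = unstrip[OF u]
  have "Im (extF f (unstrip (Complex x ?\<eta>))) = ?\<eta>" using un(2) by (simp add: strip_def complex_eq_iff)
  with x have "extF f (unstrip (Complex x ?\<eta>)) = \<omega>" by (simp add: level_def complex_eq_iff)
  with un(1) show ?thesis by blast
qed

end

section \<open>The extension to the disc\<close>

definition logz :: "complex \<Rightarrow> complex" where
  "logz w = Ln w / (2 * pi * \<i>)"

lemma pt_logz: "w \<noteq> 0 \<Longrightarrow> pt (logz w) = w"
  by (simp add: pt_def logz_def)

lemma pt_neq_0 [simp]: "pt z \<noteq> 0"
  by (simp add: pt_def)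

lemma pt_add: "pt (z + z') = pt z * pt z'"
  by (simp add: pt_def distrib_left exp_add)

lemma pt_of_real [simp]: "pt (of_real x) = circ x"
  by (simp add: pt_def circ_exp)

lemma pt_of_int [simp]: "pt (of_int n) = 1"
  using exp_integer_2pi[of "of_int n"] by (simp add: pt_def mult_ac)

lemma pt_eq_iff: "pt z = pt z' \<longleftrightarrow> (\<exists>n::int. z = z' + of_int n)"
proof
  assume "pt z = pt z'"
  then obtain n :: int where n: "2 * pi * \<i> * z = 2 * pi * \<i> * z' + (of_int (2 * n) * pi) * \<i>"
    unfolding pt_def exp_eq by auto
  then have "(2 * pi * \<i>) * z = (2 * pi * \<i>) * (z' + of_int n)" by (simp add: algebra_simps)
  then have "z = z' + of_int n" by (subst (asm) mult_cancel_left) simp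
  then show "\<exists>n::int. z = z' + of_int n" ..
next
  assume "\<exists>n::int. z = z' + of_int n"
  then show "pt z = pt z'" by (auto simp: pt_add)
qed

lemma Im_logz: "w \<noteq> 0 \<Longrightarrow> Im (logz w) = - ln (cmod w) / (2 * pi)"
  by (simp add: logz_def Im_divide power2_eq_square)

lemma Im_logz_pos: "w \<noteq> 0 \<Longrightarrow> cmod w < 1 \<Longrightarrow> Im (logz w) > 0"
  by (simp add: Im_logz divide_neg_pos)

text \<open>The principal logarithm jumps across the negative axis, so continuity settles only the
  slit plane; on the closed ray an explicit measurable formula takes over.\<close>

lemma Ln_measurable [measurable]: "Ln \<in> borel_measurable borel"
proof -
  let ?A = "\<real>\<^sub>\<le>\<^sub>0 :: complex set"
  have A: "?A \<in> sets borel" by (intro borel_closed closed_nonpos_Reals_complex)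
  have m1: "(\<lambda>w. if w \<in> ?A then 0 else Ln w) \<in> borel_measurable borel"
    by (intro borel_measurable_continuous_on_if A continuous_intros) auto
  have m2: "(\<lambda>w::complex. if w = 0 then Ln 0 else of_real (ln (- Re w)) + \<i> * of_real pi) \<in> borel_measurable borel"
    by measurable
  have eq: "Ln = (\<lambda>w. if w \<in> ?A then (if w = 0 then Ln 0 else of_real (ln (- Re w)) + \<i> * of_real pi) else (if w \<in> ?A then 0 else Ln w))"
  proof
    fix w :: complex
    show "Ln w = (if w \<in> ?A then (if w = 0 then Ln 0 else of_real (ln (- Re w)) + \<i> * of_real pi) else (if w \<in> ?A then 0 else Ln w))"
    proof (cases "w \<in> ?A \<and> w \<noteq> 0")
      case True
      then have w: "w = - of_real (- Re w)" "- Re w > 0"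
        by (auto simp: complex_nonpos_Reals_iff complex_eq_iff)
      have "Ln w = Ln (- of_real (- Re w))" using w(1) by simp
      also have "\<dots> = of_real (ln (- Re w)) + \<i> * of_real pi"
        using w(2) by (subst Ln_minus) (auto simp: Ln_of_real simp del: of_real_minus)
      finally show ?thesis using True by simp
    qed auto
  qed
  have "(\<lambda>w. if w \<in> ?A then (if w = 0 then Ln 0 else of_real (ln (- Re w)) + \<i> * of_real pi) else (if w \<in> ?A then 0 else Ln w)) \<in> borel_measurable borel"
    by (rule measurable_If_set[OF m2 m1]) (simp add: A)
  then show ?thesis by (subst eq)
qed

lemma logz_measurable [measurable]: "logz \<in> borel_measurable borel"
  unfolding logz_def by measurable

locale bext_disc = bext +
  fixes g :: "complex \<Rightarrow> complex"
  assumes g_cont: "continuous_on (sphere 0 1) g" and g_circ: "\<And>x. g (circ x) = circ (f x)"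
begin

abbreviation "G \<equiv> extG f g"

text \<open>The logarithm in \<open>extG\<close> recovers \<open>z\<close> only up to an integer. As
  \<open>extF f\<close> commutes with integer translations, the choice of branch disappears.\<close>

lemma G_pt:
  assumes z: "Im z > 0" shows "G (pt z) = pt (extF f z)"
proof -
  have "pt (logz (pt z)) = pt z" by (simp add: pt_logz)
  then obtain n :: int where n: "logz (pt z) = z + of_int n" by (auto simp: pt_eq_iff)
  have "G (pt z) = pt (extF f (logz (pt z)))"
    using norm_pt_less_1[OF z] by (simp add: extG_def logz_def pt_def[of "extF f _"])
  also have "\<dots> = pt (extF f z)" unfolding n extF_add_int[OF z] by (simp add: pt_add)
  finally show ?thesis .
qed

lemma disc_cases:
  assumes "cmod w < 1" "w \<noteq> 0"
  obtains z where "Im z > 0" "w = pt z"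
  using that[of "logz w"] assms by (simp add: Im_logz_pos pt_logz)

lemma G_0 [simp]: "G 0 = 0" by (simp add: extG_def)

lemma G_circle: "cmod w = 1 \<Longrightarrow> G w = g w"
  by (auto simp: extG_def)

lemma norm_G_less_1: "cmod w < 1 \<Longrightarrow> cmod (G w) < 1"
proof (cases "w = 0")
  case False
  assume "cmod w < 1"
  then obtain z where z: "Im z > 0" "w = pt z" using False by (rule disc_cases)
  then show ?thesis by (simp add: G_pt norm_pt_less_1 Im_extF_pos)
qed simp

text \<open>Equal images lift to points of the half plane that differ by an integer. This integer
  can be moved through \<open>extF f\<close>, after which \<open>extF_inj\<close> applies.\<close>

lemma inj_on_G: "inj_on G (ball 0 1)"
proof (rule inj_onI)
  fix w w' assume w: "w \<in> ball 0 1" "w' \<in> ball 0 1" and eq: "G w = G w'"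
  have nz: "G v \<noteq> 0" if v: "cmod v < 1" "v \<noteq> 0" for v
  proof -
    obtain z where "Im z > 0" "v = pt z" by (rule disc_cases[OF v])
    then show ?thesis by (simp add: G_pt)
  qed
  show "w = w'"
  proof (cases "w = 0 \<or> w' = 0")
    case True
    then show ?thesis using nz w eq by (metis G_0 dist_0_norm mem_ball)
  next
    case False
    then obtain z z' where z: "Im z > 0" "w = pt z" "Im z' > 0" "w' = pt z'"
      using disc_cases[of w] disc_cases[of w'] w by (metis dist_0_norm mem_ball)
    then have "pt (extF f z) = pt (extF f z')" using eq by (simp add: G_pt)
    then obtain n :: int where "extF f z = extF f z' + of_int n" by (auto simp: pt_eq_iff)
    then have "extF f z = extF f (z' + of_int n)" using z by (simp add: extF_add_int)
    then have "z = z' + of_int n" using z by (intro extF_inj[of z "z' + of_int n"]) auto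
    then show ?thesis using z by (simp add: pt_add)
  qed
qed

lemma G_image: "G ` ball 0 1 = ball 0 1"
proof
  show "G ` ball 0 1 \<subseteq> ball 0 1" using norm_G_less_1 by auto
  show "ball 0 1 \<subseteq> G ` ball 0 1"
  proof
    fix w :: complex assume w: "w \<in> ball 0 1"
    show "w \<in> G ` ball 0 1"
    proof (cases "w = 0")
      case True
      then have "w = G 0" by simp
      then show ?thesis by (intro image_eqI[of _ _ 0]) auto
    next
      case False
      then obtain \<omega> where \<omega>: "Im \<omega> > 0" "w = pt \<omega>" using disc_cases[of w] w by auto
      obtain z where z: "Im z > 0" "extF f z = \<omega>" using extF_surj[OF \<omega>(1)] by blast
      then have "w = G (pt z)" using \<omega> by (simp add: G_pt)
      then show ?thesis using norm_pt_less_1[OF z(1)] by (intro image_eqI[of _ _ "pt z"]) auto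
    qed
  qed
qed

text \<open>If \<open>pt z0 = b\<close>, this is the branch of the inverse of \<open>pt\<close> near
  \<open>b\<close> with value \<open>z0\<close>. The logarithm is taken of \<open>w / b\<close>,
  which is close to \<open>1\<close>, so the branch cut is avoided wherever \<open>b\<close>
  lies.\<close>

lemma local_lift:
  assumes b: "b \<noteq> 0" and \<zeta>_def: "\<zeta> = (\<lambda>w. z0 + Ln (w / b) / (2 * pi * \<i>))"
  shows "(\<zeta> has_field_derivative 1 / (2 * pi * \<i> * b)) (at b)" "\<zeta> b = z0" "w \<noteq> 0 \<Longrightarrow> pt (\<zeta> w) = pt z0 * (w / b)"
proof -
  have "1 \<notin> (\<real>\<^sub>\<le>\<^sub>0 :: complex set)" by simp
  then show "(\<zeta> has_field_derivative 1 / (2 * pi * \<i> * b)) (at b)"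
    unfolding \<zeta>_def using b by (auto intro!: derivative_eq_intros simp: field_simps)
  show "\<zeta> b = z0" using b by (simp add: \<zeta>_def)
  show "pt (\<zeta> w) = pt z0 * (w / b)" if "w \<noteq> 0"
    using that b unfolding \<zeta>_def by (simp only: pt_add) (simp add: pt_def)
qed

lemma G_has_derivative:
  assumes z: "Im z > 0"
  defines "a \<equiv> mom u 0 (Re z) (Im z)" and "b \<equiv> mom u 1 (Re z) (Im z)" and "c \<equiv> mom u 2 (Re z) (Im z)"
  shows "(G has_derivative (\<lambda>v. 2 * pi * \<i> * G (pt z) *
     (let \<zeta> = v / (2 * pi * \<i> * pt z) in Complex (a * Re \<zeta> - b * Im \<zeta>) (- 2 * b * Re \<zeta> + 2 * c * Im \<zeta>)))) (at (pt z))"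
proof -
  define \<zeta> where "\<zeta> = (\<lambda>w. z + Ln (w / pt z) / (2 * pi * \<i>))"
  note L = local_lift[OF pt_neq_0 \<zeta>_def]
  let ?D = "\<lambda>\<zeta>. Complex (a * Re \<zeta> - b * Im \<zeta>) (- 2 * b * Re \<zeta> + 2 * c * Im \<zeta>)"
  have d1: "(\<zeta> has_derivative (\<lambda>v. v / (2 * pi * \<i> * pt z))) (at (pt z))"
  proof -
    have "(*) (1 / k) = (\<lambda>v. v / k)" for k :: complex by (simp add: fun_eq_iff)
    then show ?thesis using L(1) by (simp only: has_field_derivative_def)
  qed
  have "(extF f has_derivative ?D) (at (\<zeta> (pt z)))"
    using extF_has_derivative[OF z] by (simp add: L(2) a_def b_def c_def)
  from has_derivative_compose[OF d1 this]
  have d2: "((\<lambda>w. extF f (\<zeta> w)) has_derivative (\<lambda>v. ?D (v / (2 * pi * \<i> * pt z)))) (at (pt z))" .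
  have d3: "(pt has_derivative (\<lambda>h. 2 * pi * \<i> * pt (extF f (\<zeta> (pt z))) * h)) (at (extF f (\<zeta> (pt z))))"
  proof -
    have "(pt has_field_derivative (2 * pi * \<i> * pt x)) (at x)" for x
      unfolding pt_def by (rule derivative_eq_intros refl)+ simp
    then show ?thesis by (simp add: has_field_derivative_def)
  qed
  from has_derivative_compose[OF d2 d3]
  have d4: "((\<lambda>w. pt (extF f (\<zeta> w))) has_derivative (\<lambda>v. 2 * pi * \<i> * G (pt z) * ?D (v / (2 * pi * \<i> * pt z)))) (at (pt z))"
    by (simp add: L(2) G_pt[OF z])
  have "\<forall>\<^sub>F w in at (pt z). Im (\<zeta> w) > 0"
  proof -
    have "isCont \<zeta> (pt z)" using L(1) DERIV_isCont by blast
    then have "((\<lambda>w. Im (\<zeta> w)) \<longlongrightarrow> Im (\<zeta> (pt z))) (at (pt z))" by (intro tendsto_Im) (simp add: isCont_def)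
    then show ?thesis by (rule order_tendstoD) (use z L(2) in simp)
  qed
  moreover have "\<forall>\<^sub>F w in at (pt z). w \<noteq> 0"
    by (intro tendsto_imp_eventually_ne[OF tendsto_ident_at]) simp
  ultimately have "\<forall>\<^sub>F w in at (pt z). pt (extF f (\<zeta> w)) = G w"
  proof eventually_elim
    case (elim w)
    have "pt (\<zeta> w) = w" using L(3)[OF elim(2)] by simp
    with G_pt[OF elim(1)] show ?case by simp
  qed
  moreover have "pt (extF f (\<zeta> (pt z))) = G (pt z)" by (simp add: L(2) G_pt[OF z])
  ultimately have "(G has_derivative (\<lambda>v. 2 * pi * \<i> * G (pt z) * ?D (v / (2 * pi * \<i> * pt z)))) (at (pt z))"
    using has_derivative_transform_eventually[OF d4] by simp
  then show ?thesis by (simp add: Let_def)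
qed

lemma real_linear_complex:
  "Complex (a * Re \<zeta> - b * Im \<zeta>) (- 2 * b * Re \<zeta> + 2 * c * Im \<zeta>) =
    (Complex (a + 2 * c) (- b) / 2) * \<zeta> + (Complex (a - 2 * c) (- 3 * b) / 2) * cnj \<zeta>"
  by (simp add: complex_eq_iff field_simps)

text \<open>\<open>pt\<close> and its local inverses are holomorphic, so passing to the disc
  multiplies the quotient of the Wirtinger coefficients by a unimodular number
  \<open>cnj k / k\<close>, and the modulus of the dilatation is that of the half-plane map.\<close>

lemma G_has_derivative':
  assumes z: "Im z > 0"
  obtains A B where "(G has_derivative (\<lambda>v. A * v + B * cnj v)) (at (pt z))" "A \<noteq> 0"
    "cmod (B / A) = cmod (mu u (Re z) (Im z))" "cmod (cdil G (pt z)) = cmod (mu u (Re z) (Im z))"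
proof -
  let ?k = "1 / (2 * pi * \<i> * pt z)" and ?C = "2 * pi * \<i> * G (pt z)"
  let ?P = "Complex (mom u 0 (Re z) (Im z) + 2 * mom u 2 (Re z) (Im z)) (- mom u 1 (Re z) (Im z)) / 2"
  let ?Q = "Complex (mom u 0 (Re z) (Im z) - 2 * mom u 2 (Re z) (Im z)) (- 3 * mom u 1 (Re z) (Im z)) / 2"
  define A where "A = ?C * ?P * ?k"
  define B where "B = ?C * ?Q * cnj ?k"
  have "(\<lambda>v. 2 * pi * \<i> * G (pt z) *
     (let \<zeta> = v / (2 * pi * \<i> * pt z) in Complex (mom u 0 (Re z) (Im z) * Re \<zeta> - mom u 1 (Re z) (Im z) * Im \<zeta>)
     (- 2 * mom u 1 (Re z) (Im z) * Re \<zeta> + 2 * mom u 2 (Re z) (Im z) * Im \<zeta>))) = (\<lambda>v. A * v + B * cnj v)"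
  proof -
    have "C * (P * (v / k) + Q * cnj (v / k)) = C * P * (1 / k) * v + C * Q * cnj (1 / k) * cnj v" for C P Q v k :: complex
      by (simp add: distrib_left mult.assoc)
    then show ?thesis unfolding Let_def real_linear_complex A_def B_def by blast
  qed
  with G_has_derivative[OF z] have D: "(G has_derivative (\<lambda>v. A * v + B * cnj v)) (at (pt z))" by simp
  have P: "?P \<noteq> 0" using mom_0_pos[OF z, of "Re z"] mom_2_pos[OF z, of "Re z"] by (simp add: complex_eq_iff)
  have GC: "?C \<noteq> 0" by (simp add: G_pt[OF z])
  have A: "A \<noteq> 0" using P GC by (simp add: A_def)
  have "B / A = (?Q / ?P) * (cnj ?k / ?k)"
    using GC unfolding A_def B_def by simp
  moreover have "?Q / ?P = mu u (Re z) (Im z)" by (simp add: mu_def)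
  moreover have "cmod (cnj ?k / ?k) = 1" by (simp add: norm_divide norm_mult)
  ultimately have n: "cmod (B / A) = cmod (mu u (Re z) (Im z))" by (simp only: norm_mult mult_1_right)
  have fd: "frechet_derivative G (at (pt z)) = (\<lambda>v. A * v + B * cnj v)"
    using frechet_derivative_at[OF D] by simp
  have "cdil G (pt z) = (A * 1 + B * cnj 1 + \<i> * (A * \<i> + B * cnj \<i>)) / (A * 1 + B * cnj 1 - \<i> * (A * \<i> + B * cnj \<i>))"
    using D unfolding cdil_def fd Let_def by (auto simp: differentiable_def)
  also have "A * 1 + B * cnj 1 + \<i> * (A * \<i> + B * cnj \<i>) = 2 * B" by (simp add: algebra_simps)
  also have "A * 1 + B * cnj 1 - \<i> * (A * \<i> + B * cnj \<i>) = 2 * A" by (simp add: algebra_simps)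
  finally have "cdil G (pt z) = B / A" by simp
  with that[OF D A n] n show thesis by simp
qed

lemma norm_cdil: "Im z > 0 \<Longrightarrow> cmod (cdil G (pt z)) = cmod (mu u (Re z) (Im z))"
  by (rule G_has_derivative') auto

text \<open>The bound for \<open>Im (extF f z) - Im z\<close> exponentiates to a two-sided
  comparison with \<open>cmod w\<close>. It is what gives control at the origin, a point that
  \<open>pt\<close> does not reach.\<close>

lemma norm_G_bounds:
  assumes w: "cmod w < 1"
  shows "exp (- 2 * pi * im_const) * cmod w \<le> cmod (G w)" "cmod (G w) \<le> exp (2 * pi * im_const) * cmod w"
proof -
  have "exp (- 2 * pi * im_const) * cmod w \<le> cmod (G w) \<and> cmod (G w) \<le> exp (2 * pi * im_const) * cmod w"
  proof (cases "w = 0")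
    case False
    then obtain z where z: "Im z > 0" "w = pt z" using w by (elim disc_cases)
    have "\<bar>Im (extF f z) - Im z\<bar> \<le> im_const" by (rule abs_Im_extF_minus_Im[OF z(1)])
    then have "Im (extF f z) \<le> Im z + im_const" "Im z - im_const \<le> Im (extF f z)" by linarith+
    then have "2 * pi * Im (extF f z) \<le> 2 * pi * (Im z + im_const)" "2 * pi * (Im z - im_const) \<le> 2 * pi * Im (extF f z)"
      by (intro mult_left_mono; simp)+
    then show ?thesis
      by (simp add: z(2) G_pt[OF z(1)] norm_pt exp_add[symmetric] algebra_simps)
  qed simp
  then show "exp (- 2 * pi * im_const) * cmod w \<le> cmod (G w)" "cmod (G w) \<le> exp (2 * pi * im_const) * cmod w" by auto
qed

section \<open>Continuity up to the circle and quasiconformality\<close>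

lemma isCont_G:
  assumes w: "cmod w < 1" shows "isCont G w"
proof (cases "w = 0")
  case True
  have "(G \<longlongrightarrow> 0) (at 0)"
  proof (rule Lim_null_comparison)
    have "\<forall>\<^sub>F v in at 0. v \<in> ball (0::complex) 1" by (intro eventually_at_in_open') auto
    then show "\<forall>\<^sub>F v in at 0. norm (G v) \<le> exp (2 * pi * im_const) * cmod v"
      by eventually_elim (use norm_G_bounds(2) in auto)
    show "((\<lambda>v. exp (2 * pi * im_const) * cmod v) \<longlongrightarrow> 0) (at 0)"
      by (auto intro!: tendsto_eq_intros)
  qed
  then show ?thesis using True by (simp add: isCont_def)
next
  case False
  then obtain z where z: "Im z > 0" "w = pt z" using w by (elim disc_cases)
  obtain A B where "(G has_derivative (\<lambda>v. A * v + B * cnj v)) (at (pt z))" by (rule G_has_derivative'[OF z(1)])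
  from has_derivative_continuous[OF this] show ?thesis by (simp add: z)
qed

lemma G_tendsto_boundary: "(G \<longlongrightarrow> g (circ x)) (at (circ x) within ball 0 1)"
proof -
  let ?b = "circ x"
  have b: "?b \<noteq> 0" using norm_circ[of x] by fastforce
  define \<zeta> where "\<zeta> = (\<lambda>w. of_real x + Ln (w / ?b) / (2 * pi * \<i>))"
  note L = local_lift[OF b \<zeta>_def]
  have cz: "(\<zeta> \<longlongrightarrow> of_real x) (at ?b within ball 0 1)"
    using L(1,2) DERIV_isCont by (metis isCont_def tendsto_within_subset subset_UNIV)
  have ev0: "\<forall>\<^sub>F w in at ?b within ball 0 1. w \<noteq> 0"
    by (intro tendsto_imp_eventually_ne[OF tendsto_ident_at]) (use b in simp)
  have evb: "\<forall>\<^sub>F w in at ?b within ball 0 1. cmod w < 1"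
    unfolding eventually_at_filter by (auto simp: eventually_nhds)
  have pw: "pt (\<zeta> w) = w" if "w \<noteq> 0" for w using L(3)[OF that] b by simp
  have ip: "Im (\<zeta> w) > 0" if "w \<noteq> 0" "cmod w < 1" for w
    using norm_pt[of "\<zeta> w"] that pi_gt_zero by (simp add: pw[OF that(1)] zero_less_mult_iff)
  have "\<forall>\<^sub>F w in at ?b within ball 0 1. \<zeta> w \<in> {z. Im z > 0} \<and> \<zeta> w \<noteq> of_real x"
    using ev0 evb
  proof eventually_elim
    case (elim w)
    with ip[of w] show ?case by auto
  qed
  then have "filterlim \<zeta> (at (of_real x) within {z. Im z > 0}) (at ?b within ball 0 1)"
    using cz by (auto simp: filterlim_at)
  from filterlim_compose[OF extF_tendsto_boundary this]
  have "((\<lambda>w. extF f (\<zeta> w)) \<longlongrightarrow> of_real (f x)) (at ?b within ball 0 1)" .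
  then have "((\<lambda>w. pt (extF f (\<zeta> w))) \<longlongrightarrow> pt (of_real (f x))) (at ?b within ball 0 1)"
    unfolding pt_def by (intro tendsto_intros)
  then have "((\<lambda>w. pt (extF f (\<zeta> w))) \<longlongrightarrow> g ?b) (at ?b within ball 0 1)" by (simp add: g_circ)
  moreover have "\<forall>\<^sub>F w in at ?b within ball 0 1. pt (extF f (\<zeta> w)) = G w"
    using ev0 evb
  proof eventually_elim
    case (elim w)
    from G_pt[OF ip[OF elim]] pw[OF elim(1)] show ?case by simp
  qed
  ultimately show ?thesis by (rule Lim_transform_eventually)
qed

text \<open>At a boundary point the limit from inside the disc and the limit along the circle, which
  is continuity of \<open>g\<close>, are combined.\<close>

lemma continuous_on_G: "continuous_on (cball 0 1) G"
proof (unfold continuous_on_def, intro ballI)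
  fix w :: complex assume "w \<in> cball 0 1"
  then consider "cmod w < 1" | "cmod w = 1" by fastforce
  then show "(G \<longlongrightarrow> G w) (at w within cball 0 1)"
  proof cases
    case 1
    then show ?thesis using isCont_G by (metis isCont_def tendsto_within_subset subset_UNIV)
  next
    case 2
    obtain x where x: "w = circ x"
    proof
      have "w = cis (Arg w)" using 2 by (metis cis_Arg norm_zero zero_neq_one sgn_div_norm inverse_1 scaleR_one)
      then show "w = circ (Arg w / (2 * pi))" by (simp add: circ_def)
    qed
    have "(g \<longlongrightarrow> g w) (at w within sphere 0 1)" using g_cont 2 by (auto simp: continuous_on_def)
    moreover have "\<forall>\<^sub>F v in at w within sphere 0 1. g v = G v"
      unfolding eventually_at_filter by (auto simp: G_circle)
    ultimately have "(G \<longlongrightarrow> g w) (at w within sphere 0 1)" by (rule Lim_transform_eventually)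
    moreover have "(G \<longlongrightarrow> g w) (at w within ball 0 1)" unfolding x by (rule G_tendsto_boundary)
    ultimately have "(G \<longlongrightarrow> g w) (at w within (ball 0 1 \<union> sphere 0 1))" by (intro Lim_Un)
    moreover have "ball 0 1 \<union> sphere 0 1 = (cball 0 1 :: complex set)" by auto
    ultimately show ?thesis by (simp add: G_circle[OF 2])
  qed
qed

lemma homeomorphism_G: "\<exists>H'. homeomorphism (ball 0 1) (ball 0 1) G H'"
proof -
  have "continuous_on (ball 0 1) G" by (rule continuous_on_subset[OF continuous_on_G]) auto
  from invariance_of_domain_homeomorphism[OF open_ball this _ inj_on_G] show ?thesis
    unfolding G_image by auto
qed

lemma qc_ratio_le:
  assumes "r > 0" and "0 < a" and "\<And>w. w \<in> sphere z r \<Longrightarrow> a \<le> cmod (H w - H z) \<and> cmod (H w - H z) \<le> b"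
  shows "qc_ratio H z r \<le> b / a"
proof -
  have ne: "sphere z r \<noteq> {}" using assms(1) by simp
  then obtain w0 where "w0 \<in> sphere z r" by blast
  then have "0 \<le> b" using assms(2) assms(3)[of w0] by linarith
  moreover have "(SUP w\<in>sphere z r. cmod (H w - H z)) \<le> b" using ne assms(3) by (intro cSUP_least) auto
  moreover have "a \<le> (INF w\<in>sphere z r. cmod (H w - H z))" using ne assms(3) by (intro cINF_greatest) auto
  ultimately show ?thesis unfolding qc_ratio_def using assms(2) by (intro frac_le) auto
qed

lemma Limsup_qc_ratio_le:
  assumes "\<forall>\<^sub>F r in at_right 0. qc_ratio H z r \<le> K"
  shows "Limsup (at_right 0) (\<lambda>r. ereal (qc_ratio H z r)) \<le> ereal K"
  using assms by (intro Limsup_bounded) (simp add: eventually_mono)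

text \<open>For \<open>w \<noteq> 0\<close> and \<open>k = mu_bound E\<close> the derivative
  stretches between \<open>cmod A * (1 - k)\<close> and \<open>cmod A * (1 + k)\<close>, and on
  small circles the remainder is at most half of the smaller stretch. At the origin
  \<open>norm_G_bounds\<close> takes the place of a derivative.\<close>

lemma quasiconformal_G: "quasiconformal_disc G"
  unfolding quasiconformal_disc_def
proof (intro conjI homeomorphism_G)
  let ?k = "mu_bound E"
  define K where "K = max (exp (2 * pi * im_const) / exp (- 2 * pi * im_const)) ((1 + ?k + (1 - ?k) / 2) / ((1 - ?k) / 2))"
  have k1: "?k < 1" by (rule mu_bound_less_1)
  show "\<exists>K::real. \<forall>z\<in>ball 0 1. Limsup (at_right 0) (\<lambda>r. ereal (qc_ratio G z r)) \<le> ereal K"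
  proof (intro exI[of _ K] ballI Limsup_qc_ratio_le)
    fix w :: complex assume w: "w \<in> ball 0 1"
    show "\<forall>\<^sub>F r in at_right 0. qc_ratio G w r \<le> K"
    proof (cases "w = 0")
      case True
      have "qc_ratio G 0 r \<le> K" if r: "0 < r" "r < 1" for r
      proof -
        have "qc_ratio G 0 r \<le> (exp (2 * pi * im_const) * r) / (exp (- 2 * pi * im_const) * r)"
          using r norm_G_bounds by (intro qc_ratio_le) auto
        also have "\<dots> = exp (2 * pi * im_const) / exp (- 2 * pi * im_const)" using r by simp
        also have "\<dots> \<le> K" by (simp add: K_def)
        finally show ?thesis .
      qed
      then show ?thesis unfolding True eventually_at_right_field by (intro exI[of _ 1]) auto
    next
      case False
      then obtain z where z: "Im z > 0" "w = pt z" using disc_cases[of w] w by auto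
      obtain A B where AB: "(G has_derivative (\<lambda>v. A * v + B * cnj v)) (at w)" "A \<noteq> 0" "cmod (B / A) = cmod (mu u (Re z) (Im z))"
        using G_has_derivative'[OF z(1)] unfolding z(2) by metis
      have B: "cmod B \<le> ?k * cmod A"
        using norm_mu_le[OF z(1), of "Re z"] AB(2,3) by (simp add: norm_divide field_simps)
      define e where "e = cmod A * (1 - ?k) / 2"
      have e: "e > 0" using AB(2) k1 by (simp add: e_def)
      from AB(1) e obtain d where d: "d > 0" "\<And>v. norm (v - w) < d \<Longrightarrow> norm (G v - G w - (A * (v - w) + B * cnj (v - w))) \<le> e * norm (v - w)"
        unfolding has_derivative_at_alt by blast
      have "qc_ratio G w r \<le> K" if r: "0 < r" "r < d" for r
      proof -
        have "qc_ratio G w r \<le> ((cmod A * (1 + ?k) + e) * r) / ((cmod A * (1 - ?k) - e) * r)"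
        proof (rule qc_ratio_le[OF r(1)])
          show "0 < (cmod A * (1 - ?k) - e) * r" using r e by (simp add: e_def)
          fix v assume "v \<in> sphere w r"
          then have vr: "norm (v - w) = r" by (simp add: dist_norm norm_minus_commute)
          have 1: "norm (G v - G w - (A * (v - w) + B * cnj (v - w))) \<le> e * r" using d(2)[of v] vr r by simp
          have Av: "norm (A * (v - w)) = cmod A * r" by (simp add: norm_mult vr)
          have Bv: "norm (B * cnj (v - w)) \<le> ?k * cmod A * r"
            using B r vr by (simp only: norm_mult complex_mod_cnj) (intro mult_right_mono; simp)
          have "norm (A * (v - w) + B * cnj (v - w)) \<le> cmod A * r + ?k * cmod A * r"
            using norm_triangle_ineq[of "A * (v - w)" "B * cnj (v - w)"] Av Bv by linarith
          moreover have "norm (A * (v - w) + B * cnj (v - w)) \<ge> cmod A * r - ?k * cmod A * r"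
            using norm_diff_ineq[of "A * (v - w)" "B * cnj (v - w)"] Av Bv by linarith
          moreover have "norm (G v - G w) \<le> norm (A * (v - w) + B * cnj (v - w)) + norm (G v - G w - (A * (v - w) + B * cnj (v - w)))"
            using norm_triangle_ineq[of "A * (v - w) + B * cnj (v - w)" "G v - G w - (A * (v - w) + B * cnj (v - w))"] by simp
          moreover have "norm (A * (v - w) + B * cnj (v - w)) \<le> norm (G v - G w) + norm (G v - G w - (A * (v - w) + B * cnj (v - w)))"
            using norm_triangle_ineq4[of "G v - G w" "G v - G w - (A * (v - w) + B * cnj (v - w))"] by simp
          ultimately have "norm (G v - G w) \<le> cmod A * r + ?k * cmod A * r + e * r" "cmod A * r - ?k * cmod A * r - e * r \<le> norm (G v - G w)"
            using 1 by linarith+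
          then show "(cmod A * (1 - ?k) - e) * r \<le> cmod (G v - G w) \<and> cmod (G v - G w) \<le> (cmod A * (1 + ?k) + e) * r"
            by (simp add: algebra_simps)
        qed
        also have "\<dots> = (cmod A * (1 + ?k + (1 - ?k) / 2)) / (cmod A * ((1 - ?k) / 2))"
        proof -
          have "cmod A * (1 + ?k) + e = cmod A * (1 + ?k + (1 - ?k) / 2)" "cmod A * (1 - ?k) - e = cmod A * ((1 - ?k) / 2)"
            by (simp_all add: e_def field_simps)
          then show ?thesis using r by simp
        qed
        also have "\<dots> = (1 + ?k + (1 - ?k) / 2) / ((1 - ?k) / 2)" using AB(2) by simp
        also have "\<dots> \<le> K" by (simp add: K_def)
        finally show ?thesis .
      qed
      then show ?thesis unfolding eventually_at_right_field using d(1) by (intro exI[of _ d]) auto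
    qed
  qed
qed

end

section \<open>Quasisymmetry and Carleson boxes\<close>

context bext
begin

text \<open>An increment is an integral of \<open>exp u\<close> over an interval where
  \<open>qker t (x - s)\<close> is at least \<open>1 / (4 * t)\<close>. Normalised by
  \<open>exp m\<close>, it is bounded above through \<open>exp_osc_qker\<close> and below through
  the parabola bound.\<close>

lemma f_increment_bounds:
  assumes t: "0 < t" "t \<le> 1"
  shows "\<exists>m>0. \<forall>a b. x - t \<le> a \<longrightarrow> b = a + t \<longrightarrow> b \<le> x + t \<longrightarrow>
     f b - f a \<le> m * (4 * t * (ker_const * osc_const 1 E)) \<and> m * (t / (4 * (ker_const * osc_const 1 E))) \<le> f b - f a"
proof -
  define K where "K = ker_const * osc_const 1 E"
  have K: "K > 0" by (simp add: K_def ker_const_pos osc_const_pos)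
  define m where "m = med (pt (Complex x t))"
  have "f b - f a \<le> exp m * (4 * t * K) \<and> exp m * (t / (4 * K)) \<le> f b - f a"
    if ab: "x - t \<le> a" "b = a + t" "b \<le> x + t" for a b
  proof -
    let ?J = "indicator {a..b} :: real \<Rightarrow> ennreal"
    have abs: "(\<integral>\<^sup>+s. ennreal (exp \<bar>u s - m\<bar>) * ?J s \<partial>lborel) \<le> ennreal (4 * t * K)"
    proof -
      have "(\<integral>\<^sup>+s. ennreal (exp \<bar>u s - m\<bar>) * ?J s \<partial>lborel) \<le> (\<integral>\<^sup>+s. ennreal (4 * t) * (ennreal (exp \<bar>u s - m\<bar>) * ennreal (qker t (x - s))) \<partial>lborel)"
      proof (intro nn_integral_mono)
        fix s
        show "ennreal (exp \<bar>u s - m\<bar>) * ?J s \<le> ennreal (4 * t) * (ennreal (exp \<bar>u s - m\<bar>) * ennreal (qker t (x - s)))"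
        proof (cases "s \<in> {a..b}")
          case True
          then have "\<bar>x - s\<bar> \<le> t" using ab by auto
          then have "(x - s)\<^sup>2 \<le> t\<^sup>2" using abs_le_square_iff[of "x - s" t] t by simp
          then have "(t\<^sup>2 + (x - s)\<^sup>2)\<^sup>2 \<le> (2 * t\<^sup>2)\<^sup>2" by (intro power_mono) auto
          then have "t ^ 3 / (2 * t\<^sup>2)\<^sup>2 \<le> qker t (x - s)"
            unfolding qker_def using t by (intro divide_left_mono mult_pos_pos zero_less_power add_pos_nonneg) auto
          moreover have "t ^ 3 / (2 * t\<^sup>2)\<^sup>2 = 1 / (4 * t)" using t by (simp add: power2_eq_square power3_eq_cube)
          ultimately have "1 \<le> 4 * t * qker t (x - s)" using t by (simp add: field_simps)
          then have "exp \<bar>u s - m\<bar> * 1 \<le> exp \<bar>u s - m\<bar> * (4 * t * qker t (x - s))" by (intro mult_left_mono) auto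
          then have "ennreal (exp \<bar>u s - m\<bar>) \<le> ennreal (4 * t * (exp \<bar>u s - m\<bar> * qker t (x - s)))"
            by (intro ennreal_leI) (simp add: mult_ac)
          also have "\<dots> = ennreal (4 * t) * (ennreal (exp \<bar>u s - m\<bar>) * ennreal (qker t (x - s)))"
            using t qker_nonneg[OF t(1), of "x - s"] by (simp add: ennreal_mult)
          finally show ?thesis using True by simp
        qed simp
      qed
      also have "\<dots> = ennreal (4 * t) * (\<integral>\<^sup>+s. ennreal (exp \<bar>u s - m\<bar>) * ennreal (qker t (x - s)) \<partial>lborel)"
        by (intro nn_integral_cmult) measurable
      also have "\<dots> \<le> ennreal (4 * t) * ennreal K"
        unfolding m_def K_def by (intro mult_left_mono exp_osc_qker t) auto
      also have "\<dots> = ennreal (4 * t * K)" using t K by (simp add: ennreal_mult)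
      finally show ?thesis .
    qed
    have fe: "ennreal (f b - f a) = (\<integral>\<^sup>+s. ennreal (exp (u s)) * ?J s \<partial>lborel)"
      using nn_integral_exp_u[of a b] ab t by simp
    have "ennreal (f b - f a) \<le> (\<integral>\<^sup>+s. ennreal (exp m) * (ennreal (exp \<bar>u s - m\<bar>) * ?J s) \<partial>lborel)"
      unfolding fe
    proof (intro nn_integral_mono)
      fix s
      have "exp (u s) \<le> exp m * exp \<bar>u s - m\<bar>" unfolding exp_add[symmetric] by simp
      then have "ennreal (exp (u s)) \<le> ennreal (exp m) * ennreal (exp \<bar>u s - m\<bar>)"
        by (subst ennreal_mult[symmetric]) (auto intro: ennreal_leI)
      then show "ennreal (exp (u s)) * ?J s \<le> ennreal (exp m) * (ennreal (exp \<bar>u s - m\<bar>) * ?J s)"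
        unfolding mult.assoc[symmetric] by (intro mult_right_mono) auto
    qed
    also have "\<dots> = ennreal (exp m) * (\<integral>\<^sup>+s. ennreal (exp \<bar>u s - m\<bar>) * ?J s \<partial>lborel)"
      by (intro nn_integral_cmult) measurable
    also have "\<dots> \<le> ennreal (exp m) * ennreal (4 * t * K)" by (intro mult_left_mono abs) auto
    also have "\<dots> = ennreal (exp m * (4 * t * K))" using t K by (simp add: ennreal_mult)
    finally have up: "f b - f a \<le> exp m * (4 * t * K)" using t K by (simp add: ennreal_le_iff)
    \<comment> \<open>Maximises \<open>2 * \<tau> - 4 * K * \<tau>\<^sup>2\<close>; the maximum
      equals \<tau>.\<close>
    define \<tau> where "\<tau> = 1 / (4 * K)"
    have \<tau>: "\<tau> > 0" using K by (simp add: \<tau>_def)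
    have "ennreal (2 * \<tau> * exp m * t) = (\<integral>\<^sup>+s. ennreal (2 * \<tau> * exp m) * ?J s \<partial>lborel)"
      using ab t \<tau> by (simp add: nn_integral_cmult ennreal_mult)
    also have "\<dots> \<le> (\<integral>\<^sup>+s. ennreal (exp (u s)) * ?J s + ennreal (\<tau>\<^sup>2 * exp m) * (ennreal (exp \<bar>u s - m\<bar>) * ?J s) \<partial>lborel)"
    proof (intro nn_integral_mono)
      fix s
      have "2 * \<tau> \<le> exp (u s - m) + \<tau>\<^sup>2 * exp (- (u s - m))" using exp_ge_parabola[of \<tau> "u s - m"] by simp
      also have "\<dots> \<le> exp (u s - m) + \<tau>\<^sup>2 * exp \<bar>u s - m\<bar>" by (intro add_left_mono mult_left_mono) auto
      finally have "exp m * (2 * \<tau>) \<le> exp m * (exp (u s - m) + \<tau>\<^sup>2 * exp \<bar>u s - m\<bar>)" by (intro mult_left_mono) auto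
      then have "2 * \<tau> * exp m \<le> exp (u s) + \<tau>\<^sup>2 * exp m * exp \<bar>u s - m\<bar>"
        by (simp add: distrib_left exp_diff mult_ac)
      then have "ennreal (2 * \<tau> * exp m) \<le> ennreal (exp (u s)) + ennreal (\<tau>\<^sup>2 * exp m) * ennreal (exp \<bar>u s - m\<bar>)"
        using ennreal_leI ennreal_plus[of "exp (u s)" "\<tau>\<^sup>2 * exp m * exp \<bar>u s - m\<bar>"]
          ennreal_mult[of "\<tau>\<^sup>2 * exp m" "exp \<bar>u s - m\<bar>"] by fastforce
      then show "ennreal (2 * \<tau> * exp m) * ?J s \<le> ennreal (exp (u s)) * ?J s + ennreal (\<tau>\<^sup>2 * exp m) * (ennreal (exp \<bar>u s - m\<bar>) * ?J s)"
        by (auto simp: indicator_def)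
    qed
    also have "\<dots> = ennreal (f b - f a) + ennreal (\<tau>\<^sup>2 * exp m) * (\<integral>\<^sup>+s. ennreal (exp \<bar>u s - m\<bar>) * ?J s \<partial>lborel)"
      unfolding fe by (subst nn_integral_add) (auto simp: nn_integral_cmult)
    also have "\<dots> \<le> ennreal (f b - f a) + ennreal (\<tau>\<^sup>2 * exp m) * ennreal (4 * t * K)"
      by (intro add_left_mono mult_left_mono abs) auto
    also have "\<dots> = ennreal ((f b - f a) + \<tau>\<^sup>2 * exp m * (4 * t * K))"
      using t K f_le[of a b] ab by (simp add: ennreal_mult ennreal_plus)
    finally have "2 * \<tau> * exp m * t \<le> (f b - f a) + \<tau>\<^sup>2 * exp m * (4 * t * K)"
      using t K \<tau> f_le[of a b] ab by (subst (asm) ennreal_le_iff) auto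
    moreover have "\<tau>\<^sup>2 * exp m * (4 * t * K) = \<tau> * exp m * t" using K by (simp add: \<tau>_def power2_eq_square)
    ultimately have "\<tau> * exp m * t \<le> f b - f a" by linarith
    then have "exp m * (t / (4 * K)) \<le> f b - f a" by (simp add: \<tau>_def mult_ac)
    with up show ?thesis by simp
  qed
  then show ?thesis unfolding K_def[symmetric] by (intro exI[of _ "exp m"]) auto
qed

text \<open>Up to scale \<open>1\<close> adjacent increments share the normalising factor
  \<open>m\<close>, and the ratio of the two bounds is \<open>16 * K\<^sup>2\<close>. Above scale
  \<open>1\<close>, translation by integers puts every increment between \<open>t / 2\<close> and
  \<open>t + 1\<close>.\<close>

lemma f_quasisymmetric:
  "\<exists>M\<ge>1. \<forall>x t. t > 0 \<longrightarrow> \<bar>f (x + t) - f x\<bar> \<le> M * \<bar>f x - f (x - t)\<bar> \<and> \<bar>f x - f (x - t)\<bar> \<le> M * \<bar>f (x + t) - f x\<bar>"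
proof -
  define K where "K = ker_const * osc_const 1 E"
  have K: "K > 0" by (simp add: K_def ker_const_pos osc_const_pos)
  define M where "M = max 4 (16 * K\<^sup>2)"
  have M: "M \<ge> 4" "M \<ge> 16 * K\<^sup>2" by (auto simp: M_def)
  show ?thesis
  proof (intro exI[of _ M] conjI allI impI)
    show "M \<ge> 1" using M by simp
    fix x t :: real assume t: "t > 0"
    define A where "A = f (x + t) - f x"
    define B where "B = f x - f (x - t)"
    have AB0: "A \<ge> 0" "B \<ge> 0" using f_le t by (auto simp: A_def B_def)
    have "A \<le> M * B \<and> B \<le> M * A"
    proof (cases "t \<le> 1")
      case True
      obtain m where m: "m > 0" "\<forall>a b. x - t \<le> a \<longrightarrow> b = a + t \<longrightarrow> b \<le> x + t \<longrightarrow>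
         f b - f a \<le> m * (4 * t * K) \<and> m * (t / (4 * K)) \<le> f b - f a"
        using f_increment_bounds[OF t True, of x] unfolding K_def by blast
      have bA: "A \<le> m * (4 * t * K)" "m * (t / (4 * K)) \<le> A"
        using m(2)[THEN spec, THEN spec, of x "x + t"] t by (auto simp: A_def)
      have bB: "B \<le> m * (4 * t * K)" "m * (t / (4 * K)) \<le> B"
        using m(2)[THEN spec, THEN spec, of "x - t" x] t by (auto simp: B_def)
      have e: "m * (4 * t * K) = 16 * K\<^sup>2 * (m * (t / (4 * K)))" using K by (simp add: power2_eq_square)
      have *: "X \<le> M * Y" if "X \<le> m * (4 * t * K)" "m * (t / (4 * K)) \<le> Y" "Y \<ge> 0" for X Y
      proof -
        have "X \<le> 16 * K\<^sup>2 * (m * (t / (4 * K)))" using that(1) unfolding e .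
        also have "\<dots> \<le> 16 * K\<^sup>2 * Y" using that(2) by (intro mult_left_mono) auto
        also have "\<dots> \<le> M * Y" using M that(3) by (intro mult_right_mono) auto
        finally show ?thesis .
      qed
      show ?thesis using *[OF bA(1) bB(2) AB0(2)] *[OF bB(1) bA(2) AB0(1)] by simp
    next
      case False
      have *: "f (r + t) - f r \<le> t + 1 \<and> t / 2 \<le> f (r + t) - f r" for r
      proof
        show "f (r + t) - f r \<le> t + 1" using abs_f_diff_le[of "r + t" r] t by simp
        define n where "n = nat \<lfloor>t\<rfloor>"
        have n: "real n \<le> t" "t < real n + 1" "real n \<ge> 1" using False by (auto simp: n_def le_nat_floor)
        have "f (r + real n) \<le> f (r + t)" using n by (intro f_le) simp
        then have "real n \<le> f (r + t) - f r" by (simp add: f_add_nat)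
        then show "t / 2 \<le> f (r + t) - f r" using n by linarith
      qed
      have "A \<le> t + 1" "t / 2 \<le> A" using *[of x] by (auto simp: A_def)
      moreover have "B \<le> t + 1" "t / 2 \<le> B" using *[of "x - t"] by (auto simp: B_def)
      ultimately have "A \<le> 4 * B" "B \<le> 4 * A" using False by linarith+
      moreover have "4 * B \<le> M * B" "4 * A \<le> M * A" using M AB0 by (auto intro: mult_right_mono)
      ultimately show ?thesis by linarith
    qed
    then show "\<bar>f (x + t) - f x\<bar> \<le> M * \<bar>f x - f (x - t)\<bar>" "\<bar>f x - f (x - t)\<bar> \<le> M * \<bar>f (x + t) - f x\<bar>"
      using AB0 by (auto simp: A_def B_def)
  qed
qed

end

section \<open>Power weights on Carleson boxes\<close>

lemma nn_integral_powr_0: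
  assumes "\<beta> > 0" "h \<ge> 0"
  shows "(\<integral>\<^sup>+t. ennreal (t powr (\<beta> - 1)) * indicator {0..h} t \<partial>lborel) = ennreal (h powr \<beta> / \<beta>)"
proof -
  have "((\<lambda>x. x powr (\<beta> - 1)) has_integral (h powr \<beta> / \<beta>)) {0..h}"
    using has_integral_powr_from_0[of "\<beta> - 1" h] assms by simp
  then show ?thesis by (intro nn_integral_has_integral_lebesgue') auto
qed

text \<open>Factorisation into \<open>s - \<bar>y\<bar>\<close> and \<open>s + \<bar>y\<bar>\<close>
  with \<open>s = sqrt (1 - x\<^sup>2)\<close>; the second factor is at least \<open>1\<close>
  because \<open>s > \<bar>y\<bar> \<ge> 1/2\<close>.\<close>

lemma one_minus_squares_ge:
  fixes x y :: real
  assumes "\<bar>y\<bar> \<ge> 1/2" "x\<^sup>2 + y\<^sup>2 < 1"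
  shows "0 < sqrt (1 - x\<^sup>2) - \<bar>y\<bar>" "sqrt (1 - x\<^sup>2) - \<bar>y\<bar> \<le> 1 - x\<^sup>2 - y\<^sup>2"
proof -
  define s where "s = sqrt (1 - x\<^sup>2)"
  have "y\<^sup>2 < 1 - x\<^sup>2" using assms(2) by simp
  then have "sqrt (y\<^sup>2) < s" unfolding s_def by (rule real_sqrt_less_mono)
  then have ys: "\<bar>y\<bar> < s" by simp
  have "1 - x\<^sup>2 \<ge> 0" using assms(2) zero_le_power2[of y] by linarith
  then have s2: "s\<^sup>2 = 1 - x\<^sup>2" by (simp add: s_def)
  show "0 < sqrt (1 - x\<^sup>2) - \<bar>y\<bar>" using ys by (simp add: s_def)
  have "(s - \<bar>y\<bar>) * 1 \<le> (s - \<bar>y\<bar>) * (s + \<bar>y\<bar>)" using ys assms(1) by (intro mult_left_mono) auto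
  also have "\<dots> = s\<^sup>2 - y\<^sup>2" by (simp add: power2_eq_square algebra_simps)
  finally have "s - \<bar>y\<bar> \<le> 1 - x\<^sup>2 - y\<^sup>2" unfolding s2 by simp
  then show "sqrt (1 - x\<^sup>2) - \<bar>y\<bar> \<le> 1 - x\<^sup>2 - y\<^sup>2" unfolding s_def .
qed

text \<open>Replacing \<open>1 - x\<^sup>2 - y\<^sup>2\<close> by the smaller distance to the circle
  along the slice only increases the weight, as its exponent is not positive; a one-dimensional
  power integral remains for each sign of \<open>y\<close>.\<close>

lemma nn_integral_collar_slice:
  assumes \<beta>: "0 < \<beta>" "\<beta> \<le> 1" and h: "h \<ge> 0"
  shows "(\<integral>\<^sup>+y. ennreal ((1 - x\<^sup>2 - y\<^sup>2) powr (\<beta> - 1)) * indicator {y. \<bar>y\<bar> \<ge> 1/2 \<and> 0 < 1 - x\<^sup>2 - y\<^sup>2 \<and> 1 - x\<^sup>2 - y\<^sup>2 \<le> h} y \<partial>lborel)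
    \<le> ennreal (2 * (h powr \<beta> / \<beta>))"
proof -
  define s where "s = sqrt (1 - x\<^sup>2)"
  let ?f = "\<lambda>\<tau>. ennreal (\<tau> powr (\<beta> - 1)) * indicator {0..h} \<tau>"
  have "(\<integral>\<^sup>+y. ennreal ((1 - x\<^sup>2 - y\<^sup>2) powr (\<beta> - 1)) * indicator {y. \<bar>y\<bar> \<ge> 1/2 \<and> 0 < 1 - x\<^sup>2 - y\<^sup>2 \<and> 1 - x\<^sup>2 - y\<^sup>2 \<le> h} y \<partial>lborel)
     \<le> (\<integral>\<^sup>+y. ?f (s + (-1) * y) + ?f (s + 1 * y) \<partial>lborel)"
  proof (intro nn_integral_mono)
    fix y
    show "ennreal ((1 - x\<^sup>2 - y\<^sup>2) powr (\<beta> - 1)) * indicator {y. \<bar>y\<bar> \<ge> 1/2 \<and> 0 < 1 - x\<^sup>2 - y\<^sup>2 \<and> 1 - x\<^sup>2 - y\<^sup>2 \<le> h} y \<le> ?f (s + (-1) * y) + ?f (s + 1 * y)"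
    proof (cases "\<bar>y\<bar> \<ge> 1/2 \<and> 0 < 1 - x\<^sup>2 - y\<^sup>2 \<and> 1 - x\<^sup>2 - y\<^sup>2 \<le> h")
      case True
      then have o: "0 < s - \<bar>y\<bar>" "s - \<bar>y\<bar> \<le> 1 - x\<^sup>2 - y\<^sup>2" using one_minus_squares_ge[of y x] by (auto simp: s_def)
      have "(1 - x\<^sup>2 - y\<^sup>2) powr (\<beta> - 1) \<le> (s - \<bar>y\<bar>) powr (\<beta> - 1)"
        using o \<beta> by (intro powr_mono2') auto
      then have "ennreal ((1 - x\<^sup>2 - y\<^sup>2) powr (\<beta> - 1)) \<le> ?f (s - \<bar>y\<bar>)"
        using o True by (auto intro!: ennreal_leI)
      also have "\<dots> \<le> ?f (s + (-1) * y) + ?f (s + 1 * y)"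
        by (cases "y \<ge> 0") auto
      finally show ?thesis using True by simp
    qed simp
  qed
  also have "\<dots> = (\<integral>\<^sup>+y. ?f (s + (-1) * y) \<partial>lborel) + (\<integral>\<^sup>+y. ?f (s + 1 * y) \<partial>lborel)"
    by (intro nn_integral_add) measurable
  also have "(\<integral>\<^sup>+y. ?f (s + (-1) * y) \<partial>lborel) = (\<integral>\<^sup>+\<tau>. ?f \<tau> \<partial>lborel)"
    using nn_integral_real_affine[of ?f "-1" s] by simp
  also have "(\<integral>\<^sup>+y. ?f (s + 1 * y) \<partial>lborel) = (\<integral>\<^sup>+\<tau>. ?f \<tau> \<partial>lborel)"
    using nn_integral_real_affine[of ?f 1 s] by simp
  also have "(\<integral>\<^sup>+\<tau>. ?f \<tau> \<partial>lborel) + (\<integral>\<^sup>+\<tau>. ?f \<tau> \<partial>lborel) = ennreal (2 * (h powr \<beta> / \<beta>))"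
    using \<beta> h by (simp add: nn_integral_powr_0 ennreal_plus[symmetric] del: ennreal_plus)
  finally show ?thesis .
qed

text \<open>\<open>X\<close> is \<open>1\<close> or \<open>0\<close> and selects the coordinate along which the collar extends: \<open>Re w\<close> for \<open>X = 1\<close> (near the
  top and the bottom of the circle), \<open>Im w\<close> for \<open>X = 0\<close>.\<close>
definition collar :: "real \<Rightarrow> complex \<Rightarrow> real \<Rightarrow> real \<Rightarrow> complex set" where
  "collar L c h X = {w. \<bar>X * Im w + (1 - X) * Re w\<bar> \<ge> 1/2 \<and> \<bar>X * Re w + (1 - X) * Im w - (X * Re c + (1 - X) * Im c)\<bar> \<le> L \<and> 0 < 1 - (cmod w)\<^sup>2 \<and> 1 - (cmod w)\<^sup>2 \<le> h}"

lemma nn_integral_collar: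
  assumes \<beta>: "0 < \<beta>" "\<beta> \<le> 1" and h: "h \<ge> 0" and L: "L \<ge> 0" and X: "X = 0 \<or> X = 1"
  shows "(\<integral>\<^sup>+w. ennreal ((1 - (cmod w)\<^sup>2) powr (\<beta> - 1)) * indicator (collar L c h X) w \<partial>lborel) \<le> ennreal (4 * L * (h powr \<beta> / \<beta>))"
proof -
  let ?S = "\<lambda>x. {y. \<bar>y\<bar> \<ge> 1/2 \<and> 0 < 1 - x\<^sup>2 - y\<^sup>2 \<and> 1 - x\<^sup>2 - y\<^sup>2 \<le> h}"
  let ?G = "\<lambda>x y. ennreal ((1 - x\<^sup>2 - y\<^sup>2) powr (\<beta> - 1)) * indicator (?S x) y"
  have cm [measurable]: "collar L c h X \<in> sets borel"
    unfolding collar_def by measurable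
  define d where "d = X * Re c + (1 - X) * Im c"
  have Sm [measurable]: "Measurable.pred (borel \<Otimes>\<^sub>M borel) (\<lambda>z. snd z \<in> ?S (fst z))"
    by (simp, measurable)
  have "(\<integral>\<^sup>+w. ennreal ((1 - (cmod w)\<^sup>2) powr (\<beta> - 1)) * indicator (collar L c h X) w \<partial>lborel) =
     (\<integral>\<^sup>+x. \<integral>\<^sup>+y. ennreal ((1 - (cmod (Complex x y))\<^sup>2) powr (\<beta> - 1)) * indicator (collar L c h X) (Complex x y) \<partial>lborel \<partial>lborel)"
    by (rule nn_integral_complex) measurable
  also have "\<dots> = (\<integral>\<^sup>+x. \<integral>\<^sup>+y. ?G x y * indicator {d - L..d + L} x \<partial>lborel \<partial>lborel)"
  proof (cases "X = 1")
    case True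
    then show ?thesis
      by (intro nn_integral_cong) (auto simp: collar_def cmod_power2 d_def indicator_def abs_le_iff diff_diff_eq)
  next
    case False
    then have X0: "X = 0" using X by simp
    have "(\<integral>\<^sup>+x. \<integral>\<^sup>+y. ennreal ((1 - (cmod (Complex x y))\<^sup>2) powr (\<beta> - 1)) * indicator (collar L c h X) (Complex x y) \<partial>lborel \<partial>lborel) =
      (\<integral>\<^sup>+x. \<integral>\<^sup>+y. ?G y x * indicator {d - L..d + L} y \<partial>lborel \<partial>lborel)"
      by (intro nn_integral_cong) (auto simp: X0 collar_def cmod_power2 d_def indicator_def abs_le_iff diff_diff_eq add.commute)
    also have "\<dots> = (\<integral>\<^sup>+y. \<integral>\<^sup>+x. ?G y x * indicator {d - L..d + L} y \<partial>lborel \<partial>lborel)"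
      by (rule lborel_pair.Fubini') measurable
    finally show ?thesis .
  qed
  also have "\<dots> = (\<integral>\<^sup>+x. (\<integral>\<^sup>+y. ?G x y \<partial>lborel) * indicator {d - L..d + L} x \<partial>lborel)"
    by (intro nn_integral_cong nn_integral_multc) measurable
  also have "\<dots> \<le> (\<integral>\<^sup>+x. ennreal (2 * (h powr \<beta> / \<beta>)) * indicator {d - L..d + L} x \<partial>lborel)"
    by (intro nn_integral_mono mult_right_mono nn_integral_collar_slice \<beta> h) auto
  also have "\<dots> = ennreal (4 * L * (h powr \<beta> / \<beta>))"
  proof -
    have "(\<integral>\<^sup>+x. ennreal (2 * (h powr \<beta> / \<beta>)) * indicator {d - L..d + L} x \<partial>lborel) = ennreal (2 * (h powr \<beta> / \<beta>)) * ennreal (2 * L)"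
      using L by (subst nn_integral_cmult_indicator) auto
    also have "\<dots> = ennreal (2 * (h powr \<beta> / \<beta>) * (2 * L))" using L \<beta> by (intro ennreal_mult[symmetric]) auto
    finally show ?thesis by (simp add: mult_ac)
  qed
  finally show ?thesis .
qed

lemma norm_large_coordinate:
  assumes "cmod w \<ge> 3/4" shows "\<bar>Im w\<bar> \<ge> 1/2 \<or> \<bar>Re w\<bar> \<ge> 1/2"
proof (rule ccontr)
  assume "\<not> ?thesis"
  then have "\<bar>Im w\<bar>\<^sup>2 \<le> (1/2)\<^sup>2" "\<bar>Re w\<bar>\<^sup>2 \<le> (1/2)\<^sup>2"
    using power_mono[of "\<bar>Im w\<bar>" "1/2" 2] power_mono[of "\<bar>Re w\<bar>" "1/2" 2] by simp_all
  moreover have "(3/4)\<^sup>2 \<le> (cmod w)\<^sup>2" using assms by (intro power_mono) auto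
  ultimately show False unfolding cmod_power2 by (simp add: power_divide)
qed

text \<open>For \<open>cmod w < 3/4\<close> the weight is at most \<open>4\<close>, on a square of
  area \<open>4\<close>; the rest of the disc is covered by the two collars, each contributing
  \<open>4 / \<beta>\<close>.\<close>

lemma nn_integral_disc_powr:
  assumes \<beta>: "0 < \<beta>" "\<beta> \<le> 1"
  shows "(\<integral>\<^sup>+w. ennreal ((1 - (cmod w)\<^sup>2) powr (\<beta> - 1)) * indicator (ball 0 1) w \<partial>lborel) \<le> ennreal (16 + 8 / \<beta>)"
proof -
  let ?d = "\<lambda>w. ennreal ((1 - (cmod w)\<^sup>2) powr (\<beta> - 1))"
  let ?C = "\<lambda>X. collar 1 0 1 X"
  let ?B = "cbox (Complex (-1) (-1)) (Complex 1 1)"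
  have cm [measurable]: "?C X \<in> sets borel" for X unfolding collar_def by measurable
  have "(\<integral>\<^sup>+w. ?d w * indicator (ball 0 1) w \<partial>lborel) \<le> (\<integral>\<^sup>+w. 4 * indicator ?B w + (?d w * indicator (?C 0) w + ?d w * indicator (?C 1) w) \<partial>lborel)"
  proof (intro nn_integral_mono)
    fix w
    show "?d w * indicator (ball 0 1) w \<le> 4 * indicator ?B w + (?d w * indicator (?C 0) w + ?d w * indicator (?C 1) w)"
    proof (cases "cmod w < 1")
      case True
      have c1: "\<bar>Re w\<bar> \<le> 1" "\<bar>Im w\<bar> \<le> 1" using abs_Re_le_cmod[of w] abs_Im_le_cmod[of w] True by linarith+
      have pos: "0 < 1 - (cmod w)\<^sup>2" using True by (simp add: abs_square_less_1)
      show ?thesis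
      proof (cases "cmod w \<ge> 3/4")
        case big: True
        from norm_large_coordinate[OF this] show ?thesis
        proof
          assume "1/2 \<le> \<bar>Im w\<bar>"
          then have "w \<in> ?C 1" using c1 pos by (simp add: collar_def)
          then show ?thesis using True by (simp add: add_increasing)
        next
          assume "1/2 \<le> \<bar>Re w\<bar>"
          then have "w \<in> ?C 0" using c1 pos by (simp add: collar_def)
          then show ?thesis using True by (simp add: add_increasing)
        qed
      next
        case False
        then have "(cmod w)\<^sup>2 \<le> (3/4)\<^sup>2" by (intro power_mono) auto
        then have q: "1 - (cmod w)\<^sup>2 \<ge> 1/4" by (simp add: power2_eq_square)
        have "(1 - (cmod w)\<^sup>2) powr (\<beta> - 1) \<le> (1/4) powr (\<beta> - 1)" using q \<beta> by (intro powr_mono2') auto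
        also have "\<dots> \<le> (1/4) powr (-1)" using \<beta> by (intro powr_mono') auto
        also have "\<dots> = 4" by (simp add: powr_minus_divide)
        finally have "?d w \<le> 4" using ennreal_leI[of "(1 - (cmod w)\<^sup>2) powr (\<beta> - 1)" 4] by simp
        moreover have "w \<in> ?B" using c1 by (auto simp: cbox_def Basis_complex_def)
        ultimately show ?thesis using True by (simp add: add_increasing2)
      qed
    qed simp
  qed
  also have "\<dots> = 4 * emeasure lborel ?B + ((\<integral>\<^sup>+w. ?d w * indicator (?C 0) w \<partial>lborel) + (\<integral>\<^sup>+w. ?d w * indicator (?C 1) w \<partial>lborel))"
    by (subst nn_integral_add, measurable, subst nn_integral_add, measurable, simp add: nn_integral_cmult)
  also have "\<dots> \<le> ennreal 16 + (ennreal (4 * 1 * (1 powr \<beta> / \<beta>)) + ennreal (4 * 1 * (1 powr \<beta> / \<beta>)))"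
  proof (intro add_mono nn_integral_collar \<beta>)
    have "emeasure lborel ?B = ennreal 4"
      by (subst emeasure_lborel_cbox) (auto simp: Basis_complex_def)
    then show "4 * emeasure lborel ?B \<le> ennreal 16" by (simp flip: ennreal_numeral ennreal_mult)
  qed auto
  also have "\<dots> = ennreal (16 + 8 / \<beta>)"
    using \<beta> ennreal_plus[of "4 / \<beta>" "4 / \<beta>"] ennreal_plus[of 16 "8 / \<beta>"] by simp
  finally show ?thesis .
qed

lemma cos_sin_lipschitz: "\<bar>cos x - cos y\<bar> \<le> \<bar>x - y\<bar>" "\<bar>sin x - sin y\<bar> \<le> \<bar>x - y\<bar>" for x y :: real
proof -
  have "cmod (cis x - cis y) \<le> \<bar>x - y\<bar>"
    using dist_circ_le[of "x / (2 * pi)" "y / (2 * pi)"] by (simp add: circ_def diff_divide_distrib[symmetric] abs_divide)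
  then show "\<bar>cos x - cos y\<bar> \<le> \<bar>x - y\<bar>" "\<bar>sin x - sin y\<bar> \<le> \<bar>x - y\<bar>"
    using abs_Re_le_cmod[of "cis x - cis y"] abs_Im_le_cmod[of "cis x - cis y"] by auto
qed

definition box_const :: "real \<Rightarrow> real" where
  "box_const \<beta> = 4 powr (1 + \<beta>) * (16 + 8 / \<beta>) + 16 * 2 powr \<beta> / \<beta>"

text \<open>A box of length \<open>l < 1/4\<close> lies in the two collars of size
  \<open>2 * l\<close> around \<open>cis a\<close>. For larger \<open>l\<close> the integral over
  the whole disc is enough, since \<open>(4 * l) powr (1 + \<beta>) \<ge> 1\<close>.\<close>

lemma nn_integral_carleson_box:
  assumes \<beta>: "0 < \<beta>" "\<beta> \<le> 1" and l: "l > 0" and S: "carleson_box a l \<in> sets borel"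
  shows "(\<integral>\<^sup>+w. ennreal ((1 - (cmod w)\<^sup>2) powr (\<beta> - 1)) * indicator (ball 0 1 \<inter> carleson_box a l) w \<partial>lborel) \<le> ennreal (box_const \<beta> * l powr (1 + \<beta>))"
proof (cases "l < 1/4")
  case False
  note [measurable] = S
  have "(\<integral>\<^sup>+w. ennreal ((1 - (cmod w)\<^sup>2) powr (\<beta> - 1)) * indicator (ball 0 1 \<inter> carleson_box a l) w \<partial>lborel) \<le>
     (\<integral>\<^sup>+w. ennreal ((1 - (cmod w)\<^sup>2) powr (\<beta> - 1)) * indicator (ball 0 1) w \<partial>lborel)"
    by (intro nn_integral_mono mult_left_mono) (auto simp: indicator_def)
  also have "\<dots> \<le> ennreal (16 + 8 / \<beta>)" by (rule nn_integral_disc_powr[OF \<beta>])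
  also have "\<dots> \<le> ennreal (box_const \<beta> * l powr (1 + \<beta>))"
  proof (rule ennreal_leI)
    have "1 = (4 * (1/4)) powr (1 + \<beta>)" by simp
    also have "\<dots> \<le> (4 * l) powr (1 + \<beta>)" using False \<beta> by (intro powr_mono2) auto
    also have "\<dots> = 4 powr (1 + \<beta>) * l powr (1 + \<beta>)" using l by (simp add: powr_mult)
    finally have "1 * (16 + 8 / \<beta>) \<le> (4 powr (1 + \<beta>) * l powr (1 + \<beta>)) * (16 + 8 / \<beta>)"
      using \<beta> by (intro mult_right_mono) auto
    moreover have "0 \<le> 16 * 2 powr \<beta> / \<beta> * l powr (1 + \<beta>)" using \<beta> by simp
    ultimately show "16 + 8 / \<beta> \<le> box_const \<beta> * l powr (1 + \<beta>)" unfolding box_const_def by (simp add: algebra_simps)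
  qed
  finally show ?thesis .
next
  case True
  let ?d = "\<lambda>w. ennreal ((1 - (cmod w)\<^sup>2) powr (\<beta> - 1))"
  let ?C = "\<lambda>X. collar (2 * l) (cis a) (2 * l) X"
  note [measurable] = S
  have cm [measurable]: "?C X \<in> sets borel" for X unfolding collar_def by measurable
  have "(\<integral>\<^sup>+w. ?d w * indicator (ball 0 1 \<inter> carleson_box a l) w \<partial>lborel) \<le> (\<integral>\<^sup>+w. ?d w * indicator (?C 0) w + ?d w * indicator (?C 1) w \<partial>lborel)"
  proof (intro nn_integral_mono)
    fix w
    show "?d w * indicator (ball 0 1 \<inter> carleson_box a l) w \<le> ?d w * indicator (?C 0) w + ?d w * indicator (?C 1) w"
    proof (cases "w \<in> ball 0 1 \<inter> carleson_box a l")
      case box: True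
      then obtain r \<theta> where r: "w = complex_of_real r * cis \<theta>" "a \<le> \<theta>" "\<theta> \<le> a + l" "0 \<le> r" "1 - l \<le> r" "r < 1"
        by (auto simp: carleson_box_def)
      have nw: "cmod w = r" using r by (simp add: norm_mult)
      have pos: "0 < 1 - (cmod w)\<^sup>2" using r nw by (simp add: abs_square_less_1)
      have "1 - r\<^sup>2 = (1 - r) * (1 + r)" by (simp add: power2_eq_square algebra_simps)
      also have "\<dots> \<le> l * 2" using r l by (intro mult_mono) auto
      finally have h: "1 - (cmod w)\<^sup>2 \<le> 2 * l" by (simp add: nw)
      have lip: "\<bar>r * p - q\<bar> \<le> 2 * l" if "\<bar>p - q\<bar> \<le> \<bar>\<theta> - a\<bar>" "\<bar>p\<bar> \<le> 1" for p q
      proof -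
        have "r * p - q = - ((1 - r) * p) + (p - q)" by (simp add: algebra_simps)
        then have "\<bar>r * p - q\<bar> \<le> (1 - r) * \<bar>p\<bar> + \<bar>p - q\<bar>" using r by (metis abs_minus_cancel abs_mult abs_of_nonneg abs_triangle_ineq diff_ge_0_iff_ge less_imp_le)
        also have "\<dots> \<le> l * 1 + l" using that r l by (intro add_mono mult_mono) auto
        finally show ?thesis by simp
      qed
      have re: "\<bar>Re w - cos a\<bar> \<le> 2 * l" and im: "\<bar>Im w - sin a\<bar> \<le> 2 * l"
        using lip[OF cos_sin_lipschitz(1)] lip[OF cos_sin_lipschitz(2)] by (auto simp: r(1))
      have "cmod w \<ge> 3/4" using r True nw by simp
      from norm_large_coordinate[OF this] have "w \<in> ?C 0 \<or> w \<in> ?C 1"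
        using re im pos h by (auto simp: collar_def)
      then show ?thesis using box by (auto simp: add_increasing add_increasing2)
    qed simp
  qed
  also have "\<dots> = (\<integral>\<^sup>+w. ?d w * indicator (?C 0) w \<partial>lborel) + (\<integral>\<^sup>+w. ?d w * indicator (?C 1) w \<partial>lborel)"
    by (intro nn_integral_add) measurable
  also have "\<dots> \<le> ennreal (4 * (2 * l) * ((2 * l) powr \<beta> / \<beta>)) + ennreal (4 * (2 * l) * ((2 * l) powr \<beta> / \<beta>))"
    using l by (intro add_mono nn_integral_collar \<beta>) auto
  also have "\<dots> = ennreal (16 * 2 powr \<beta> / \<beta> * l powr (1 + \<beta>))"
    using l \<beta> by (simp add: ennreal_plus[symmetric] powr_mult powr_add mult_ac del: ennreal_plus)
  also have "\<dots> \<le> ennreal (box_const \<beta> * l powr (1 + \<beta>))"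
    unfolding box_const_def using \<beta> by (intro ennreal_leI mult_right_mono) auto
  finally show ?thesis .
qed

text \<open>A manifestly Borel measurable formula for the modulus of the dilatation, while
  \<open>cdil\<close> rests on a case distinction about differentiability. The two agree on the
  punctured disc.\<close>

definition dil_rep :: "(real \<Rightarrow> real) \<Rightarrow> complex \<Rightarrow> real" where
  "dil_rep u w = cmod (mu u (Re (logz w)) (Im (logz w)))"

lemma dil_rep_nonneg [simp]: "dil_rep u w \<ge> 0"
  by (simp add: dil_rep_def)

lemma dil_rep_measurable [measurable]:
  assumes [measurable]: "u \<in> borel_measurable borel"
  shows "dil_rep u \<in> borel_measurable borel"
proof -
  have [measurable]: "(\<lambda>w. mom u j (Re (logz w)) (Im (logz w))) \<in> borel_measurable borel" for j
    unfolding mom_def gk_def by measurable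
  have [measurable]: "(\<lambda>w. Complex (h w) (k w)) \<in> borel_measurable borel"
    if [measurable]: "h \<in> borel_measurable borel" "k \<in> borel_measurable borel" for h k :: "complex \<Rightarrow> real"
    unfolding borel_measurable_complex_iff by simp
  show ?thesis unfolding dil_rep_def mu_def by measurable
qed

context besov
begin

lemma u_circ_cong: "circ s = circ t \<Longrightarrow> u s = u t"
  unfolding circ_eq_circ_iff using u_add_of_int by auto

lemma dil_rep_powr_le:
  assumes "w \<noteq> 0" "cmod w < 1"
  shows "ennreal (dil_rep u w powr p) \<le> ennreal (dil_const p E) * dosc p u w"
  using norm_mu_powr_le[OF Im_logz_pos[OF assms], of "Re (logz w)"] pt_logz[OF assms(1)]
  by (simp add: dil_rep_def)

lemma dil_rep_le_1:
  assumes "w \<noteq> 0" "cmod w < 1" shows "dil_rep u w \<le> 1"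
proof -
  have "dil_rep u w \<le> mu_bound E" unfolding dil_rep_def by (rule norm_mu_le[OF Im_logz_pos[OF assms]])
  also have "\<dots> \<le> 1" using mu_bound_less_1[of E] by simp
  finally show ?thesis .
qed

lemma nn_integral_dil_rep_le:
  "(\<integral>\<^sup>+w. indicator (ball 0 1) w * ennreal (dil_rep u w powr p / (1 - (cmod w)\<^sup>2)\<^sup>2) \<partial>lborel)
     \<le> ennreal (dil_const p E * (256 * pi\<^sup>2)) * ener p u"
proof -
  have [measurable]: "dosc p u \<in> borel_measurable borel"
    unfolding dosc_def rho_def pois_def by measurable
  have [measurable]: "ball (0::complex) 1 \<in> sets borel" by simp
  have "(\<integral>\<^sup>+w. indicator (ball 0 1) w * ennreal (dil_rep u w powr p / (1 - (cmod w)\<^sup>2)\<^sup>2) \<partial>lborel)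
     \<le> (\<integral>\<^sup>+w. ennreal (dil_const p E) * (indicator (ball 0 1) w * (dosc p u w * ennreal (1 / (1 - (cmod w)\<^sup>2)\<^sup>2))) \<partial>lborel)"
  proof (intro nn_integral_mono_AE AE_I2[THEN AE_mp[OF AE_lborel_singleton[of 0]]] impI)
    fix w :: complex assume w: "w \<noteq> 0"
    show "indicator (ball 0 1) w * ennreal (dil_rep u w powr p / (1 - (cmod w)\<^sup>2)\<^sup>2) \<le>
       ennreal (dil_const p E) * (indicator (ball 0 1) w * (dosc p u w * ennreal (1 / (1 - (cmod w)\<^sup>2)\<^sup>2)))"
    proof (cases "cmod w < 1")
      case True
      have "ennreal (dil_rep u w powr p / (1 - (cmod w)\<^sup>2)\<^sup>2) = ennreal (dil_rep u w powr p) * ennreal (1 / (1 - (cmod w)\<^sup>2)\<^sup>2)"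
        by (subst ennreal_mult[symmetric]) auto
      also have "\<dots> \<le> ennreal (dil_const p E) * dosc p u w * ennreal (1 / (1 - (cmod w)\<^sup>2)\<^sup>2)"
        by (intro mult_right_mono dil_rep_powr_le w True) auto
      finally show ?thesis using True by (simp add: mult.assoc)
    qed simp
  qed
  also have "\<dots> = ennreal (dil_const p E) * (\<integral>\<^sup>+w. indicator (ball 0 1) w * (dosc p u w * ennreal (1 / (1 - (cmod w)\<^sup>2)\<^sup>2)) \<partial>lborel)"
    by (intro nn_integral_cmult) measurable
  also have "\<dots> \<le> ennreal (dil_const p E) * (ennreal (256 * pi\<^sup>2) * ener p u)"
    by (intro mult_left_mono nn_integral_dosc_le u u_circ_cong) auto
  also have "\<dots> = ennreal (dil_const p E * (256 * pi\<^sup>2)) * ener p u"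
    using dil_const_pos[of p E] by (simp add: ennreal_mult mult.assoc)
  finally show ?thesis .
qed

lemma dil_rep_vanishing:
  assumes e: "e > 0"
  shows "\<exists>r<1. \<forall>w. r < cmod w \<longrightarrow> cmod w < 1 \<longrightarrow> dil_rep u w \<le> e"
proof -
  have "ener p u < \<infinity>" using ener by (simp add: le_less_trans)
  moreover have "e powr p / dil_const p E > 0" using e dil_const_pos[of p E] by simp
  ultimately obtain r where r: "r < 1" "\<And>w. r < cmod w \<Longrightarrow> cmod w < 1 \<Longrightarrow> dosc p u w \<le> ennreal (e powr p / dil_const p E)"
    using dosc_vanishing[OF u _ u_circ_cong] by blast
  show ?thesis
  proof (intro exI[of _ "max r 0"] conjI allI impI)
    show "max r 0 < 1" using r by simp
    fix w :: complex assume w: "max r 0 < cmod w" "cmod w < 1"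
    have "ennreal (dil_rep u w powr p) \<le> ennreal (dil_const p E) * dosc p u w"
      using w by (intro dil_rep_powr_le) auto
    also have "\<dots> \<le> ennreal (dil_const p E) * ennreal (e powr p / dil_const p E)"
      using w by (intro mult_left_mono r) auto
    also have "\<dots> = ennreal (e powr p)"
      using dil_const_pos[of p E] by (subst ennreal_mult[symmetric]) auto
    finally have "dil_rep u w powr p \<le> e powr p" by (simp add: ennreal_le_iff)
    then show "dil_rep u w \<le> e" using e p powr_less_mono2[of p e "dil_rep u w"] by (auto simp: not_less[symmetric])
  qed
qed

end

context bext_disc
begin

lemma cmod_cdil_eq: "w \<noteq> 0 \<Longrightarrow> cmod w < 1 \<Longrightarrow> cmod (cdil G w) = dil_rep u w"
  using norm_cdil[OF Im_logz_pos, of w] by (simp add: dil_rep_def pt_logz)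

lemma dil_integral_G_le: "dil_integral p G \<le> ennreal (dil_const p E * (256 * pi\<^sup>2)) * ener p u"
proof -
  have "dil_integral p G = (\<integral>\<^sup>+w. indicator (ball 0 1) w * ennreal (dil_rep u w powr p / (1 - (cmod w)\<^sup>2)\<^sup>2) \<partial>lborel)"
    unfolding dil_integral_def
    by (intro nn_integral_cong_AE AE_mp[OF AE_lborel_singleton[of 0] AE_I2]) (auto simp: indicator_def cmod_cdil_eq)
  then show ?thesis using nn_integral_dil_rep_le by simp
qed

lemma in_Wp_g:
  assumes "\<exists>h. homeomorphism (sphere 0 1) (sphere 0 1) g h"
  shows "in_Wp p g"
  unfolding in_Wp_def
proof (intro conjI exI[of _ G] ballI)
  show "quasisymmetric_circle g"
    unfolding quasisymmetric_circle_def using assms f_quasisymmetric f_cont g_circ by blast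
  have "dil_integral p G \<le> ennreal (dil_const p E * (256 * pi\<^sup>2)) * ener p u" by (rule dil_integral_G_le)
  also have "\<dots> < \<infinity>" using ener by (simp add: ennreal_mult_less_top le_less_trans)
  finally show "dil_integral p G < \<infinity>" .
qed (auto simp: continuous_on_G quasiconformal_G G_circle)

end

text \<open>Over a null set the essential supremum would be minus infinity, so positive measure is
  what gives the limit its lower bound.\<close>

lemma emeasure_annulus:
  assumes "0 < r" "r < 1"
  shows "emeasure lborel {w::complex. r < cmod w \<and> cmod w < 1} \<noteq> 0"
proof
  assume 0: "emeasure lborel {w::complex. r < cmod w \<and> cmod w < 1} = 0"
  define c where "c = complex_of_real ((r + 1) / 2)"
  have c: "cmod c = (r + 1) / 2" unfolding c_def norm_of_real using assms by simp
  have sub: "ball c ((1 - r) / 2) \<subseteq> {w. r < cmod w \<and> cmod w < 1}"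
  proof
    fix w assume "w \<in> ball c ((1 - r) / 2)"
    then have "cmod (c - w) < (1 - r) / 2" by (simp add: dist_norm)
    moreover have "cmod c - cmod w \<le> cmod (c - w)" by (rule norm_triangle_ineq2)
    moreover have "cmod w - cmod c \<le> cmod (c - w)" unfolding norm_minus_commute[of c w] by (rule norm_triangle_ineq2)
    ultimately show "w \<in> {w. r < cmod w \<and> cmod w < 1}" unfolding c by (simp add: field_simps)
  qed
  have S: "{w::complex. r < cmod w \<and> cmod w < 1} \<in> sets lborel" by measurable
  have "emeasure lborel (ball c ((1 - r) / 2)) = 0"
    using emeasure_mono[OF sub S] unfolding 0 by simp
  moreover have "ball c ((1 - r) / 2) \<noteq> {}" using assms by simp
  ultimately show False using open_not_negligible[of "ball c ((1 - r) / 2)"]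
    by (simp add: negligible_iff_null_sets null_sets_def)
qed

text \<open>The uniform bound \<open>van\<close> gives the limit from above; a nonnegative function
  on a set of positive measure gives it from below. Radii \<open>r > 0\<close> keep out the origin,
  where \<open>N\<close> and \<open>R\<close> may differ.\<close>

lemma esssup_annulus_tendsto_0:
  fixes N R :: "complex \<Rightarrow> real"
  assumes R [measurable]: "R \<in> borel_measurable borel" and N: "\<And>w. N w \<ge> 0"
    and eq: "\<And>w. w \<noteq> 0 \<Longrightarrow> cmod w < 1 \<Longrightarrow> N w = R w"
    and van: "\<And>e. e > 0 \<Longrightarrow> \<exists>r<1. \<forall>w. r < cmod w \<longrightarrow> cmod w < 1 \<longrightarrow> R w \<le> e"
  shows "((\<lambda>r. esssup (restrict_space lborel {w. r < cmod w \<and> cmod w < 1}) (\<lambda>w. ereal (N w))) \<longlongrightarrow> 0) (at_left 1)"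
proof (rule order_tendstoI)
  let ?M = "\<lambda>r. restrict_space lborel {w::complex. r < cmod w \<and> cmod w < 1}"
  have S [measurable]: "{w::complex. r < cmod w \<and> cmod w < 1} \<in> sets borel" for r by measurable
  have meas: "(\<lambda>w. ereal (N w)) \<in> borel_measurable (?M r)" if "r \<ge> 0" for r
  proof -
    have "(\<lambda>w. ereal (R w)) \<in> borel_measurable (?M r)" by (intro measurable_restrict_space1) measurable
    moreover have "N w = R w" if "w \<in> space (?M r)" for w
      using that \<open>r \<ge> 0\<close> by (intro eq) (auto simp: space_restrict_space)
    ultimately show ?thesis using measurable_cong[of "?M r" "\<lambda>w. ereal (N w)" "\<lambda>w. ereal (R w)"] by simp
  qed
  have ev0: "\<forall>\<^sub>F r::real in at_left 1. r > 0 \<and> r < 1"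
    using eventually_at_left_real[of 0 "1::real"] by simp
  {
    fix a :: ereal assume a: "a < 0"
    show "\<forall>\<^sub>F r in at_left 1. a < esssup (?M r) (\<lambda>w. ereal (N w))"
      using ev0
    proof eventually_elim
      case (elim r)
      have "emeasure (?M r) (space (?M r)) = emeasure lborel {w::complex. r < cmod w \<and> cmod w < 1}"
        by (subst emeasure_restrict_space) (simp_all add: space_restrict_space)
      then have "emeasure (?M r) (space (?M r)) \<noteq> 0" using emeasure_annulus[of r] elim by simp
      then have "0 = esssup (?M r) (\<lambda>w. 0 :: ereal)" by (simp add: esssup_const)
      also have "\<dots> \<le> esssup (?M r) (\<lambda>w. ereal (N w))" by (intro esssup_mono) (auto simp: N)
      finally show ?case using a by simp
    qed
  next
    fix a :: ereal assume "0 < a"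
    then obtain e :: real where e: "0 < e" "ereal e < a" using ereal_dense2[of 0 a] by auto
    obtain s where s: "s < 1" "\<And>w. s < cmod w \<Longrightarrow> cmod w < 1 \<Longrightarrow> R w \<le> e" using van[OF e(1)] by blast
    have "\<forall>\<^sub>F r::real in at_left 1. r > s \<and> r < 1"
      using eventually_at_left_real[OF s(1)] by simp
    with ev0 show "\<forall>\<^sub>F r in at_left 1. esssup (?M r) (\<lambda>w. ereal (N w)) < a"
    proof eventually_elim
      case (elim r)
      have "N w \<le> e" if "w \<in> space (?M r)" for w
        using that elim eq[of w] s(2)[of w] by (cases "w = 0") (auto simp: space_restrict_space)
      then have "esssup (?M r) (\<lambda>w. ereal (N w)) \<le> ereal e"
        using elim by (intro esssup_I meas AE_I2) simp_all
      then show ?case using e(2) by simp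
    qed
  }
qed

text \<open>The two terms correspond to the cases \<open>\<delta> / T \<le> N powr (p + 2)\<close> and \<open>\<delta> / T > N powr (p + 2)\<close>. The first
  is controlled by the \<open>p\<close>-integrability of the dilatation, the second is integrable over Carleson boxes.\<close>
lemma square_split:
  fixes N \<delta> T :: real
  assumes N: "0 \<le> N" and d: "\<delta> > 0" and T: "T > 0" and p: "p > 0"
  shows "N\<^sup>2 / \<delta> \<le> T * (N ^ 4 * N powr p) / \<delta>\<^sup>2 + T powr (- (2 / (p + 2))) * \<delta> powr (2 / (p + 2) - 1)"
proof -
  let ?\<beta> = "2 / (p + 2)"
  have r: "T powr (- ?\<beta>) * \<delta> powr (?\<beta> - 1) = (\<delta> / T) powr ?\<beta> / \<delta>"
    using d T by (simp add: powr_diff powr_minus_divide powr_divide)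
  show ?thesis
  proof (cases "\<delta> / T \<le> N powr (p + 2)")
    case True
    then have "\<delta> \<le> T * (N\<^sup>2 * N powr p)"
      using T N p by (cases "N = 0") (simp_all add: powr_add field_simps powr_realpow)
    then have "N\<^sup>2 * \<delta> \<le> N\<^sup>2 * (T * (N\<^sup>2 * N powr p))" by (intro mult_left_mono) auto
    then have "N\<^sup>2 / \<delta> \<le> T * (N ^ 4 * N powr p) / \<delta>\<^sup>2"
      using d by (simp add: field_simps power2_eq_square power4_eq_xxxx)
    then show ?thesis unfolding r using d by (simp add: add_increasing2)
  next
    case False
    have "(N powr a) powr (2 / a) = N\<^sup>2" if "a > 0" for a
      using that N by (cases "N = 0") (simp_all add: powr_powr powr_realpow)
    from this[of "p + 2"] have "N\<^sup>2 = (N powr (p + 2)) powr ?\<beta>" using p by simp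
    also have "\<dots> \<le> (\<delta> / T) powr ?\<beta>" using False p by (intro powr_mono2) auto
    finally have "N\<^sup>2 / \<delta> \<le> (\<delta> / T) powr ?\<beta> / \<delta>" using d by (intro divide_right_mono) auto
    moreover have "T * (N ^ 4 * N powr p) / \<delta>\<^sup>2 \<ge> 0" using T N by simp
    ultimately show ?thesis unfolding r by linarith
  qed
qed

lemma box_const_nonneg: "\<beta> > 0 \<Longrightarrow> box_const \<beta> \<ge> 0"
  by (simp add: box_const_def)

text \<open>\<open>T = \<theta> * l\<close> in \<open>square_split\<close> makes both terms scale
  like \<open>l\<close>: the first becomes \<open>\<theta> * s * D * l\<close>, and in the second
  \<open>T powr (- \<beta>)\<close> meets \<open>l powr (1 + \<beta>)\<close>. The free numbers
  \<theta> and \<open>s\<close> act on the two terms separately.\<close>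

lemma nn_integral_carleson_box_le:
  fixes R :: "complex \<Rightarrow> real"
  assumes R [measurable]: "R \<in> borel_measurable borel" and R0: "\<And>w. R w \<ge> 0" and p: "p > 1"
    and D: "(\<integral>\<^sup>+w. indicator (ball 0 1) w * ennreal (R w powr p / (1 - (cmod w)\<^sup>2)\<^sup>2) \<partial>lborel) \<le> ennreal D" "D \<ge> 0"
    and l: "l > 0" and \<theta>: "\<theta> > 0" and S [measurable]: "carleson_box a l \<in> sets borel"
    and s: "s \<ge> 0" "\<And>w. w \<noteq> 0 \<Longrightarrow> cmod w < 1 \<Longrightarrow> w \<in> carleson_box a l \<Longrightarrow> R w ^ 4 \<le> s"
  shows "(\<integral>\<^sup>+w. indicator (ball 0 1) w * ennreal ((R w)\<^sup>2 / (1 - (cmod w)\<^sup>2)) * indicator (carleson_box a l) w \<partial>lborel)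
     \<le> ennreal ((\<theta> * s * D + \<theta> powr (- (2 / (p + 2))) * box_const (2 / (p + 2))) * l)"
proof -
  let ?\<beta> = "2 / (p + 2)" and ?T = "\<theta> * l"
  let ?f = "\<lambda>w. indicator (ball 0 1) w * ennreal (R w powr p / (1 - (cmod w)\<^sup>2)\<^sup>2)"
  let ?g = "\<lambda>w. ennreal ((1 - (cmod w)\<^sup>2) powr (?\<beta> - 1)) * indicator (ball 0 1 \<inter> carleson_box a l) w"
  have \<beta>: "0 < ?\<beta>" "?\<beta> \<le> 1" using p by auto
  have T: "?T > 0" using l \<theta> by simp
  have [measurable]: "ball (0::complex) 1 \<in> sets borel" by simp
  have "(\<integral>\<^sup>+w. indicator (ball 0 1) w * ennreal ((R w)\<^sup>2 / (1 - (cmod w)\<^sup>2)) * indicator (carleson_box a l) w \<partial>lborel)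
     \<le> (\<integral>\<^sup>+w. ennreal (?T * s) * ?f w + ennreal (?T powr (- ?\<beta>)) * ?g w \<partial>lborel)"
  proof (intro nn_integral_mono_AE AE_mp[OF AE_lborel_singleton[of 0] AE_I2] impI)
    fix w :: complex assume w: "w \<noteq> 0"
    show "indicator (ball 0 1) w * ennreal ((R w)\<^sup>2 / (1 - (cmod w)\<^sup>2)) * indicator (carleson_box a l) w
       \<le> ennreal (?T * s) * ?f w + ennreal (?T powr (- ?\<beta>)) * ?g w"
    proof (cases "cmod w < 1 \<and> w \<in> carleson_box a l")
      case True
      define \<delta> where "\<delta> = 1 - (cmod w)\<^sup>2"
      have d: "\<delta> > 0" using True by (simp add: \<delta>_def abs_square_less_1)
      have "R w ^ 4 * R w powr p \<le> s * R w powr p" using s(2)[OF w] True by (intro mult_right_mono) auto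
      then have "?T * (R w ^ 4 * R w powr p) / \<delta>\<^sup>2 \<le> ?T * (s * R w powr p) / \<delta>\<^sup>2"
        using T by (intro divide_right_mono mult_left_mono) auto
      then have "(R w)\<^sup>2 / \<delta> \<le> (?T * s) * (R w powr p / \<delta>\<^sup>2) + ?T powr (- ?\<beta>) * \<delta> powr (?\<beta> - 1)"
        using square_split[OF R0 d T, of p w] p by (simp add: mult.assoc)
      then have "ennreal ((R w)\<^sup>2 / \<delta>) \<le> ennreal ((?T * s) * (R w powr p / \<delta>\<^sup>2) + ?T powr (- ?\<beta>) * \<delta> powr (?\<beta> - 1))"
        by (rule ennreal_leI)
      also have "\<dots> = ennreal ((?T * s) * (R w powr p / \<delta>\<^sup>2)) + ennreal (?T powr (- ?\<beta>) * \<delta> powr (?\<beta> - 1))"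
        using T s(1) by (intro ennreal_plus) auto
      also have "ennreal ((?T * s) * (R w powr p / \<delta>\<^sup>2)) = ennreal (?T * s) * ennreal (R w powr p / \<delta>\<^sup>2)"
        using T s(1) by (intro ennreal_mult) auto
      also have "ennreal (?T powr (- ?\<beta>) * \<delta> powr (?\<beta> - 1)) = ennreal (?T powr (- ?\<beta>)) * ennreal (\<delta> powr (?\<beta> - 1))"
        by (intro ennreal_mult) auto
      finally show ?thesis using True unfolding \<delta>_def by simp
    qed (auto simp: indicator_def)
  qed
  also have "\<dots> = ennreal (?T * s) * (\<integral>\<^sup>+w. ?f w \<partial>lborel) + ennreal (?T powr (- ?\<beta>)) * (\<integral>\<^sup>+w. ?g w \<partial>lborel)"
  proof -
    have [measurable]: "?f \<in> borel_measurable lborel" "?g \<in> borel_measurable lborel" by measurable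
    have "(\<integral>\<^sup>+w. ennreal (?T * s) * ?f w \<partial>lborel) = ennreal (?T * s) * (\<integral>\<^sup>+w. ?f w \<partial>lborel)"
      "(\<integral>\<^sup>+w. ennreal (?T powr (- ?\<beta>)) * ?g w \<partial>lborel) = ennreal (?T powr (- ?\<beta>)) * (\<integral>\<^sup>+w. ?g w \<partial>lborel)"
      by (rule nn_integral_cmult; measurable)+
    moreover have "(\<integral>\<^sup>+w. ennreal (?T * s) * ?f w + ennreal (?T powr (- ?\<beta>)) * ?g w \<partial>lborel) =
      (\<integral>\<^sup>+w. ennreal (?T * s) * ?f w \<partial>lborel) + (\<integral>\<^sup>+w. ennreal (?T powr (- ?\<beta>)) * ?g w \<partial>lborel)"
      by (rule nn_integral_add; measurable)
    ultimately show ?thesis by (simp only:)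
  qed
  also have "\<dots> \<le> ennreal (?T * s) * ennreal D + ennreal (?T powr (- ?\<beta>)) * ennreal (box_const ?\<beta> * l powr (1 + ?\<beta>))"
    by (rule add_mono[OF mult_left_mono[OF D(1) zero_le] mult_left_mono[OF nn_integral_carleson_box[OF \<beta> l S] zero_le]])
  also have "\<dots> = ennreal (?T * s * D + ?T powr (- ?\<beta>) * (box_const ?\<beta> * l powr (1 + ?\<beta>)))"
  proof -
    have "ennreal x * ennreal d + ennreal y * ennreal z = ennreal (x * d + y * z)"
      if "x \<ge> 0" "d \<ge> 0" "y \<ge> 0" "z \<ge> 0" for x d y z
      using that by (simp add: ennreal_mult)
    moreover have "?T * s \<ge> 0" by (rule mult_nonneg_nonneg[OF less_imp_le[OF T] s(1)])
    moreover have "box_const ?\<beta> * l powr (1 + ?\<beta>) \<ge> 0"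
      by (rule mult_nonneg_nonneg[OF box_const_nonneg[OF \<beta>(1)] powr_ge_zero])
    ultimately show ?thesis using D(2) powr_ge_zero by blast
  qed
  also have "?T * s * D + ?T powr (- ?\<beta>) * (box_const ?\<beta> * l powr (1 + ?\<beta>)) = (\<theta> * s * D + \<theta> powr (- ?\<beta>) * box_const ?\<beta>) * l"
  proof -
    have "(\<theta> * l) powr (- b) * (B * l powr (1 + b)) = \<theta> powr (- b) * B * l" for b B
    proof -
      have "l powr (- b) * l powr (1 + b) = l" using l by (simp flip: powr_add)
      moreover have "(\<theta> * l) powr (- b) = \<theta> powr (- b) * l powr (- b)" using \<theta> l by (simp add: powr_mult)
      ultimately show ?thesis by (metis mult.assoc mult.commute)
    qed
    note e = this[of ?\<beta> "box_const ?\<beta>"]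
    show ?thesis unfolding e by (simp add: algebra_simps)
  qed
  finally show ?thesis .
qed

text \<open>Boundedness is the case where \<theta> and \<open>s\<close> are both \<open>1\<close>.
  For the vanishing part \<theta> is chosen so large that the box term is at most half of
  \<epsilon>; \<open>s\<close> is adapted to this \<theta>, and the decay of \<open>R\<close> at the
  circle provides it on all short boxes.\<close>

lemma vanishing_carleson_density:
  fixes N R :: "complex \<Rightarrow> real"
  assumes R [measurable]: "R \<in> borel_measurable borel" and R0: "\<And>w. R w \<ge> 0" and p: "p > 1"
    and eq: "\<And>w. w \<noteq> 0 \<Longrightarrow> cmod w < 1 \<Longrightarrow> N w = R w"
    and le1: "\<And>w. w \<noteq> 0 \<Longrightarrow> cmod w < 1 \<Longrightarrow> R w \<le> 1"
    and fin: "(\<integral>\<^sup>+w. indicator (ball 0 1) w * ennreal (R w powr p / (1 - (cmod w)\<^sup>2)\<^sup>2) \<partial>lborel) < \<infinity>"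
    and van: "\<And>e. e > 0 \<Longrightarrow> \<exists>r<1. \<forall>w. r < cmod w \<longrightarrow> cmod w < 1 \<longrightarrow> R w \<le> e"
  shows "vanishing_carleson (density lborel (\<lambda>w. indicator (ball 0 1) w * ennreal ((N w)\<^sup>2 / (1 - (cmod w)\<^sup>2))))"
proof -
  let ?h = "\<lambda>w. indicator (ball 0 1) w * ennreal ((R w)\<^sup>2 / (1 - (cmod w)\<^sup>2))"
  let ?\<beta> = "2 / (p + 2)"
  let ?I = "\<integral>\<^sup>+w. indicator (ball 0 1) w * ennreal (R w powr p / (1 - (cmod w)\<^sup>2)\<^sup>2) \<partial>lborel"
  define D where "D = enn2real ?I"
  have D: "?I \<le> ennreal D" "D \<ge> 0" using fin by (simp_all add: D_def less_top)
  have \<beta>: "?\<beta> > 0" using p by simp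
  have [measurable]: "ball (0::complex) 1 \<in> sets borel" by simp
  have [measurable]: "(\<lambda>w. indicator (ball 0 1) w * ennreal ((N w)\<^sup>2 / (1 - (cmod w)\<^sup>2))) \<in> borel_measurable lborel"
  proof -
    \<comment> \<open>\<open>N\<close> is known to agree with \<open>R\<close> only off the origin,
      so its value there is inserted by hand.\<close>
    have "(\<lambda>w. if w = 0 then ennreal ((N 0)\<^sup>2) else ?h w) \<in> borel_measurable borel" by measurable
    also have "(\<lambda>w. if w = 0 then ennreal ((N 0)\<^sup>2) else ?h w) = (\<lambda>w. indicator (ball 0 1) w * ennreal ((N w)\<^sup>2 / (1 - (cmod w)\<^sup>2)))"
      by (auto simp: indicator_def eq)
    finally show ?thesis by simp
  qed
  have "density lborel (\<lambda>w. indicator (ball 0 1) w * ennreal ((N w)\<^sup>2 / (1 - (cmod w)\<^sup>2))) = density lborel ?h"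
    by (intro density_cong AE_mp[OF AE_lborel_singleton[of 0] AE_I2]) (measurable, auto simp: indicator_def eq)
  moreover have "vanishing_carleson (density lborel ?h)"
  proof -
    have box: "emeasure (density lborel ?h) (carleson_box a l) \<le> ennreal ((\<theta> * s * D + \<theta> powr (- ?\<beta>) * box_const ?\<beta>) * l)"
      if "l > 0" "\<theta> > 0" "s \<ge> 0" "\<And>w. w \<noteq> 0 \<Longrightarrow> cmod w < 1 \<Longrightarrow> w \<in> carleson_box a l \<Longrightarrow> R w ^ 4 \<le> s" for a l \<theta> s
    \<comment> \<open>A set outside the Borel sets has measure \<open>0\<close> by convention, so
      only Borel boxes call for an estimate.\<close>
    proof (cases "carleson_box a l \<in> sets borel")
      case True
      then have "emeasure (density lborel ?h) (carleson_box a l) = (\<integral>\<^sup>+w. ?h w * indicator (carleson_box a l) w \<partial>lborel)"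
        by (intro emeasure_density) auto
      also have "\<dots> \<le> ennreal ((\<theta> * s * D + \<theta> powr (- ?\<beta>) * box_const ?\<beta>) * l)"
        using nn_integral_carleson_box_le[OF R R0 p D that(1,2) True that(3,4)] by blast
      finally show ?thesis .
    qed (simp add: emeasure_notin_sets)
    have pow: "R w ^ 4 \<le> e" if "w \<noteq> 0" "cmod w < 1" "R w \<le> e" for w e
    proof -
      have "R w ^ 4 \<le> R w ^ 1" using R0 le1 that by (intro power_decreasing) auto
      with that show ?thesis by simp
    qed
    show ?thesis
      unfolding vanishing_carleson_def
    proof (rule conjI; (rule exI[of _ "1 * 1 * D + 1 powr (- ?\<beta>) * box_const ?\<beta>"])?; intro allI impI)
      fix a l :: real assume "0 < l \<and> l \<le> 2 * pi"
      then show "emeasure (density lborel ?h) (carleson_box a l) \<le> ennreal ((1 * 1 * D + 1 powr (- ?\<beta>) * box_const ?\<beta>) * l)"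
        by (intro box pow le1) auto
    next
      fix \<epsilon> :: real assume e: "\<epsilon> > 0"
      define B where "B = 1 + box_const ?\<beta>"
      have B: "B > 0" "box_const ?\<beta> \<le> B" using box_const_nonneg[OF \<beta>] by (auto simp: B_def)
      \<comment> \<open>The solution of
        \<open>\<theta> powr (- \<beta>) = \<epsilon> / (2 * B)\<close>; the summand
        \<open>1\<close> in \<open>B\<close> keeps the divisor positive.\<close>
      define \<theta> where "\<theta> = (\<epsilon> / (2 * B)) powr (- (1 / ?\<beta>))"
      have \<theta>: "\<theta> > 0" using e B by (simp add: \<theta>_def)
      have "(x powr (- (1 / b))) powr (- b) = x" if "x > 0" "b > 0" for x b :: real
        using that by (simp add: powr_powr)
      from this[of "\<epsilon> / (2 * B)" ?\<beta>] have "\<theta> powr (- ?\<beta>) = \<epsilon> / (2 * B)"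
        unfolding \<theta>_def using e B(1) \<beta> by simp
      then have b1: "\<theta> powr (- ?\<beta>) * box_const ?\<beta> \<le> \<epsilon> / 2"
        using e B mult_left_mono[OF B(2), of "\<epsilon> / (2 * B)"] by simp
      \<comment> \<open>Makes \<open>\<theta> * s * (1 + D)\<close> equal to half of \<epsilon>;
        \<open>1 + D\<close> rather than \<open>D\<close> admits \<open>D = 0\<close>.\<close>
      define s where "s = \<epsilon> / (2 * \<theta> * (1 + D))"
      have s: "s > 0" using e \<theta> D(2) by (simp add: s_def)
      have "\<theta> * s * D \<le> \<theta> * s * (1 + D)" using \<theta> s by (intro mult_left_mono) auto
      also have "\<dots> = \<epsilon> / 2"
      proof -
        have "\<theta> * (\<epsilon> / (2 * \<theta> * K)) * K = \<epsilon> / 2" if "K > 0" for K using that \<theta> by simp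
        then show ?thesis using D(2) by (simp add: s_def)
      qed
      finally have b: "\<theta> * s * D + \<theta> powr (- ?\<beta>) * box_const ?\<beta> \<le> \<epsilon>" using b1 by simp
      obtain r where r: "r < 1" "\<And>w. r < cmod w \<Longrightarrow> cmod w < 1 \<Longrightarrow> R w \<le> s" using van[OF s] by blast
      show "\<exists>\<delta>>0. \<forall>a l. 0 < l \<and> l < \<delta> \<longrightarrow> emeasure (density lborel ?h) (carleson_box a l) \<le> ennreal (\<epsilon> * l)"
      proof (intro exI[of _ "1 - r"] conjI allI impI)
        show "1 - r > 0" using r by simp
        fix a l assume l: "0 < l \<and> l < 1 - r"
        have "r < cmod w" if "w \<in> carleson_box a l" for w
        proof -
          from that obtain \<rho> \<phi> where "w = complex_of_real \<rho> * cis \<phi>" "0 \<le> \<rho>" "1 - l \<le> \<rho>"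
            unfolding carleson_box_def by blast
          then show ?thesis using l by (simp add: norm_mult)
        qed
        then have "emeasure (density lborel ?h) (carleson_box a l) \<le> ennreal ((\<theta> * s * D + \<theta> powr (- ?\<beta>) * box_const ?\<beta>) * l)"
          using l \<theta> s by (intro box pow r(2)) auto
        also have "\<dots> \<le> ennreal (\<epsilon> * l)" using b l by (intro ennreal_leI mult_right_mono) auto
        finally show "emeasure (density lborel ?h) (carleson_box a l) \<le> ennreal (\<epsilon> * l)" .
      qed
    qed
  qed
  ultimately show ?thesis by simp
qed

section \<open>Dependence on the Besov norm\<close>

text \<open>The constants that enter \<open>dil_const\<close> increase with \<open>E\<close>, so a
  bound for the norm on a neighbourhood bounds the final constant there.\<close>

lemma const_mono:
  assumes "0 \<le> E" "E \<le> E'"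
  shows "tm_const q E \<le> tm_const q E'" "osc_const q E \<le> osc_const q E'" "mom_const E \<le> mom_const E'"
proof -
  have *: "tm_const q E \<le> tm_const q E'" for q
    unfolding tm_const_def using assms by (intro mult_left_mono add_left_mono exp_le_cancel_iff[THEN iffD2] mult_right_mono) auto
  then show "tm_const q E \<le> tm_const q E'" .
  from * have o: "osc_const q E \<le> osc_const q E'" for q by (simp add: osc_const_def)
  then show "osc_const q E \<le> osc_const q E'" .
  show "mom_const E \<le> mom_const E'"
    unfolding mom_const_def using o[of 1] ker_const_pos by simp
qed

lemma dil_const_mono:
  assumes E: "0 \<le> E" "E \<le> E'" and p: "p > 0"
  shows "dil_const p E \<le> dil_const p E'"
proof -
  have "osc_const (conj_exp p) E * osc_const 0 E \<le> osc_const (conj_exp p) E' * osc_const 0 E'"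
    by (intro mult_mono const_mono E less_imp_le osc_const_pos)
  then have "split_const p E \<le> split_const p E'"
    unfolding split_const_def by (intro mult_left_mono) auto
  then have "diff_const p E \<le> diff_const p E'"
    unfolding diff_const_def by (intro mult_left_mono add_left_mono) auto
  then show ?thesis
    unfolding dil_const_def using const_mono(3)[OF E] mom_const_pos[of E] diff_const_pos[of p E] p
    by (intro mult_mono powr_mono2) auto
qed

text \<open>A quasi-triangle inequality: a sum of two increments is at most twice the larger one,
  which gives \<open>2 powr p\<close>, and the maximum of the powers is at most their sum.\<close>

lemma ener_add_le:
  assumes [measurable]: "u \<in> borel_measurable borel" "v \<in> borel_measurable borel" and p: "p > 0"
  shows "ener p (\<lambda>x. u x + v x) \<le> ennreal (2 powr p) * (ener p u + ener p v)"
proof -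
  let ?I = "\<lambda>x y::real. indicator {0..1} x * indicator {0..1} y :: ennreal"
  let ?e = "\<lambda>u x y. ennreal (\<bar>u x - u y\<bar> powr p / (cmod (circ x - circ y))\<^sup>2)"
  have "ener p (\<lambda>x. u x + v x) \<le> (\<integral>\<^sup>+x. \<integral>\<^sup>+y. ennreal (2 powr p) * (?I x y * ?e u x y + ?I x y * ?e v x y) \<partial>lborel \<partial>lborel)"
    unfolding ener_def
  proof (intro nn_integral_mono)
    fix x y
    define d where "d = (cmod (circ x - circ y))\<^sup>2"
    have "\<bar>s + t\<bar> \<le> 2 * max \<bar>s\<bar> \<bar>t\<bar>" for s t :: real
      using abs_triangle_ineq[of s t] max.cobounded1[of "\<bar>s\<bar>" "\<bar>t\<bar>"] max.cobounded2[of "\<bar>t\<bar>" "\<bar>s\<bar>"] by linarith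
    from this[of "u x - u y" "v x - v y"]
    have "\<bar>(u x + v x) - (u y + v y)\<bar> powr p \<le> (2 * max \<bar>u x - u y\<bar> \<bar>v x - v y\<bar>) powr p"
      using p by (intro powr_mono2) (auto simp: algebra_simps)
    also have "\<dots> = 2 powr p * (max \<bar>u x - u y\<bar> \<bar>v x - v y\<bar>) powr p" by (simp add: powr_mult)
    also have "\<dots> \<le> 2 powr p * (\<bar>u x - u y\<bar> powr p + \<bar>v x - v y\<bar> powr p)"
      by (intro mult_left_mono) (auto simp: max_def)
    finally have "\<bar>(u x + v x) - (u y + v y)\<bar> powr p / d \<le> 2 powr p * (\<bar>u x - u y\<bar> powr p / d + \<bar>v x - v y\<bar> powr p / d)"
      unfolding add_divide_distrib[symmetric] times_divide_eq_right by (rule divide_right_mono) (simp add: d_def)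
    then have "ennreal (\<bar>(u x + v x) - (u y + v y)\<bar> powr p / d) \<le> ennreal (2 powr p * (\<bar>u x - u y\<bar> powr p / d + \<bar>v x - v y\<bar> powr p / d))"
      by (rule ennreal_leI)
    also have "\<dots> = ennreal (2 powr p) * (?e u x y + ?e v x y)"
    proof -
      have "d \<ge> 0" by (simp add: d_def)
      then show ?thesis by (simp add: ennreal_mult flip: d_def)
    qed
    finally show "?I x y * ?e (\<lambda>x. u x + v x) x y \<le> ennreal (2 powr p) * (?I x y * ?e u x y + ?I x y * ?e v x y)"
      unfolding d_def by (auto simp: indicator_def)
  qed
  also have "\<dots> = ennreal (2 powr p) * (\<integral>\<^sup>+x. \<integral>\<^sup>+y. ?I x y * ?e u x y + ?I x y * ?e v x y \<partial>lborel \<partial>lborel)"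
    by (simp add: nn_integral_cmult)
  also have "(\<integral>\<^sup>+x. \<integral>\<^sup>+y. ?I x y * ?e u x y + ?I x y * ?e v x y \<partial>lborel \<partial>lborel) = ener p u + ener p v"
    unfolding ener_def by (simp add: nn_integral_add)
  finally show ?thesis .
qed

lemma circ_frac: "circ (frac x) = circ x"
  unfolding circ_eq_circ_iff by (intro exI[of _ "- \<lfloor>x\<rfloor>"]) (simp add: frac_def)

text \<open>Integrability is known on \<open>{0..1}\<close> only; composition with
  \<open>frac\<close> carries measurability to the whole line, as \<open>circ\<close> has period
  \<open>1\<close>.\<close>

lemma in_BpR_measurable:
  assumes "in_BpR p v" shows "(\<lambda>x. v (circ x)) \<in> borel_measurable borel"
proof -
  let ?h = "\<lambda>x. indicator {0..1} x *\<^sub>R v (circ x)"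
  have "integrable lborel ?h" using assms unfolding in_BpR_def set_integrable_def by simp
  then have [measurable]: "?h \<in> borel_measurable borel" using borel_measurable_integrable by fastforce
  have [measurable]: "(\<lambda>x::real. frac x) \<in> borel_measurable borel" unfolding frac_def by measurable
  have "(\<lambda>x. ?h (frac x)) \<in> borel_measurable borel" by measurable
  moreover have "?h (frac x) = v (circ x)" for x
    using frac_lt_1[of x] by (simp add: circ_frac less_imp_le)
  ultimately show ?thesis by simp
qed

lemma in_BpR_ener:
  assumes "in_BpR p v" shows "ener p (\<lambda>x. v (circ x)) = ennreal (Bp_pnorm p v)"
  using assms by (simp add: in_BpR_def Bp_pnorm_def Bp_pow_eq_ener)

text \<open>\<open>Bp_pnorm\<close> sends infinite energy to \<open>0\<close>, so the energy of the
  difference has to be shown finite before the quasi-triangle inequality can be read in real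
  numbers.\<close>

lemma Bp_pnorm_le:
  assumes v: "in_BpR p v" "in_BpR p v0" and p: "p > 0"
  shows "Bp_pnorm p v \<le> 2 powr p * (Bp_pnorm p (\<lambda>z. v z - v0 z) + Bp_pnorm p v0)"
proof -
  define a where "a = (\<lambda>x. v (circ x))"
  define b where "b = (\<lambda>x. v0 (circ x))"
  have [measurable]: "a \<in> borel_measurable borel" "b \<in> borel_measurable borel"
    using in_BpR_measurable v by (auto simp: a_def b_def)
  have ea: "ener p a = ennreal (Bp_pnorm p v)" and eb: "ener p b = ennreal (Bp_pnorm p v0)"
    using in_BpR_ener v by (auto simp: a_def b_def)
  have eq: "Bp_pow p (\<lambda>z. v z - v0 z) = ener p (\<lambda>x. a x + - b x)"
    by (simp add: Bp_pow_eq_ener a_def b_def)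
  have "ener p (\<lambda>x. a x + - b x) \<le> ennreal (2 powr p) * (ener p a + ener p (\<lambda>x. - b x))"
    using p by (intro ener_add_le) measurable
  also have "\<dots> < \<infinity>" unfolding ener_uminus ea eb by (simp add: ennreal_mult_less_top)
  finally have ed: "ener p (\<lambda>x. a x + - b x) = ennreal (Bp_pnorm p (\<lambda>z. v z - v0 z))"
    unfolding Bp_pnorm_def eq by simp
  have "ener p (\<lambda>x. (a x + - b x) + b x) \<le> ennreal (2 powr p) * (ener p (\<lambda>x. a x + - b x) + ener p b)"
    using p by (intro ener_add_le) measurable
  then have "ennreal (Bp_pnorm p v) \<le> ennreal (2 powr p) * (ennreal (Bp_pnorm p (\<lambda>z. v z - v0 z)) + ennreal (Bp_pnorm p v0))"
    unfolding ed eb using ea by simp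
  also have "\<dots> = ennreal (2 powr p * (Bp_pnorm p (\<lambda>z. v z - v0 z) + Bp_pnorm p v0))"
    by (simp add: ennreal_mult Bp_pnorm_def)
  finally show ?thesis by (simp add: ennreal_le_iff Bp_pnorm_def)
qed

text \<open>The constant is a function of the norm alone and nondecreasing in it; local boundedness
  therefore reduces to a bound for the norm on the set where the difference has norm below
  \<open>1\<close>.\<close>

theorem theorem5p2:
  fixes p :: real
  assumes "p > 1"
  shows "\<exists>C :: (complex \<Rightarrow> real) \<Rightarrow> real.
     (\<forall>v. in_BpR p v \<longrightarrow> C v > 0) \<and>
     (\<forall>v0. in_BpR p v0 \<longrightarrow> (\<exists>\<delta>>0. \<exists>M. \<forall>v. in_BpR p v \<and> Bp_pnorm p (\<lambda>z. v z - v0 z) < \<delta> \<longrightarrow> C v \<le> M)) \<and>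
     (\<forall>(g :: complex \<Rightarrow> complex) (f :: real \<Rightarrow> real) (v :: complex \<Rightarrow> real).
        (\<exists>h. homeomorphism (sphere 0 1) (sphere 0 1) g h) \<and>
        continuous_on UNIV f \<and> (\<forall>x. g (circ x) = circ (f x)) \<and>
        strict_mono f \<and> (\<forall>x. f (x + 1) = f x + 1) \<and>
        abs_continuous_on 0 1 f \<and>
        in_BpR p v \<and>
        (AE x in lborel. x \<in> {0..1} \<longrightarrow> (f has_real_derivative exp (v (circ x))) (at x))
      \<longrightarrow>
        dil_integral p (extG f g) \<le> ennreal (C v * Bp_pnorm p v) \<and>
        in_Wp p g \<and>
        ((\<lambda>r. esssup (restrict_space lborel {w. r < cmod w \<and> cmod w < 1})
                 (\<lambda>w. ereal (cmod (cdil (extG f g) w)))) \<longlongrightarrow> 0) (at_left 1) \<and>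
        vanishing_carleson (density lborel (\<lambda>w. indicator (ball 0 1) w *
                 ennreal ((cmod (cdil (extG f g) w))\<^sup>2 / (1 - (cmod w)\<^sup>2)))))"
proof (rule exI[of _ "\<lambda>v. dil_const p (Bp_pnorm p v) * (256 * pi\<^sup>2)"], rule conjI[OF _ conjI])
  show "\<forall>v. in_BpR p v \<longrightarrow> dil_const p (Bp_pnorm p v) * (256 * pi\<^sup>2) > 0"
    by (simp add: dil_const_pos)
next
  show "\<forall>v0. in_BpR p v0 \<longrightarrow> (\<exists>\<delta>>0. \<exists>M. \<forall>v. in_BpR p v \<and> Bp_pnorm p (\<lambda>z. v z - v0 z) < \<delta> \<longrightarrow>
     dil_const p (Bp_pnorm p v) * (256 * pi\<^sup>2) \<le> M)"
  proof (rule allI, rule impI)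
    fix v0 assume v0: "in_BpR p v0"
    have "dil_const p (Bp_pnorm p v) * (256 * pi\<^sup>2) \<le> dil_const p (2 powr p * (1 + Bp_pnorm p v0)) * (256 * pi\<^sup>2)"
      if v: "in_BpR p v" "Bp_pnorm p (\<lambda>z. v z - v0 z) < 1" for v
    proof (intro mult_right_mono dil_const_mono)
      have "Bp_pnorm p v \<le> 2 powr p * (Bp_pnorm p (\<lambda>z. v z - v0 z) + Bp_pnorm p v0)"
        using assms by (intro Bp_pnorm_le v v0) auto
      also have "\<dots> \<le> 2 powr p * (1 + Bp_pnorm p v0)" using v(2) by (intro mult_left_mono) auto
      finally show "Bp_pnorm p v \<le> 2 powr p * (1 + Bp_pnorm p v0)" .
    qed (use assms in \<open>auto simp: Bp_pnorm_def\<close>)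
    then show "\<exists>\<delta>>0. \<exists>M. \<forall>v. in_BpR p v \<and> Bp_pnorm p (\<lambda>z. v z - v0 z) < \<delta> \<longrightarrow>
       dil_const p (Bp_pnorm p v) * (256 * pi\<^sup>2) \<le> M"
      by (intro exI[of _ "1::real"] exI[of _ "dil_const p (2 powr p * (1 + Bp_pnorm p v0)) * (256 * pi\<^sup>2)"] conjI) auto
  qed
next
  show "\<forall>(g :: complex \<Rightarrow> complex) (f :: real \<Rightarrow> real) (v :: complex \<Rightarrow> real).
        (\<exists>h. homeomorphism (sphere 0 1) (sphere 0 1) g h) \<and>
        continuous_on UNIV f \<and> (\<forall>x. g (circ x) = circ (f x)) \<and>
        strict_mono f \<and> (\<forall>x. f (x + 1) = f x + 1) \<and>
        abs_continuous_on 0 1 f \<and>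
        in_BpR p v \<and>
        (AE x in lborel. x \<in> {0..1} \<longrightarrow> (f has_real_derivative exp (v (circ x))) (at x))
      \<longrightarrow>
        dil_integral p (extG f g) \<le> ennreal (dil_const p (Bp_pnorm p v) * (256 * pi\<^sup>2) * Bp_pnorm p v) \<and>
        in_Wp p g \<and>
        ((\<lambda>r. esssup (restrict_space lborel {w. r < cmod w \<and> cmod w < 1})
                 (\<lambda>w. ereal (cmod (cdil (extG f g) w)))) \<longlongrightarrow> 0) (at_left 1) \<and>
        vanishing_carleson (density lborel (\<lambda>w. indicator (ball 0 1) w *
                 ennreal ((cmod (cdil (extG f g) w))\<^sup>2 / (1 - (cmod w)\<^sup>2))))"
  proof (intro allI impI, elim conjE)
    fix g :: "complex \<Rightarrow> complex" and f :: "real \<Rightarrow> real" and v :: "complex \<Rightarrow> real"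
    assume h: "\<exists>h. homeomorphism (sphere 0 1) (sphere 0 1) g h"
      and f: "continuous_on UNIV f" "\<forall>x. g (circ x) = circ (f x)" "strict_mono f" "\<forall>x. f (x + 1) = f x + 1"
        "abs_continuous_on 0 1 f" and v: "in_BpR p v"
      and d: "AE x in lborel. x \<in> {0..1} \<longrightarrow> (f has_real_derivative exp (v (circ x))) (at x)"
    let ?u = "\<lambda>x. v (circ x)" and ?E = "Bp_pnorm p v"
    have en: "ener p ?u = ennreal ?E" by (rule in_BpR_ener[OF v])
    have um: "?u \<in> borel_measurable borel" by (rule in_BpR_measurable[OF v])
    have E0: "?E \<ge> 0" by (simp add: Bp_pnorm_def)
    \<comment> \<open>The energy itself is taken as the bound \<open>E\<close>, which turns all
      constants into functions of the norm of \<open>v\<close>.\<close>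
    interpret bext_disc p ?E ?u f g
    proof unfold_locales
      show "continuous_on (sphere 0 1) g" using h homeomorphism_cont1 by blast
    qed (use assms um en E0 f d in auto)
    have cd: "cmod (cdil G w) = dil_rep ?u w" if "w \<noteq> 0" "cmod w < 1" for w
      by (rule cmod_cdil_eq[OF that])
    have dm: "dil_rep ?u \<in> borel_measurable borel" by (rule dil_rep_measurable[OF um])
    have "dil_integral p G \<le> ennreal (dil_const p ?E * (256 * pi\<^sup>2)) * ennreal ?E"
      using dil_integral_G_le unfolding en .
    also have "\<dots> = ennreal (dil_const p ?E * (256 * pi\<^sup>2) * ?E)"
      using dil_const_pos[of p ?E] E0 by (intro ennreal_mult[symmetric]) auto
    finally have 1: "dil_integral p G \<le> ennreal (dil_const p ?E * (256 * pi\<^sup>2) * ?E)" .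
    have "(\<integral>\<^sup>+w. indicator (ball 0 1) w * ennreal (dil_rep ?u w powr p / (1 - (cmod w)\<^sup>2)\<^sup>2) \<partial>lborel)
       \<le> ennreal (dil_const p ?E * (256 * pi\<^sup>2)) * ennreal ?E"
      using nn_integral_dil_rep_le unfolding en .
    also have "\<dots> < \<infinity>" by (simp add: ennreal_mult_less_top)
    finally have fin: "(\<integral>\<^sup>+w. indicator (ball 0 1) w * ennreal (dil_rep ?u w powr p / (1 - (cmod w)\<^sup>2)\<^sup>2) \<partial>lborel) < \<infinity>" .
    have 3: "((\<lambda>r. esssup (restrict_space lborel {w. r < cmod w \<and> cmod w < 1}) (\<lambda>w. ereal (cmod (cdil G w)))) \<longlongrightarrow> 0) (at_left 1)"
      by (rule esssup_annulus_tendsto_0[OF dm norm_ge_zero cd dil_rep_vanishing])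
    have 4: "vanishing_carleson (density lborel (\<lambda>w. indicator (ball 0 1) w * ennreal ((cmod (cdil G w))\<^sup>2 / (1 - (cmod w)\<^sup>2))))"
      by (rule vanishing_carleson_density[OF dm dil_rep_nonneg assms cd dil_rep_le_1 fin dil_rep_vanishing])
    show "dil_integral p G \<le> ennreal (dil_const p ?E * (256 * pi\<^sup>2) * ?E) \<and> in_Wp p g \<and>
      ((\<lambda>r. esssup (restrict_space lborel {w. r < cmod w \<and> cmod w < 1}) (\<lambda>w. ereal (cmod (cdil G w)))) \<longlongrightarrow> 0) (at_left 1) \<and>
      vanishing_carleson (density lborel (\<lambda>w. indicator (ball 0 1) w * ennreal ((cmod (cdil G w))\<^sup>2 / (1 - (cmod w)\<^sup>2))))"
      using 1 in_Wp_g[OF h] 3 4 by (intro conjI)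
  qed
qed

end
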